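(* The inclusion functor $\mathcal{C}^{\infty}\mathbf{vNRng}\hookrightarrow\mathcal{C}^{\infty}\mathbf{Rng}$ has a left adjoint functor $\mathrm{vN}:\mathcal{C}^{\infty}\mathbf{Rng}\to\mathcal{C}^{\infty}\mathbf{vNRng}$. In more detail: for any $\mathcal{C}^{\infty}$-ring $A$, with $\mathbb{H}(A)$ and $\mu_A:A\to\mathbb{H}(A)$ the $\mathcal{C}^{\infty}$-ring of global sections and the canonical homomorphism defined in the context, the pair $(\mathbb{H}(A),\mu_A)$ is the $\mathcal{C}^{\infty}$-von Neumann regular hull of $A$; that is, $\mathbb{H}(A)$ is a von Neumann regular $\mathcal{C}^{\infty}$-ring and for every von Neumann regular $\mathcal{C}^{\infty}$-ring $V$ and every $\mathcal{C}^{\infty}$-homomorphism $f:A\to V$ there is a unique $\mathcal{C}^{\infty}$-homomorphism $\widetilde{f}:\mathbb{H}(A)\to V$ such that $\widetilde{f}\circ\mu_A=f$.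
   Context: A $\mathcal{C}^{\infty}$-ring is a set $A$ with an operation $A^n\to A$ for each $n\ge 0$ and each smooth $f:\mathbb{R}^n\to\mathbb{R}$, such that coordinate projections are interpreted as projections and composition of smooth functions is respected; $\mathcal{C}^{\infty}$-homomorphisms preserve all these operations. $\mathcal{C}^{\infty}\mathbf{Rng}$ is the resulting category. Each $\mathcal{C}^{\infty}$-ring has an underlying commutative unital ring; ideals are ring ideals, and $A/I$ is canonically a $\mathcal{C}^{\infty}$-ring. $A$ is von Neumann regular if $(\forall a\in A)(\exists x\in A)(a=a^2x)$; $\mathcal{C}^{\infty}\mathbf{vNRng}$ is the full subcategory of von Neumann regular $\mathcal{C}^{\infty}$-rings. For $S\subseteq A$, $A\to A\{S^{-1}\}$ is the universal $\mathcal{C}^{\infty}$-homomorphism making the elements of $S$ invertible; $A\{a^{-1}\}=A\{\{a\}^{-1}\}$. The $\mathcal{C}^{\infty}$-radical of an ideal $I$ is $\sqrt[\infty]{I}=\{a\in A\mid (A/I)\{(a+I)^{-1}\}\cong 0\}$. $\mathrm{Spec}^{\infty}(A)$ is the set of prime ideals $\mathfrak{p}$ with $\sqrt[\infty]{\mathfrak{p}}=\mathfrak{p}$. Put $D^{\infty}(a)=\{\mathfrak{p}\in\mathrm{Spec}^{\infty}(A)\mid a\notin\mathfrak{p}\}$ and $Z^{\infty}(b)=\{\mathfrak{p}\in\mathrm{Spec}^{\infty}(A)\mid b\in\mathfrak{p}\}$. $\mathrm{Spec}^{\infty-\mathrm{const}}(A)$ is the set $\mathrm{Spec}^{\infty}(A)$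 with the constructible topology, whose basic open sets are the $D^{\infty}(a)\cap Z^{\infty}(b)$, $a,b\in A$. Presheaf $F_A$ on these basic open sets: for $D^{\infty}(a)\cap Z^{\infty}(b)\subseteq D^{\infty}(a')\cap Z^{\infty}(b')$ there is a unique $\mathcal{C}^{\infty}$-homomorphism $$t^{a',b'}_{a,b}:\left(\tfrac{A}{\sqrt[\infty]{(b')}}\right)\{(a'+\sqrt[\infty]{(b')})^{-1}\}\to\left(\tfrac{A}{\sqrt[\infty]{(b)}}\right)\{(a+\sqrt[\infty]{(b)})^{-1}\}$$ compatible with the canonical maps from $A$; these are isomorphisms when the two open sets are equal. $F_A(U)$ is the (co)limit of the rings $(A/\sqrt[\infty]{(b)})\{(a+\sqrt[\infty]{(b)})^{-1}\}$ over all pairs $(a,b)$ with $U=D^{\infty}(a)\cap Z^{\infty}(b)$, along these isomorphisms, and the restriction maps are induced by the $t^{a',b'}_{a,b}$. Let $H_A$ be the sheaf of $\mathcal{C}^{\infty}$-rings on $\mathrm{Spec}^{\infty-\mathrm{const}}(A)$ associated to $F_A$ (sheafify on the basis and extend uniquely to all open sets). Put $\mathbb{H}(A)=H_A(\mathrm{Spec}^{\infty-\mathrm{const}}(A))$, and let $\mu_A:A\to\mathbb{H}(A)$ be the canonical map $A\to F_A(\mathrm{Spec}^{\infty-\mathrm{const}}(A))\cong A/\sqrt[\infty]{(0)}$ followed by the sheafification map. *)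

theory Defs
  imports "HOL-Analysis.Analysis" "HOL-Algebra.QuotRing"
begin

section \<open>Smooth functions of finitely many real variables\<close>

text \<open>
  The power \<open>X\<^sup>n\<close> of a set is the set of extensional functions on \<open>{..<n}\<close>; for
  \<open>X = \<real>\<close> this is the underlying set of the product topology \<open>powertop_real {..<n}\<close>.
\<close>

abbreviation tuples :: "nat \<Rightarrow> 'a set \<Rightarrow> (nat \<Rightarrow> 'a) set" where
  "tuples n X \<equiv> {..<n} \<rightarrow>\<^sub>E X"

definition partial_deriv :: "nat \<Rightarrow> nat \<Rightarrow> ((nat \<Rightarrow> real) \<Rightarrow> real) \<Rightarrow> (nat \<Rightarrow> real) \<Rightarrow> real" where
  "partial_deriv n i f = (\<lambda>x\<in>tuples n UNIV. deriv (\<lambda>t. f (x(i := t))) (x i))"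

primrec C_k :: "nat \<Rightarrow> nat \<Rightarrow> ((nat \<Rightarrow> real) \<Rightarrow> real) \<Rightarrow> bool" where
  "C_k n 0 f \<longleftrightarrow> continuous_map (powertop_real {..<n}) euclideanreal f"
| "C_k n (Suc k) f \<longleftrightarrow>
     continuous_map (powertop_real {..<n}) euclideanreal f \<and>
     (\<forall>i<n. (\<forall>x\<in>tuples n UNIV. (\<lambda>t. f (x(i := t))) field_differentiable (at (x i))) \<and>
            C_k n k (partial_deriv n i f))"

text \<open>
  Smooth functions are taken extensional, so that each smooth map \<open>\<real>\<^sup>n \<rightarrow> \<real>\<close> is represented
  by exactly one element of \<open>smooth_fns n\<close>.
\<close>

definition smooth_fns :: "nat \<Rightarrow> ((nat \<Rightarrow> real) \<Rightarrow> real) set" where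
  "smooth_fns n = {f \<in> tuples n UNIV \<rightarrow>\<^sub>E UNIV. \<forall>k. C_k n k f}"

definition coord :: "nat \<Rightarrow> nat \<Rightarrow> (nat \<Rightarrow> real) \<Rightarrow> real" where
  "coord n i = (\<lambda>x\<in>tuples n UNIV. x i)"

text \<open>The composite \<open>f \<circ> (g\<^sub>0, \<dots>, g\<^sub>m\<^sub>-\<^sub>1)\<close> of \<open>f : \<real>\<^sup>m \<rightarrow> \<real>\<close> with maps \<open>g\<^sub>i : \<real>\<^sup>n \<rightarrow> \<real>\<close>.\<close>

definition smooth_comp ::
  "nat \<Rightarrow> nat \<Rightarrow> ((nat \<Rightarrow> real) \<Rightarrow> real) \<Rightarrow> (nat \<Rightarrow> (nat \<Rightarrow> real) \<Rightarrow> real) \<Rightarrow> (nat \<Rightarrow> real) \<Rightarrow> real" where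
  "smooth_comp n m f g = (\<lambda>x\<in>tuples n UNIV. f (\<lambda>i\<in>{..<m}. g i x))"


section \<open>\<open>C\<^sup>\<infinity>\<close>-rings and their homomorphisms\<close>

record 'a cinf = "'a partial_object" +
  smooth_op :: "nat \<Rightarrow> ((nat \<Rightarrow> real) \<Rightarrow> real) \<Rightarrow> (nat \<Rightarrow> 'a) \<Rightarrow> 'a"

locale cinf_ring =
  fixes A :: "'a cinf"
  assumes op_closed:
      "\<lbrakk>f \<in> smooth_fns n; x \<in> tuples n (carrier A)\<rbrakk> \<Longrightarrow> smooth_op A n f x \<in> carrier A"
    and op_coord:
      "\<lbrakk>i < n; x \<in> tuples n (carrier A)\<rbrakk> \<Longrightarrow> smooth_op A n (coord n i) x = x i"
    and op_comp:
      "\<lbrakk>f \<in> smooth_fns m; g \<in> {..<m} \<rightarrow> smooth_fns n; x \<in> tuples n (carrier A)\<rbrakk> \<Longrightarrow>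
        smooth_op A n (smooth_comp n m f g) x =
        smooth_op A m f (\<lambda>i\<in>{..<m}. smooth_op A n (g i) x)"

text \<open>Homomorphisms are extensional, so that equality of homomorphisms is equality of functions.\<close>

definition cinf_hom :: "'a cinf \<Rightarrow> 'b cinf \<Rightarrow> ('a \<Rightarrow> 'b) set" where
  "cinf_hom A B = {\<phi> \<in> carrier A \<rightarrow>\<^sub>E carrier B.
     \<forall>n. \<forall>f\<in>smooth_fns n. \<forall>x\<in>tuples n (carrier A).
       \<phi> (smooth_op A n f x) = smooth_op B n f (\<lambda>i\<in>{..<n}. \<phi> (x i))}"

definition cinf_id :: "'a cinf \<Rightarrow> 'a \<Rightarrow> 'a" where
  "cinf_id A = (\<lambda>x\<in>carrier A. x)"

definition cinf_iso :: "'a cinf \<Rightarrow> 'b cinf \<Rightarrow> bool" where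
  "cinf_iso A B \<longleftrightarrow> (\<exists>\<phi>\<in>cinf_hom A B. bij_betw \<phi> (carrier A) (carrier B))"

definition cinf_zero :: "unit cinf" where
  "cinf_zero = \<lparr>carrier = UNIV, smooth_op = (\<lambda>_ _ _. ())\<rparr>"

definition ring_of :: "'a cinf \<Rightarrow> 'a ring" where
  "ring_of A =
    \<lparr>carrier = carrier A,
     mult = (\<lambda>x y. smooth_op A 2 (\<lambda>v\<in>tuples 2 UNIV. v 0 * v 1) (\<lambda>i\<in>{..<2}. if i = 0 then x else y)),
     one = smooth_op A 0 (\<lambda>v\<in>tuples 0 UNIV. 1) (\<lambda>i\<in>{..<0}. undefined),
     zero = smooth_op A 0 (\<lambda>v\<in>tuples 0 UNIV. 0) (\<lambda>i\<in>{..<0}. undefined),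
     add = (\<lambda>x y. smooth_op A 2 (\<lambda>v\<in>tuples 2 UNIV. v 0 + v 1) (\<lambda>i\<in>{..<2}. if i = 0 then x else y))\<rparr>"

definition vN_regular :: "'a cinf \<Rightarrow> bool" where
  "vN_regular A \<longleftrightarrow>
     (\<forall>a\<in>carrier A. \<exists>x\<in>carrier A. a = (a [^]\<^bsub>ring_of A\<^esub> (2::nat)) \<otimes>\<^bsub>ring_of A\<^esub> x)"

definition vN_cinf_ring :: "'a cinf \<Rightarrow> bool" where
  "vN_cinf_ring A \<longleftrightarrow> cinf_ring A \<and> vN_regular A"


section \<open>Quotients and rings of fractions\<close>

definition quot_by :: "'a cinf \<Rightarrow> ('a \<times> 'a) set \<Rightarrow> 'a set cinf" where
  "quot_by A R =
    \<lparr>carrier = carrier A // R,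
     smooth_op = (\<lambda>n f X. R `` {smooth_op A n f (\<lambda>i\<in>{..<n}. SOME x. x \<in> X i)})\<rparr>"

definition ideal_rel :: "'a cinf \<Rightarrow> 'a set \<Rightarrow> ('a \<times> 'a) set" where
  "ideal_rel A I =
     {(x, y). x \<in> carrier A \<and> y \<in> carrier A \<and> x \<ominus>\<^bsub>ring_of A\<^esub> y \<in> I}"

definition quot_ideal :: "'a cinf \<Rightarrow> 'a set \<Rightarrow> 'a set cinf" where
  "quot_ideal A I = quot_by A (ideal_rel A I)"

definition quot_map :: "'a cinf \<Rightarrow> 'a set \<Rightarrow> 'a \<Rightarrow> 'a set" where
  "quot_map A I = (\<lambda>x\<in>carrier A. ideal_rel A I `` {x})"

text \<open>
  The ring \<open>A{S\<^sup>-\<^sup>1}\<close> is presented by generators and relations: formal smooth expressions in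
  the elements of \<open>A\<close> and in formal inverses of the elements of \<open>S\<close>, modulo the least congruence
  that enforces the axioms of \<open>C\<^sup>\<infinity>\<close>-rings, the operations of \<open>A\<close>, and \<open>s \<cdot> s\<^sup>-\<^sup>1 = 1\<close> for \<open>s \<in> S\<close>.
\<close>

datatype 'a frac_term =
    Elt 'a
  | Inv 'a
  | App nat "(nat \<Rightarrow> real) \<Rightarrow> real" "nat \<Rightarrow> 'a frac_term"

inductive_set frac_terms :: "'a cinf \<Rightarrow> 'a set \<Rightarrow> 'a frac_term set"
  for A :: "'a cinf" and S :: "'a set" where
  Elt: "a \<in> carrier A \<Longrightarrow> Elt a \<in> frac_terms A S"
| Inv: "s \<in> S \<Longrightarrow> Inv s \<in> frac_terms A S"
| App: "\<lbrakk>f \<in> smooth_fns n; t \<in> extensional {..<n}; \<And>i. i < n \<Longrightarrow> t i \<in> frac_terms A S\<rbrakk> \<Longrightarrow>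
          App n f t \<in> frac_terms A S"

definition frac_term_alg :: "'a cinf \<Rightarrow> 'a set \<Rightarrow> 'a frac_term cinf" where
  "frac_term_alg A S = \<lparr>carrier = frac_terms A S, smooth_op = App\<rparr>"

inductive_set frac_rel :: "'a cinf \<Rightarrow> 'a set \<Rightarrow> ('a frac_term \<times> 'a frac_term) set"
  for A :: "'a cinf" and S :: "'a set" where
  refl: "t \<in> frac_terms A S \<Longrightarrow> (t, t) \<in> frac_rel A S"
| sym: "(s, t) \<in> frac_rel A S \<Longrightarrow> (t, s) \<in> frac_rel A S"
| trans: "\<lbrakk>(s, t) \<in> frac_rel A S; (t, u) \<in> frac_rel A S\<rbrakk> \<Longrightarrow> (s, u) \<in> frac_rel A S"
| cong: "\<lbrakk>f \<in> smooth_fns n; s \<in> extensional {..<n}; t \<in> extensional {..<n};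
          \<And>i. i < n \<Longrightarrow> (s i, t i) \<in> frac_rel A S\<rbrakk> \<Longrightarrow>
          (App n f s, App n f t) \<in> frac_rel A S"
| coord: "\<lbrakk>i < n; t \<in> tuples n (frac_terms A S)\<rbrakk> \<Longrightarrow>
          (App n (coord n i) t, t i) \<in> frac_rel A S"
| comp: "\<lbrakk>f \<in> smooth_fns m; g \<in> {..<m} \<rightarrow> smooth_fns n; t \<in> tuples n (frac_terms A S)\<rbrakk> \<Longrightarrow>
          (App n (smooth_comp n m f g) t, App m f (\<lambda>i\<in>{..<m}. App n (g i) t)) \<in> frac_rel A S"
| Elt_op: "\<lbrakk>f \<in> smooth_fns n; x \<in> tuples n (carrier A)\<rbrakk> \<Longrightarrow>
          (App n f (\<lambda>i\<in>{..<n}. Elt (x i)), Elt (smooth_op A n f x)) \<in> frac_rel A S"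
| inverse: "s \<in> S \<Longrightarrow>
          (Elt s \<otimes>\<^bsub>ring_of (frac_term_alg A S)\<^esub> Inv s, \<one>\<^bsub>ring_of (frac_term_alg A S)\<^esub>)
            \<in> frac_rel A S"

definition fractions :: "'a cinf \<Rightarrow> 'a set \<Rightarrow> 'a frac_term set cinf" where
  "fractions A S = quot_by (frac_term_alg A S) (frac_rel A S)"

definition fractions_map :: "'a cinf \<Rightarrow> 'a set \<Rightarrow> 'a \<Rightarrow> 'a frac_term set" where
  "fractions_map A S = (\<lambda>a\<in>carrier A. frac_rel A S `` {Elt a})"


section \<open>The smooth spectrum with the constructible topology\<close>

definition cinf_radical :: "'a cinf \<Rightarrow> 'a set \<Rightarrow> 'a set" where
  "cinf_radical A I =
     {a \<in> carrier A. cinf_iso (fractions (quot_ideal A I) {quot_map A I a}) cinf_zero}"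

definition cinf_Spec :: "'a cinf \<Rightarrow> 'a set set" where
  "cinf_Spec A = {p. primeideal p (ring_of A) \<and> cinf_radical A p = p}"

definition D_inf :: "'a cinf \<Rightarrow> 'a \<Rightarrow> 'a set set" where
  "D_inf A a = {p \<in> cinf_Spec A. a \<notin> p}"

definition Z_inf :: "'a cinf \<Rightarrow> 'a \<Rightarrow> 'a set set" where
  "Z_inf A b = {p \<in> cinf_Spec A. b \<in> p}"

definition basic_opens :: "'a cinf \<Rightarrow> 'a set set set" where
  "basic_opens A = {D_inf A a \<inter> Z_inf A b | a b. a \<in> carrier A \<and> b \<in> carrier A}"

definition Spec_const :: "'a cinf \<Rightarrow> 'a set topology" where
  "Spec_const A = topology_generated_by (basic_opens A)"


section \<open>The presheaf on the basic open sets\<close>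

definition rad_principal :: "'a cinf \<Rightarrow> 'a \<Rightarrow> 'a set" where
  "rad_principal A b = cinf_radical A (genideal (ring_of A) {b})"

definition local_ring :: "'a cinf \<Rightarrow> 'a \<Rightarrow> 'a \<Rightarrow> 'a set frac_term set cinf" where
  "local_ring A a b =
     fractions (quot_ideal A (rad_principal A b)) {quot_map A (rad_principal A b) a}"

definition local_map :: "'a cinf \<Rightarrow> 'a \<Rightarrow> 'a \<Rightarrow> 'a \<Rightarrow> 'a set frac_term set" where
  "local_map A a b =
     compose (carrier A)
       (fractions_map (quot_ideal A (rad_principal A b)) {quot_map A (rad_principal A b) a})
       (quot_map A (rad_principal A b))"

text \<open>\<open>transition A a' b' a b\<close> is the map \<open>t\<close> with upper indices \<open>a', b'\<close> and lower indices \<open>a, b\<close>.\<close>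

definition transition ::
  "'a cinf \<Rightarrow> 'a \<Rightarrow> 'a \<Rightarrow> 'a \<Rightarrow> 'a \<Rightarrow> 'a set frac_term set \<Rightarrow> 'a set frac_term set" where
  "transition A a' b' a b =
     (THE \<phi>. \<phi> \<in> cinf_hom (local_ring A a' b') (local_ring A a b) \<and>
             compose (carrier A) \<phi> (local_map A a' b') = local_map A a b)"

definition pairs :: "'a cinf \<Rightarrow> 'a set set \<Rightarrow> ('a \<times> 'a) set" where
  "pairs A U = {(a, b). a \<in> carrier A \<and> b \<in> carrier A \<and> D_inf A a \<inter> Z_inf A b = U}"

type_synonym 'a sec = "'a \<times> 'a \<Rightarrow> 'a set frac_term set"

text \<open>\<open>F_obj A U\<close> is the limit of the rings \<open>local_ring A a b\<close> along the transition maps.\<close>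

definition F_obj :: "'a cinf \<Rightarrow> 'a set set \<Rightarrow> 'a sec cinf" where
  "F_obj A U =
    \<lparr>carrier = {s \<in> (\<Pi>\<^sub>E (a, b)\<in>pairs A U. carrier (local_ring A a b)).
        \<forall>(a', b')\<in>pairs A U. \<forall>(a, b)\<in>pairs A U. transition A a' b' a b (s (a', b')) = s (a, b)},
     smooth_op = (\<lambda>n f s. \<lambda>(a, b)\<in>pairs A U.
        smooth_op (local_ring A a b) n f (\<lambda>i\<in>{..<n}. s i (a, b)))\<rparr>"

text \<open>For \<open>U \<subseteq> U'\<close>, the value of a restricted section at \<open>(a, b)\<close> does not depend on \<open>(a', b')\<close>.\<close>

definition F_res :: "'a cinf \<Rightarrow> 'a set set \<Rightarrow> 'a set set \<Rightarrow> 'a sec \<Rightarrow> 'a sec" where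
  "F_res A U' U s =
     (\<lambda>(a, b)\<in>pairs A U. THE y. \<forall>(a', b')\<in>pairs A U'. transition A a' b' a b (s (a', b')) = y)"

definition F_unit :: "'a cinf \<Rightarrow> 'a set set \<Rightarrow> 'a \<Rightarrow> 'a sec" where
  "F_unit A U x = (\<lambda>(a, b)\<in>pairs A U. local_map A a b x)"


section \<open>The sheaf associated to a presheaf on a base\<close>

text \<open>
  In this section \<open>\<B>\<close> is a base, closed under binary intersections, of a topology, and \<open>(F, \<rho>)\<close> is a
  presheaf of \<open>C\<^sup>\<infinity>\<close>-rings on it, with restriction maps \<open>\<rho> U V\<close> for \<open>V \<subseteq> U\<close>.
\<close>

definition germ ::
  "'p set set \<Rightarrow> ('p set \<Rightarrow> 's cinf) \<Rightarrow> ('p set \<Rightarrow> 'p set \<Rightarrow> 's \<Rightarrow> 's) \<Rightarrow>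
   'p \<Rightarrow> 'p set \<Rightarrow> 's \<Rightarrow> ('p set \<times> 's) set" where
  "germ \<B> F \<rho> p U s =
     {(V, t). V \<in> \<B> \<and> p \<in> V \<and> t \<in> carrier (F V) \<and>
              (\<exists>W\<in>\<B>. p \<in> W \<and> W \<subseteq> U \<inter> V \<and> \<rho> U W s = \<rho> V W t)}"

definition stalk ::
  "'p set set \<Rightarrow> ('p set \<Rightarrow> 's cinf) \<Rightarrow> ('p set \<Rightarrow> 'p set \<Rightarrow> 's \<Rightarrow> 's) \<Rightarrow>
   'p \<Rightarrow> ('p set \<times> 's) set cinf" where
  "stalk \<B> F \<rho> p =
    \<lparr>carrier = {germ \<B> F \<rho> p U s | U s. U \<in> \<B> \<and> p \<in> U \<and> s \<in> carrier (F U)},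
     smooth_op = (\<lambda>n f \<xi>. THE \<eta>. \<exists>U\<in>\<B>. p \<in> U \<and>
        (\<exists>s\<in>tuples n (carrier (F U)).
           (\<forall>i<n. \<xi> i = germ \<B> F \<rho> p U (s i)) \<and> \<eta> = germ \<B> F \<rho> p U (smooth_op (F U) n f s)))\<rparr>"

text \<open>Sections over an open set \<open>W\<close>: families of germs that come locally from sections of \<open>F\<close>.\<close>

definition assoc_sheaf ::
  "'p set set \<Rightarrow> ('p set \<Rightarrow> 's cinf) \<Rightarrow> ('p set \<Rightarrow> 'p set \<Rightarrow> 's \<Rightarrow> 's) \<Rightarrow>
   'p set \<Rightarrow> ('p \<Rightarrow> ('p set \<times> 's) set) cinf" where
  "assoc_sheaf \<B> F \<rho> W =
    \<lparr>carrier = {\<sigma> \<in> (\<Pi>\<^sub>E p\<in>W. carrier (stalk \<B> F \<rho> p)).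
        \<forall>p\<in>W. \<exists>U\<in>\<B>. p \<in> U \<and> U \<subseteq> W \<and> (\<exists>s\<in>carrier (F U). \<forall>q\<in>U. \<sigma> q = germ \<B> F \<rho> q U s)},
     smooth_op = (\<lambda>n f \<sigma>. \<lambda>p\<in>W. smooth_op (stalk \<B> F \<rho> p) n f (\<lambda>i\<in>{..<n}. \<sigma> i p))\<rparr>"

definition sheafification_map ::
  "'p set set \<Rightarrow> ('p set \<Rightarrow> 's cinf) \<Rightarrow> ('p set \<Rightarrow> 'p set \<Rightarrow> 's \<Rightarrow> 's) \<Rightarrow>
   'p set \<Rightarrow> 's \<Rightarrow> 'p \<Rightarrow> ('p set \<times> 's) set" where
  "sheafification_map \<B> F \<rho> U s = (\<lambda>p\<in>U. germ \<B> F \<rho> p U s)"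


section \<open>Global sections and the induced functor\<close>

type_synonym 'a glob = "'a set \<Rightarrow> ('a set set \<times> 'a sec) set"

definition H_sheaf :: "'a cinf \<Rightarrow> 'a set set \<Rightarrow> 'a glob cinf" where
  "H_sheaf A W = assoc_sheaf (basic_opens A) (F_obj A) (F_res A) W"

definition HH :: "'a cinf \<Rightarrow> 'a glob cinf" where
  "HH A = H_sheaf A (topspace (Spec_const A))"

definition mu :: "'a cinf \<Rightarrow> 'a \<Rightarrow> 'a glob" where
  "mu A = (\<lambda>x\<in>carrier A.
     sheafification_map (basic_opens A) (F_obj A) (F_res A) (topspace (Spec_const A))
       (F_unit A (topspace (Spec_const A)) x))"

text \<open>
  The functor \<open>vN\<close> is \<open>HH\<close> on objects and the following on morphisms \<open>f : A \<rightarrow> B\<close>. Both are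
  polymorphic in the types that carry \<open>A\<close> and \<open>B\<close>; no type is fixed as a universe.
\<close>

definition vN_map :: "'a cinf \<Rightarrow> 'b cinf \<Rightarrow> ('a \<Rightarrow> 'b) \<Rightarrow> 'a glob \<Rightarrow> 'b glob" where
  "vN_map A B f =
     (THE g. g \<in> cinf_hom (HH A) (HH B) \<and>
             compose (carrier A) g (mu A) = compose (carrier A) (mu B) f)"

end

(*
  A smooth function F(y, t) becomes, after multiplication by a positive and rapidly decreasing smooth
  function of all its variables, a function G such that G(y, 1/t), extended by 0 to t = 0, is smooth.
  Hence every element of A{a^-1}, being a smooth expression in elements of A and 1/a, is a fraction h/w
  with h, w in A and w invertible. The set where the numerator h vanishes and its complement are basic
  open sets of the constructible topology, so a section of H_A is, locally, zero or invertible, and H(A)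
  is von Neumann regular.

  Let f : A -> V with V von Neumann regular. A maximal ideal q of V is a smooth prime with V/q a field, so
  f induces a homomorphism from the stalk at p = f^-1(q), a field, to V/q. For a section s, these maps give
  a value of s modulo each q. Locally on the maximal spectrum these values come from one element of V;
  the elements e of V such that one element of V works wherever e does not vanish form an ideal which lies in
  no maximal ideal, so one element works everywhere. It is unique because the maximal ideals of V meet in 0.
  Conversely, the characteristic section of D(a) \<inter> Z(b) is a polynomial in mu(a), mu(b) and their
  quasi-inverses, which every homomorphism preserves; so every section is locally a smooth expression in
  elements of the image of mu and their quasi-inverses, and a homomorphism out of H(A) is determined by its
  composite with mu.
*)
theory Submission
  imports Defs "HOL-Algebra.Ring_Divisibility"
begin

section \<open>Smooth functions on the space of real sequences\<close>

text \<open>The obstacle is that \<open>fractions\<close> offers formal smooth expressions in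
  elements of \<open>A\<close> and 1/a, while only functions smooth across t = 0 can be evaluated in
  \<open>A\<close> itself. Decay of G alone makes G(y, 1/t) continuous; for smoothness all
  derivatives must decay against all powers of the coordinates. These functions form a countable
  family, so one weight beats them all. Everything about spectra passes through homomorphisms into
  fields: their kernels are smooth primes, and an element outside the radical of an ideal is made
  invertible by one that kills the ideal. Hence units and zeros of the local rings can be read off
  on the spectrum, which yields the transition maps. Maximal ideals of V may be used because, by
  Hadamard's lemma, ring ideals are congruences for all smooth operations, so V/q is again a smooth
  ring. Quasi-inverses satisfy both xxy = x and yyx = y; this makes them unique, so they glue and
  are preserved by homomorphisms.\<close>

primrec cont_diff :: "nat \<Rightarrow> ((nat \<Rightarrow> real) \<Rightarrow> real) \<Rightarrow> bool" where
  "cont_diff 0 f \<longleftrightarrow> continuous_on UNIV f"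
| "cont_diff (Suc k) f \<longleftrightarrow> continuous_on UNIV f \<and>
     (\<forall>i. \<exists>f'. (\<forall>x. ((\<lambda>t. f (x(i := t))) has_real_derivative f' x) (at (x i))) \<and> cont_diff k f')"

definition csmooth :: "((nat \<Rightarrow> real) \<Rightarrow> real) \<Rightarrow> bool" where
  "csmooth f \<longleftrightarrow> (\<forall>k. cont_diff k f)"

text \<open>Plays the role of an arity: functions live on all sequences, so arguments need no
  extensional padding, and \<open>dep m\<close> recovers that finitely many coordinates matter, as
  the chain rule requires.\<close>

definition dep :: "nat \<Rightarrow> ((nat \<Rightarrow> real) \<Rightarrow> real) \<Rightarrow> bool" where
  "dep m f \<longleftrightarrow> (\<forall>x y. (\<forall>i<m. x i = y i) \<longrightarrow> f x = f y)"

definition pd :: "nat \<Rightarrow> ((nat \<Rightarrow> real) \<Rightarrow> real) \<Rightarrow> (nat \<Rightarrow> real) \<Rightarrow> real" where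
  "pd i f x = deriv (\<lambda>t. f (x(i := t))) (x i)"

lemma tendsto_fun_iff:
  fixes f :: "'b \<Rightarrow> 'i \<Rightarrow> 'a::topological_space"
  shows "(f \<longlongrightarrow> l) F \<longleftrightarrow> (\<forall>i. ((\<lambda>x. f x i) \<longlongrightarrow> l i) F)"
proof -
  have "(f \<longlongrightarrow> l) F \<longleftrightarrow> limitin (product_topology (\<lambda>i::'i. euclidean) UNIV) f l F"
    by (simp add: euclidean_product_topology)
  then show ?thesis
    by (simp add: limitin_componentwise)
qed

lemma continuous_on_fun_upd [continuous_intros]:
  assumes "continuous_on A (f :: 'b::topological_space \<Rightarrow> 'i \<Rightarrow> 'a::topological_space)" "continuous_on A g"
  shows "continuous_on A (\<lambda>x. (f x)(i := g x))"
proof (rule continuous_on_coordinatewise_then_product)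
  show "continuous_on A (\<lambda>x. ((f x)(i := g x)) j)" for j
    by (cases "j = i") (use assms in \<open>auto intro: continuous_on_product_then_coordinatewise\<close>)
qed

section \<open>Closure of k-fold differentiability under sums, products, inverses and
  composition\<close>

lemma cont_diff_continuous: "cont_diff k f \<Longrightarrow> continuous_on UNIV f"
  by (cases k) auto

lemma cont_diff_Suc_D: "cont_diff (Suc k) f \<Longrightarrow> cont_diff k f"
proof (induction k arbitrary: f)
  case (Suc k)
  then show ?case by (metis cont_diff.simps(2))
qed simp

lemma cont_diff_SucI:
  assumes "continuous_on UNIV f"
    and "\<And>i x. ((\<lambda>t. f (x(i := t))) has_real_derivative f' i x) (at (x i))"
    and "\<And>i. cont_diff k (f' i)"
  shows "cont_diff (Suc k) f"
  using assms by auto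

lemma cont_diff_SucE:
  assumes "cont_diff (Suc k) f"
  obtains f' where "\<And>i x. ((\<lambda>t. f (x(i := t))) has_real_derivative f' i x) (at (x i))"
    "\<And>i. cont_diff k (f' i)" "continuous_on UNIV f"
  using assms unfolding cont_diff.simps by metis

lemma cont_diff_const: "cont_diff k (\<lambda>x. c)"
proof (induction k arbitrary: c)
  case (Suc k)
  show ?case
    by (rule cont_diff_SucI[where f' = "\<lambda>_ _. 0"]) (auto intro: Suc)
qed simp

lemma cont_diff_coord: "cont_diff k (\<lambda>x. x j)"
proof (cases k)
  case (Suc m)
  show ?thesis unfolding Suc
  proof (rule cont_diff_SucI[where f' = "\<lambda>i _. if i = j then 1 else 0"])
    show "((\<lambda>t. (x(i := t)) j) has_real_derivative (if i = j then 1 else 0)) (at (x i))" for i and x :: "nat \<Rightarrow> real"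
      by (cases "i = j") auto
  qed (auto intro: cont_diff_const)
qed simp

lemma cont_diff_add: "cont_diff k f \<Longrightarrow> cont_diff k g \<Longrightarrow> cont_diff k (\<lambda>x. f x + g x)"
proof (induction k arbitrary: f g)
  case 0
  then show ?case by (auto intro: continuous_intros)
next
  case (Suc k)
  obtain f' where f: "\<And>i x. ((\<lambda>t. f (x(i := t))) has_real_derivative f' i x) (at (x i))"
    "\<And>i. cont_diff k (f' i)" "continuous_on UNIV f"
    using Suc.prems(1) by (rule cont_diff_SucE) (rule that)
  obtain g' where g: "\<And>i x. ((\<lambda>t. g (x(i := t))) has_real_derivative g' i x) (at (x i))"
    "\<And>i. cont_diff k (g' i)" "continuous_on UNIV g"
    using Suc.prems(2) by (rule cont_diff_SucE) (rule that)
  show ?case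
  proof (rule cont_diff_SucI[where f' = "\<lambda>i x. f' i x + g' i x"])
    show "continuous_on UNIV (\<lambda>x. f x + g x)"
      by (rule continuous_on_add[OF f(3) g(3)])
    show "((\<lambda>t. f (x(i := t)) + g (x(i := t))) has_real_derivative f' i x + g' i x) (at (x i))" for i x
      by (rule DERIV_add[OF f(1) g(1)])
    show "cont_diff k (\<lambda>x. f' i x + g' i x)" for i
      by (rule Suc.IH[OF f(2) g(2)])
  qed
qed

lemma cont_diff_mult: "cont_diff k f \<Longrightarrow> cont_diff k g \<Longrightarrow> cont_diff k (\<lambda>x. f x * g x)"
proof (induction k arbitrary: f g)
  case 0
  then show ?case by (auto intro: continuous_intros)
next
  case (Suc k)
  obtain f' where f: "\<And>i x. ((\<lambda>t. f (x(i := t))) has_real_derivative f' i x) (at (x i))"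
    "\<And>i. cont_diff k (f' i)" "continuous_on UNIV f"
    using Suc.prems(1) by (rule cont_diff_SucE) (rule that)
  obtain g' where g: "\<And>i x. ((\<lambda>t. g (x(i := t))) has_real_derivative g' i x) (at (x i))"
    "\<And>i. cont_diff k (g' i)" "continuous_on UNIV g"
    using Suc.prems(2) by (rule cont_diff_SucE) (rule that)
  show ?case
  proof (rule cont_diff_SucI[where f' = "\<lambda>i x. f' i x * g x + g' i x * f x"])
    show "continuous_on UNIV (\<lambda>x. f x * g x)"
      by (rule continuous_on_mult[OF f(3) g(3)])
    show "((\<lambda>t. f (x(i := t)) * g (x(i := t))) has_real_derivative f' i x * g x + g' i x * f x) (at (x i))" for i x
      using DERIV_mult[OF f(1)[where i=i and x=x] g(1)[where i=i and x=x]] by simp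
    show "cont_diff k (\<lambda>x. f' i x * g x + g' i x * f x)" for i
      by (rule cont_diff_add[OF Suc.IH[OF f(2) cont_diff_Suc_D[OF Suc.prems(2)]]
            Suc.IH[OF g(2) cont_diff_Suc_D[OF Suc.prems(1)]]])
  qed
qed

lemma cont_diff_minus: "cont_diff k f \<Longrightarrow> cont_diff k (\<lambda>x. - f x)"
  using cont_diff_mult[OF cont_diff_const[where c="-1"]] by force

lemma cont_diff_sum: "(\<And>i. i \<in> I \<Longrightarrow> cont_diff k (f i)) \<Longrightarrow> cont_diff k (\<lambda>x. \<Sum>i\<in>I. f i x)"
proof (induction I rule: infinite_finite_induct)
  case (insert i I)
  then show ?case by (simp add: cont_diff_add)
qed (auto simp: cont_diff_const)

lemma cont_diff_inverse: "cont_diff k f \<Longrightarrow> (\<And>x. f x \<noteq> 0) \<Longrightarrow> cont_diff k (\<lambda>x. inverse (f x))"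
proof (induction k)
  case 0
  then show ?case by (auto intro: continuous_intros)
next
  case (Suc k)
  obtain f' where f: "\<And>i x. ((\<lambda>t. f (x(i := t))) has_real_derivative f' i x) (at (x i))"
    "\<And>i. cont_diff k (f' i)" "continuous_on UNIV f"
    using Suc.prems(1) by (rule cont_diff_SucE) (rule that)
  have inv: "cont_diff k (\<lambda>x. inverse (f x))"
    using Suc.IH Suc.prems cont_diff_Suc_D by blast
  show ?case
  proof (rule cont_diff_SucI[where f' = "\<lambda>i x. - (inverse (f x) * f' i x * inverse (f x))"])
    show "continuous_on UNIV (\<lambda>x. inverse (f x))"
      using f(3) Suc.prems(2) by (intro continuous_intros) auto
    show "((\<lambda>t. inverse (f (x(i := t)))) has_real_derivative - (inverse (f x) * f' i x * inverse (f x))) (at (x i))" for i x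
      using DERIV_inverse'[OF f(1)[where i=i and x=x]] Suc.prems by simp
    show "cont_diff k (\<lambda>x. - (inverse (f x) * f' i x * inverse (f x)))" for i
      by (rule cont_diff_minus[OF cont_diff_mult[OF cont_diff_mult[OF inv f(2)] inv]])
  qed
qed

text \<open>For i < m the two one-variable slices coincide and derivatives are unique; for i >= m
  every slice is constant, so the derivative is 0.\<close>

lemma partial_dep:
  assumes "dep m f"
    and d: "\<And>i x. ((\<lambda>t. f (x(i := t))) has_real_derivative f' i x) (at (x i))"
  shows "dep m (f' i)"
  unfolding dep_def
proof (intro allI impI)
  fix x y :: "nat \<Rightarrow> real" assume xy: "\<forall>i<m. x i = y i"
  show "f' i x = f' i y"
  proof (cases "i < m")
    case True
    have "(\<lambda>t. f (x(i := t))) = (\<lambda>t. f (y(i := t)))"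
      using assms(1) xy by (auto simp: dep_def fun_eq_iff)
    then show ?thesis using d[of x i] d[of y i] True xy by (simp add: DERIV_unique)
  next
    case False
    have "(\<lambda>t. f (z(i := t))) = (\<lambda>t. f z)" for z
      using assms(1) False by (auto simp: dep_def fun_eq_iff)
    then have "f' i z = 0" for z
      using d[of z i] DERIV_unique[OF _ DERIV_const] by simp
    then show ?thesis by simp
  qed
qed

text \<open>The increments in the coordinates \<open>j < m\<close> are added one coordinate at a time, each being
  controlled by the mean value theorem.\<close>

lemma DERIV_chain_coords:
  fixes f :: "(nat \<Rightarrow> real) \<Rightarrow> real" and g :: "nat \<Rightarrow> real \<Rightarrow> real"
  assumes dep: "dep m f"
    and d: "\<And>i x. ((\<lambda>t. f (x(i := t))) has_real_derivative f' i x) (at (x i))"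
    and c: "\<And>i. continuous_on UNIV (f' i)"
    and g: "\<And>j. j < m \<Longrightarrow> (g j has_real_derivative g' j) (at t0)"
  shows "((\<lambda>t. f (\<lambda>j. g j t)) has_real_derivative (\<Sum>j<m. f' j (\<lambda>j. g j t0) * g' j)) (at t0)"
proof -
  define x0 where "x0 = (\<lambda>j. g j t0)"
  define X where "X p t = (\<lambda>j. if j < p then g j t else g j t0)" for p t
  have "((\<lambda>t. f (X p t)) has_real_derivative (\<Sum>j<p. f' j x0 * g' j)) (at t0)" if "p \<le> m" for p
    using that
  proof (induction p)
    case 0
    have "X 0 = (\<lambda>t. x0)" by (auto simp: X_def x0_def)
    then show ?case by simp
  next
    case (Suc p)
    have upd: "X (Suc p) t = (X p t)(p := g p t)" "X p t = (X p t)(p := g p t0)" for t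
      by (auto simp: X_def fun_eq_iff less_Suc_eq)
    have "\<exists>\<xi>. \<bar>\<xi> - g p t0\<bar> \<le> \<bar>g p t - g p t0\<bar> \<and>
        f ((X p t)(p := g p t)) - f ((X p t)(p := g p t0)) = (g p t - g p t0) * f' p ((X p t)(p := \<xi>))" for t
    proof -
      have dd: "((\<lambda>s. f ((X p t)(p := s))) has_real_derivative f' p ((X p t)(p := s))) (at s)" for s
        using d[of "(X p t)(p := s)" p] by simp
      consider "g p t = g p t0" | "g p t < g p t0" | "g p t > g p t0" by linarith
      then show ?thesis
      proof cases
        case 2
        then obtain z where "z > g p t" "z < g p t0"
          "f ((X p t)(p := g p t0)) - f ((X p t)(p := g p t)) = (g p t0 - g p t) * f' p ((X p t)(p := z))"
          using MVT2[OF 2, of "\<lambda>s. f ((X p t)(p := s))" "\<lambda>s. f' p ((X p t)(p := s))"] dd by blast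
        then show ?thesis by (intro exI[of _ z]) (auto simp: algebra_simps)
      next
        case 3
        then obtain z where "z > g p t0" "z < g p t"
          "f ((X p t)(p := g p t)) - f ((X p t)(p := g p t0)) = (g p t - g p t0) * f' p ((X p t)(p := z))"
          using MVT2[OF 3, of "\<lambda>s. f ((X p t)(p := s))" "\<lambda>s. f' p ((X p t)(p := s))"] dd by blast
        then show ?thesis by (intro exI[of _ z]) auto
      qed auto
    qed
    then obtain \<xi> where \<xi>: "\<And>t. \<bar>\<xi> t - g p t0\<bar> \<le> \<bar>g p t - g p t0\<bar>"
      "\<And>t. f ((X p t)(p := g p t)) - f ((X p t)(p := g p t0)) = (g p t - g p t0) * f' p ((X p t)(p := \<xi> t))"
      by metis
    have gc: "(g j \<longlongrightarrow> g j t0) (at t0)" if "j < m" for j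
      using DERIV_isCont[OF g[OF that]] by (simp add: isCont_def)
    have "((\<lambda>t. \<bar>g p t - g p t0\<bar>) \<longlongrightarrow> 0) (at t0)"
      using tendsto_rabs[OF LIM_zero[OF gc]] Suc.prems by simp
    then have "((\<lambda>t. \<xi> t - g p t0) \<longlongrightarrow> 0) (at t0)"
      by (rule Lim_null_comparison[rotated]) (simp add: \<xi>)
    then have \<xi>c: "(\<xi> \<longlongrightarrow> g p t0) (at t0)" by (rule LIM_zero_cancel)
    \<comment> \<open>The mean value points are squeezed between \<open>g p t0\<close> and
      \<open>g p t\<close>, so the intermediate points tend to \<open>x0\<close> in each coordinate;
      continuity of \<open>f' p\<close> at \<open>x0\<close> then gives the limit of the
      quotient.\<close>
    have "((\<lambda>t. (X p t)(p := \<xi> t)) \<longlongrightarrow> x0) (at t0)"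
      unfolding tendsto_fun_iff
    proof (intro allI)
      fix i
      consider "i = p" | "i < p" | "i > p" by linarith
      then show "((\<lambda>t. ((X p t)(p := \<xi> t)) i) \<longlongrightarrow> x0 i) (at t0)"
        by cases (use \<xi>c gc[of i] Suc.prems in \<open>auto simp: X_def x0_def\<close>)
    qed
    moreover have "isCont (f' p) x0" using c by (simp add: continuous_on_eq_continuous_at)
    ultimately have "((\<lambda>t. f' p ((X p t)(p := \<xi> t))) \<longlongrightarrow> f' p x0) (at t0)"
      using isCont_tendsto_compose by blast
    moreover have "((\<lambda>t. (g p t - g p t0) / (t - t0)) \<longlongrightarrow> g' p) (at t0)"
      using g[of p] Suc.prems by (simp add: has_field_derivative_iff)
    ultimately have "((\<lambda>t. f' p ((X p t)(p := \<xi> t)) * ((g p t - g p t0) / (t - t0))) \<longlongrightarrow> f' p x0 * g' p) (at t0)"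
      by (rule tendsto_mult)
    moreover have "f' p ((X p t)(p := \<xi> t)) * ((g p t - g p t0) / (t - t0)) =
      ((f (X (Suc p) t) - f (X p t)) - (f (X (Suc p) t0) - f (X p t0))) / (t - t0)" for t
    proof -
      have "f (X (Suc p) t) - f (X p t) = (g p t - g p t0) * f' p ((X p t)(p := \<xi> t))"
        using \<xi>(2)[of t] upd(1)[of t] upd(2)[of t] by simp
      moreover have "X (Suc p) t0 = X p t0" by (auto simp: X_def)
      ultimately show ?thesis by simp
    qed
    ultimately have "((\<lambda>t. f (X (Suc p) t) - f (X p t)) has_real_derivative f' p x0 * g' p) (at t0)"
      by (simp only: has_field_derivative_iff)
    from DERIV_add[OF this Suc.IH] Suc.prems show ?case by (simp add: add.commute)
  qed
  from this[of m] have "((\<lambda>t. f (X m t)) has_real_derivative (\<Sum>j<m. f' j x0 * g' j)) (at t0)" by simp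
  moreover have "(\<lambda>t. f (X m t)) = (\<lambda>t. f (\<lambda>j. g j t))"
    using dep by (auto simp: dep_def X_def fun_eq_iff)
  ultimately show ?thesis by (simp add: x0_def)
qed

text \<open>Induction on k with \<open>f\<close> general: the chain rule expresses the partial
  derivatives as a finite sum of products of \<open>f' j\<close> composed with \<open>g\<close> and
  derivatives of \<open>g j\<close>, and \<open>f' j\<close> inherits \<open>dep m\<close>.\<close>

lemma cont_diff_comp:
  "cont_diff k f \<Longrightarrow> dep m f \<Longrightarrow> (\<And>j. cont_diff k (g j)) \<Longrightarrow> cont_diff k (\<lambda>x. f (\<lambda>j. g j x))"
proof (induction k arbitrary: f)
  case 0
  have "continuous_on UNIV (\<lambda>x. (\<lambda>j. g j x))"
    by (rule continuous_on_coordinatewise_then_product) (rule cont_diff_continuous[OF "0.prems"(3)])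
  from continuous_on_compose2[OF cont_diff_continuous[OF "0.prems"(1)] this] show ?case by simp
next
  case (Suc k)
  obtain f' where f: "\<And>i x. ((\<lambda>t. f (x(i := t))) has_real_derivative f' i x) (at (x i))"
    "\<And>i. cont_diff k (f' i)" "continuous_on UNIV f"
    using Suc.prems(1) by (rule cont_diff_SucE) (rule that)
  have "\<forall>j. \<exists>g'. (\<forall>i x. ((\<lambda>t. g j (x(i := t))) has_real_derivative g' i x) (at (x i))) \<and>
    (\<forall>i. cont_diff k (g' i))"
  proof
    fix j
    show "\<exists>g'. (\<forall>i x. ((\<lambda>t. g j (x(i := t))) has_real_derivative g' i x) (at (x i))) \<and>
      (\<forall>i. cont_diff k (g' i))"
      using Suc.prems(3)[of j] by (rule cont_diff_SucE) blast
  qed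
  then obtain g' where g: "\<And>j i x. ((\<lambda>t. g j (x(i := t))) has_real_derivative g' j i x) (at (x i))"
    "\<And>j i. cont_diff k (g' j i)"
    by metis
  have gk: "cont_diff k (g j)" for j by (rule cont_diff_Suc_D[OF Suc.prems(3)])
  show ?case
  proof (rule cont_diff_SucI[where f' = "\<lambda>i x. \<Sum>j<m. f' j (\<lambda>j. g j x) * g' j i x"])
    show "continuous_on UNIV (\<lambda>x. f (\<lambda>j. g j x))"
    proof -
      have "continuous_on UNIV (\<lambda>x. (\<lambda>j. g j x))"
        by (rule continuous_on_coordinatewise_then_product) (rule cont_diff_continuous[OF gk])
      from continuous_on_compose2[OF f(3) this] show ?thesis by simp
    qed
    show "((\<lambda>t. f (\<lambda>j. g j (x(i := t)))) has_real_derivative (\<Sum>j<m. f' j (\<lambda>j. g j x) * g' j i x)) (at (x i))" for i x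
      using DERIV_chain_coords[OF Suc.prems(2) f(1) cont_diff_continuous[OF f(2)], OF g(1)[where x=x and i=i]]
        by (simp only: fun_upd_triv)
    show "cont_diff k (\<lambda>x. \<Sum>j<m. f' j (\<lambda>j. g j x) * g' j i x)" for i
    proof (rule cont_diff_sum)
      fix j
      have "dep m (f' j)" by (rule partial_dep[OF Suc.prems(2) f(1)])
      then have "cont_diff k (\<lambda>x. f' j (\<lambda>j. g j x))"
        by (rule Suc.IH[OF f(2)]) (rule gk)
      then show "cont_diff k (\<lambda>x. f' j (\<lambda>j. g j x) * g' j i x)"
        by (rule cont_diff_mult) (rule g)
    qed
  qed
qed

section \<open>Smooth functions on sequences and their partial derivatives\<close>

lemma csmoothI [intro?]: "(\<And>k. cont_diff k f) \<Longrightarrow> csmooth f"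
  by (simp add: csmooth_def)

lemma csmooth_const: "csmooth (\<lambda>x. c)"
  by (simp add: csmooth_def cont_diff_const)

lemma csmooth_coord: "csmooth (\<lambda>x. x j)"
  by (simp add: csmooth_def cont_diff_coord)

lemma csmooth_add: "csmooth f \<Longrightarrow> csmooth g \<Longrightarrow> csmooth (\<lambda>x. f x + g x)"
  by (simp add: csmooth_def cont_diff_add)

lemma csmooth_mult: "csmooth f \<Longrightarrow> csmooth g \<Longrightarrow> csmooth (\<lambda>x. f x * g x)"
  by (simp add: csmooth_def cont_diff_mult)

lemma csmooth_minus: "csmooth f \<Longrightarrow> csmooth (\<lambda>x. - f x)"
  by (simp add: csmooth_def cont_diff_minus)

lemma csmooth_inverse: "csmooth f \<Longrightarrow> (\<And>x. f x \<noteq> 0) \<Longrightarrow> csmooth (\<lambda>x. inverse (f x))"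
  by (simp add: csmooth_def cont_diff_inverse)

lemma csmooth_sum: "(\<And>i. i \<in> I \<Longrightarrow> csmooth (F i)) \<Longrightarrow> csmooth (\<lambda>x. \<Sum>i\<in>I. F i x)"
  by (simp add: csmooth_def cont_diff_sum)

lemma csmooth_comp:
  assumes "csmooth f" "dep m f" "\<And>j. csmooth (G j)"
  shows "csmooth (\<lambda>x. f (\<lambda>j. G j x))"
  unfolding csmooth_def
proof
  fix k
  show "cont_diff k (\<lambda>x. f (\<lambda>j. G j x))"
    by (rule cont_diff_comp[OF _ assms(2)]) (use assms(1,3) in \<open>simp_all add: csmooth_def\<close>)
qed

lemma csmooth_diff: "csmooth f \<Longrightarrow> csmooth g \<Longrightarrow> csmooth (\<lambda>x. f x - g x)"
  using csmooth_add[OF _ csmooth_minus[of g], of f] by simp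

lemma csmooth_power: "csmooth f \<Longrightarrow> csmooth (\<lambda>x. f x ^ n)"
  by (induction n) (auto intro: csmooth_const csmooth_mult)

lemmas csmooth_intros =
  csmooth_const csmooth_coord csmooth_add csmooth_mult csmooth_minus csmooth_sum csmooth_diff csmooth_power

lemma csmooth_continuous: "csmooth f \<Longrightarrow> continuous_on UNIV f"
  using cont_diff_continuous csmooth_def by blast

text \<open>A priori the derivative asserted by \<open>cont_diff (Suc k)\<close> depends on k;
  uniqueness of derivatives identifies all of them with \<open>pd i f\<close>.\<close>

lemma csmooth_pd:
  assumes "csmooth f"
  shows DERIV_pd: "((\<lambda>t. f (x(i := t))) has_real_derivative pd i f x) (at (x i))"
    and csmooth_pd': "csmooth (pd i f)"
proof -
  have eq: "f' = pd i f" if "\<And>x. ((\<lambda>t. f (x(i := t))) has_real_derivative f' x) (at (x i))" for f'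
    using DERIV_imp_deriv[OF that] by (auto simp: pd_def fun_eq_iff)
  have "cont_diff (Suc k) f" for k using assms by (simp add: csmooth_def)
  then have *: "(\<forall>x. ((\<lambda>t. f (x(i := t))) has_real_derivative pd i f x) (at (x i))) \<and> cont_diff k (pd i f)" for k
    using eq unfolding cont_diff.simps by metis
  show "((\<lambda>t. f (x(i := t))) has_real_derivative pd i f x) (at (x i))" "csmooth (pd i f)"
    using * by (auto simp: csmooth_def)
qed

lemma dep_pd: "csmooth f \<Longrightarrow> dep m f \<Longrightarrow> dep m (pd i f)"
  using partial_dep[of m f "\<lambda>i. pd i f"] DERIV_pd by blast

text \<open>Induction on k without leaving \<open>K\<close>. This coinductive criterion serves
  functions given by integrals or by extension with 0, where one writes down a class closed under
  differentiation instead of iterated derivatives.\<close>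

lemma csmooth_class:
  assumes "\<And>G. G \<in> K \<Longrightarrow> continuous_on UNIV G"
    and "\<And>G i. G \<in> K \<Longrightarrow> \<exists>G'\<in>K. \<forall>x. ((\<lambda>t. G (x(i := t))) has_real_derivative G' x) (at (x i))"
    and "G \<in> K"
  shows "csmooth G"
proof
  fix k
  show "cont_diff k G" using assms(3)
  proof (induction k arbitrary: G)
    case (Suc k)
    then show ?case unfolding cont_diff.simps using assms(1,2) by blast
  qed (simp add: assms)
qed

subsection \<open>Comparison with the smooth functions on tuples\<close>

text \<open>Restriction from sequences to tuples is continuous, and so is the inclusion of tuples
  into sequences, because the coordinates beyond n are constantly \<open>undefined\<close>.\<close>

lemma continuous_map_tuples_iff:
  "continuous_map (powertop_real {..<n}) euclideanreal f \<longleftrightarrow>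
   continuous_on UNIV (\<lambda>x. f (restrict x {..<n}))"
proof
  assume f: "continuous_map (powertop_real {..<n}) euclideanreal f"
  have "continuous_map (powertop_real UNIV) (powertop_real {..<n}) (\<lambda>x. restrict x {..<n})"
    using continuous_map_product_projection[of _ UNIV "\<lambda>_. euclideanreal"]
    by (auto simp: continuous_map_componentwise restrict_def extensional_def)
  from continuous_map_compose[OF this f]
  show "continuous_on UNIV (\<lambda>x. f (restrict x {..<n}))"
    by (simp add: euclidean_product_topology o_def)
next
  assume "continuous_on UNIV (\<lambda>x. f (restrict x {..<n}))"
  then have f: "continuous_map (powertop_real UNIV) euclideanreal (\<lambda>x. f (restrict x {..<n}))"
    by (simp add: euclidean_product_topology)
  have "continuous_map (powertop_real {..<n}) euclideanreal (\<lambda>x. x k)" for k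
  proof (cases "k < n")
    case True
    then show ?thesis
      using continuous_map_product_projection[of k "{..<n}" "\<lambda>_. euclideanreal"] by simp
  next
    case False
    then show ?thesis
      using continuous_map_eq[of "powertop_real {..<n}" euclideanreal "\<lambda>x. undefined" "\<lambda>x. x k"]
      by (auto simp: PiE_def extensional_def)
  qed
  then have "continuous_map (powertop_real {..<n}) (powertop_real UNIV) (\<lambda>x. x)"
    by (auto simp: continuous_map_componentwise_UNIV)
  from continuous_map_compose[OF this f]
  show "continuous_map (powertop_real {..<n}) euclideanreal f"
    by (rule continuous_map_eq) auto
qed

lemma restrict_upd_tuple: "i < n \<Longrightarrow> restrict (x(i := t)) {..<n} = (restrict x {..<n})(i := t)"
  by (auto simp: restrict_def fun_eq_iff)

lemma restrict_upd_tuple': "\<not> i < n \<Longrightarrow> restrict (x(i := t)) {..<n} = restrict x {..<n}"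
  by (auto simp: restrict_def fun_eq_iff)

text \<open>Updating a coordinate i < n commutes with restriction, so both notions differentiate the
  same slices; a coordinate i >= n contributes the derivative 0. Conversely
  \<open>partial_dep\<close> shows that \<open>f' i\<close> is determined by its values on
  tuples.\<close>

lemma C_k_iff: "C_k n k f \<longleftrightarrow> cont_diff k (\<lambda>x. f (restrict x {..<n}))"
proof (induction k arbitrary: f)
  case 0
  show ?case by (simp only: C_k.simps cont_diff.simps continuous_map_tuples_iff)
next
  case (Suc k)
  let ?f = "\<lambda>x. f (restrict x {..<n})"
  have restr: "restrict x {..<n} \<in> tuples n UNIV" for x :: "nat \<Rightarrow> real" by auto
  have up: "restrict (x(i := t)) {..<n} = (restrict x {..<n})(i := t)" if "i < n" for x :: "nat \<Rightarrow> real" and i t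
    using that by (rule restrict_upd_tuple)
  show ?case
  proof
    assume L: "C_k n (Suc k) f"
    show "cont_diff (Suc k) ?f"
    proof (rule cont_diff_SucI[where f' = "\<lambda>i x. if i < n then partial_deriv n i f (restrict x {..<n}) else 0"])
      show "continuous_on UNIV ?f" using L by (simp only: C_k.simps continuous_map_tuples_iff)
      show "((\<lambda>t. f (restrict (x(i := t)) {..<n})) has_real_derivative
          (if i < n then partial_deriv n i f (restrict x {..<n}) else 0)) (at (x i))" for i and x :: "nat \<Rightarrow> real"
      proof (cases "i < n")
        case True
        with L have "\<forall>z\<in>tuples n UNIV. (\<lambda>t. f (z(i := t))) field_differentiable (at (z i))"
          by simp
        from bspec[OF this restr[of x]] True
        have "(\<lambda>t. f ((restrict x {..<n})(i := t))) field_differentiable (at (x i))"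
          by simp
        then show ?thesis
          using True restr[of x] by (simp add: partial_deriv_def up flip: DERIV_deriv_iff_field_differentiable)
      next
        case False
        then show ?thesis by (simp add: restrict_upd_tuple')
      qed
      show "cont_diff k (\<lambda>x. if i < n then partial_deriv n i f (restrict x {..<n}) else 0)" for i
      proof (cases "i < n")
        case True
        then have "C_k n k (partial_deriv n i f)" using L by simp
        then show ?thesis using True unfolding Suc by (simp only: if_True)
      qed (simp add: cont_diff_const)
    qed
  next
    assume R: "cont_diff (Suc k) ?f"
    then obtain f' where f: "\<And>i x. ((\<lambda>t. f (restrict (x(i := t)) {..<n})) has_real_derivative f' i x) (at (x i))"
      "\<And>i. cont_diff k (f' i)" "continuous_on UNIV ?f"
      by (rule cont_diff_SucE) (rule that)
    have "(\<lambda>t. f (x(i := t))) field_differentiable at (x i) \<and> deriv (\<lambda>t. f (x(i := t))) (x i) = f' i x"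
      if "x \<in> tuples n UNIV" "i < n" for x i
    proof -
      have "restrict x {..<n} = x" using that by (auto simp: PiE_restrict)
      then show ?thesis using f(1)[of x i] that
        by (auto simp: up field_differentiable_def intro: DERIV_imp_deriv)
    qed note * = this
    have "dep n ?f" by (auto simp: dep_def restrict_def intro!: arg_cong[where f=f])
    then have dep: "dep n (f' i)" for i using partial_dep[OF _ f(1)] by blast
    have "C_k n k (partial_deriv n i f)" if "i < n" for i
    proof -
      have "partial_deriv n i f (restrict x {..<n}) = f' i x" for x
      proof -
        have "f' i (restrict x {..<n}) = f' i x" using dep by (auto simp: dep_def)
        then show ?thesis
          using *[OF restr that, of x] that by (simp add: partial_deriv_def)
      qed
      then show ?thesis unfolding Suc using f(2) by simp
    qed
    then show "C_k n (Suc k) f"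
      using f(3) * by (auto simp: continuous_map_tuples_iff)
  qed
qed

lemma smooth_fns_iff:
  "f \<in> smooth_fns n \<longleftrightarrow> f \<in> extensional (tuples n UNIV) \<and> csmooth (\<lambda>x. f (restrict x {..<n}))"
  by (auto simp: smooth_fns_def C_k_iff csmooth_def PiE_def)

lemma smooth_fns_restrict:
  assumes "csmooth f" "dep n f"
  shows "restrict f (tuples n UNIV) \<in> smooth_fns n"
proof -
  have "restrict f (tuples n UNIV) (restrict x {..<n}) = f x" for x
    using assms(2) by (auto simp: dep_def)
  then show ?thesis using assms(1) by (simp add: smooth_fns_iff)
qed

section \<open>Analytic lemmas\<close>

subsection \<open>Hadamard's lemma\<close>

text \<open>The class of all such integrals is closed under differentiation: for i other than m one
  differentiates under the integral sign, and the integral does not vary with the coordinate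
  m.\<close>

lemma csmooth_integral:
  assumes "csmooth H"
  shows "csmooth (\<lambda>x. integral {0..1} (\<lambda>t. H (x(m := t))))"
proof (rule csmooth_class[where K = "(\<lambda>H x. integral {0..1} (\<lambda>t. H (x(m := t)))) ` Collect csmooth"])
  have cont: "continuous_on UNIV (\<lambda>x. integral {0..1} (\<lambda>t. H (x(m := t))))" if "csmooth H" for H
  proof -
    have "continuous_on (UNIV \<times> cbox 0 1) (\<lambda>(x::nat\<Rightarrow>real, t). H (x(m := t)))"
      unfolding case_prod_beta
      by (rule continuous_on_compose2[OF csmooth_continuous[OF that]])
         (intro continuous_on_fun_upd continuous_intros, simp)
    from integral_continuous_on_param[OF this] show ?thesis by simp
  qed
  show "continuous_on UNIV G" if "G \<in> (\<lambda>H x. integral {0..1} (\<lambda>t. H (x(m := t)))) ` Collect csmooth" for G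
    using that cont by auto
  show "\<exists>G'\<in>(\<lambda>H x. integral {0..1} (\<lambda>t. H (x(m := t)))) ` Collect csmooth.
       \<forall>x. ((\<lambda>t. G (x(i := t))) has_real_derivative G' x) (at (x i))"
    if G: "G \<in> (\<lambda>H x. integral {0..1} (\<lambda>t. H (x(m := t)))) ` Collect csmooth" for G i
  proof (cases "i = m")
    case True
    have "((\<lambda>t. G (x(i := t))) has_real_derivative 0) (at (x i))" for x
      using G True by auto
    \<comment> \<open>The derivative 0 has to be exhibited as the integral of a smooth function to
      stay in the class.\<close>
    moreover have "(\<lambda>x. 0) = (\<lambda>x. integral {0..1} (\<lambda>t. (\<lambda>_. 0::real) (x(m := t))))" by simp
    ultimately show ?thesis using csmooth_const[of 0]
      by (intro bexI[of _ "\<lambda>x. 0"] allI) (auto intro!: image_eqI[where x="\<lambda>_. 0"])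
  next
    case False
    from G obtain H where H: "csmooth H" "G = (\<lambda>x. integral {0..1} (\<lambda>t. H (x(m := t))))" by auto
    have "((\<lambda>s. integral {0..1} (\<lambda>t. H (x(m := t, i := s)))) has_real_derivative
        integral {0..1} (\<lambda>t. pd i H (x(m := t)))) (at (x i))" for x
    proof -
      have d: "((\<lambda>s. H (x(m := t, i := s))) has_real_derivative pd i H (x(m := t, i := s))) (at s)" for s t
        using DERIV_pd[OF H(1), of "x(m := t, i := s)" i] by simp
      have "continuous_on (UNIV \<times> cbox 0 1) (\<lambda>(s, t). pd i H (x(m := t, i := s)))"
        unfolding case_prod_beta
        by (rule continuous_on_compose2[OF csmooth_continuous[OF csmooth_pd'[OF H(1)]]])
           (intro continuous_on_fun_upd continuous_intros, simp)
      moreover have "(\<lambda>t. H (x(m := t, i := s))) integrable_on cbox 0 1" for s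
        by (rule integrable_continuous, rule continuous_on_compose2[OF csmooth_continuous[OF H(1)]])
           (intro continuous_on_fun_upd continuous_intros, simp)
      ultimately have "((\<lambda>s. integral (cbox 0 1) (\<lambda>t. H (x(m := t, i := s)))) has_real_derivative
        integral (cbox 0 1) (\<lambda>t. pd i H (x(m := t, i := x i)))) (at (x i))"
        using leibniz_rule_field_derivative[where U=UNIV and f="\<lambda>s t. H (x(m := t, i := s))"
            and fx="\<lambda>s t. pd i H (x(m := t, i := s))" and a="0::real" and b=1] d by simp
      moreover have "x(m := t, i := x i) = x(m := t)" for t using False by auto
      ultimately show ?thesis by simp
    qed
    moreover have "(\<lambda>s. G (x(i := s))) = (\<lambda>s. integral {0..1} (\<lambda>t. H (x(m := t, i := s))))" for x
      by (simp add: H(2) fun_upd_twist[OF False])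
    ultimately show ?thesis
      using csmooth_pd'[OF H(1)]
      by (intro bexI[of _ "\<lambda>x. integral {0..1} (\<lambda>t. pd i H (x(m := t)))"]) auto
  qed
qed (use assms in auto)

lemma csmooth_coord_upd: "csmooth F \<Longrightarrow> dep m F \<Longrightarrow> csmooth u \<Longrightarrow> csmooth (\<lambda>x. F (x(i := u x)))"
proof -
  assume *: "csmooth F" "dep m F" "csmooth u"
  have "csmooth (\<lambda>x. if j = i then u x else x j)" for j
    using *(3) csmooth_coord by (cases "j = i") simp_all
  from csmooth_comp[OF *(1,2) this]
  have "csmooth (\<lambda>x. F (\<lambda>j. if j = i then u x else x j))" .
  moreover have "(\<lambda>j. if j = i then u x else x j) = x(i := u x)" for x by auto
  ultimately show ?thesis by simp
qed

text \<open>The quotient is the integral of \<open>pd i f\<close> along the segment from x n to x i.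
  Coordinate n, free because of \<open>dep n f\<close>, holds the second value of the argument i,
  and coordinate n + 1 is the integration variable.\<close>

lemma Hadamard_coord:
  assumes f: "csmooth f" "dep n f" and i: "i < n"
  shows "\<exists>g. csmooth g \<and> dep (Suc n) g \<and> (\<forall>x. f x - f (x(i := x n)) = (x i - x n) * g x)"
proof -
  let ?h = "\<lambda>x::nat\<Rightarrow>real. x n + x (Suc n) * (x i - x n)"
  define H where "H x = pd i f (x(i := ?h x))" for x
  have dp: "dep n (pd i f)" using dep_pd[OF f] .
  have H: "csmooth H" unfolding H_def
    by (rule csmooth_coord_upd[OF csmooth_pd'[OF f(1)] dp]) (intro csmooth_intros)
  define g where "g x = integral {0..1} (\<lambda>t. H (x(Suc n := t)))" for x
  have "csmooth g" unfolding g_def by (rule csmooth_integral[OF H])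
  moreover have "dep (Suc n) g"
    unfolding dep_def
  proof (intro allI impI)
    fix x y :: "nat \<Rightarrow> real" assume xy: "\<forall>j<Suc n. x j = y j"
    have "H (x(Suc n := t)) = H (y(Suc n := t))" for t
      unfolding H_def using dp xy i by (auto simp: dep_def)
    then show "g x = g y" by (simp add: g_def)
  qed
  moreover have "f x - f (x(i := x n)) = (x i - x n) * g x" for x
  proof -
    let ?l = "\<lambda>t. x n + t * (x i - x n)"
    have "((\<lambda>t. f (x(i := ?l t))) has_vector_derivative (x i - x n) * pd i f (x(i := ?l t))) (at t within {0..1})" for t
    proof -
      have "((\<lambda>s. f (x(i := s))) has_real_derivative pd i f (x(i := ?l t))) (at (?l t))"
        using DERIV_pd[OF f(1), of "x(i := ?l t)" i] by simp
      moreover have "(?l has_real_derivative (x i - x n)) (at t)"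
        by (auto intro!: derivative_eq_intros)
      ultimately have "((\<lambda>t. f (x(i := ?l t))) has_real_derivative pd i f (x(i := ?l t)) * (x i - x n)) (at t)"
        by (rule DERIV_chain2)
      then show ?thesis
        by (simp add: has_real_derivative_iff_has_vector_derivative has_vector_derivative_at_within mult.commute)
    qed
    from fundamental_theorem_of_calculus[OF _ this]
    have "integral {0..1} (\<lambda>t. (x i - x n) * pd i f (x(i := ?l t))) = f (x(i := ?l 1)) - f (x(i := ?l 0))"
      by (intro integral_unique) simp
    moreover have "integral {0..1} (\<lambda>t. (x i - x n) * pd i f (x(i := ?l t))) = (x i - x n) * g x"
    proof -
      have "H (x(Suc n := t)) = pd i f (x(i := ?l t))" for t
        unfolding H_def using dp i by (auto simp: dep_def)
      then show ?thesis by (simp add: g_def)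
    qed
    ultimately show ?thesis by simp
  qed
  ultimately show ?thesis by blast
qed

subsection \<open>Smooth functions of one variable and a flat function\<close>

definition smooth1 :: "(real \<Rightarrow> real) \<Rightarrow> bool" where
  "smooth1 g \<longleftrightarrow> csmooth (\<lambda>x. g (x 0))"

lemma csmooth_smooth1: "smooth1 g \<Longrightarrow> csmooth u \<Longrightarrow> csmooth (\<lambda>x. g (u x))"
  unfolding smooth1_def by (drule csmooth_comp[where m=1 and G="\<lambda>_. u"]) (auto simp: dep_def)

lemma smooth1_deriv:
  assumes "smooth1 g"
  shows DERIV_smooth1: "(g has_real_derivative deriv g t) (at t)"
    and smooth1_deriv': "smooth1 (deriv g)"
proof -
  have *: "csmooth (\<lambda>x. g (x 0))" using assms by (simp add: smooth1_def)
  have "pd 0 (\<lambda>x. g (x 0)) = (\<lambda>x. deriv g (x 0))" by (auto simp: pd_def)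
  then show "smooth1 (deriv g)" using csmooth_pd'[OF *, of 0] by (simp add: smooth1_def)
  show "(g has_real_derivative deriv g t) (at t)"
    using DERIV_pd[OF *, of "\<lambda>_. t" 0] by (simp add: pd_def)
qed

text \<open>The one-variable form of \<open>csmooth_class\<close>; the zero function joins the class
  as the derivative in the coordinates other than 0.\<close>

lemma smooth1_class:
  assumes "\<And>g. g \<in> K \<Longrightarrow> \<exists>g'\<in>K. \<forall>t. (g has_real_derivative g' t) (at t)" "g \<in> K"
  shows "smooth1 g"
  unfolding smooth1_def
proof (rule csmooth_class[where K = "insert (\<lambda>_. 0) ((\<lambda>g x. g (x 0)) ` K)"])
  show "continuous_on UNIV G" if "G \<in> insert (\<lambda>_. 0) ((\<lambda>g x. g (x 0)) ` K)" for G :: "(nat \<Rightarrow> real) \<Rightarrow> real"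
  proof -
    have "continuous_on UNIV (\<lambda>x::nat\<Rightarrow>real. g (x 0))" if "g \<in> K" for g
    proof -
      have "continuous_on UNIV g"
        using assms(1)[OF that] DERIV_isCont by (blast intro: continuous_at_imp_continuous_on)
      from continuous_on_compose2[OF this, of UNIV "\<lambda>x. x 0"] show ?thesis by simp
    qed
    then show ?thesis using that by auto
  qed
  show "\<exists>G'\<in>insert (\<lambda>_. 0) ((\<lambda>g x. g (x 0)) ` K).
       \<forall>x. ((\<lambda>t. G (x(i := t))) has_real_derivative G' x) (at (x i))"
    if G: "G \<in> insert (\<lambda>_. 0) ((\<lambda>g x. g (x 0)) ` K)" for G :: "(nat \<Rightarrow> real) \<Rightarrow> real" and i
  proof (cases "i = 0 \<and> G \<noteq> (\<lambda>_. 0)")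
    case True
    then obtain g where g: "g \<in> K" "G = (\<lambda>x. g (x 0))" using G by auto
    from assms(1)[OF g(1)] obtain g' where "g' \<in> K" "\<forall>t. (g has_real_derivative g' t) (at t)" by blast
    then show ?thesis using g True by (intro bexI[of _ "\<lambda>x. g' (x 0)"]) auto
  next
    case False
    then have "((\<lambda>t. G (x(i := t))) has_real_derivative 0) (at (x i))" for x
      using G by auto
    then show ?thesis by (intro bexI[of _ "\<lambda>_. 0"]) auto
  qed
qed (use assms in auto)

text \<open>The classical function exp(-1/t) flat at 0, with a polynomial factor in 1/t so that the
  family is closed under differentiation.\<close>

definition flat :: "real poly \<Rightarrow> real \<Rightarrow> real" where
  "flat q t = (if t > 0 then poly q (inverse t) * exp (- inverse t) else 0)"

lemma poly_exp_tendsto_0: "((\<lambda>u. poly q u * exp (- u)) \<longlongrightarrow> 0) (at_top :: real filter)"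
proof -
  have "((\<lambda>u. Polynomial.coeff q i * u ^ i * exp (- u)) \<longlongrightarrow> 0) (at_top :: real filter)" for i
    using tendsto_mult[OF tendsto_const tendsto_power_div_exp_0[of i], of "Polynomial.coeff q i"]
    by (simp add: exp_minus field_simps)
  then have "((\<lambda>u. \<Sum>i\<le>degree q. Polynomial.coeff q i * u ^ i * exp (- u)) \<longlongrightarrow> (\<Sum>i\<le>degree q. 0)) (at_top :: real filter)"
    by (rule tendsto_sum)
  then show ?thesis by (simp add: poly_altdef sum_distrib_right)
qed

text \<open>With u = 1/t one has du/dt = -u^2, so q(u) exp(-u) differentiates to u^2 (q(u) - q'(u))
  exp(-u). At 0 exponential decay in u beats every polynomial.\<close>

lemma DERIV_flat: "(flat q has_real_derivative flat ([:0, 0, 1:] * (q - pderiv q)) t) (at t)"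
proof -
  let ?q = "[:0, 0, 1:] * (q - pderiv q)"
  consider "t > 0" | "t < 0" | "t = 0" by linarith
  then show ?thesis
  proof cases
    case 1
    have "((\<lambda>t. poly q (inverse t) * exp (- inverse t)) has_real_derivative flat ?q t) (at t)"
      using 1 by (auto intro!: derivative_eq_intros simp: flat_def algebra_simps power2_eq_square)
    then show ?thesis
      by (rule has_field_derivative_transform_within_open[where S="{0<..}"])
         (use 1 in \<open>auto simp: flat_def\<close>)
  next
    case 2
    have "((\<lambda>t. 0) has_real_derivative flat ?q t) (at t)"
      using 2 by (simp add: flat_def)
    then show ?thesis
      by (rule has_field_derivative_transform_within_open[where S="{..<0}"])
         (use 2 in \<open>auto simp: flat_def\<close>)
  next
    case 3
    \<comment> \<open>\<open>pCons 0 q\<close> stands for u q(u): the extra factor u = 1/h is the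
      division in the difference quotient.\<close>
    have "((\<lambda>h. poly (pCons 0 q) (inverse h) * exp (- inverse h)) \<longlongrightarrow> 0) (at_right 0)"
      using filterlim_compose[OF poly_exp_tendsto_0 filterlim_inverse_at_top_right] .
    then have "((\<lambda>h. flat q h / h) \<longlongrightarrow> 0) (at_right 0)"
      by (rule Lim_transform_eventually)
         (auto simp: flat_def eventually_at_filter field_simps)
    moreover have "((\<lambda>h. flat q h / h) \<longlongrightarrow> 0) (at_left 0)"
      by (rule Lim_transform_eventually[OF tendsto_const]) (auto simp: flat_def eventually_at_filter)
    ultimately have "((\<lambda>h. flat q h / h) \<longlongrightarrow> 0) (at 0)"
      by (simp add: filterlim_split_at_real)
    then show ?thesis using 3 by (simp add: has_field_derivative_iff flat_def)
  qed
qed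

lemma smooth1_flat: "smooth1 (flat q)"
  by (rule smooth1_class[where K = "range flat"]) (use DERIV_flat in blast)+

abbreviation flat1 :: "real \<Rightarrow> real" where
  "flat1 \<equiv> flat 1"

lemma flat1_pos [simp]: "t > 0 \<Longrightarrow> flat1 t > 0"
  and flat1_zero [simp]: "t \<le> 0 \<Longrightarrow> flat1 t = 0"
  and flat1_nonneg [simp]: "flat1 t \<ge> 0"
  by (auto simp: flat_def)

text \<open>Take (P + Q) / (v P + Q) with P vanishing for v <= 1/4 and Q vanishing for v >= 1/2. The
  denominator is positive: Q is positive for v <= 1/4, and v P is positive beyond. Where Q vanishes
  the quotient is 1/v.\<close>

lemma smooth_reciprocal_extension:
  obtains \<theta> where "smooth1 \<theta>" "\<And>v. v \<ge> 1/2 \<Longrightarrow> \<theta> v = 1 / v"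
proof -
  let ?p = "\<lambda>v. flat1 (v - 1/4)" and ?q = "\<lambda>v. flat1 (1/2 - v)"
  have pq: "?p v + ?q v \<noteq> 0" for v
    by (cases "v > 1/4") (auto simp: add_pos_nonneg add_nonneg_pos less_imp_neq[THEN not_sym])
  have "v * ?p v + ?q v > 0" for v
  proof (cases "v > 1/4")
    case True
    then show ?thesis by (intro add_pos_nonneg mult_pos_pos) auto
  qed auto
  then have m0: "v * ?p v + ?q v \<noteq> 0" for v by (metis less_irrefl)
  have p: "csmooth (\<lambda>x. ?p (x 0))" and q: "csmooth (\<lambda>x. ?q (x 0))"
    by (rule csmooth_smooth1[OF smooth1_flat]; intro csmooth_intros)+
  have "csmooth (\<lambda>x. (?p (x 0) + ?q (x 0)) * inverse (x 0 * ?p (x 0) + ?q (x 0)))"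
    by (intro csmooth_inverse csmooth_mult csmooth_add csmooth_coord p q m0)
  then have "smooth1 (\<lambda>v. (?p v + ?q v) * inverse (v * ?p v + ?q v))" by (simp add: smooth1_def)
  moreover have "(?p v + ?q v) * inverse (v * ?p v + ?q v) = 1 / v" if "v \<ge> 1/2" for v
  proof -
    have "(P + 0) * inverse (v * P + 0) = 1 / v" if "P \<noteq> 0" for P :: real
      using that \<open>v \<ge> 1/2\<close> by (simp add: field_simps)
    moreover have "?p v \<noteq> 0" "?q v = 0"
      using that flat1_pos[of "v - 1/4"] by (auto simp del: flat1_pos)
    ultimately show ?thesis by metis
  qed
  ultimately show ?thesis using that by blast
qed

subsection \<open>Inverting one coordinate of a rapidly decreasing function\<close>

definition invert_coord :: "nat \<Rightarrow> ((nat \<Rightarrow> real) \<Rightarrow> real) \<Rightarrow> (nat \<Rightarrow> real) \<Rightarrow> real" where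
  "invert_coord n G x = (if x n = 0 then 0 else G (x(n := inverse (x n))))"

lemma eventually_coord_nz:
  assumes "(x::nat \<Rightarrow> real) n \<noteq> 0"
  shows "eventually (\<lambda>z. z n \<noteq> 0) (at x)"
proof -
  have "((\<lambda>z::nat\<Rightarrow>real. z n) \<longlongrightarrow> x n) (at x)"
    using tendsto_ident_at[of x UNIV] unfolding tendsto_fun_iff by blast
  from tendsto_imp_eventually_ne[OF this assms] show ?thesis .
qed

text \<open>Only points with x n = 0 are delicate: near them the coordinates below n stay bounded
  while the inverted coordinate is 0 or large, and there \<open>decay\<close> makes \<open>G\<close>
  small.\<close>

lemma continuous_invert_coord:
  assumes c: "continuous_on UNIV G"
    and decay: "\<And>B e. e > 0 \<Longrightarrow> \<exists>S. \<forall>z. (\<forall>i<n. \<bar>z i\<bar> \<le> B) \<longrightarrow> \<bar>z n\<bar> \<ge> S \<longrightarrow> \<bar>G z\<bar> \<le> e"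
  shows "continuous_on UNIV (invert_coord n G)"
proof (intro continuous_at_imp_continuous_on ballI)
  fix x :: "nat \<Rightarrow> real"
  have coord: "((\<lambda>z. z i) \<longlongrightarrow> x i) (at x)" for i
    using tendsto_ident_at[of x UNIV] unfolding tendsto_fun_iff by blast
  show "isCont (invert_coord n G) x"
  proof (cases "x n = 0")
    case False
    have "((\<lambda>z. z(n := inverse (z n))) \<longlongrightarrow> x(n := inverse (x n))) (at x)"
      unfolding tendsto_fun_iff
    proof
      fix i show "((\<lambda>z. (z(n := inverse (z n))) i) \<longlongrightarrow> (x(n := inverse (x n))) i) (at x)"
        by (cases "i = n") (use coord[of i] False in \<open>auto intro: tendsto_inverse\<close>)
    qed
    moreover have "isCont G (x(n := inverse (x n)))" using c by (simp add: continuous_on_eq_continuous_at)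
    ultimately have "((\<lambda>z. G (z(n := inverse (z n)))) \<longlongrightarrow> G (x(n := inverse (x n)))) (at x)"
      by (rule isCont_tendsto_compose[rotated])
    then have "(invert_coord n G \<longlongrightarrow> G (x(n := inverse (x n)))) (at x)"
      by (rule Lim_transform_eventually)
         (use eventually_coord_nz[of x n] False in \<open>auto simp: invert_coord_def elim: eventually_mono\<close>)
    then show ?thesis using False by (simp add: isCont_def invert_coord_def)
  next
    case True
    have "(invert_coord n G \<longlongrightarrow> 0) (at x)"
    proof (rule tendstoI)
      fix e :: real assume "e > 0"
      \<comment> \<open>The summand 1 makes the bounds strict at x, so that they persist in a
        neighbourhood.\<close>
      define B where "B = (\<Sum>i<n. \<bar>x i\<bar>) + 1"
      from decay[of "e/2" B] \<open>e > 0\<close> obtain S0 where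
        S0: "\<And>z. (\<forall>i<n. \<bar>z i\<bar> \<le> B) \<Longrightarrow> \<bar>z n\<bar> \<ge> S0 \<Longrightarrow> \<bar>G z\<bar> \<le> e/2" by force
      define S where "S = max S0 1"
      have "\<bar>x i\<bar> < B" if "i < n" for i
        using member_le_sum[of i "{..<n}" "\<lambda>i. \<bar>x i\<bar>"] that by (simp add: B_def)
      then have "eventually (\<lambda>z. \<bar>z i\<bar> < B) (at x)" if "i < n" for i
        using order_tendstoD(2)[OF tendsto_rabs[OF coord[of i]]] that by blast
      then have "eventually (\<lambda>z. \<forall>i\<in>{..<n}. \<bar>z i\<bar> < B) (at x)"
        by (intro eventually_ball_finite) auto
      moreover have "eventually (\<lambda>z. \<bar>z n\<bar> < inverse S) (at x)"
        using order_tendstoD(2)[OF tendsto_rabs[OF coord[of n]], of "inverse S"] True by (simp add: S_def)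
      ultimately show "eventually (\<lambda>z. dist (invert_coord n G z) 0 < e) (at x)"
      proof eventually_elim
        case (elim z)
        show ?case
        proof (cases "z n = 0")
          case False
          have "\<bar>inverse (z n)\<bar> \<ge> S"
            using elim(2) False by (simp add: S_def divide_simps mult.commute split: if_splits)
          then have "\<bar>G (z(n := inverse (z n)))\<bar> \<le> e/2"
            using elim(1) by (intro S0) (auto simp: S_def less_imp_le)
          then show ?thesis using False \<open>e > 0\<close> by (simp add: invert_coord_def)
        qed (simp add: invert_coord_def \<open>e > 0\<close>)
      qed
    qed
    then show ?thesis using True by (simp add: isCont_def invert_coord_def)
  qed
qed

text \<open>The derivative of G(y, 1/t) in t is -(1/t)^2 times the n-th partial derivative of G at
  (y, 1/t), hence again an inverted function, of -(x n)^2 times that derivative. This is why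
  \<open>K\<close> must be closed under \<open>m\<close>.\<close>

lemma csmooth_invert_coord:
  assumes c: "\<And>G. G \<in> K \<Longrightarrow> continuous_on UNIV G"
    and decay: "\<And>G B e. G \<in> K \<Longrightarrow> e > 0 \<Longrightarrow>
      \<exists>S. \<forall>z. (\<forall>i<n. \<bar>z i\<bar> \<le> B) \<longrightarrow> \<bar>z n\<bar> \<ge> S \<longrightarrow> \<bar>G z\<bar> \<le> e"
    and d: "\<And>G i. G \<in> K \<Longrightarrow> \<exists>G'\<in>K. \<forall>x. ((\<lambda>t. G (x(i := t))) has_real_derivative G' x) (at (x i))"
    and m: "\<And>G. G \<in> K \<Longrightarrow> (\<lambda>x. - (x n * x n * G x)) \<in> K"
    and G: "G \<in> K"
  shows "csmooth (invert_coord n G)"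
proof (rule csmooth_class[where K = "invert_coord n ` K"])
  show "continuous_on UNIV H" if "H \<in> invert_coord n ` K" for H
    using that continuous_invert_coord[OF c decay] by auto
  show "\<exists>H'\<in>invert_coord n ` K. \<forall>x. ((\<lambda>t. H (x(i := t))) has_real_derivative H' x) (at (x i))"
    if "H \<in> invert_coord n ` K" for H i
  proof -
    from that obtain G where G: "G \<in> K" "H = invert_coord n G" by auto
    from d[OF G(1)] obtain G' where
      G': "G' \<in> K" "\<And>x. ((\<lambda>t. G (x(i := t))) has_real_derivative G' x) (at (x i))" by blast
    show ?thesis
    proof (cases "i = n")
      case False
      have "((\<lambda>t. H (x(i := t))) has_real_derivative invert_coord n G' x) (at (x i))" for x
      proof (cases "x n = 0")
        case True
        then show ?thesis using False by (simp add: G(2) invert_coord_def)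
      next
        case x: False
        have "(\<lambda>t. H (x(i := t))) = (\<lambda>t. G (x(n := inverse (x n), i := t)))"
          using x False fun_upd_twist[of i n x] by (simp add: G(2) invert_coord_def)
        then show ?thesis using G'(2)[of "x(n := inverse (x n))"] x False by (simp add: invert_coord_def)
      qed
      then show ?thesis by (intro bexI[of _ "invert_coord n G'"] allI imageI G'(1))
    next
      case True
      let ?G = "\<lambda>x. - (x n * x n * G' x)"
      have "((\<lambda>t. H (x(n := t))) has_real_derivative invert_coord n ?G x) (at (x n))" for x
      proof (cases "x n = 0")
        case False
        let ?s = "inverse (x n)"
        have "((\<lambda>s. G (x(n := s))) has_real_derivative G' (x(n := ?s))) (at ?s)"
          using G'(2)[of "x(n := ?s)"] True by simp
        moreover have "(inverse has_real_derivative - (?s * ?s)) (at (x n))"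
          using DERIV_inverse[OF False] by (simp add: power2_eq_square)
        ultimately have "((\<lambda>t. G (x(n := inverse t))) has_real_derivative G' (x(n := ?s)) * (- (?s * ?s))) (at (x n))"
          by (rule DERIV_chain2)
        then have "((\<lambda>t. H (x(n := t))) has_real_derivative G' (x(n := ?s)) * (- (?s * ?s))) (at (x n))"
          by (rule has_field_derivative_transform_within_open[where S="- {0}"])
             (use False in \<open>auto simp: G(2) invert_coord_def\<close>)
        then show ?thesis using False by (simp add: invert_coord_def mult.commute)
      next
        case x: True
        have "((\<lambda>h. H (x(n := h)) / h) \<longlongrightarrow> 0) (at 0)"
        proof (rule tendstoI)
          fix e :: real assume "e > 0"
          define B where "B = (\<Sum>i<n. \<bar>x i\<bar>)"
          have B: "\<forall>i<n. \<bar>x i\<bar> \<le> B"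
            using member_le_sum[of _ "{..<n}" "\<lambda>i. \<bar>x i\<bar>"] by (simp add: B_def)
          \<comment> \<open>With s = 1/h the difference quotient is s G(s). Decay is available in
            \<open>K\<close> for s^2 G(s), which dominates it because |s| >= 1.\<close>
          from decay[OF m[OF G(1)], of "e/2" B] \<open>e > 0\<close> obtain S0 where
            S0: "\<And>z. (\<forall>i<n. \<bar>z i\<bar> \<le> B) \<Longrightarrow> \<bar>z n\<bar> \<ge> S0 \<Longrightarrow> \<bar>z n * z n * G z\<bar> \<le> e/2" by force
          define S where "S = max S0 1"
          have "eventually (\<lambda>h. \<bar>h\<bar> < inverse S \<and> h \<noteq> 0) (at (0::real))"
            unfolding eventually_at by (rule exI[of _ "inverse S"]) (auto simp: S_def dist_real_def)
          then show "eventually (\<lambda>h. dist (H (x(n := h)) / h) 0 < e) (at 0)"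
          proof eventually_elim
            case (elim h)
            let ?s = "inverse h"
            have s: "\<bar>?s\<bar> \<ge> S"
              using elim by (simp add: S_def divide_simps mult.commute split: if_splits)
            then have "\<bar>?s * ?s * G (x(n := ?s))\<bar> \<le> e/2"
              using S0[of "x(n := ?s)"] B by (simp add: S_def)
            moreover have "\<bar>?s * G (x(n := ?s))\<bar> \<le> \<bar>?s\<bar> * \<bar>?s * G (x(n := ?s))\<bar>"
              using s mult_right_mono[of 1 "\<bar>?s\<bar>" "\<bar>?s * G (x(n := ?s))\<bar>"] by (simp add: S_def)
            ultimately have "\<bar>?s * G (x(n := ?s))\<bar> \<le> e/2" by (simp add: abs_mult mult.assoc)
            moreover have "H (x(n := h)) = G (x(n := ?s))" using elim by (simp add: G(2) invert_coord_def)
            then have "H (x(n := h)) / h = ?s * G (x(n := ?s))" by (simp only: divide_inverse mult.commute)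
            ultimately show ?case using \<open>e > 0\<close> by (simp add: dist_real_def)
          qed
        qed
        then show ?thesis using x by (simp add: has_field_derivative_iff G(2) invert_coord_def)
      qed
      then show ?thesis unfolding True by (intro bexI[of _ "invert_coord n ?G"] allI imageI m[OF G'(1)])
    qed
  qed
qed (rule imageI[OF G])

subsection \<open>Taming functions\<close>

text \<open>By Tychonoff the cube with sides [-R, R] in the first N coordinates and 0 elsewhere is
  compact; \<open>dep N\<close> allows z to be replaced by its truncation, which lies in the
  cube.\<close>

lemma bounded_cube:
  assumes "continuous_on UNIV g" "dep N g"
  obtains M where "M \<ge> 0" "\<And>z. (\<Sum>i<N. z i * z i) \<le> c \<Longrightarrow> \<bar>g z\<bar> \<le> M"
proof -
  define R where "R = sqrt \<bar>c\<bar>"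
  define X where "X = PiE (UNIV::nat set) (\<lambda>i. if i < N then {-R..R} else {0::real})"
  have "compactin (product_topology (\<lambda>i. euclideanreal) UNIV) X"
    unfolding X_def by (subst compactin_PiE) auto
  then have "compact X" by (simp add: euclidean_product_topology)
  then have "compact (g ` X)"
    using compact_continuous_image continuous_on_subset[OF assms(1)] by blast
  then obtain M where M: "\<And>y. y \<in> g ` X \<Longrightarrow> \<bar>y\<bar> \<le> M"
    using compact_imp_bounded bounded_iff[of "g ` X"] by auto
  have "\<bar>g z\<bar> \<le> max M 0" if z: "(\<Sum>i<N. z i * z i) \<le> c" for z
  proof -
    let ?z = "\<lambda>i. if i < N then z i else 0"
    have "\<bar>z i\<bar> \<le> R" if "i < N" for i
    proof -
      have "z i * z i \<le> (\<Sum>i<N. z i * z i)"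
        using member_le_sum[of i "{..<N}" "\<lambda>i. z i * z i"] that by simp
      then have "(z i)\<^sup>2 \<le> \<bar>c\<bar>" using z by (simp add: power2_eq_square)
      then show ?thesis unfolding R_def by (metis real_sqrt_abs real_sqrt_le_iff)
    qed
    then have "?z \<in> X" by (auto simp: X_def PiE_iff abs_le_iff minus_le_iff)
    moreover have "g z = g ?z" using assms(2) by (auto simp: dep_def)
    ultimately show ?thesis using M by force
  qed
  then show ?thesis using that[of "max M 0"] by simp
qed

text \<open>Positive exactly on (-1, 1), so that integer translates cover the line while at most
  three of them have a given point in their closed supports.\<close>

definition bump :: "real \<Rightarrow> real" where
  "bump t = flat1 (1 + t) * flat1 (1 - t)"

lemma smooth1_bump: "smooth1 bump"
  unfolding smooth1_def bump_def
  by (intro csmooth_mult csmooth_smooth1[OF smooth1_flat] csmooth_intros)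

lemma bump_nonneg: "bump t \<ge> 0"
  by (simp add: bump_def)

lemma bump_pos: "\<bar>t\<bar> < 1 \<Longrightarrow> bump t > 0"
  by (auto simp: bump_def)

abbreviation dbump :: "nat \<Rightarrow> real \<Rightarrow> real" where
  "dbump j \<equiv> (deriv ^^ j) bump"

lemma smooth1_dbump: "smooth1 (dbump j)"
  by (induction j) (auto intro: smooth1_bump smooth1_deriv')

lemma dbump_zero: "\<bar>t\<bar> > 1 \<Longrightarrow> dbump j t = 0"
proof (induction j arbitrary: t)
  case 0
  then show ?case by (cases "t > 0") (auto simp: bump_def)
next
  case (Suc j)
  have "open {t::real. 1 < \<bar>t\<bar>}" by (intro open_Collect_less continuous_intros)
  then have "((dbump j) has_real_derivative 0) (at t)"
    using Suc by (intro has_field_derivative_transform_within_open[OF DERIV_const[of 0], where S="{t. \<bar>t\<bar> > 1}"]) auto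
  then show ?case by (simp add: DERIV_imp_deriv)
qed

lemma dbump_bounded: "\<exists>B. \<forall>t. \<bar>dbump j t\<bar> \<le> B"
proof -
  have "continuous_on {-1..1} (dbump j)"
    using DERIV_smooth1[OF smooth1_dbump] DERIV_isCont by (blast intro: continuous_at_imp_continuous_on)
  then have "compact (dbump j ` {-1..1})" by (intro compact_continuous_image) auto
  then obtain M where "\<forall>y\<in>dbump j ` {-1..1}. norm y \<le> M"
    using compact_imp_bounded[of "dbump j ` {-1..1}"] unfolding bounded_iff by blast
  then have M: "\<bar>dbump j t\<bar> \<le> M" if "\<bar>t\<bar> \<le> 1" for t using that by (force simp: abs_le_iff)
  have "\<bar>dbump j t\<bar> \<le> M" for t
  proof (cases "\<bar>t\<bar> \<le> 1")
    case False
    then show ?thesis using dbump_zero[of t j] M[of 0] by simp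
  qed (rule M)
  then show ?thesis by blast
qed

text \<open>\<open>\<phi> j\<close> is the \<open>j\<close>-th derivative of a sum of integer translates of \<open>bump\<close>. The weight of the \<open>k\<close>-th translate
  beats \<open>m i k\<close> for all \<open>i \<le> k\<close>, so countably many growth conditions are met at once.\<close>

lemma taming_function:
  fixes m :: "nat \<Rightarrow> nat \<Rightarrow> real"
  assumes m: "\<And>i k. m i k \<ge> 0"
  obtains \<phi> :: "nat \<Rightarrow> real \<Rightarrow> real"
  where "\<And>j t. (\<phi> j has_real_derivative \<phi> (Suc j) t) (at t)"
    and "\<And>t. t \<ge> 0 \<Longrightarrow> \<phi> 0 t > 0"
    and "\<And>i j e. e > 0 \<Longrightarrow> \<exists>S. \<forall>t\<ge>S. \<forall>g. (\<forall>k::nat. t \<le> real k + 1 \<longrightarrow> \<bar>g\<bar> \<le> m i k) \<longrightarrow> \<bar>g * \<phi> j t\<bar> \<le> e"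
proof -
  \<comment> \<open>The sum dominates \<open>m i k\<close> for every i <= k, and the factor k + 1
    produces decay: \<epsilon> k times \<open>m i k\<close> is at most 1/(k + 1).\<close>
  define \<epsilon> where "\<epsilon> k = inverse ((1 + (\<Sum>i\<le>k. m i k)) * (real k + 1))" for k
  have s0: "(\<Sum>i\<le>k. m i k) \<ge> 0" for k by (simp add: m sum_nonneg)
  have pos: "\<epsilon> k > 0" for k
    unfolding \<epsilon>_def using s0[of k] by (intro positive_imp_inverse_positive mult_pos_pos) auto
  have \<epsilon>m: "\<epsilon> k * m i k \<le> 1 / (real k + 1)" if "i \<le> k" for i k
  proof -
    have "m i k \<le> 1 + (\<Sum>i\<le>k. m i k)"
      using member_le_sum[of i "{..k}" "\<lambda>i. m i k"] that m by auto
    then show ?thesis using s0[of k] by (simp add: \<epsilon>_def divide_simps)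
  qed
  \<comment> \<open>Translates with index at least \<lceil>t\<rceil> + 2 vanish near t, so the
    infinite sum may be cut off there or at any later index.\<close>
  define \<phi> where "\<phi> j t = (\<Sum>k<nat \<lceil>t\<rceil> + 2. \<epsilon> k * dbump j (t - real k))" for j t
  have \<phi>N: "\<phi> j t = (\<Sum>k<N. \<epsilon> k * dbump j (t - real k))" if "N \<ge> nat \<lceil>t\<rceil> + 2" for j t N
  proof -
    have "dbump j (t - real k) = 0" if "k \<ge> nat \<lceil>t\<rceil> + 2" for k
      using that by (intro dbump_zero) linarith
    then show ?thesis unfolding \<phi>_def using that
      by (intro sum.mono_neutral_left) auto
  qed
  have "(\<phi> j has_real_derivative \<phi> (Suc j) t) (at t)" for j t
  proof -
    \<comment> \<open>The slack lets a single finite sum represent \<phi> on the whole ball of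
      radius 1 around t.\<close>
    define N where "N = nat \<lceil>t\<rceil> + 5"
    have "((\<lambda>t. \<Sum>k<N. \<epsilon> k * dbump j (t - real k)) has_real_derivative (\<Sum>k<N. \<epsilon> k * dbump (Suc j) (t - real k))) (at t)"
    proof (rule DERIV_sum)
      fix k
      have "((\<lambda>t. dbump j (t - real k)) has_real_derivative dbump (Suc j) (t - real k) * 1) (at t)"
        by (rule DERIV_chain2[where f = "dbump j"])
           (use DERIV_smooth1[OF smooth1_dbump[of j]] in \<open>auto intro!: derivative_eq_intros\<close>)
      then show "((\<lambda>t. \<epsilon> k * dbump j (t - real k)) has_real_derivative \<epsilon> k * dbump (Suc j) (t - real k)) (at t)"
        by (intro DERIV_cmult) simp
    qed
    moreover have "(\<Sum>k<N. \<epsilon> k * dbump (Suc j) (t - real k)) = \<phi> (Suc j) t"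
      by (rule \<phi>N[symmetric]) (simp add: N_def)
    ultimately have "((\<lambda>t. \<Sum>k<N. \<epsilon> k * dbump j (t - real k)) has_real_derivative \<phi> (Suc j) t) (at t)"
      by simp
    then show ?thesis
    proof (rule has_field_derivative_transform_within_open[where S="ball t 1"])
      show "(\<Sum>k<N. \<epsilon> k * dbump j (x - real k)) = \<phi> j x" if "x \<in> ball t 1" for x
      proof (rule \<phi>N[symmetric])
        show "N \<ge> nat \<lceil>x\<rceil> + 2" using that unfolding N_def mem_ball dist_real_def by linarith
      qed
    qed auto
  qed
  moreover have "\<phi> 0 t > 0" if "t \<ge> 0" for t
  proof -
    \<comment> \<open>The translate centred at the integer part of t lies at distance less than 1
      and is therefore positive at t.\<close>
    let ?k = "nat \<lfloor>t\<rfloor>"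
    have "0 < \<epsilon> ?k * bump (t - real ?k)"
      using pos that by (intro mult_pos_pos bump_pos) (simp_all, linarith)
    also have "\<dots> \<le> (\<Sum>k<nat \<lceil>t\<rceil> + 2. \<epsilon> k * bump (t - real k))"
    proof (rule member_le_sum)
      show "?k \<in> {..<nat \<lceil>t\<rceil> + 2}" using that by simp linarith
      show "0 \<le> \<epsilon> k * bump (t - real k)" for k
        using pos[of k] bump_nonneg by simp
    qed simp
    finally show ?thesis by (simp add: \<phi>_def)
  qed
  moreover have "\<exists>S. \<forall>t\<ge>S. \<forall>g. (\<forall>k::nat. t \<le> real k + 1 \<longrightarrow> \<bar>g\<bar> \<le> m i k) \<longrightarrow> \<bar>g * \<phi> j t\<bar> \<le> e" if "e > 0" for i j e
  proof -
    obtain B where B: "\<And>t. \<bar>dbump j t\<bar> \<le> B" using dbump_bounded by blast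
    have B0: "B \<ge> 0" using B[of 0] by linarith
    \<comment> \<open>For t >= i + 2 the translates alive at t have index at least i, where the
      weights beat \<open>m i\<close>. At most three of them contribute, each bounded by B/t, whence
      the threshold 3 B/e.\<close>
    define S where "S = max (real i + 2) (3 * B / e)"
    have "\<bar>g * \<phi> j t\<bar> \<le> e" if t: "t \<ge> S" and g: "\<forall>k::nat. t \<le> real k + 1 \<longrightarrow> \<bar>g\<bar> \<le> m i k" for t g
    proof -
      let ?p = "nat \<lceil>t - 1\<rceil>"
      have t1: "t \<ge> real i + 2" "t * e \<ge> 3 * B" "t > 0"
        using t \<open>e > 0\<close> by (auto simp: S_def field_simps)
      have summand: "\<bar>g * (\<epsilon> k * dbump j (t - real k))\<bar> \<le> (if k \<in> {?p..?p+2} then B / t else 0)" for k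
      proof (cases "\<bar>t - real k\<bar> \<le> 1")
        case True
        have "?p \<le> k" "k \<le> ?p + 2" "i \<le> k" "t \<le> real k + 1"
          using True t1(1) by linarith+
        then have k: "k \<in> {?p..?p+2}" "i \<le> k" "t \<le> real k + 1" by simp_all
        have "\<bar>g\<bar> * \<epsilon> k \<le> m i k * \<epsilon> k" using g k pos[of k] by (intro mult_right_mono) auto
        also have "\<dots> \<le> 1 / (real k + 1)" using \<epsilon>m[OF k(2)] by (simp add: mult.commute)
        also have "\<dots> \<le> 1 / t" using k t1 by (intro divide_left_mono) auto
        finally have "\<bar>g\<bar> * \<epsilon> k * \<bar>dbump j (t - real k)\<bar> \<le> 1 / t * B"
          using B t1 by (intro mult_mono) auto
        then show ?thesis using k pos[of k] by (simp add: abs_mult mult.assoc)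
      next
        case False
        then show ?thesis using dbump_zero[of "t - real k" j] B0 t1 by simp
      qed
      have "\<bar>g * \<phi> j t\<bar> \<le> (\<Sum>k<nat \<lceil>t\<rceil> + 2. if k \<in> {?p..?p+2} then B / t else 0)"
        unfolding \<phi>_def sum_distrib_left by (rule order.trans[OF sum_abs sum_mono[OF summand]])
      also have "\<dots> = (\<Sum>k\<in>{..<nat \<lceil>t\<rceil> + 2} \<inter> {?p..?p+2}. B / t)"
        by (rule sum.inter_restrict[symmetric]) simp
      also have "\<dots> \<le> (\<Sum>k\<in>{?p..?p+2}. B / t)"
        using B0 t1 by (intro sum_mono2) auto
      also have "\<dots> = 3 * (B / t)" by simp
      also have "\<dots> \<le> e" using t1 by (simp add: field_simps)
      finally show ?thesis .
    qed
    then show ?thesis by blast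
  qed
  ultimately show ?thesis by (rule that[of \<phi>])
qed

text \<open>The coefficients that arise when F times the weight (from F), or the weight alone (from
  1), is differentiated and multiplied by coordinates. Constants are left out to keep the set
  countable.\<close>

inductive_set derived :: "nat \<Rightarrow> ((nat \<Rightarrow> real) \<Rightarrow> real) \<Rightarrow> ((nat \<Rightarrow> real) \<Rightarrow> real) set"
  for N F where
  self: "F \<in> derived N F"
| one: "(\<lambda>_. 1) \<in> derived N F"
| partial: "G \<in> derived N F \<Longrightarrow> pd i G \<in> derived N F"
| coordinate: "G \<in> derived N F \<Longrightarrow> i < N \<Longrightarrow> (\<lambda>x. x i * G x) \<in> derived N F"

lemma derived_csmooth:
  assumes "csmooth F" "dep N F" "G \<in> derived N F"
  shows "csmooth G" "dep N G"
proof -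
  have "csmooth G \<and> dep N G"
    using assms(3)
  proof induction
    case (partial G i)
    then show ?case using csmooth_pd' dep_pd by blast
  next
    case (coordinate G i)
    then have "dep N (\<lambda>x. x i * G x)" unfolding dep_def by metis
    then show ?case using coordinate csmooth_mult[OF csmooth_coord] by blast
  qed (use assms csmooth_const in \<open>auto simp: dep_def\<close>)
  then show "csmooth G" "dep N G" by auto
qed

text \<open>A member is coded by a word of numbers and a bit: an even letter 2i differentiates, an
  odd letter 2i + 1 multiplies by the coordinate i, and the bit selects the starting
  function.\<close>

lemma countable_derived: "countable (derived N F)"
proof -
  define step :: "nat \<Rightarrow> ((nat \<Rightarrow> real) \<Rightarrow> real) \<Rightarrow> (nat \<Rightarrow> real) \<Rightarrow> real" where
    "step j G = (if even j then pd (j div 2) G else (\<lambda>x. x (j div 2) * G x))" for j G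
  define build where "build p = foldr step (fst p) (if snd p then F else (\<lambda>_. 1))" for p :: "nat list \<times> bool"
  have "G \<in> range build" if "G \<in> derived N F" for G
    using that
  proof induction
    case self
    show ?case by (rule range_eqI[of _ _ "([], True)"]) (simp add: build_def)
  next
    case one
    show ?case by (rule range_eqI[of _ _ "([], False)"]) (simp add: build_def)
  next
    case (partial G i)
    then obtain l b where G: "G = build (l, b)" by auto
    have "pd i G = build ((2 * i) # l, b)" unfolding G by (simp add: build_def step_def)
    then show ?case by (rule range_eqI)
  next
    case (coordinate G i)
    then obtain l b where G: "G = build (l, b)" by auto
    have "(\<lambda>x. x i * G x) = build ((2 * i + 1) # l, b)" unfolding G by (simp add: build_def step_def)
    then show ?case by (rule range_eqI)
  qed
  then have "derived N F \<subseteq> range build" by blast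
  then show ?thesis by (rule countable_subset) simp
qed

definition sqsum :: "nat \<Rightarrow> (nat \<Rightarrow> real) \<Rightarrow> real" where
  "sqsum N z = (\<Sum>i<N. z i * z i)"

lemma csmooth_sqsum: "csmooth (sqsum N)"
  unfolding sqsum_def[abs_def] by (intro csmooth_sum csmooth_mult csmooth_coord)

lemma sqsum_nonneg: "sqsum N z \<ge> 0"
  by (simp add: sqsum_def sum_nonneg)

lemma sqsum_ge: "i < N \<Longrightarrow> z i * z i \<le> sqsum N z"
  unfolding sqsum_def using member_le_sum[of i "{..<N}" "\<lambda>i. z i * z i"] by simp

lemma DERIV_sqsum:
  "((\<lambda>t. sqsum N (x(i := t))) has_real_derivative (if i < N then 2 * x i else 0)) (at (x i))"
proof (cases "i < N")
  case True
  have "sqsum N (x(i := t)) = t * t + (\<Sum>l\<in>{..<N} - {i}. x l * x l)" for t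
    unfolding sqsum_def using True by (subst sum.remove[of _ i]) auto
  then show ?thesis using True by (auto intro!: derivative_eq_intros)
next
  case False
  then have "sqsum N (x(i := t)) = sqsum N x" for t by (auto simp: sqsum_def intro!: sum.cong)
  then show ?thesis using False by simp
qed

text \<open>Real combinations of coefficients times derivatives of the weight. The partial
  derivative of \<open>sqsum\<close> is 2 z i, and z i times a coefficient is a coefficient again,
  so the class is closed under differentiation.\<close>

inductive_set tamed :: "nat \<Rightarrow> ((nat \<Rightarrow> real) \<Rightarrow> real) \<Rightarrow> (nat \<Rightarrow> real \<Rightarrow> real) \<Rightarrow> ((nat \<Rightarrow> real) \<Rightarrow> real) set"
  for N F \<phi> where
  mem: "G \<in> derived N F \<Longrightarrow> (\<lambda>z. c * G z * \<phi> j (sqsum N z)) \<in> tamed N F \<phi>"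
| add: "G \<in> tamed N F \<phi> \<Longrightarrow> H \<in> tamed N F \<phi> \<Longrightarrow> (\<lambda>z. G z + H z) \<in> tamed N F \<phi>"

text \<open>\<open>\<Psi> z = \<phi> 0 (\<Sum>i\<le>n. (z i)\<^sup>2)\<close>, where \<open>\<phi> 0\<close> decays so fast that the derivatives of \<open>\<Psi>\<close> and \<open>F \<cdot> \<Psi>\<close>,
  multiplied by any polynomials, tend to \<open>0\<close> at infinity.\<close>

lemma invertible_coord_multiplier:
  assumes F: "csmooth F" "dep (Suc n) F"
  obtains \<Psi> where "csmooth \<Psi>" "dep (Suc n) \<Psi>" "\<And>z. \<Psi> z > 0"
    "csmooth (invert_coord n \<Psi>)" "csmooth (invert_coord n (\<lambda>z. F z * \<Psi> z))"
proof -
  let ?N = "Suc n" and ?D = "derived (Suc n) F"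
  define g where "g = from_nat_into ?D"
  have ne: "?D \<noteq> {}" using derived.self by blast
  have gD: "g i \<in> ?D" for i unfolding g_def by (rule from_nat_into[OF ne])
  have Dg: "\<exists>i. G = g i" if "G \<in> ?D" for G
    using from_nat_into_surj[OF countable_derived that] unfolding g_def by metis
  \<comment> \<open>These are the growth conditions for \<open>taming_function\<close>:
    \<open>m i k\<close> bounds the i-th coefficient on the ball of squared radius k + 1.\<close>
  have "\<forall>i k. \<exists>M\<ge>0. \<forall>z. sqsum ?N z \<le> real k + 1 \<longrightarrow> \<bar>g i z\<bar> \<le> M"
  proof (intro allI)
    fix i k
    have "continuous_on UNIV (g i)" "dep ?N (g i)"
      using derived_csmooth[OF F gD] csmooth_continuous by auto
    then obtain M where "M \<ge> 0" "\<And>z. (\<Sum>i<?N. z i * z i) \<le> real k + 1 \<Longrightarrow> \<bar>g i z\<bar> \<le> M"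
      by (rule bounded_cube[where c = "real k + 1"]) (rule that)
    then show "\<exists>M\<ge>0. \<forall>z. sqsum ?N z \<le> real k + 1 \<longrightarrow> \<bar>g i z\<bar> \<le> M"
      unfolding sqsum_def by blast
  qed
  then obtain m where m: "\<And>i k. m i k \<ge> 0"
    "\<And>i k z. sqsum ?N z \<le> real k + 1 \<Longrightarrow> \<bar>g i z\<bar> \<le> m i k" by metis
  obtain \<phi> where \<phi>: "\<And>j t. (\<phi> j has_real_derivative \<phi> (Suc j) t) (at t)"
    "\<And>t. t \<ge> 0 \<Longrightarrow> \<phi> 0 t > 0"
    "\<And>i j e. e > 0 \<Longrightarrow> \<exists>S. \<forall>t\<ge>S. \<forall>g. (\<forall>k::nat. t \<le> real k + 1 \<longrightarrow> \<bar>g\<bar> \<le> m i k) \<longrightarrow> \<bar>g * \<phi> j t\<bar> \<le> e"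
    using taming_function[of m, OF m(1)] by blast
  let ?K = "tamed ?N F \<phi>"
  have smooth_\<phi>: "smooth1 (\<phi> j)" for j
    by (rule smooth1_class[where K = "range \<phi>"]) (use \<phi>(1) in blast)+
  have Ksmooth: "csmooth G" if "G \<in> ?K" for G
    using that
  proof induction
    case (mem G c j)
    show ?case
      by (intro csmooth_mult csmooth_const derived_csmooth(1)[OF F mem] csmooth_smooth1[OF smooth_\<phi> csmooth_sqsum])
  qed (rule csmooth_add)
  have Kdecay: "\<exists>S. \<forall>z. sqsum ?N z \<ge> S \<longrightarrow> \<bar>G z\<bar> \<le> e" if "G \<in> ?K" "e > 0" for G and e :: real
    using that
  proof (induction arbitrary: e)
    case (mem G c j)
    obtain i where i: "G = g i" using Dg[OF mem(1)] by blast
    \<comment> \<open>The constant c is absorbed by asking for a smaller bound; adding 1 covers c =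
      0.\<close>
    have "e / (\<bar>c\<bar> + 1) > 0" using mem by (simp add: add_nonneg_pos)
    from \<phi>(3)[OF this, of i j] obtain S where
      S: "\<And>t g. t \<ge> S \<Longrightarrow> (\<forall>k::nat. t \<le> real k + 1 \<longrightarrow> \<bar>g\<bar> \<le> m i k) \<Longrightarrow> \<bar>g * \<phi> j t\<bar> \<le> e / (\<bar>c\<bar> + 1)"
      by blast
    have "\<bar>c * G z * \<phi> j (sqsum ?N z)\<bar> \<le> e" if "sqsum ?N z \<ge> S" for z
    proof -
      have "\<bar>G z * \<phi> j (sqsum ?N z)\<bar> \<le> e / (\<bar>c\<bar> + 1)"
        using S[OF that, of "G z"] m(2) i by blast
      then have "\<bar>c\<bar> * \<bar>G z * \<phi> j (sqsum ?N z)\<bar> \<le> \<bar>c\<bar> * (e / (\<bar>c\<bar> + 1))"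
        by (rule mult_left_mono) simp
      also have "\<dots> \<le> e" using mem(2) by (simp add: divide_simps mult.commute add_nonneg_pos distrib_left)
      finally show ?thesis by (simp add: abs_mult mult.assoc)
    qed
    then show ?case by blast
  next
    case (add G H)
    obtain S where S: "\<forall>z. sqsum ?N z \<ge> S \<longrightarrow> \<bar>G z\<bar> \<le> e/2" using add.IH(1)[of "e/2"] add.prems by auto
    obtain S' where S': "\<forall>z. sqsum ?N z \<ge> S' \<longrightarrow> \<bar>H z\<bar> \<le> e/2" using add.IH(2)[of "e/2"] add.prems by auto
    have "\<bar>G z + H z\<bar> \<le> e" if "sqsum ?N z \<ge> max S S'" for z
    proof -
      have "\<bar>G z\<bar> \<le> e/2" "\<bar>H z\<bar> \<le> e/2" using S S' that by auto
      then show ?thesis by linarith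
    qed
    then show ?case by blast
  qed
  have inv: "csmooth (invert_coord n G)" if "G \<in> ?K" for G
  proof (rule csmooth_invert_coord[where K = "?K"])
    show "continuous_on UNIV G" if "G \<in> ?K" for G using csmooth_continuous[OF Ksmooth[OF that]] .
    show "\<exists>S. \<forall>z. (\<forall>i<n. \<bar>z i\<bar> \<le> B) \<longrightarrow> \<bar>z n\<bar> \<ge> S \<longrightarrow> \<bar>G z\<bar> \<le> e" if Ge: "G \<in> ?K" "e > 0" for G B and e :: real
    proof -
      obtain S where S: "\<And>z. sqsum ?N z \<ge> S \<Longrightarrow> \<bar>G z\<bar> \<le> e" using Kdecay[OF Ge] by blast
      \<comment> \<open>Once |z n| >= 1 its square dominates it, so one large coordinate already
        makes \<open>sqsum\<close> large.\<close>
      have "\<bar>G z\<bar> \<le> e" if "\<bar>z n\<bar> \<ge> max 1 S" for z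
      proof (rule S)
        have "S \<le> \<bar>z n\<bar>" "1 \<le> \<bar>z n\<bar>" using that by auto
        then have "S \<le> \<bar>z n\<bar> * \<bar>z n\<bar>" using mult_right_mono[of 1 "\<bar>z n\<bar>" "\<bar>z n\<bar>"] by linarith
        also have "\<dots> \<le> sqsum ?N z" using sqsum_ge[of n ?N z] by simp
        finally show "S \<le> sqsum ?N z" .
      qed
      then show ?thesis by blast
    qed
    \<comment> \<open>Both factors x n are absorbed by \<open>derived\<close>, the sign by the
      constant c.\<close>
    show "(\<lambda>x. - (x n * x n * G x)) \<in> ?K" if "G \<in> ?K" for G
      using that
    proof induction
      case (mem G c j)
      have "(\<lambda>x. x n * (x n * G x)) \<in> ?D" by (intro derived.coordinate mem) auto
      from tamed.mem[OF this, of "-c" \<phi> j] show ?case by (simp add: mult_ac)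
    next
      case (add G H)
      from tamed.add[OF add.IH] show ?case by (simp add: algebra_simps)
    qed
    show "\<exists>G'\<in>?K. \<forall>x. ((\<lambda>t. G (x(i := t))) has_real_derivative G' x) (at (x i))" if "G \<in> ?K" for G i
      using that
    proof induction
      case (mem G c j)
      note G = derived_csmooth[OF F mem]
      have d: "((\<lambda>t. c * G (x(i := t)) * \<phi> j (sqsum ?N (x(i := t)))) has_real_derivative
         c * pd i G x * \<phi> j (sqsum ?N x) + c * G x * (\<phi> (Suc j) (sqsum ?N x) * (if i < ?N then 2 * x i else 0))) (at (x i))" for x
      proof -
        have "((\<lambda>t. \<phi> j (sqsum ?N (x(i := t)))) has_real_derivative
           \<phi> (Suc j) (sqsum ?N x) * (if i < ?N then 2 * x i else 0)) (at (x i))"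
          by (rule DERIV_chain2[OF _ DERIV_sqsum]) (use \<phi>(1) in simp)
        from DERIV_mult[OF DERIV_cmult[OF DERIV_pd[OF G(1), where x = x and i = i], of c] this]
        show ?thesis by (simp add: algebra_simps)
      qed
      show ?case
      proof (cases "i < ?N")
        case True
        have "(\<lambda>z. c * pd i G z * \<phi> j (sqsum ?N z) + 2 * c * (z i * G z) * \<phi> (Suc j) (sqsum ?N z)) \<in> ?K"
          by (intro tamed.add tamed.mem derived.partial derived.coordinate mem True)
        then show ?thesis
        proof (rule bexI[rotated], intro allI)
          fix x
          have e: "c * pd i G x * \<phi> j (sqsum ?N x) + 2 * c * (x i * G x) * \<phi> (Suc j) (sqsum ?N x) =
            c * pd i G x * \<phi> j (sqsum ?N x) + c * G x * (\<phi> (Suc j) (sqsum ?N x) * (if i < ?N then 2 * x i else 0))"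
            using True by simp
          show "((\<lambda>t. c * G (x(i := t)) * \<phi> j (sqsum ?N (x(i := t)))) has_real_derivative
            c * pd i G x * \<phi> j (sqsum ?N x) + 2 * c * (x i * G x) * \<phi> (Suc j) (sqsum ?N x)) (at (x i))"
            unfolding e by (rule d)
        qed
      next
        case False
        have "(\<lambda>z. c * pd i G z * \<phi> j (sqsum ?N z)) \<in> ?K"
          by (intro tamed.mem derived.partial mem)
        then show ?thesis
        proof (rule bexI[rotated], intro allI)
          fix x
          show "((\<lambda>t. c * G (x(i := t)) * \<phi> j (sqsum ?N (x(i := t)))) has_real_derivative
            c * pd i G x * \<phi> j (sqsum ?N x)) (at (x i))"
            using d[of x] False by (simp only: if_False mult_zero_right add_0_right)
        qed
      qed
    next
      case (add G H)
      then obtain G' H' where "G' \<in> ?K" "H' \<in> ?K"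
        and d: "\<And>x. ((\<lambda>t. G (x(i := t))) has_real_derivative G' x) (at (x i))"
        "\<And>x. ((\<lambda>t. H (x(i := t))) has_real_derivative H' x) (at (x i))" by blast
      then show ?case
        by (intro bexI[of _ "\<lambda>z. G' z + H' z"] allI DERIV_add[OF d] tamed.add)
    qed
  qed (rule that)
  let ?\<Psi> = "\<lambda>z. \<phi> 0 (sqsum ?N z)"
  have 1: "?\<Psi> \<in> ?K" using tamed.mem[OF derived.one, where c = 1 and \<phi> = \<phi> and j = 0] by simp
  have 2: "(\<lambda>z. F z * ?\<Psi> z) \<in> ?K" using tamed.mem[OF derived.self, where c = 1 and \<phi> = \<phi> and j = 0] by simp
  have 3: "dep ?N ?\<Psi>" unfolding dep_def sqsum_def
    by (intro allI impI arg_cong[where f = "\<phi> 0"] sum.cong) auto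
  show ?thesis
    by (rule that[OF Ksmooth[OF 1] 3 \<phi>(2)[OF sqsum_nonneg] inv[OF 1] inv[OF 2]])
qed

section \<open>The algebra of smooth operations\<close>

definition csm :: "nat \<Rightarrow> ((nat \<Rightarrow> real) \<Rightarrow> real) \<Rightarrow> bool" where
  "csm n F \<longleftrightarrow> csmooth F \<and> dep n F"

definition fn :: "nat \<Rightarrow> ((nat \<Rightarrow> real) \<Rightarrow> real) \<Rightarrow> (nat \<Rightarrow> real) \<Rightarrow> real" where
  "fn n F = restrict F (tuples n UNIV)"

text \<open>Operations and arguments are made total, so that they compose without side conditions on
  extensionality.\<close>

definition sop :: "'a cinf \<Rightarrow> nat \<Rightarrow> ((nat \<Rightarrow> real) \<Rightarrow> real) \<Rightarrow> (nat \<Rightarrow> 'a) \<Rightarrow> 'a" where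
  "sop A n F x = smooth_op A n (fn n F) (restrict x {..<n})"

lemma csm_const: "csm n (\<lambda>_. c)"
  by (simp add: csm_def csmooth_const dep_def)

lemma csm_coord: "i < n \<Longrightarrow> csm n (\<lambda>v. v i)"
  by (simp add: csm_def csmooth_coord dep_def)

lemma csm_add: "csm n F \<Longrightarrow> csm n G \<Longrightarrow> csm n (\<lambda>v. F v + G v)"
  unfolding csm_def dep_def by (metis csmooth_add)

lemma csm_mult: "csm n F \<Longrightarrow> csm n G \<Longrightarrow> csm n (\<lambda>v. F v * G v)"
  unfolding csm_def dep_def by (metis csmooth_mult)

lemma csm_minus: "csm n F \<Longrightarrow> csm n (\<lambda>v. - F v)"
  unfolding csm_def dep_def by (metis csmooth_minus)

lemma csm_diff: "csm n F \<Longrightarrow> csm n G \<Longrightarrow> csm n (\<lambda>v. F v - G v)"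
  unfolding csm_def dep_def by (metis csmooth_diff)

lemma csm_inverse: "csm n F \<Longrightarrow> (\<And>v. F v \<noteq> 0) \<Longrightarrow> csm n (\<lambda>v. inverse (F v))"
  unfolding csm_def dep_def by (metis csmooth_inverse)

lemma csm_smooth1: "smooth1 g \<Longrightarrow> csm n F \<Longrightarrow> csm n (\<lambda>v. g (F v))"
  unfolding csm_def dep_def by (metis csmooth_smooth1)

text \<open>The \<open>G j\<close> with j >= m are replaced by 0, as nothing is assumed of them;
  \<open>dep m F\<close> makes the replacement invisible.\<close>

lemma csm_comp:
  assumes "csm m F" "\<And>j. j < m \<Longrightarrow> csm n (G j)"
  shows "csm n (\<lambda>v. F (\<lambda>j. G j v))"
proof -
  let ?G = "\<lambda>j v. if j < m then G j v else 0"
  have "csmooth (?G j)" for j 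
    using assms(2)[of j] csmooth_const[of 0] by (cases "j < m") (simp_all add: csm_def)
  with assms(1) have "csmooth (\<lambda>v. F (\<lambda>j. ?G j v))"
    unfolding csm_def by (elim conjE) (rule csmooth_comp[where m=m and G="?G"])
  moreover have "F (\<lambda>j. ?G j v) = F (\<lambda>j. G j v)" for v
    using assms(1) by (simp add: csm_def dep_def)
  moreover have "dep n (\<lambda>v. F (\<lambda>j. G j v))"
    unfolding dep_def
  proof (intro allI impI)
    fix x y :: "nat \<Rightarrow> real" assume "\<forall>i<n. x i = y i"
    then have "\<forall>j<m. G j x = G j y" using assms(2) by (simp add: csm_def dep_def)
    then show "F (\<lambda>j. G j x) = F (\<lambda>j. G j y)" using assms(1) by (simp add: csm_def dep_def)
  qed
  ultimately show ?thesis by (simp add: csm_def)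
qed

lemma csm_plus: "csm 2 (\<lambda>v. v 0 + v 1)"
  by (intro csm_add csm_coord) simp_all

lemma csm_times: "csm 2 (\<lambda>v. v 0 * v 1)"
  by (intro csm_mult csm_coord) simp_all

lemma csm_mono: "csm n F \<Longrightarrow> n \<le> m \<Longrightarrow> csm m F"
  by (auto simp: csm_def dep_def)

lemma fn_smooth: "csm n F \<Longrightarrow> fn n F \<in> smooth_fns n"
  unfolding csm_def fn_def by (auto intro: smooth_fns_restrict)

lemma smooth_fns_obtain:
  assumes "f \<in> smooth_fns n"
  obtains F where "csm n F" "f = fn n F"
proof
  let ?F = "\<lambda>x. f (restrict x {..<n})"
  have f: "f \<in> extensional (tuples n UNIV)" "csmooth ?F" using assms by (auto simp: smooth_fns_iff)
  have "dep n ?F" unfolding dep_def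
    by (intro allI impI arg_cong[where f = f]) (auto simp: restrict_def)
  then show "csm n ?F" using f by (simp add: csm_def)
  show "f = fn n ?F" unfolding fn_def
  proof (rule extensionalityI[OF f(1)])
    fix x assume "x \<in> tuples n (UNIV :: real set)"
    then show "f x = restrict ?F (tuples n UNIV) x" by (simp only: restrict_apply' PiE_restrict)
  qed simp
qed

lemma coord_fn: "coord n i = fn n (\<lambda>v. v i)"
  by (simp add: coord_def fn_def)

lemma smooth_comp_fn:
  assumes "csm m F"
  shows "smooth_comp n m (fn m F) (\<lambda>j. fn n (G j)) = fn n (\<lambda>v. F (\<lambda>j. G j v))"
proof
  fix v
  show "smooth_comp n m (fn m F) (\<lambda>j. fn n (G j)) v = fn n (\<lambda>v. F (\<lambda>j. G j v)) v"
  proof (cases "v \<in> tuples n (UNIV :: real set)")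
    case True
    have "(\<lambda>i\<in>{..<m}. G i v) \<in> tuples m UNIV" by auto
    then have "fn m F (\<lambda>i\<in>{..<m}. G i v) = F (\<lambda>i\<in>{..<m}. G i v)"
      by (simp only: fn_def restrict_apply')
    also have "\<dots> = F (\<lambda>j. G j v)" using assms by (simp add: csm_def dep_def)
    finally show ?thesis using True by (simp add: smooth_comp_def fn_def)
  next
    case False
    then show ?thesis by (simp add: smooth_comp_def fn_def)
  qed
qed

lemma smooth_comp_cong:
  "(\<And>i. i < m \<Longrightarrow> g i = g' i) \<Longrightarrow> smooth_comp n m f g = smooth_comp n m f g'"
  unfolding smooth_comp_def by (intro restrict_ext arg_cong[where f = f]) auto

lemma smooth_family_obtain:
  assumes "g \<in> {..<m} \<rightarrow> smooth_fns n"
  obtains G where "\<And>j. csm n (G j)" "\<And>j. j < m \<Longrightarrow> g j = fn n (G j)"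
proof -
  have "\<exists>G. csm n G \<and> (j < m \<longrightarrow> g j = fn n G)" for j
  proof (cases "j < m")
    case True
    then have "g j \<in> smooth_fns n" using assms by blast
    then obtain G where "csm n G" "g j = fn n G" by (rule smooth_fns_obtain)
    then show ?thesis by blast
  qed (use csm_const[of n 0] in blast)
  then obtain G where "\<And>j. csm n (G j) \<and> (j < m \<longrightarrow> g j = fn n (G j))" by metis
  then show ?thesis using that by blast
qed

lemma smooth_comp_smooth:
  assumes "f \<in> smooth_fns m" "g \<in> {..<m} \<rightarrow> smooth_fns n"
  shows "smooth_comp n m f g \<in> smooth_fns n"
proof -
  obtain F where F: "csm m F" "f = fn m F" using assms(1) by (rule smooth_fns_obtain)
  obtain G where G: "\<And>j. csm n (G j)" "\<And>j. j < m \<Longrightarrow> g j = fn n (G j)"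
    using assms(2) by (rule smooth_family_obtain) (rule that)
  have "smooth_comp n m f g = smooth_comp n m f (\<lambda>j. fn n (G j))"
    by (rule smooth_comp_cong) (rule G(2))
  also have "\<dots> = fn n (\<lambda>v. F (\<lambda>j. G j v))"
    unfolding F(2) by (rule smooth_comp_fn[OF F(1)])
  finally have "smooth_comp n m f g = fn n (\<lambda>v. F (\<lambda>j. G j v))" .
  then show ?thesis using fn_smooth[OF csm_comp[OF F(1) G(1)]] by simp
qed

lemma coord_smooth: "i < n \<Longrightarrow> coord n i \<in> smooth_fns n"
  unfolding coord_fn by (intro fn_smooth csm_coord)

lemma sop_cong: "(\<And>i. i < n \<Longrightarrow> x i = y i) \<Longrightarrow> sop A n F x = sop A n F y"
  unfolding sop_def by (intro arg_cong[where f = "smooth_op A n (fn n F)"]) auto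

lemma smooth_op_sop: "x \<in> extensional {..<n} \<Longrightarrow> smooth_op A n (fn n F) x = sop A n F x"
  by (simp add: sop_def extensional_restrict)

section \<open>Evaluation of smooth functions and the underlying commutative ring\<close>

definition cst :: "'a cinf \<Rightarrow> real \<Rightarrow> 'a" where
  "cst A c = sop A 0 (\<lambda>_. c) (\<lambda>_. undefined)"

lemma ring_of_carrier [simp]: "carrier (ring_of A) = carrier A"
  by (simp add: ring_of_def)

lemma ring_of_add: "x \<oplus>\<^bsub>ring_of A\<^esub> y = sop A 2 (\<lambda>v. v 0 + v 1) (\<lambda>i. if i = 0 then x else y)"
  by (simp add: ring_of_def sop_def fn_def)

lemma ring_of_mult: "x \<otimes>\<^bsub>ring_of A\<^esub> y = sop A 2 (\<lambda>v. v 0 * v 1) (\<lambda>i. if i = 0 then x else y)"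
  by (simp add: ring_of_def sop_def fn_def)

lemma ring_of_zero: "\<zero>\<^bsub>ring_of A\<^esub> = cst A 0"
  by (simp add: ring_of_def cst_def sop_def fn_def)

lemma ring_of_one: "\<one>\<^bsub>ring_of A\<^esub> = cst A 1"
  by (simp add: ring_of_def cst_def sop_def fn_def)

context cinf_ring
begin

lemma sop_closed: "csm n F \<Longrightarrow> (\<And>i. i < n \<Longrightarrow> x i \<in> carrier A) \<Longrightarrow> sop A n F x \<in> carrier A"
  unfolding sop_def by (intro op_closed fn_smooth) auto

lemma sop_coord: "i < n \<Longrightarrow> (\<And>i. i < n \<Longrightarrow> x i \<in> carrier A) \<Longrightarrow> sop A n (\<lambda>v. v i) x = x i"
  unfolding sop_def using op_coord[of i n "restrict x {..<n}"] by (auto simp: coord_fn)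

lemma sop_comp:
  assumes "csm m F" "\<And>j. j < m \<Longrightarrow> csm n (G j)" "\<And>i. i < n \<Longrightarrow> x i \<in> carrier A"
  shows "sop A n (\<lambda>v. F (\<lambda>j. G j v)) x = sop A m F (\<lambda>j. sop A n (G j) x)"
proof -
  have "smooth_op A n (smooth_comp n m (fn m F) (\<lambda>j. fn n (G j))) (restrict x {..<n}) =
    smooth_op A m (fn m F) (\<lambda>i\<in>{..<m}. smooth_op A n (fn n (G i)) (restrict x {..<n}))"
    by (rule op_comp) (use assms fn_smooth in auto)
  then show ?thesis unfolding smooth_comp_fn[OF assms(1), of n G] sop_def .
qed

text \<open>A constant function of n variables is a composite with the nullary operation, so its
  value does not depend on the arguments.\<close>

lemma sop_const:
  assumes "\<And>i. i < n \<Longrightarrow> x i \<in> carrier A"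
  shows "sop A n (\<lambda>_. c) x = cst A c"
  using sop_comp[of 0 "\<lambda>_. c" n "\<lambda>_ _. 0" x] assms
  unfolding cst_def by (auto simp: csm_const intro: sop_cong)

lemma cst_closed: "cst A c \<in> carrier A"
  unfolding cst_def by (rule sop_closed) (auto simp: csm_const)

lemma sop_binary:
  assumes "csm 2 H" "csm n F" "csm n G" "\<And>i. i < n \<Longrightarrow> x i \<in> carrier A"
  shows "sop A n (\<lambda>v. H (\<lambda>j. if j = 0 then F v else G v)) x =
    sop A 2 H (\<lambda>j. if j = 0 then sop A n F x else sop A n G x)"
proof -
  have "sop A n (\<lambda>v. H (\<lambda>j. (if j = 0 then F else G) v)) x =
    sop A 2 H (\<lambda>j. sop A n (if j = 0 then F else G) x)"
    by (rule sop_comp) (use assms in auto)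
  moreover have "(\<lambda>v. H (\<lambda>j. (if j = 0 then F else G) v)) = (\<lambda>v. H (\<lambda>j. if j = 0 then F v else G v))"
    by (intro ext arg_cong[where f=H]) simp
  ultimately show ?thesis by (auto intro!: sop_cong elim: HOL.trans)
qed

lemma sop_add:
  assumes "csm n F" "csm n G" "\<And>i. i < n \<Longrightarrow> x i \<in> carrier A"
  shows "sop A n (\<lambda>v. F v + G v) x = sop A n F x \<oplus>\<^bsub>ring_of A\<^esub> sop A n G x"
  using sop_binary[OF csm_plus assms] unfolding ring_of_add by simp

lemma sop_mult:
  assumes "csm n F" "csm n G" "\<And>i. i < n \<Longrightarrow> x i \<in> carrier A"
  shows "sop A n (\<lambda>v. F v * G v) x = sop A n F x \<otimes>\<^bsub>ring_of A\<^esub> sop A n G x"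
  using sop_binary[OF csm_times assms] unfolding ring_of_mult by simp

text \<open>Each ring law is an identity between smooth functions of three variables. The elements
  are written as values of the coordinate functions on (x, y, z), both sides become values of smooth
  functions, and these functions are equal; laws in fewer elements repeat one of them.\<close>

lemma cring_ring_of: "cring (ring_of A)"
proof -
  define u where "u x y z = (\<lambda>i::nat. if i = 0 then x else if i = 1 then y else z)" for x y z :: 'a
  note ev = sop_add sop_mult sop_const sop_coord csm_add csm_mult csm_coord csm_const csm_minus
  have closed: "x \<oplus>\<^bsub>ring_of A\<^esub> y \<in> carrier A" "x \<otimes>\<^bsub>ring_of A\<^esub> y \<in> carrier A"
    if "x \<in> carrier A" "y \<in> carrier A" for x y
    unfolding ring_of_add ring_of_mult by (rule sop_closed; (rule csm_plus csm_times)?; simp add: that)+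
  have U: "u x y z i \<in> carrier A" if "x \<in> carrier A" "y \<in> carrier A" "z \<in> carrier A" for x y z i
    using that by (simp add: u_def)
  have c: "x = sop A 3 (\<lambda>v. v 0) (u x y z)" "y = sop A 3 (\<lambda>v. v 1) (u x y z)" "z = sop A 3 (\<lambda>v. v 2) (u x y z)"
    if "x \<in> carrier A" "y \<in> carrier A" "z \<in> carrier A" for x y z
    using sop_coord[of _ 3 "u x y z"] U[OF that] by (auto simp: u_def)
  have c3: "csm 3 (\<lambda>v. v 0)" "csm 3 (\<lambda>v. v 1)" "csm 3 (\<lambda>v. v 2)" by (auto intro: csm_coord)
  note add = sop_add[where n=3, OF _ _ U] and mult = sop_mult[where n=3, OF _ _ U]
  have E: "sop A n F x = sop A n G x" if "\<And>v. F v = G v" for n F G and x :: "nat \<Rightarrow> 'a"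
    using that by presburger
  show ?thesis
  proof (rule cringI)
    show "abelian_group (ring_of A)"
    proof (rule abelian_groupI)
      fix x y z assume "x \<in> carrier (ring_of A)" "y \<in> carrier (ring_of A)" "z \<in> carrier (ring_of A)"
      then have xyz: "x \<in> carrier A" "y \<in> carrier A" "z \<in> carrier A" by auto
      note t = c[OF xyz] and a = add[OF _ _ xyz]
      have "x \<oplus>\<^bsub>ring_of A\<^esub> y \<oplus>\<^bsub>ring_of A\<^esub> z = sop A 3 (\<lambda>v. (v 0 + v 1) + v 2) (u x y z)"
        using t c3 by (simp add: a csm_add)
      also have "\<dots> = sop A 3 (\<lambda>v. v 0 + (v 1 + v 2)) (u x y z)" by (rule E) simp
      also have "\<dots> = x \<oplus>\<^bsub>ring_of A\<^esub> (y \<oplus>\<^bsub>ring_of A\<^esub> z)"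
        using t c3 by (simp add: a csm_add)
      finally show "x \<oplus>\<^bsub>ring_of A\<^esub> y \<oplus>\<^bsub>ring_of A\<^esub> z = x \<oplus>\<^bsub>ring_of A\<^esub> (y \<oplus>\<^bsub>ring_of A\<^esub> z)" .
    next
      fix x y assume "x \<in> carrier (ring_of A)" "y \<in> carrier (ring_of A)"
      then have xyz: "x \<in> carrier A" "y \<in> carrier A" "y \<in> carrier A" by auto
      note t = c[OF xyz] and a = add[OF _ _ xyz]
      have "x \<oplus>\<^bsub>ring_of A\<^esub> y = sop A 3 (\<lambda>v. v 0 + v 1) (u x y y)"
        using t c3 by (simp add: a csm_add)
      also have "\<dots> = sop A 3 (\<lambda>v. v 1 + v 0) (u x y y)" by (rule E) simp
      also have "\<dots> = y \<oplus>\<^bsub>ring_of A\<^esub> x"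
        using t c3 by (simp add: a csm_add)
      finally show "x \<oplus>\<^bsub>ring_of A\<^esub> y = y \<oplus>\<^bsub>ring_of A\<^esub> x" .
    next
      fix x assume "x \<in> carrier (ring_of A)"
      then have xyz: "x \<in> carrier A" "x \<in> carrier A" "x \<in> carrier A" by auto
      note t = c[OF xyz] and a = add[OF _ _ xyz]
      have z: "\<zero>\<^bsub>ring_of A\<^esub> = sop A 3 (\<lambda>v. 0) (u x x x)"
        unfolding ring_of_zero by (rule sop_const[symmetric]) (rule U[OF xyz])
      have "\<zero>\<^bsub>ring_of A\<^esub> \<oplus>\<^bsub>ring_of A\<^esub> x = sop A 3 (\<lambda>v. 0 + v 0) (u x x x)"
        unfolding z using t c3 by (simp only: a csm_const)
      also have "\<dots> = sop A 3 (\<lambda>v. v 0) (u x x x)" by (rule E) simp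
      finally show "\<zero>\<^bsub>ring_of A\<^esub> \<oplus>\<^bsub>ring_of A\<^esub> x = x" using t by simp
      have "sop A 3 (\<lambda>v. - v 0) (u x x x) \<oplus>\<^bsub>ring_of A\<^esub> x = sop A 3 (\<lambda>v. - v 0 + v 0) (u x x x)"
        using t c3 by (simp only: a csm_minus)
      also have "\<dots> = sop A 3 (\<lambda>v. 0) (u x x x)" by (rule E) simp
      finally have "sop A 3 (\<lambda>v. - v 0) (u x x x) \<oplus>\<^bsub>ring_of A\<^esub> x = \<zero>\<^bsub>ring_of A\<^esub>" using z by simp
      moreover have "sop A 3 (\<lambda>v. - v 0) (u x x x) \<in> carrier A"
        by (intro sop_closed csm_minus c3 U xyz)
      ultimately show "\<exists>y\<in>carrier (ring_of A). y \<oplus>\<^bsub>ring_of A\<^esub> x = \<zero>\<^bsub>ring_of A\<^esub>" by auto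
    qed (auto simp: closed ring_of_zero cst_closed)
    show "comm_monoid (ring_of A)"
    proof (rule comm_monoidI)
      fix x y z assume "x \<in> carrier (ring_of A)" "y \<in> carrier (ring_of A)" "z \<in> carrier (ring_of A)"
      then have xyz: "x \<in> carrier A" "y \<in> carrier A" "z \<in> carrier A" by auto
      note t = c[OF xyz] and a = mult[OF _ _ xyz]
      have "x \<otimes>\<^bsub>ring_of A\<^esub> y \<otimes>\<^bsub>ring_of A\<^esub> z = sop A 3 (\<lambda>v. (v 0 * v 1) * v 2) (u x y z)"
        using t c3 by (simp add: a csm_mult)
      also have "\<dots> = sop A 3 (\<lambda>v. v 0 * (v 1 * v 2)) (u x y z)" by (rule E) simp
      also have "\<dots> = x \<otimes>\<^bsub>ring_of A\<^esub> (y \<otimes>\<^bsub>ring_of A\<^esub> z)"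
        using t c3 by (simp add: a csm_mult)
      finally show "x \<otimes>\<^bsub>ring_of A\<^esub> y \<otimes>\<^bsub>ring_of A\<^esub> z = x \<otimes>\<^bsub>ring_of A\<^esub> (y \<otimes>\<^bsub>ring_of A\<^esub> z)" .
    next
      fix x y assume "x \<in> carrier (ring_of A)" "y \<in> carrier (ring_of A)"
      then have xyz: "x \<in> carrier A" "y \<in> carrier A" "y \<in> carrier A" by auto
      note t = c[OF xyz] and a = mult[OF _ _ xyz]
      have "x \<otimes>\<^bsub>ring_of A\<^esub> y = sop A 3 (\<lambda>v. v 0 * v 1) (u x y y)"
        using t c3 by (simp add: a csm_mult)
      also have "\<dots> = sop A 3 (\<lambda>v. v 1 * v 0) (u x y y)" by (rule E) simp
      also have "\<dots> = y \<otimes>\<^bsub>ring_of A\<^esub> x"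
        using t c3 by (simp add: a csm_mult)
      finally show "x \<otimes>\<^bsub>ring_of A\<^esub> y = y \<otimes>\<^bsub>ring_of A\<^esub> x" .
    next
      fix x assume "x \<in> carrier (ring_of A)"
      then have xyz: "x \<in> carrier A" "x \<in> carrier A" "x \<in> carrier A" by auto
      note t = c[OF xyz] and a = mult[OF _ _ xyz]
      have z: "\<one>\<^bsub>ring_of A\<^esub> = sop A 3 (\<lambda>v. 1) (u x x x)"
        unfolding ring_of_one by (rule sop_const[symmetric]) (rule U[OF xyz])
      have "\<one>\<^bsub>ring_of A\<^esub> \<otimes>\<^bsub>ring_of A\<^esub> x = sop A 3 (\<lambda>v. 1 * v 0) (u x x x)"
        unfolding z using t c3 by (simp only: a csm_const)
      also have "\<dots> = sop A 3 (\<lambda>v. v 0) (u x x x)" by (rule E) simp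
      finally show "\<one>\<^bsub>ring_of A\<^esub> \<otimes>\<^bsub>ring_of A\<^esub> x = x" using t by simp
    qed (auto simp: closed ring_of_one cst_closed)
    fix x y z assume "x \<in> carrier (ring_of A)" "y \<in> carrier (ring_of A)" "z \<in> carrier (ring_of A)"
    then have xyz: "x \<in> carrier A" "y \<in> carrier A" "z \<in> carrier A" by auto
    note t = c[OF xyz] and a = mult[OF _ _ xyz] add[OF _ _ xyz]
    have "(x \<oplus>\<^bsub>ring_of A\<^esub> y) \<otimes>\<^bsub>ring_of A\<^esub> z = sop A 3 (\<lambda>v. (v 0 + v 1) * v 2) (u x y z)"
      using t c3 by (simp add: a csm_mult csm_add)
    also have "\<dots> = sop A 3 (\<lambda>v. v 0 * v 2 + v 1 * v 2) (u x y z)" by (rule E) (simp add: algebra_simps)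
    also have "\<dots> = x \<otimes>\<^bsub>ring_of A\<^esub> z \<oplus>\<^bsub>ring_of A\<^esub> y \<otimes>\<^bsub>ring_of A\<^esub> z"
      using t c3 by (simp add: a csm_mult csm_add)
    finally show "(x \<oplus>\<^bsub>ring_of A\<^esub> y) \<otimes>\<^bsub>ring_of A\<^esub> z = x \<otimes>\<^bsub>ring_of A\<^esub> z \<oplus>\<^bsub>ring_of A\<^esub> y \<otimes>\<^bsub>ring_of A\<^esub> z" .
  qed
qed

sublocale R: cring "ring_of A"
  rewrites "carrier (ring_of A) = carrier A"
  by (rule cring_ring_of) simp

lemma sop_minus:
  assumes "csm n F" "\<And>i. i < n \<Longrightarrow> x i \<in> carrier A"
  shows "sop A n (\<lambda>v. - F v) x = \<ominus>\<^bsub>ring_of A\<^esub> sop A n F x"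
proof -
  have "sop A n (\<lambda>v. - F v) x \<oplus>\<^bsub>ring_of A\<^esub> sop A n F x = sop A n (\<lambda>v. - F v + F v) x"
    by (rule sop_add[symmetric]) (use assms in \<open>auto intro: csm_minus\<close>)
  also have "\<dots> = \<zero>\<^bsub>ring_of A\<^esub>" using sop_const[of n x 0] assms(2) by (simp add: ring_of_zero)
  finally show ?thesis
    using R.minus_equality[of "sop A n (\<lambda>v. - F v) x" "sop A n F x"] assms
    by (simp add: sop_closed csm_minus)
qed

lemma sop_diff:
  assumes "csm n F" "csm n G" "\<And>i. i < n \<Longrightarrow> x i \<in> carrier A"
  shows "sop A n (\<lambda>v. F v - G v) x = sop A n F x \<ominus>\<^bsub>ring_of A\<^esub> sop A n G x"
  using sop_add[OF assms(1) csm_minus[OF assms(2)] assms(3)] sop_minus[OF assms(2,3)]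
  by (simp add: a_minus_def)

lemma sop_extend:
  assumes "csm n F" "n \<le> m" "\<And>i. i < m \<Longrightarrow> x i \<in> carrier A"
  shows "sop A m F x = sop A n F x"
proof -
  have "sop A m (\<lambda>v. F (\<lambda>j. v j)) x = sop A n F (\<lambda>j. sop A m (\<lambda>v. v j) x)"
    by (rule sop_comp) (use assms in \<open>auto intro: csm_coord\<close>)
  also have "\<dots> = sop A n F x" by (rule sop_cong) (use assms in \<open>auto intro: sop_coord\<close>)
  finally show ?thesis by simp
qed

end

section \<open>Homomorphisms, quotients and rings of fractions\<close>

lemma tuples_ext: "x \<in> tuples n C \<Longrightarrow> x \<in> extensional {..<n}"
  by (simp add: PiE_def)

lemma tuples_mem: "x \<in> tuples n C \<Longrightarrow> i < n \<Longrightarrow> x i \<in> C"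
  by (drule PiE_mem) auto

lemma cinf_hom_closed: "\<phi> \<in> cinf_hom A B \<Longrightarrow> x \<in> carrier A \<Longrightarrow> \<phi> x \<in> carrier B"
  by (auto simp: cinf_hom_def)

lemma cinf_hom_ext: "\<phi> \<in> cinf_hom A B \<Longrightarrow> \<phi> \<in> extensional (carrier A)"
  by (auto simp: cinf_hom_def PiE_def)

lemma cinf_hom_eqI:
  assumes "\<phi> \<in> cinf_hom A B" "\<psi> \<in> cinf_hom A C" "\<And>x. x \<in> carrier A \<Longrightarrow> \<phi> x = \<psi> x"
  shows "\<phi> = \<psi>"
  using assms cinf_hom_ext by (metis extensionalityI)

lemma hom_sop:
  assumes "\<phi> \<in> cinf_hom A B" "csm n F" "\<And>i. i < n \<Longrightarrow> x i \<in> carrier A"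
  shows "\<phi> (sop A n F x) = sop B n F (\<lambda>i. \<phi> (x i))"
proof -
  have "restrict x {..<n} \<in> tuples n (carrier A)" using assms(3) by auto
  then have "\<phi> (sop A n F x) = smooth_op B n (fn n F) (\<lambda>i\<in>{..<n}. \<phi> (restrict x {..<n} i))"
    using assms(1) fn_smooth[OF assms(2)] unfolding cinf_hom_def sop_def by blast
  also have "\<dots> = sop B n F (\<lambda>i. \<phi> (x i))"
    unfolding sop_def by (intro arg_cong[where f = "smooth_op B n (fn n F)"] restrict_ext) auto
  finally show ?thesis .
qed

lemma cinf_homI:
  assumes "\<phi> \<in> carrier A \<rightarrow>\<^sub>E carrier B"
    and "\<And>n F x. csm n F \<Longrightarrow> (\<And>i. i < n \<Longrightarrow> x i \<in> carrier A) \<Longrightarrow> \<phi> (sop A n F x) = sop B n F (\<lambda>i. \<phi> (x i))"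
  shows "\<phi> \<in> cinf_hom A B"
  unfolding cinf_hom_def
proof (intro CollectI conjI allI ballI assms(1))
  fix n f x assume f: "f \<in> smooth_fns n" and x: "x \<in> tuples n (carrier A)"
  obtain F where F: "csm n F" "f = fn n F" using f by (rule smooth_fns_obtain)
  have "smooth_op A n f x = sop A n F x" unfolding F(2) by (rule smooth_op_sop[OF tuples_ext[OF x]])
  moreover have "smooth_op B n f (\<lambda>i\<in>{..<n}. \<phi> (x i)) = sop B n F (\<lambda>i. \<phi> (x i))"
    unfolding F(2) sop_def ..
  moreover have "x i \<in> carrier A" if "i < n" for i using tuples_mem[OF x that] .
  ultimately show "\<phi> (smooth_op A n f x) = smooth_op B n f (\<lambda>i\<in>{..<n}. \<phi> (x i))"
    using assms(2)[OF F(1), of x] by simp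
qed

lemma cinf_ringI:
  assumes closed: "\<And>n F x. csm n F \<Longrightarrow> (\<And>i. i < n \<Longrightarrow> x i \<in> carrier A) \<Longrightarrow> sop A n F x \<in> carrier A"
    and coord: "\<And>n i x. i < n \<Longrightarrow> (\<And>i. i < n \<Longrightarrow> x i \<in> carrier A) \<Longrightarrow> sop A n (\<lambda>v. v i) x = x i"
    and comp: "\<And>n m F G x. csm m F \<Longrightarrow> (\<And>j. csm n (G j)) \<Longrightarrow> (\<And>i. i < n \<Longrightarrow> x i \<in> carrier A) \<Longrightarrow>
       sop A n (\<lambda>v. F (\<lambda>j. G j v)) x = sop A m F (\<lambda>j. sop A n (G j) x)"
  shows "cinf_ring A"
proof
  fix n f x assume f: "f \<in> smooth_fns n" and x: "x \<in> tuples n (carrier A)"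
  obtain F where F: "csm n F" "f = fn n F" using f by (rule smooth_fns_obtain)
  have "smooth_op A n f x = sop A n F x" unfolding F(2) by (rule smooth_op_sop[OF tuples_ext[OF x]])
  then show "smooth_op A n f x \<in> carrier A" using closed[OF F(1), of x] tuples_mem[OF x] by simp
next
  fix n i x assume i: "i < n" and x: "x \<in> tuples n (carrier A)"
  have "smooth_op A n (coord n i) x = sop A n (\<lambda>v. v i) x"
    unfolding coord_fn by (rule smooth_op_sop[OF tuples_ext[OF x]])
  then show "smooth_op A n (coord n i) x = x i" using coord[OF i, of x] tuples_mem[OF x] by simp
next
  fix n m f g x
  assume f: "f \<in> smooth_fns m" and g: "g \<in> {..<m} \<rightarrow> smooth_fns n" and x: "x \<in> tuples n (carrier A)"
  obtain F where F: "csm m F" "f = fn m F" using f by (rule smooth_fns_obtain)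
  obtain G where G: "\<And>j. csm n (G j)" "\<And>j. j < m \<Longrightarrow> g j = fn n (G j)"
    using g by (rule smooth_family_obtain) (rule that)
  have x': "x \<in> extensional {..<n}" "\<And>i. i < n \<Longrightarrow> x i \<in> carrier A"
    using tuples_ext[OF x] tuples_mem[OF x] by auto
  have "smooth_comp n m f g = smooth_comp n m f (\<lambda>j. fn n (G j))"
    by (rule smooth_comp_cong) (rule G(2))
  also have "\<dots> = fn n (\<lambda>v. F (\<lambda>j. G j v))"
    unfolding F(2) by (rule smooth_comp_fn[OF F(1)])
  finally have "smooth_op A n (smooth_comp n m f g) x = sop A n (\<lambda>v. F (\<lambda>j. G j v)) x"
    by (simp only: smooth_op_sop[OF x'(1)])
  also have "\<dots> = sop A m F (\<lambda>j. sop A n (G j) x)" by (rule comp[OF F(1) G(1) x'(2)])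
  also have "\<dots> = smooth_op A m f (\<lambda>i\<in>{..<m}. smooth_op A n (g i) x)"
    unfolding sop_def[of A m] F(2)
    by (intro arg_cong[where f = "smooth_op A m (fn m F)"] restrict_ext) (simp add: G(2) smooth_op_sop[OF x'(1)])
  finally show "smooth_op A n (smooth_comp n m f g) x = smooth_op A m f (\<lambda>i\<in>{..<m}. smooth_op A n (g i) x)" .
qed

lemma cinf_hom_compose:
  assumes "\<phi> \<in> cinf_hom A B" "\<psi> \<in> cinf_hom B C" "cinf_ring A"
  shows "compose (carrier A) \<psi> \<phi> \<in> cinf_hom A C"
proof (rule cinf_homI)
  interpret cinf_ring A by fact
  note c = cinf_hom_closed[OF assms(1)]
  show "compose (carrier A) \<psi> \<phi> \<in> carrier A \<rightarrow>\<^sub>E carrier C"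
    using c cinf_hom_closed[OF assms(2)] by (auto simp: compose_def)
  fix n F x assume F: "csm n F" and x: "\<And>i. i < n \<Longrightarrow> x i \<in> carrier A"
  have "compose (carrier A) \<psi> \<phi> (sop A n F x) = \<psi> (\<phi> (sop A n F x))"
    using sop_closed[OF F x] by (simp add: compose_def)
  also have "\<dots> = sop C n F (\<lambda>i. \<psi> (\<phi> (x i)))"
    by (simp only: hom_sop[OF assms(1) F x] hom_sop[OF assms(2) F c[OF x]])
  also have "\<dots> = sop C n F (\<lambda>i. compose (carrier A) \<psi> \<phi> (x i))"
    by (rule sop_cong) (simp add: compose_def x)
  finally show "compose (carrier A) \<psi> \<phi> (sop A n F x) = sop C n F (\<lambda>i. compose (carrier A) \<psi> \<phi> (x i))" .
qed

lemma cinf_id_hom: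
  assumes "cinf_ring A"
  shows "cinf_id A \<in> cinf_hom A A"
proof (rule cinf_homI)
  interpret cinf_ring A by fact
  show "cinf_id A \<in> carrier A \<rightarrow>\<^sub>E carrier A" by (auto simp: cinf_id_def)
  fix n F x assume F: "csm n F" and x: "\<And>i. i < n \<Longrightarrow> x i \<in> carrier A"
  show "cinf_id A (sop A n F x) = sop A n F (\<lambda>i. cinf_id A (x i))"
    using sop_closed[OF F x] x by (auto simp: cinf_id_def intro: sop_cong)
qed

lemma cinf_hom_ring_hom:
  assumes "cinf_ring A" "cinf_ring B" "\<phi> \<in> cinf_hom A B"
  shows "ring_hom_cring (ring_of A) (ring_of B) \<phi>"
proof -
  interpret A: cinf_ring A by fact
  interpret B: cinf_ring B by fact
  note h = hom_sop[OF assms(3)]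
  have add: "\<phi> (x \<oplus>\<^bsub>ring_of A\<^esub> y) = \<phi> x \<oplus>\<^bsub>ring_of B\<^esub> \<phi> y" if "x \<in> carrier A" "y \<in> carrier A" for x y
    unfolding ring_of_add by (subst h[OF csm_plus]) (use that in \<open>auto intro: sop_cong\<close>)
  have mult: "\<phi> (x \<otimes>\<^bsub>ring_of A\<^esub> y) = \<phi> x \<otimes>\<^bsub>ring_of B\<^esub> \<phi> y" if "x \<in> carrier A" "y \<in> carrier A" for x y
    unfolding ring_of_mult by (subst h[OF csm_times]) (use that in \<open>auto intro: sop_cong\<close>)
  have one: "\<phi> \<one>\<^bsub>ring_of A\<^esub> = \<one>\<^bsub>ring_of B\<^esub>"
    unfolding ring_of_one cst_def by (subst h[OF csm_const]) (auto intro: sop_cong)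
  have "\<phi> \<in> ring_hom (ring_of A) (ring_of B)"
    by (rule ring_hom_memI) (use cinf_hom_closed[OF assms(3)] add mult one in auto)
  then show ?thesis
    by (intro ring_hom_cring.intro ring_hom_cring_axioms.intro A.cring_ring_of B.cring_ring_of)
qed

subsection \<open>Congruences\<close>

text \<open>\<open>X\<close> is merely closed under the operations: besides smooth rings the term
  algebra is an instance, where coordinates and composition behave correctly only modulo
  \<open>R\<close>.\<close>

locale cinf_congruence =
  fixes X :: "'a cinf" and R :: "('a \<times> 'a) set"
  assumes equiv: "equiv (carrier X) R"
    and closed: "\<And>n F x. csm n F \<Longrightarrow> (\<And>i. i < n \<Longrightarrow> x i \<in> carrier X) \<Longrightarrow> sop X n F x \<in> carrier X"
    and compat: "\<And>n F x y. csm n F \<Longrightarrow> (\<And>i. i < n \<Longrightarrow> (x i, y i) \<in> R) \<Longrightarrow> (sop X n F x, sop X n F y) \<in> R"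
begin

lemma carrier_quot: "carrier (quot_by X R) = carrier X // R"
  by (simp add: quot_by_def)

lemma class_in: "x \<in> carrier X \<Longrightarrow> R `` {x} \<in> carrier (quot_by X R)"
  by (simp add: carrier_quot quotientI)

lemma class_obtain:
  assumes "\<xi> \<in> carrier (quot_by X R)"
  obtains x where "x \<in> carrier X" "\<xi> = R `` {x}"
  using assms unfolding carrier_quot by (rule quotientE)

lemma class_eq: "x \<in> carrier X \<Longrightarrow> y \<in> carrier X \<Longrightarrow> R `` {x} = R `` {y} \<longleftrightarrow> (x, y) \<in> R"
  using eq_equiv_class_iff[OF equiv] by simp

lemma some_class: "x \<in> carrier X \<Longrightarrow> (x, SOME y. y \<in> R `` {x}) \<in> R"
  using someI[of "\<lambda>y. y \<in> R `` {x}" x] equiv_class_self[OF equiv] by simp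

lemma quot_sop:
  assumes F: "csm n F" and x: "\<And>i. i < n \<Longrightarrow> x i \<in> carrier X"
  shows "sop (quot_by X R) n F (\<lambda>i. R `` {x i}) = R `` {sop X n F x}"
proof -
  let ?y = "\<lambda>i. SOME y. y \<in> R `` {x i}"
  have "sop (quot_by X R) n F (\<lambda>i. R `` {x i}) =
     R `` {smooth_op X n (fn n F) (\<lambda>i\<in>{..<n}. SOME y. y \<in> restrict (\<lambda>i. R `` {x i}) {..<n} i)}"
    unfolding sop_def quot_by_def by simp
  also have "(\<lambda>i\<in>{..<n}. SOME y. y \<in> restrict (\<lambda>i. R `` {x i}) {..<n} i) = restrict ?y {..<n}"
    by (rule restrict_ext) simp
  also have "smooth_op X n (fn n F) (restrict ?y {..<n}) = sop X n F ?y" by (simp only: sop_def)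
  also have "(sop X n F x, sop X n F ?y) \<in> R" by (rule compat[OF F]) (rule some_class[OF x])
  then have "R `` {sop X n F ?y} = R `` {sop X n F x}"
    using equiv_class_eq[OF equiv] by metis
  finally show ?thesis .
qed

lemma quot_cinf_ring:
  assumes coord: "\<And>n i x. i < n \<Longrightarrow> (\<And>i. i < n \<Longrightarrow> x i \<in> carrier X) \<Longrightarrow> (sop X n (\<lambda>v. v i) x, x i) \<in> R"
    and comp: "\<And>n m F G x. csm m F \<Longrightarrow> (\<And>j. csm n (G j)) \<Longrightarrow> (\<And>i. i < n \<Longrightarrow> x i \<in> carrier X) \<Longrightarrow>
       (sop X n (\<lambda>v. F (\<lambda>j. G j v)) x, sop X m F (\<lambda>j. sop X n (G j) x)) \<in> R"
  shows "cinf_ring (quot_by X R)"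
proof -
  have rep: "\<exists>x. \<forall>i<n. x i \<in> carrier X \<and> \<xi> i = R `` {x i}"
    if "\<And>i. i < n \<Longrightarrow> \<xi> i \<in> carrier (quot_by X R)" for n :: nat and \<xi>
  proof -
    have "\<forall>i. \<exists>x. i < n \<longrightarrow> x \<in> carrier X \<and> \<xi> i = R `` {x}"
      using that class_obtain by metis
    then show ?thesis by metis
  qed
  have red: "sop (quot_by X R) n F \<xi> = R `` {sop X n F x}"
    if "csm n F" "\<forall>i<n. x i \<in> carrier X \<and> \<xi> i = R `` {x i}" for n F \<xi> x
  proof -
    have "sop (quot_by X R) n F \<xi> = sop (quot_by X R) n F (\<lambda>i. R `` {x i})"
      by (rule sop_cong) (use that in blast)
    then show ?thesis using quot_sop[OF that(1), of x] that(2) by simp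
  qed
  show ?thesis
  proof (rule cinf_ringI)
    fix n F \<xi> assume F: "csm n F" and \<xi>: "\<And>i. i < n \<Longrightarrow> \<xi> i \<in> carrier (quot_by X R)"
    obtain x where x: "\<forall>i<n. x i \<in> carrier X \<and> \<xi> i = R `` {x i}" using rep[of n \<xi>, OF \<xi>] by blast
    show "sop (quot_by X R) n F \<xi> \<in> carrier (quot_by X R)"
      unfolding red[OF F x] by (intro class_in closed F) (use x in blast)
  next
    fix n i :: nat and \<xi> assume i: "i < n" and \<xi>: "\<And>i. i < n \<Longrightarrow> \<xi> i \<in> carrier (quot_by X R)"
    obtain x where x: "\<forall>i<n. x i \<in> carrier X \<and> \<xi> i = R `` {x i}" using rep[of n \<xi>, OF \<xi>] by blast
    show "sop (quot_by X R) n (\<lambda>v. v i) \<xi> = \<xi> i"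
      unfolding red[OF csm_coord[OF i] x] using coord[OF i, of x] x i equiv_class_eq[OF equiv] by auto
  next
    fix n m F and G :: "nat \<Rightarrow> (nat \<Rightarrow> real) \<Rightarrow> real" and \<xi> assume F: "csm m F" and G: "\<And>j. csm n (G j)"
      and \<xi>: "\<And>i. i < n \<Longrightarrow> \<xi> i \<in> carrier (quot_by X R)"
    obtain x where x: "\<forall>i<n. x i \<in> carrier X \<and> \<xi> i = R `` {x i}" using rep[of n \<xi>, OF \<xi>] by blast
    have "sop (quot_by X R) n (\<lambda>v. F (\<lambda>j. G j v)) \<xi> = R `` {sop X n (\<lambda>v. F (\<lambda>j. G j v)) x}"
      by (rule red[OF csm_comp[OF F G] x])
    also have "\<dots> = R `` {sop X m F (\<lambda>j. sop X n (G j) x)}"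
      by (rule equiv_class_eq[OF equiv comp[OF F G]]) (use x in blast)
    also have "\<dots> = sop (quot_by X R) m F (\<lambda>j. sop (quot_by X R) n (G j) \<xi>)"
    proof (rule red[OF F, symmetric], intro allI impI conjI)
      fix j show "sop X n (G j) x \<in> carrier X" by (rule closed[OF G]) (use x in blast)
      show "sop (quot_by X R) n (G j) \<xi> = R `` {sop X n (G j) x}" by (rule red[OF G x])
    qed
    finally show "sop (quot_by X R) n (\<lambda>v. F (\<lambda>j. G j v)) \<xi> =
      sop (quot_by X R) m F (\<lambda>j. sop (quot_by X R) n (G j) \<xi>)" .
  qed
qed

lemma quot_lift:
  assumes c: "\<And>x. x \<in> carrier X \<Longrightarrow> \<psi> x \<in> carrier B"
    and R: "\<And>x y. (x, y) \<in> R \<Longrightarrow> \<psi> x = \<psi> y"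
    and h: "\<And>n F x. csm n F \<Longrightarrow> (\<And>i. i < n \<Longrightarrow> x i \<in> carrier X) \<Longrightarrow> \<psi> (sop X n F x) = sop B n F (\<lambda>i. \<psi> (x i))"
  obtains \<kappa> where "\<kappa> \<in> cinf_hom (quot_by X R) B" "\<And>x. x \<in> carrier X \<Longrightarrow> \<kappa> (R `` {x}) = \<psi> x"
proof
  define \<kappa> where "\<kappa> = (\<lambda>\<xi>\<in>carrier (quot_by X R). \<psi> (SOME x. x \<in> \<xi>))"
  show \<kappa>: "\<kappa> (R `` {x}) = \<psi> x" if "x \<in> carrier X" for x
    using class_in[OF that] R[OF some_class[OF that]] by (simp add: \<kappa>_def)
  show "\<kappa> \<in> cinf_hom (quot_by X R) B"
  proof (rule cinf_homI)
    show "\<kappa> \<in> carrier (quot_by X R) \<rightarrow>\<^sub>E carrier B"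
    proof (rule PiE_I)
      fix \<xi> assume "\<xi> \<in> carrier (quot_by X R)"
      then obtain x where "x \<in> carrier X" "\<xi> = R `` {x}" by (rule class_obtain)
      then show "\<kappa> \<xi> \<in> carrier B" using \<kappa> c by simp
    qed (simp add: \<kappa>_def)
    fix n F \<xi> assume F: "csm n F" and \<xi>: "\<And>i. i < n \<Longrightarrow> \<xi> i \<in> carrier (quot_by X R)"
    have "\<forall>i. \<exists>x. i < n \<longrightarrow> x \<in> carrier X \<and> \<xi> i = R `` {x}"
      using \<xi> class_obtain by metis
    then obtain x where x: "\<And>i. i < n \<Longrightarrow> x i \<in> carrier X" "\<And>i. i < n \<Longrightarrow> \<xi> i = R `` {x i}" by metis
    have "sop (quot_by X R) n F \<xi> = sop (quot_by X R) n F (\<lambda>i. R `` {x i})"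
      by (rule sop_cong) (rule x(2))
    then have "\<kappa> (sop (quot_by X R) n F \<xi>) = \<psi> (sop X n F x)"
      by (simp add: quot_sop[OF F x(1)] \<kappa> closed[OF F x(1)])
    also have "\<dots> = sop B n F (\<lambda>i. \<psi> (x i))" by (rule h[OF F x(1)])
    also have "\<dots> = sop B n F (\<lambda>i. \<kappa> (\<xi> i))"
      by (rule sop_cong) (simp add: x \<kappa>)
    finally show "\<kappa> (sop (quot_by X R) n F \<xi>) = sop B n F (\<lambda>i. \<kappa> (\<xi> i))" .
  qed
qed

end

subsection \<open>Quotients by ideals\<close>

context cinf_ring
begin

lemma diff_zero_eq:
  assumes "x \<ominus>\<^bsub>ring_of A\<^esub> y = \<zero>\<^bsub>ring_of A\<^esub>" "x \<in> carrier A" "y \<in> carrier A"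
  shows "x = y"
  using R.minus_equality[of x "\<ominus>\<^bsub>ring_of A\<^esub> y"] assms by (simp add: R.minus_eq)

text \<open>Ring ideals are congruences for all smooth operations by Hadamard's lemma, applied to one
  coordinate after the other.\<close>

lemma sop_ideal:
  assumes I: "ideal I (ring_of A)" and F: "csm n F"
    and x: "\<And>i. i < n \<Longrightarrow> x i \<in> carrier A" and y: "\<And>i. i < n \<Longrightarrow> y i \<in> carrier A"
    and xy: "\<And>i. i < n \<Longrightarrow> x i \<ominus>\<^bsub>ring_of A\<^esub> y i \<in> I"
  shows "sop A n F x \<ominus>\<^bsub>ring_of A\<^esub> sop A n F y \<in> I"
proof -
  interpret I: ideal I "ring_of A" by fact
  define z where "z p = (\<lambda>i. if i < p then y i else x i)" for p
  have zc: "z p i \<in> carrier A" if "i < n" for p i using x y that by (simp add: z_def)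
  have sub: "I \<subseteq> carrier A" using I.a_subset by simp
  have step: "sop A n F (z p) \<ominus>\<^bsub>ring_of A\<^esub> sop A n F (z (Suc p)) \<in> I" if p: "p < n" for p
  proof -
    obtain g where g: "csm (Suc n) g" "\<And>v. F v - F (v(p := v n)) = (v p - v n) * g v"
      using Hadamard_coord[of F n p] F p unfolding csm_def by blast
    \<comment> \<open>The new value of the argument p is stored in the extra coordinate n, where
      \<open>Hadamard_coord\<close> expects it.\<close>
    define w where "w = (z p)(n := y p)"
    have wc: "w i \<in> carrier A" if "i < Suc n" for i
      using that zc[of i p] y[OF p] by (cases "i = n") (simp_all add: w_def)
    have F': "csm (Suc n) F" using csm_mono[OF F] by simp
    have up: "csm (Suc n) (\<lambda>v. (v(p := v n)) j)" if "j < n" for j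
      using that by (cases "j = p") (auto intro: csm_coord)
    have "csm (Suc n) (\<lambda>v. F (\<lambda>j. (v(p := v n)) j))"
      by (rule csm_comp[OF F]) (rule up)
    then have F2: "csm (Suc n) (\<lambda>v. F (v(p := v n)))" .
    have "sop A (Suc n) F w = sop A n F w" by (rule sop_extend[OF F]) (use wc in auto)
    also have "\<dots> = sop A n F (z p)" by (rule sop_cong) (simp add: w_def)
    finally have e1: "sop A (Suc n) F w = sop A n F (z p)" .
    have "sop A (Suc n) (\<lambda>v. F (\<lambda>j. (v(p := v n)) j)) w = sop A n F (\<lambda>j. sop A (Suc n) (\<lambda>v. (v(p := v n)) j) w)"
      by (rule sop_comp[OF F up wc])
    also have "\<dots> = sop A n F (z (Suc p))"
    proof (rule sop_cong)
      fix i assume i: "i < n"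
      show "sop A (Suc n) (\<lambda>v. (v(p := v n)) i) w = z (Suc p) i"
      proof (cases "i = p")
        case True
        then have "sop A (Suc n) (\<lambda>v. (v(p := v n)) i) w = w n" using sop_coord[of n "Suc n" w, OF _ wc] by simp
        then show ?thesis using True by (simp add: w_def z_def)
      next
        case False
        then have "sop A (Suc n) (\<lambda>v. (v(p := v n)) i) w = w i" using sop_coord[of i "Suc n" w, OF _ wc] i by simp
        then show ?thesis using False i by (simp add: w_def z_def less_Suc_eq)
      qed
    qed
    finally have e2: "sop A (Suc n) (\<lambda>v. F (v(p := v n))) w = sop A n F (z (Suc p))" .
    have "sop A n F (z p) \<ominus>\<^bsub>ring_of A\<^esub> sop A n F (z (Suc p)) = sop A (Suc n) (\<lambda>v. F v - F (v(p := v n))) w"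
    proof -
      have "sop A (Suc n) (\<lambda>v. F v - F (v(p := v n))) w =
        sop A (Suc n) F w \<ominus>\<^bsub>ring_of A\<^esub> sop A (Suc n) (\<lambda>v. F (v(p := v n))) w"
        by (rule sop_diff[OF F' F2 wc])
      then show ?thesis by (simp only: e1 e2)
    qed
    also have "\<dots> = sop A (Suc n) (\<lambda>v. (v p - v n) * g v) w" by (simp only: g(2))
    also have "\<dots> = (w p \<ominus>\<^bsub>ring_of A\<^esub> w n) \<otimes>\<^bsub>ring_of A\<^esub> sop A (Suc n) g w"
    proof -
      have pn: "p < Suc n" "n < Suc n" using p by auto
      show ?thesis
        by (simp only: sop_mult[OF csm_diff[OF csm_coord[OF pn(1)] csm_coord[OF pn(2)]] g(1) wc]
            sop_diff[OF csm_coord[OF pn(1)] csm_coord[OF pn(2)] wc] sop_coord[OF pn(1) wc] sop_coord[OF pn(2) wc])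
    qed
    also have "\<dots> = (x p \<ominus>\<^bsub>ring_of A\<^esub> y p) \<otimes>\<^bsub>ring_of A\<^esub> sop A (Suc n) g w"
      using p by (simp add: w_def z_def)
    finally show ?thesis using I.I_r_closed[OF xy[OF p]] sop_closed[OF g(1) wc] by simp
  qed
  have zs: "sop A n F (z p) \<in> carrier A" for p by (rule sop_closed[OF F zc])
  have "sop A n F (z 0) \<ominus>\<^bsub>ring_of A\<^esub> sop A n F (z p) \<in> I" if "p \<le> n" for p
    using that
  proof (induction p)
    case 0
    then show ?case using zs[of 0] by (simp add: R.minus_eq R.r_neg)
  next
    case (Suc p)
    have "(sop A n F (z 0) \<ominus>\<^bsub>ring_of A\<^esub> sop A n F (z p)) \<oplus>\<^bsub>ring_of A\<^esub>
      (sop A n F (z p) \<ominus>\<^bsub>ring_of A\<^esub> sop A n F (z (Suc p))) \<in> I"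
      using Suc step by (intro I.a_closed) auto
    moreover have "(a \<ominus>\<^bsub>ring_of A\<^esub> b) \<oplus>\<^bsub>ring_of A\<^esub> (b \<ominus>\<^bsub>ring_of A\<^esub> c) = a \<ominus>\<^bsub>ring_of A\<^esub> c"
      if "a \<in> carrier A" "b \<in> carrier A" "c \<in> carrier A" for a b c
      using that by (simp add: R.minus_eq R.a_assoc R.l_neg R.r_neg1)
    ultimately show ?case using zs by metis
  qed
  from this[of n] have "sop A n F (z 0) \<ominus>\<^bsub>ring_of A\<^esub> sop A n F (z n) \<in> I" by simp
  moreover have "sop A n F (z 0) = sop A n F x" by (rule sop_cong) (simp add: z_def)
  moreover have "sop A n F (z n) = sop A n F y" by (rule sop_cong) (simp add: z_def)
  ultimately show ?thesis by simp
qed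

lemma ideal_congruence:
  assumes I: "ideal I (ring_of A)"
  shows "cinf_congruence A (ideal_rel A I)"
proof
  interpret I: ideal I "ring_of A" by fact
  have sub: "x \<in> carrier A" if "x \<in> I" for x using I.a_subset that by auto
  show "equiv (carrier A) (ideal_rel A I)"
  proof (rule equivI)
    show "refl_on (carrier A) (ideal_rel A I)"
      by (auto simp: refl_on_def ideal_rel_def R.minus_eq R.r_neg)
    show "sym_on UNIV (ideal_rel A I)"
    proof (rule symI)
      fix x y assume "(x, y) \<in> ideal_rel A I"
      then have xy: "x \<in> carrier A" "y \<in> carrier A" "x \<ominus>\<^bsub>ring_of A\<^esub> y \<in> I" by (auto simp: ideal_rel_def)
      have "y \<ominus>\<^bsub>ring_of A\<^esub> x = \<ominus>\<^bsub>ring_of A\<^esub> (x \<ominus>\<^bsub>ring_of A\<^esub> y)"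
        using xy by (simp add: R.minus_eq R.minus_add R.a_comm)
      then show "(y, x) \<in> ideal_rel A I" using xy I.a_inv_closed by (simp add: ideal_rel_def)
    qed
    show "trans_on UNIV (ideal_rel A I)"
    proof (rule transI)
      fix a b c assume "(a, b) \<in> ideal_rel A I" "(b, c) \<in> ideal_rel A I"
      then have abc: "a \<in> carrier A" "b \<in> carrier A" "c \<in> carrier A"
        "a \<ominus>\<^bsub>ring_of A\<^esub> b \<in> I" "b \<ominus>\<^bsub>ring_of A\<^esub> c \<in> I" by (auto simp: ideal_rel_def)
      have "(a \<ominus>\<^bsub>ring_of A\<^esub> b) \<oplus>\<^bsub>ring_of A\<^esub> (b \<ominus>\<^bsub>ring_of A\<^esub> c) = a \<ominus>\<^bsub>ring_of A\<^esub> c"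
        using abc by (simp add: R.minus_eq R.a_assoc R.l_neg R.r_neg1)
      with I.a_closed[OF abc(4,5)] show "(a, c) \<in> ideal_rel A I" using abc(1,3) by (simp add: ideal_rel_def)
    qed
  qed (auto simp: ideal_rel_def)
  fix n F
  show "sop A n F x \<in> carrier A" if "csm n F" "\<And>i. i < n \<Longrightarrow> x i \<in> carrier A" for x
    by (rule sop_closed[OF that])
  show "(sop A n F x, sop A n F y) \<in> ideal_rel A I"
    if F: "csm n F" and xy: "\<And>i. i < n \<Longrightarrow> (x i, y i) \<in> ideal_rel A I" for x y
  proof -
    have "x i \<in> carrier A" "y i \<in> carrier A" "x i \<ominus>\<^bsub>ring_of A\<^esub> y i \<in> I" if "i < n" for i
      using xy[OF that] by (auto simp: ideal_rel_def)
    then show ?thesis using sop_ideal[OF I F, of x y] sop_closed[OF F] by (simp add: ideal_rel_def)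
  qed
qed

lemma quot_ideal_cinf_ring:
  assumes I: "ideal I (ring_of A)"
  shows "cinf_ring (quot_ideal A I)"
proof -
  interpret C: cinf_congruence A "ideal_rel A I" by (rule ideal_congruence[OF I])
  have refl: "(x, x) \<in> ideal_rel A I" if "x \<in> carrier A" for x
    using C.equiv that by (auto simp: equiv_def refl_on_def)
  show ?thesis unfolding quot_ideal_def
  proof (rule C.quot_cinf_ring)
    fix n i :: nat and x assume "i < n" "\<And>i. i < n \<Longrightarrow> x i \<in> carrier A"
    then show "(sop A n (\<lambda>v. v i) x, x i) \<in> ideal_rel A I" using sop_coord refl by simp
  next
    fix n m F and G :: "nat \<Rightarrow> (nat \<Rightarrow> real) \<Rightarrow> real" and x assume F: "csm m F" and G: "\<And>j. csm n (G j)" and x: "\<And>i. i < n \<Longrightarrow> x i \<in> carrier A"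
    show "(sop A n (\<lambda>v. F (\<lambda>j. G j v)) x, sop A m F (\<lambda>j. sop A n (G j) x)) \<in> ideal_rel A I"
    proof -
      have e: "sop A n (\<lambda>v. F (\<lambda>j. G j v)) x = sop A m F (\<lambda>j. sop A n (G j) x)"
        by (rule sop_comp[OF F G x])
      have "sop A n (\<lambda>v. F (\<lambda>j. G j v)) x \<in> carrier A"
        by (rule sop_closed[OF csm_comp[OF F G] x])
      then show ?thesis using refl e by metis
    qed
  qed
qed

lemma quot_map_hom:
  assumes I: "ideal I (ring_of A)"
  shows "quot_map A I \<in> cinf_hom A (quot_ideal A I)"
proof (rule cinf_homI)
  interpret C: cinf_congruence A "ideal_rel A I" by (rule ideal_congruence[OF I])
  show "quot_map A I \<in> carrier A \<rightarrow>\<^sub>E carrier (quot_ideal A I)"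
    using C.class_in by (auto simp: quot_map_def quot_ideal_def)
  fix n F x assume F: "csm n F" and x: "\<And>i. i < n \<Longrightarrow> x i \<in> carrier A"
  have "sop (quot_ideal A I) n F (\<lambda>i. quot_map A I (x i)) = sop (quot_ideal A I) n F (\<lambda>i. ideal_rel A I `` {x i})"
    by (rule sop_cong) (simp add: quot_map_def x)
  then show "quot_map A I (sop A n F x) = sop (quot_ideal A I) n F (\<lambda>i. quot_map A I (x i))"
    using C.quot_sop[OF F x] sop_closed[OF F x] by (simp add: quot_map_def quot_ideal_def)
qed

lemma quot_map_surj:
  assumes "ideal I (ring_of A)" "\<xi> \<in> carrier (quot_ideal A I)"
  obtains x where "x \<in> carrier A" "\<xi> = quot_map A I x"
proof -
  interpret C: cinf_congruence A "ideal_rel A I" by (rule ideal_congruence[OF assms(1)])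
  show ?thesis
    using assms(2) that unfolding quot_ideal_def quot_map_def by (auto elim: C.class_obtain)
qed

lemma quot_map_eq:
  assumes "ideal I (ring_of A)" "x \<in> carrier A" "y \<in> carrier A"
  shows "quot_map A I x = quot_map A I y \<longleftrightarrow> x \<ominus>\<^bsub>ring_of A\<^esub> y \<in> I"
proof -
  interpret C: cinf_congruence A "ideal_rel A I" by (rule ideal_congruence[OF assms(1)])
  show ?thesis using assms C.class_eq by (simp add: quot_map_def ideal_rel_def)
qed

lemma quot_map_zero_iff:
  assumes I: "ideal I (ring_of A)" and x: "x \<in> carrier A"
  shows "quot_map A I x = \<zero>\<^bsub>ring_of (quot_ideal A I)\<^esub> \<longleftrightarrow> x \<in> I"
proof -
  interpret Q: cinf_ring "quot_ideal A I" by (rule quot_ideal_cinf_ring[OF I])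
  interpret h: ring_hom_cring "ring_of A" "ring_of (quot_ideal A I)" "quot_map A I"
    by (rule cinf_hom_ring_hom[OF cinf_ring_axioms Q.cinf_ring_axioms quot_map_hom[OF I]])
  have "quot_map A I x = \<zero>\<^bsub>ring_of (quot_ideal A I)\<^esub> \<longleftrightarrow> quot_map A I x = quot_map A I \<zero>\<^bsub>ring_of A\<^esub>"
    by simp
  also have "\<dots> \<longleftrightarrow> x \<ominus>\<^bsub>ring_of A\<^esub> \<zero>\<^bsub>ring_of A\<^esub> \<in> I" by (rule quot_map_eq[OF I x R.zero_closed])
  finally show ?thesis using x by (simp add: R.minus_eq)
qed

lemma quot_ideal_lift:
  assumes I: "ideal I (ring_of A)" and B: "cinf_ring B" and \<phi>: "\<phi> \<in> cinf_hom A B"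
    and z: "\<And>x. x \<in> I \<Longrightarrow> \<phi> x = \<zero>\<^bsub>ring_of B\<^esub>"
  obtains \<kappa> where "\<kappa> \<in> cinf_hom (quot_ideal A I) B" "\<And>x. x \<in> carrier A \<Longrightarrow> \<kappa> (quot_map A I x) = \<phi> x"
proof -
  interpret C: cinf_congruence A "ideal_rel A I" by (rule ideal_congruence[OF I])
  interpret B: cinf_ring B by fact
  interpret h: ring_hom_cring "ring_of A" "ring_of B" \<phi>
    by (rule cinf_hom_ring_hom[OF cinf_ring_axioms B \<phi>])
  obtain \<kappa> where \<kappa>: "\<kappa> \<in> cinf_hom (quot_by A (ideal_rel A I)) B"
    "\<And>x. x \<in> carrier A \<Longrightarrow> \<kappa> (ideal_rel A I `` {x}) = \<phi> x"
  proof (rule C.quot_lift[of \<phi> B])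
    fix x y assume "(x, y) \<in> ideal_rel A I"
    then have xy: "x \<in> carrier A" "y \<in> carrier A" "x \<ominus>\<^bsub>ring_of A\<^esub> y \<in> I" by (auto simp: ideal_rel_def)
    then have "\<phi> x \<ominus>\<^bsub>ring_of B\<^esub> \<phi> y = \<zero>\<^bsub>ring_of B\<^esub>"
      using z[OF xy(3)] by (simp add: R.minus_eq B.R.minus_eq)
    then show "\<phi> x = \<phi> y" using xy cinf_hom_closed[OF \<phi>] B.diff_zero_eq by blast
  qed (use cinf_hom_closed[OF \<phi>] hom_sop[OF \<phi>] in auto)
  then show ?thesis using that[of \<kappa>] by (simp add: quot_ideal_def quot_map_def)
qed

end

subsection \<open>Rings of fractions\<close>

lemma carrier_term_alg [simp]: "carrier (frac_term_alg A S) = frac_terms A S"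
  by (simp add: frac_term_alg_def)

lemma sop_term_alg: "sop (frac_term_alg A S) n F t = App n (fn n F) (restrict t {..<n})"
  by (simp add: sop_def frac_term_alg_def)

lemma sop_term_alg_closed:
  assumes "csm n F" "\<And>i. i < n \<Longrightarrow> t i \<in> frac_terms A S"
  shows "sop (frac_term_alg A S) n F t \<in> frac_terms A S"
  unfolding sop_term_alg by (rule frac_terms.App[OF fn_smooth[OF assms(1)]]) (use assms(2) in auto)

text \<open>Formal inverses are sent to \<open>inv\<close>, which is total; that it is a true
  inverse is supplied in \<open>fractions_lift\<close> by the hypothesis on the images of
  \<open>S\<close>.\<close>

primrec frac_eval :: "'b cinf \<Rightarrow> ('a \<Rightarrow> 'b) \<Rightarrow> 'a frac_term \<Rightarrow> 'b" where
  "frac_eval B \<phi> (Elt a) = \<phi> a"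
| "frac_eval B \<phi> (Inv s) = inv\<^bsub>ring_of B\<^esub> (\<phi> s)"
| "frac_eval B \<phi> (App n f t) = smooth_op B n f (\<lambda>i\<in>{..<n}. frac_eval B \<phi> (t i))"

context cinf_ring
begin

context
  fixes S assumes S: "S \<subseteq> carrier A"
begin

lemma frac_rel_terms: "(s, t) \<in> frac_rel A S \<Longrightarrow> s \<in> frac_terms A S \<and> t \<in> frac_terms A S"
proof (induction rule: frac_rel.induct)
  case (cong f n s t)
  then show ?case by (auto intro: frac_terms.App)
next
  case (coord i n t)
  have "App n (coord n i) t \<in> frac_terms A S"
    by (rule frac_terms.App[OF coord_smooth[OF coord(1)] tuples_ext[OF coord(2)] tuples_mem[OF coord(2)]])
  then show ?case using tuples_mem[OF coord(2,1)] by simp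
next
  case (comp f m g n t)
  note t = tuples_ext[OF comp(3)] tuples_mem[OF comp(3)]
  have "App n (g i) t \<in> frac_terms A S" if "i < m" for i
    by (rule frac_terms.App[OF _ t]) (use comp(2) that in auto)
  then have "App m f (\<lambda>i\<in>{..<m}. App n (g i) t) \<in> frac_terms A S"
    by (intro frac_terms.App comp(1)) auto
  moreover have "App n (smooth_comp n m f g) t \<in> frac_terms A S"
    by (rule frac_terms.App[OF smooth_comp_smooth[OF comp(1,2)] t])
  ultimately show ?case by simp
next
  case (Elt_op f n x)
  have "App n f (\<lambda>i\<in>{..<n}. Elt (x i)) \<in> frac_terms A S"
    by (rule frac_terms.App[OF Elt_op(1)]) (use tuples_mem[OF Elt_op(2)] in \<open>auto intro: frac_terms.Elt\<close>)
  then show ?case using op_closed[OF Elt_op] by (auto intro: frac_terms.Elt)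
next
  case (inverse s)
  then have s: "Elt s \<in> frac_terms A S" "Inv s \<in> frac_terms A S"
    using S by (auto intro: frac_terms.intros)
  then show ?case
    unfolding ring_of_mult ring_of_one cst_def
    using sop_term_alg_closed[OF csm_times, of "\<lambda>i. if i = 0 then Elt s else Inv s" A S]
      sop_term_alg_closed[OF csm_const[of 0 1], of "\<lambda>_. undefined" A S] by simp
qed auto

lemma frac_congruence: "cinf_congruence (frac_term_alg A S) (frac_rel A S)"
proof
  show "equiv (carrier (frac_term_alg A S)) (frac_rel A S)"
  proof (rule equivI)
    show "refl_on (carrier (frac_term_alg A S)) (frac_rel A S)"
      by (auto simp: refl_on_def intro: frac_rel.refl)
    show "sym_on UNIV (frac_rel A S)" by (rule symI) (rule frac_rel.sym)
    show "trans_on UNIV (frac_rel A S)" by (rule transI) (rule frac_rel.trans)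
    show "frac_rel A S \<subseteq> carrier (frac_term_alg A S) \<times> carrier (frac_term_alg A S)"
      using frac_rel_terms by auto
  qed
  show "sop (frac_term_alg A S) n F t \<in> carrier (frac_term_alg A S)"
    if "csm n F" "\<And>i. i < n \<Longrightarrow> t i \<in> carrier (frac_term_alg A S)" for n F t
    using sop_term_alg_closed[of n F t A S] that by simp
  show "(sop (frac_term_alg A S) n F x, sop (frac_term_alg A S) n F y) \<in> frac_rel A S"
    if "csm n F" "\<And>i. i < n \<Longrightarrow> (x i, y i) \<in> frac_rel A S" for n F x y
    unfolding sop_term_alg by (rule frac_rel.cong[OF fn_smooth[OF that(1)]]) (use that(2) in auto)
qed

interpretation C: cinf_congruence "frac_term_alg A S" "frac_rel A S"
  by (rule frac_congruence)

lemma fractions_cinf_ring: "cinf_ring (fractions A S)"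
  unfolding fractions_def
proof (rule C.quot_cinf_ring)
  fix n i :: nat and x assume i: "i < n" and x: "\<And>i. i < n \<Longrightarrow> x i \<in> carrier (frac_term_alg A S)"
  have "restrict x {..<n} \<in> tuples n (frac_terms A S)" using x by auto
  from frac_rel.coord[OF i this] i show "(sop (frac_term_alg A S) n (\<lambda>v. v i) x, x i) \<in> frac_rel A S"
    by (simp add: sop_term_alg coord_fn)
next
  fix n m F and G :: "nat \<Rightarrow> (nat \<Rightarrow> real) \<Rightarrow> real" and x
  assume F: "csm m F" and G: "\<And>j. csm n (G j)" and x: "\<And>i. i < n \<Longrightarrow> x i \<in> carrier (frac_term_alg A S)"
  have "restrict x {..<n} \<in> tuples n (frac_terms A S)" using x by auto
  from frac_rel.comp[OF fn_smooth[OF F] _ this, of "\<lambda>j. fn n (G j)"] fn_smooth[OF G]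
  show "(sop (frac_term_alg A S) n (\<lambda>v. F (\<lambda>j. G j v)) x,
     sop (frac_term_alg A S) m F (\<lambda>j. sop (frac_term_alg A S) n (G j) x)) \<in> frac_rel A S"
    unfolding sop_term_alg smooth_comp_fn[OF F, of n G] by simp
qed

lemma fractions_map_hom: "fractions_map A S \<in> cinf_hom A (fractions A S)"
proof (rule cinf_homI)
  show "fractions_map A S \<in> carrier A \<rightarrow>\<^sub>E carrier (fractions A S)"
    using C.class_in by (auto simp: fractions_map_def fractions_def intro: frac_terms.Elt)
  fix n F x assume F: "csm n F" and x: "\<And>i. i < n \<Longrightarrow> x i \<in> carrier A"
  have "sop (fractions A S) n F (\<lambda>i. fractions_map A S (x i)) =
    sop (fractions A S) n F (\<lambda>i. frac_rel A S `` {Elt (x i)})"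
    by (rule sop_cong) (simp add: fractions_map_def x)
  also have "\<dots> = frac_rel A S `` {sop (frac_term_alg A S) n F (\<lambda>i. Elt (x i))}"
    unfolding fractions_def by (rule C.quot_sop[OF F]) (simp add: x frac_terms.Elt)
  also have "\<dots> = frac_rel A S `` {Elt (sop A n F x)}"
  proof (rule equiv_class_eq[OF C.equiv])
    have "restrict x {..<n} \<in> tuples n (carrier A)" using x by auto
    from frac_rel.Elt_op[OF fn_smooth[OF F] this, of S]
    have "(App n (fn n F) (\<lambda>i\<in>{..<n}. Elt (restrict x {..<n} i)), Elt (sop A n F x)) \<in> frac_rel A S"
      unfolding sop_def .
    moreover have "(\<lambda>i\<in>{..<n}. Elt (restrict x {..<n} i)) = (\<lambda>i\<in>{..<n}. Elt (x i))"
      by (rule restrict_ext) simp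
    ultimately show "(sop (frac_term_alg A S) n F (\<lambda>i. Elt (x i)), Elt (sop A n F x)) \<in> frac_rel A S"
      unfolding sop_term_alg by simp
  qed
  also have "\<dots> = fractions_map A S (sop A n F x)"
    using sop_closed[OF F x] by (simp add: fractions_map_def)
  finally show "fractions_map A S (sop A n F x) = sop (fractions A S) n F (\<lambda>i. fractions_map A S (x i))" ..
qed

lemma fractions_class_inverse:
  assumes s: "s \<in> S"
  shows "fractions_map A S s \<otimes>\<^bsub>ring_of (fractions A S)\<^esub> (frac_rel A S `` {Inv s}) = \<one>\<^bsub>ring_of (fractions A S)\<^esub>"
proof -
  let ?t = "\<lambda>i::nat. if i = 0 then Elt s else Inv s"
  have t: "?t i \<in> carrier (frac_term_alg A S)" for i
    using s S by (auto intro: frac_terms.intros)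
  have "fractions_map A S s \<otimes>\<^bsub>ring_of (fractions A S)\<^esub> (frac_rel A S `` {Inv s}) =
    sop (fractions A S) 2 (\<lambda>v. v 0 * v 1) (\<lambda>i. frac_rel A S `` {?t i})"
    unfolding ring_of_mult by (rule sop_cong) (use s S in \<open>auto simp: fractions_map_def\<close>)
  also have "\<dots> = frac_rel A S `` {sop (frac_term_alg A S) 2 (\<lambda>v. v 0 * v 1) ?t}"
    unfolding fractions_def by (rule C.quot_sop[OF csm_times t])
  also have "\<dots> = frac_rel A S `` {sop (frac_term_alg A S) 0 (\<lambda>_. 1) (\<lambda>_. undefined)}"
    using frac_rel.inverse[OF s, of A] unfolding ring_of_mult ring_of_one cst_def
    by (rule equiv_class_eq[OF C.equiv])
  also have "\<dots> = sop (fractions A S) 0 (\<lambda>_. 1) (\<lambda>i. frac_rel A S `` {undefined})"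
    unfolding fractions_def by (rule C.quot_sop[OF csm_const, symmetric]) simp
  also have "\<dots> = \<one>\<^bsub>ring_of (fractions A S)\<^esub>"
    unfolding ring_of_one cst_def by (rule sop_cong) simp
  finally show ?thesis .
qed

text \<open>Induction on a representing term. The inverse case is phrased through the equation that
  determines the inverse, so that no term or choice of representative appears in later uses.\<close>

lemma fractions_induct [consumes 1, case_names elt inverse op]:
  assumes \<xi>: "\<xi> \<in> carrier (fractions A S)"
    and elt: "\<And>a. a \<in> carrier A \<Longrightarrow> P (fractions_map A S a)"
    and inverse: "\<And>s \<eta>. s \<in> S \<Longrightarrow> \<eta> \<in> carrier (fractions A S) \<Longrightarrow>
      fractions_map A S s \<otimes>\<^bsub>ring_of (fractions A S)\<^esub> \<eta> = \<one>\<^bsub>ring_of (fractions A S)\<^esub> \<Longrightarrow> P \<eta>"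
    and op: "\<And>n F \<xi>. csm n F \<Longrightarrow> (\<And>i. i < n \<Longrightarrow> \<xi> i \<in> carrier (fractions A S)) \<Longrightarrow> (\<And>i. i < n \<Longrightarrow> P (\<xi> i)) \<Longrightarrow>
      P (sop (fractions A S) n F \<xi>)"
  shows "P \<xi>"
proof -
  have "P (frac_rel A S `` {t})" if "t \<in> frac_terms A S" for t
    using that
  proof induction
    case (Elt a)
    then show ?case using elt[of a] by (simp add: fractions_map_def)
  next
    case (Inv s)
    then show ?case
      using inverse[OF Inv _ fractions_class_inverse[OF Inv]] C.class_in[of "Inv s"]
      by (simp add: fractions_def frac_terms.Inv)
  next
    case (App f n t)
    obtain F where F: "csm n F" "f = fn n F" using App(1) by (rule smooth_fns_obtain)
    have "P (sop (fractions A S) n F (\<lambda>i. frac_rel A S `` {t i}))"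
      by (rule op[OF F(1)]) (use App C.class_in in \<open>auto simp: fractions_def\<close>)
    also have "sop (fractions A S) n F (\<lambda>i. frac_rel A S `` {t i}) =
      frac_rel A S `` {sop (frac_term_alg A S) n F t}"
      unfolding fractions_def by (rule C.quot_sop[OF F(1)]) (simp add: App)
    also have "sop (frac_term_alg A S) n F t = App n f t"
      unfolding sop_term_alg F(2) using App(2) by (simp add: extensional_restrict)
    finally show ?case .
  qed
  moreover obtain t where "t \<in> carrier (frac_term_alg A S)" "\<xi> = frac_rel A S `` {t}"
    using \<xi> unfolding fractions_def by (rule C.class_obtain)
  ultimately show ?thesis by simp
qed

lemma fractions_unit:
  assumes "s \<in> S"
  shows "fractions_map A S s \<in> Units (ring_of (fractions A S))"
proof -
  interpret F: cinf_ring "fractions A S" by (rule fractions_cinf_ring)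
  have "frac_rel A S `` {Inv s} \<in> carrier (fractions A S)"
    unfolding fractions_def using assms by (intro C.class_in) (simp add: frac_terms.Inv)
  moreover have "fractions_map A S s \<in> carrier (fractions A S)"
    by (rule cinf_hom_closed[OF fractions_map_hom]) (use assms S in blast)
  ultimately show ?thesis
    using fractions_class_inverse[OF assms] F.R.m_comm unfolding Units_def by force
qed

text \<open>Terms are evaluated in \<open>B\<close>, and induction over \<open>frac_rel\<close>
  checks every generating relation; only the relation for inverses uses that \<open>\<phi>\<close>
  makes \<open>S\<close> invertible.\<close>

lemma fractions_lift:
  assumes B: "cinf_ring B" and \<phi>: "\<phi> \<in> cinf_hom A B"
    and u: "\<And>s. s \<in> S \<Longrightarrow> \<phi> s \<in> Units (ring_of B)"
  obtains \<kappa> where "\<kappa> \<in> cinf_hom (fractions A S) B" "\<And>x. x \<in> carrier A \<Longrightarrow> \<kappa> (fractions_map A S x) = \<phi> x"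
proof -
  interpret B: cinf_ring B by fact
  let ?e = "frac_eval B \<phi>" and ?T = "frac_term_alg A S"
  have e_App: "?e (App n f t) = smooth_op B n f (\<lambda>i\<in>{..<n}. ?e (t i))" for n f t by simp
  have e_sop: "?e (sop ?T n F t) = sop B n F (\<lambda>i. ?e (t i))" for n F t
  proof -
    have "(\<lambda>i\<in>{..<n}. ?e (restrict t {..<n} i)) = (\<lambda>i\<in>{..<n}. ?e (t i))"
      by (rule restrict_ext) simp
    then have "?e (sop ?T n F t) = smooth_op B n (fn n F) (\<lambda>i\<in>{..<n}. ?e (t i))"
      by (simp only: sop_term_alg e_App)
    then show ?thesis by (simp only: sop_def[of B])
  qed
  have closed: "?e t \<in> carrier B" if "t \<in> frac_terms A S" for t
    using that
  proof induction
    case (Elt a) then show ?case using cinf_hom_closed[OF \<phi>] by simp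
  next
    case (Inv s) then show ?case using B.R.Units_inv_closed[OF u[OF Inv]] by simp
  next
    case (App f n t)
    show ?case unfolding e_App by (rule B.op_closed[OF App(1)]) (use App in auto)
  qed
  have rel: "?e s = ?e t" if "(s, t) \<in> frac_rel A S" for s t
    using that
  proof (induction rule: frac_rel.induct)
    case (cong f n s t)
    then have "(\<lambda>i\<in>{..<n}. ?e (s i)) = (\<lambda>i\<in>{..<n}. ?e (t i))" by (intro restrict_ext) auto
    then show ?case unfolding e_App by simp
  next
    case (coord i n t)
    have "(\<lambda>i\<in>{..<n}. ?e (t i)) \<in> tuples n (carrier B)" using closed tuples_mem[OF coord(2)] by auto
    from B.op_coord[OF coord(1) this] coord(1) show ?case unfolding e_App by simp
  next
    case (comp f m g n t)
    have x: "(\<lambda>i\<in>{..<n}. ?e (t i)) \<in> tuples n (carrier B)" using closed tuples_mem[OF comp(3)] by auto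
    have "(\<lambda>i\<in>{..<m}. ?e ((\<lambda>i\<in>{..<m}. App n (g i) t) i)) =
      (\<lambda>i\<in>{..<m}. smooth_op B n (g i) (\<lambda>i\<in>{..<n}. ?e (t i)))"
      by (rule restrict_ext) simp
    then show ?case unfolding e_App B.op_comp[OF comp(1,2) x] by simp
  next
    case (Elt_op f n x)
    have "(\<lambda>i\<in>{..<n}. ?e ((\<lambda>i\<in>{..<n}. Elt (x i)) i)) = (\<lambda>i\<in>{..<n}. \<phi> (x i))"
      by (rule restrict_ext) simp
    moreover have "\<phi> (smooth_op A n f x) = smooth_op B n f (\<lambda>i\<in>{..<n}. \<phi> (x i))"
      using \<phi> Elt_op unfolding cinf_hom_def by blast
    ultimately show ?case unfolding e_App by simp
  next
    case (inverse s)
    have "?e (Elt s \<otimes>\<^bsub>ring_of ?T\<^esub> Inv s) = \<phi> s \<otimes>\<^bsub>ring_of B\<^esub> inv\<^bsub>ring_of B\<^esub> \<phi> s"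
      unfolding ring_of_mult e_sop by (rule sop_cong) simp
    also have "\<dots> = \<one>\<^bsub>ring_of B\<^esub>" by (rule B.R.Units_r_inv[OF u[OF inverse]])
    also have "\<dots> = ?e \<one>\<^bsub>ring_of ?T\<^esub>"
      unfolding ring_of_one cst_def e_sop by (rule sop_cong) simp
    finally show ?case .
  qed auto
  obtain \<kappa> where \<kappa>: "\<kappa> \<in> cinf_hom (quot_by ?T (frac_rel A S)) B"
    "\<And>t. t \<in> carrier ?T \<Longrightarrow> \<kappa> (frac_rel A S `` {t}) = ?e t"
  proof (rule C.quot_lift[of ?e B])
    show "?e t \<in> carrier B" if "t \<in> carrier ?T" for t using closed that by simp
  qed (use rel e_sop in auto)
  show ?thesis
  proof (rule that[of \<kappa>])
    show "\<kappa> \<in> cinf_hom (fractions A S) B" using \<kappa>(1) by (simp add: fractions_def)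
    show "\<kappa> (fractions_map A S x) = \<phi> x" if "x \<in> carrier A" for x
      using \<kappa>(2)[of "Elt x"] that by (simp add: fractions_map_def frac_terms.Elt)
  qed
qed

text \<open>Inverses in a commutative ring are unique, so agreement on the images of
  \<open>S\<close> forces agreement on their formal inverses, and operations carry it to all
  terms.\<close>

lemma fractions_hom_eqI:
  assumes B: "cinf_ring B" and \<phi>: "\<phi> \<in> cinf_hom (fractions A S) B" and \<psi>: "\<psi> \<in> cinf_hom (fractions A S) B"
    and eq: "\<And>x. x \<in> carrier A \<Longrightarrow> \<phi> (fractions_map A S x) = \<psi> (fractions_map A S x)"
  shows "\<phi> = \<psi>"
proof (rule cinf_hom_eqI[OF \<phi> \<psi>])
  interpret B: cinf_ring B by fact
  interpret F: cinf_ring "fractions A S" by (rule fractions_cinf_ring)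
  interpret h: ring_hom_cring "ring_of (fractions A S)" "ring_of B" \<phi>
    by (rule cinf_hom_ring_hom[OF F.cinf_ring_axioms B \<phi>])
  interpret k: ring_hom_cring "ring_of (fractions A S)" "ring_of B" \<psi>
    by (rule cinf_hom_ring_hom[OF F.cinf_ring_axioms B \<psi>])
  fix \<xi> assume "\<xi> \<in> carrier (fractions A S)"
  then show "\<phi> \<xi> = \<psi> \<xi>"
  proof (induction rule: fractions_induct)
    case (inverse s \<eta>)
    have fs: "fractions_map A S s \<in> carrier (fractions A S)"
      by (rule cinf_hom_closed[OF fractions_map_hom]) (use inverse S in blast)
    have c: "\<phi> (fractions_map A S s) \<in> carrier B" "\<phi> \<eta> \<in> carrier B" "\<psi> \<eta> \<in> carrier B"
      using cinf_hom_closed[OF \<phi>] cinf_hom_closed[OF \<psi>] fs inverse by auto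
    have 1: "\<phi> (fractions_map A S s) \<otimes>\<^bsub>ring_of B\<^esub> \<phi> \<eta> = \<one>\<^bsub>ring_of B\<^esub>"
      using h.hom_mult[of "fractions_map A S s" \<eta>] h.hom_one fs inverse by simp
    have 2: "\<phi> (fractions_map A S s) \<otimes>\<^bsub>ring_of B\<^esub> \<psi> \<eta> = \<one>\<^bsub>ring_of B\<^esub>"
      using k.hom_mult[of "fractions_map A S s" \<eta>] k.hom_one fs inverse eq[of s] S by auto
    show ?case using B.R.inv_unique[of "\<phi> \<eta>" "\<phi> (fractions_map A S s)" "\<psi> \<eta>"] 1 2 c
      by (simp add: B.R.m_comm)
  next
    case (op n F \<xi>)
    then show ?case by (simp add: hom_sop[OF \<phi>] hom_sop[OF \<psi>] cong: sop_cong)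
  qed (rule eq)
qed

end

end

section \<open>The smooth radical and the smooth spectrum\<close>

text \<open>Zorn's lemma among the ideals that contain I and avoid 1.\<close>

lemma (in cring) exists_maximalideal:
  assumes I: "ideal I R" "\<one> \<notin> I"
  obtains M where "maximalideal M R" "I \<subseteq> M"
proof -
  let ?X = "{J. ideal J R \<and> I \<subseteq> J \<and> \<one> \<notin> J}"
  have "\<exists>M\<in>?X. \<forall>J\<in>?X. M \<subseteq> J \<longrightarrow> J = M"
  proof (rule subset_Zorn_nonempty)
    fix C assume C: "C \<noteq> {}" "subset.chain ?X C"
    then have "subset.chain {J. ideal J R} C" by (auto simp: subset_chain_def)
    from chain_Union_is_ideal[OF this] C show "\<Union>C \<in> ?X"
      by (auto simp: subset_chain_def)
  qed (use I in auto)
  then obtain M where X: "M \<in> ?X" "\<forall>J\<in>?X. M \<subseteq> J \<longrightarrow> J = M" by (rule bexE)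
  then have M: "ideal M R" "I \<subseteq> M" "\<one> \<notin> M" by auto
  have max: "J = M" if "ideal J R" "I \<subseteq> J" "\<one> \<notin> J" "M \<subseteq> J" for J
    using X(2) that by simp
  have "maximalideal M R"
  proof (rule maximalidealI[OF M(1)])
    show "carrier R \<noteq> M" using M(3) by auto
    show "J = M \<or> J = carrier R" if "ideal J R" "M \<subseteq> J" "J \<subseteq> carrier R" for J
      using max[OF that(1) _ _ that(2)] M(2) that ideal.one_imp_carrier[OF that(1)] by blast
  qed
  then show ?thesis using that M(2) by blast
qed

text \<open>The sum of M and the principal ideal of x exceeds M, hence is the whole ring and
  contains 1.\<close>

lemma (in cring) maximalideal_inverse:
  assumes M: "maximalideal M R" and x: "x \<in> carrier R" "x \<notin> M"
  obtains y where "y \<in> carrier R" "x \<otimes> y \<ominus> \<one> \<in> M"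
proof -
  interpret M: maximalideal M R by fact
  let ?J = "M <+>\<^bsub>R\<^esub> PIdl x"
  have J: "ideal ?J R" by (rule add_ideals[OF M.is_ideal cgenideal_ideal[OF x(1)]])
  have zP: "\<zero> \<in> PIdl x" using cgenideal_ideal[OF x(1)] by (simp add: additive_subgroup.zero_closed ideal.axioms(1))
  have "m \<in> ?J" if "m \<in> M" for m
    unfolding set_add_def' using that zP M.a_Hcarr[OF that] by (intro UN_I[of m] UN_I[of \<zero>]) auto
  then have sub: "M \<subseteq> ?J" by blast
  have "x \<in> ?J"
    unfolding set_add_def' using M.zero_closed cgenideal_self[OF x(1)] x(1) by (intro UN_I[of \<zero>] UN_I[of x]) auto
  then have "?J = carrier R"
    using M.I_maximal[OF J sub] x(2) ideal.Icarr[OF J] by blast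
  then have "\<one> \<in> ?J" by simp
  then obtain m y where my: "m \<in> M" "y \<in> carrier R" "\<one> = m \<oplus> y \<otimes> x"
    unfolding set_add_def' cgenideal_def by auto
  have mc: "m \<in> carrier R" using my M.Icarr by blast
  have "x \<otimes> y \<ominus> \<one> = \<ominus> m"
    unfolding my(3) using my(2) mc x(1) m_comm[of y x]
    by (simp add: minus_eq minus_add a_lcomm[of "x \<otimes> y" "\<ominus> m"] r_neg)
  then show ?thesis using that[OF my(2)] M.a_inv_closed[OF my(1)] by simp
qed

lemma (in cinf_ring) unitI:
  assumes "x \<in> carrier A" "y \<in> carrier A" "x \<otimes>\<^bsub>ring_of A\<^esub> y = \<one>\<^bsub>ring_of A\<^esub>"
  shows "x \<in> Units (ring_of A)"
  unfolding Units_def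
  by (rule CollectI, intro conjI bexI[of _ y]) (use assms R.m_comm[of x y] in simp_all)

lemma (in cinf_ring) zero_unit:
  assumes "\<zero>\<^bsub>ring_of A\<^esub> \<in> Units (ring_of A)"
  shows "\<one>\<^bsub>ring_of A\<^esub> = \<zero>\<^bsub>ring_of A\<^esub>"
  using R.Units_r_inv[OF assms] R.l_null[OF R.Units_inv_closed[OF assms]] by argo

definition cinf_field :: "'a cinf \<Rightarrow> bool" where
  "cinf_field K \<longleftrightarrow> cinf_ring K \<and> \<one>\<^bsub>ring_of K\<^esub> \<noteq> \<zero>\<^bsub>ring_of K\<^esub> \<and>
     (\<forall>x\<in>carrier K. x \<noteq> \<zero>\<^bsub>ring_of K\<^esub> \<longrightarrow> x \<in> Units (ring_of K))"

lemma cinf_hom_unit: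
  assumes "cinf_ring A" "cinf_ring B" "\<phi> \<in> cinf_hom A B" "x \<in> Units (ring_of A)"
  shows "\<phi> x \<in> Units (ring_of B)"
proof -
  interpret A: cinf_ring A by fact
  interpret B: cinf_ring B by fact
  interpret h: ring_hom_cring "ring_of A" "ring_of B" \<phi>
    by (rule cinf_hom_ring_hom[OF assms(1-3)])
  have x: "x \<in> carrier A" "inv\<^bsub>ring_of A\<^esub> x \<in> carrier A" using assms(4) A.R.Units_closed A.R.Units_inv_closed by auto
  have "\<phi> x \<otimes>\<^bsub>ring_of B\<^esub> \<phi> (inv\<^bsub>ring_of A\<^esub> x) = \<one>\<^bsub>ring_of B\<^esub>"
    using h.hom_mult[of x "inv\<^bsub>ring_of A\<^esub> x"] x A.R.Units_r_inv[OF assms(4)] by simp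
  then show ?thesis using cinf_hom_closed[OF assms(3)] x by (intro B.unitI)
qed

lemma cinf_hom_zero:
  assumes "cinf_ring A" "cinf_ring B" "\<phi> \<in> cinf_hom A B"
  shows "\<phi> \<zero>\<^bsub>ring_of A\<^esub> = \<zero>\<^bsub>ring_of B\<^esub>" "\<phi> \<one>\<^bsub>ring_of A\<^esub> = \<one>\<^bsub>ring_of B\<^esub>"
proof -
  interpret ring_hom_cring "ring_of A" "ring_of B" \<phi>
    by (rule cinf_hom_ring_hom[OF assms])
  show "\<phi> \<zero>\<^bsub>ring_of A\<^esub> = \<zero>\<^bsub>ring_of B\<^esub>" "\<phi> \<one>\<^bsub>ring_of A\<^esub> = \<one>\<^bsub>ring_of B\<^esub>" by simp_all
qed

lemma cinf_hom_arith:
  assumes "cinf_ring A" "cinf_ring B" "\<phi> \<in> cinf_hom A B" "x \<in> carrier A" "y \<in> carrier A"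
  shows "\<phi> (x \<otimes>\<^bsub>ring_of A\<^esub> y) = \<phi> x \<otimes>\<^bsub>ring_of B\<^esub> \<phi> y" "\<phi> (x \<oplus>\<^bsub>ring_of A\<^esub> y) = \<phi> x \<oplus>\<^bsub>ring_of B\<^esub> \<phi> y"
    "\<phi> (x \<ominus>\<^bsub>ring_of A\<^esub> y) = \<phi> x \<ominus>\<^bsub>ring_of B\<^esub> \<phi> y"
proof -
  interpret A: cinf_ring A by fact
  interpret B: cinf_ring B by fact
  interpret ring_hom_cring "ring_of A" "ring_of B" \<phi>
    by (rule cinf_hom_ring_hom[OF assms(1-3)])
  show "\<phi> (x \<otimes>\<^bsub>ring_of A\<^esub> y) = \<phi> x \<otimes>\<^bsub>ring_of B\<^esub> \<phi> y" "\<phi> (x \<oplus>\<^bsub>ring_of A\<^esub> y) = \<phi> x \<oplus>\<^bsub>ring_of B\<^esub> \<phi> y"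
    "\<phi> (x \<ominus>\<^bsub>ring_of A\<^esub> y) = \<phi> x \<ominus>\<^bsub>ring_of B\<^esub> \<phi> y"
    using assms by (simp_all add: A.R.minus_eq B.R.minus_eq)
qed

text \<open>Hadamard's lemma makes the quotient by a mere ring ideal a smooth ring; maximality then
  provides inverses modulo M.\<close>

lemma quot_maximal_field:
  assumes "cinf_ring B" and M: "maximalideal M (ring_of B)"
  shows "cinf_field (quot_ideal B M)"
proof -
  interpret B: cinf_ring B by fact
  interpret M: maximalideal M "ring_of B" by fact
  note I = M.is_ideal
  interpret Q: cinf_ring "quot_ideal B M" by (rule B.quot_ideal_cinf_ring[OF I])
  note h = B.quot_map_hom[OF I]
  note z = cinf_hom_zero[OF B.cinf_ring_axioms Q.cinf_ring_axioms h]
  note a = cinf_hom_arith[OF B.cinf_ring_axioms Q.cinf_ring_axioms h]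
  have "\<one>\<^bsub>ring_of B\<^esub> \<notin> M" using M.I_notcarr M.one_imp_carrier by auto
  then have 1: "\<one>\<^bsub>ring_of (quot_ideal B M)\<^esub> \<noteq> \<zero>\<^bsub>ring_of (quot_ideal B M)\<^esub>"
    using B.quot_map_zero_iff[OF I B.R.one_closed] z by simp
  have "\<xi> \<in> Units (ring_of (quot_ideal B M))"
    if \<xi>: "\<xi> \<in> carrier (quot_ideal B M)" "\<xi> \<noteq> \<zero>\<^bsub>ring_of (quot_ideal B M)\<^esub>" for \<xi>
  proof -
    obtain x where x: "x \<in> carrier B" "\<xi> = quot_map B M x" using \<xi>(1) by (rule B.quot_map_surj[OF I])
    then have "x \<notin> M" using \<xi>(2) B.quot_map_zero_iff[OF I x(1)] by simp
    then obtain y where y: "y \<in> carrier B" "x \<otimes>\<^bsub>ring_of B\<^esub> y \<ominus>\<^bsub>ring_of B\<^esub> \<one>\<^bsub>ring_of B\<^esub> \<in> M"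
      using B.R.maximalideal_inverse[OF M] x(1) by auto
    then have "quot_map B M (x \<otimes>\<^bsub>ring_of B\<^esub> y) = quot_map B M \<one>\<^bsub>ring_of B\<^esub>"
      using B.quot_map_eq[OF I, of "x \<otimes>\<^bsub>ring_of B\<^esub> y" "\<one>\<^bsub>ring_of B\<^esub>"] x by simp
    then have "\<xi> \<otimes>\<^bsub>ring_of (quot_ideal B M)\<^esub> quot_map B M y = \<one>\<^bsub>ring_of (quot_ideal B M)\<^esub>"
      using a(1)[OF x(1) y(1)] z x(2) by simp
    then show ?thesis
      using \<xi>(1) cinf_hom_closed[OF h y(1)] by (intro Q.unitI)
  qed
  then show ?thesis using 1 Q.cinf_ring_axioms by (simp add: cinf_field_def)
qed

lemma cinf_iso_zero_iff:
  assumes "cinf_ring A"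
  shows "cinf_iso A cinf_zero \<longleftrightarrow> \<one>\<^bsub>ring_of A\<^esub> = \<zero>\<^bsub>ring_of A\<^esub>"
proof -
  interpret cinf_ring A by fact
  have all: "x = \<zero>\<^bsub>ring_of A\<^esub>" if "\<one>\<^bsub>ring_of A\<^esub> = \<zero>\<^bsub>ring_of A\<^esub>" "x \<in> carrier A" for x
    using that R.l_one[of x] R.l_null[of x] by simp
  show ?thesis
  proof
    assume "cinf_iso A cinf_zero"
    then obtain \<phi> :: "'a \<Rightarrow> unit" where "inj_on \<phi> (carrier A)"
      unfolding cinf_iso_def bij_betw_def by blast
    from inj_onD[OF this, of "\<one>\<^bsub>ring_of A\<^esub>" "\<zero>\<^bsub>ring_of A\<^esub>"] show "\<one>\<^bsub>ring_of A\<^esub> = \<zero>\<^bsub>ring_of A\<^esub>" by simp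
  next
    assume 1: "\<one>\<^bsub>ring_of A\<^esub> = \<zero>\<^bsub>ring_of A\<^esub>"
    have "(\<lambda>x\<in>carrier A. ()) \<in> cinf_hom A cinf_zero"
      using op_closed by (auto simp: cinf_hom_def cinf_zero_def)
    moreover have "bij_betw (\<lambda>x\<in>carrier A. ()) (carrier A) (carrier cinf_zero)"
      using all[OF 1] R.zero_closed by (auto simp: bij_betw_def inj_on_def cinf_zero_def)
    ultimately show "cinf_iso A cinf_zero" unfolding cinf_iso_def by blast
  qed
qed

section \<open>Radicals and smooth primes detected by homomorphisms into fields\<close>

context cinf_ring
begin

context
  fixes I assumes I: "ideal I (ring_of A)"
begin

abbreviation (input) "radQ \<equiv> quot_ideal A I"
abbreviation (input) "radF a \<equiv> fractions (quot_ideal A I) {quot_map A I a}"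

lemma radical_iff:
  assumes "a \<in> carrier A"
  shows "a \<in> cinf_radical A I \<longleftrightarrow> \<one>\<^bsub>ring_of (radF a)\<^esub> = \<zero>\<^bsub>ring_of (radF a)\<^esub>"
proof -
  interpret Q: cinf_ring radQ by (rule quot_ideal_cinf_ring[OF I])
  have "cinf_ring (radF a)"
    by (rule Q.fractions_cinf_ring) (use cinf_hom_closed[OF quot_map_hom[OF I] assms] in simp)
  then show ?thesis using assms by (simp add: cinf_radical_def cinf_iso_zero_iff)
qed

text \<open>If \<open>\<phi> a\<close> were invertible, \<open>\<phi>\<close> would factor through
  the ring of fractions that defines the radical. That ring is zero, so 1 = 0 would follow in
  K.\<close>

lemma radical_not_unit:
  assumes K: "cinf_ring K" "\<one>\<^bsub>ring_of K\<^esub> \<noteq> \<zero>\<^bsub>ring_of K\<^esub>" and \<phi>: "\<phi> \<in> cinf_hom A K"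
    and z: "\<And>x. x \<in> I \<Longrightarrow> \<phi> x = \<zero>\<^bsub>ring_of K\<^esub>" and a: "a \<in> cinf_radical A I"
  shows "\<phi> a \<notin> Units (ring_of K)"
proof
  assume u: "\<phi> a \<in> Units (ring_of K)"
  have ac: "a \<in> carrier A" using a by (simp add: cinf_radical_def)
  interpret Q: cinf_ring radQ by (rule quot_ideal_cinf_ring[OF I])
  have S: "{quot_map A I a} \<subseteq> carrier radQ" using cinf_hom_closed[OF quot_map_hom[OF I] ac] by simp
  obtain \<psi> where \<psi>: "\<psi> \<in> cinf_hom radQ K" "\<And>x. x \<in> carrier A \<Longrightarrow> \<psi> (quot_map A I x) = \<phi> x"
    by (rule quot_ideal_lift[OF I K(1) \<phi>], erule z) (rule that)
  have su: "\<psi> s \<in> Units (ring_of K)" if "s \<in> {quot_map A I a}" for s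
    using that \<psi>(2)[OF ac] u by simp
  obtain \<kappa> where \<kappa>: "\<kappa> \<in> cinf_hom (radF a) K"
    by (rule Q.fractions_lift[OF S K(1) \<psi>(1)], erule su) (rule that)
  note h = cinf_hom_zero[OF Q.fractions_cinf_ring[OF S] K(1) \<kappa>]
  show False using a K(2) h unfolding radical_iff[OF ac] by simp
qed

text \<open>The ring of fractions is nonzero, so it has a maximal ideal; its residue field receives
  \<open>A\<close>, kills I and inverts a.\<close>

lemma not_radical_field:
  assumes a: "a \<in> carrier A" "a \<notin> cinf_radical A I"
  obtains K :: "'a set frac_term set set cinf" and \<phi> where
    "cinf_field K" "\<phi> \<in> cinf_hom A K" "\<And>x. x \<in> I \<Longrightarrow> \<phi> x = \<zero>\<^bsub>ring_of K\<^esub>" "\<phi> a \<in> Units (ring_of K)"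
proof -
  interpret Q: cinf_ring radQ by (rule quot_ideal_cinf_ring[OF I])
  note q = quot_map_hom[OF I]
  have S: "{quot_map A I a} \<subseteq> carrier radQ" using cinf_hom_closed[OF q a(1)] by simp
  interpret F: cinf_ring "radF a" by (rule Q.fractions_cinf_ring[OF S])
  have "\<one>\<^bsub>ring_of (radF a)\<^esub> \<notin> {\<zero>\<^bsub>ring_of (radF a)\<^esub>}" using a radical_iff by simp
  obtain M where M: "maximalideal M (ring_of (radF a))"
    by (rule F.R.exists_maximalideal[OF F.R.zeroideal \<open>\<one>\<^bsub>ring_of (radF a)\<^esub> \<notin> {\<zero>\<^bsub>ring_of (radF a)\<^esub>}\<close>])
  let ?K = "quot_ideal (radF a) M"
  have K: "cinf_field ?K" by (rule quot_maximal_field[OF F.cinf_ring_axioms M])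
  then have Kr: "cinf_ring ?K" by (simp add: cinf_field_def)
  note m = F.quot_map_hom[OF maximalideal.axioms(1)[OF M]]
  note f = Q.fractions_map_hom[OF S]
  define \<phi> where "\<phi> = compose (carrier A) (quot_map (radF a) M) (compose (carrier A)
    (fractions_map radQ {quot_map A I a}) (quot_map A I))"
  have \<phi>: "\<phi> \<in> cinf_hom A ?K"
    unfolding \<phi>_def by (intro cinf_hom_compose[OF _ m] cinf_hom_compose[OF q f] cinf_ring_axioms)
  have ev: "\<phi> x = quot_map (radF a) M (fractions_map radQ {quot_map A I a} (quot_map A I x))"
    if "x \<in> carrier A" for x using that by (simp add: \<phi>_def compose_def)
  have z: "\<phi> x = \<zero>\<^bsub>ring_of ?K\<^esub>" if "x \<in> I" for x
  proof -
    have x: "x \<in> carrier A" using ideal.Icarr[OF I that] by simp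
    then show ?thesis using that quot_map_zero_iff[OF I x]
      by (simp add: ev cinf_hom_zero[OF Q.cinf_ring_axioms F.cinf_ring_axioms f] cinf_hom_zero[OF F.cinf_ring_axioms Kr m])
  qed
  have u: "\<phi> a \<in> Units (ring_of ?K)"
    unfolding ev[OF a(1)]
    by (rule cinf_hom_unit[OF F.cinf_ring_axioms Kr m]) (rule Q.fractions_unit[OF S], simp)
  show ?thesis by (rule that[OF K \<phi> z u])
qed

text \<open>An element of I outside the radical would be both zero and invertible in some
  field.\<close>

lemma ideal_subset_radical: "I \<subseteq> cinf_radical A I"
proof
  fix a assume a: "a \<in> I"
  then have ac: "a \<in> carrier A" using ideal.Icarr[OF I a] by simp
  show "a \<in> cinf_radical A I"
  proof (rule ccontr)
    assume "a \<notin> cinf_radical A I"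
    obtain K :: "'a set frac_term set set cinf" and \<phi> where K: "cinf_field K" "\<phi> a \<in> Units (ring_of K)"
      "\<And>x. x \<in> I \<Longrightarrow> \<phi> x = \<zero>\<^bsub>ring_of K\<^esub>"
      by (rule not_radical_field[OF ac \<open>a \<notin> cinf_radical A I\<close>]) (rule that)
    then interpret K: cinf_ring K by (simp add: cinf_field_def)
    show False using K(1,2) K(3)[OF a] K.zero_unit by (simp add: cinf_field_def)
  qed
qed

end

text \<open>Primality holds because fields have no zero divisors. The kernel is radical because an
  element outside it has an invertible image, which \<open>radical_not_unit\<close> forbids for
  elements of the radical.\<close>

lemma kernel_spec:
  assumes K: "cinf_field K" and \<phi>: "\<phi> \<in> cinf_hom A K"
  shows "{x \<in> carrier A. \<phi> x = \<zero>\<^bsub>ring_of K\<^esub>} \<in> cinf_Spec A"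
proof -
  let ?p = "{x \<in> carrier A. \<phi> x = \<zero>\<^bsub>ring_of K\<^esub>}"
  interpret K: cinf_ring K using K by (simp add: cinf_field_def)
  note a = cinf_hom_arith[OF cinf_ring_axioms K.cinf_ring_axioms \<phi>]
  note z = cinf_hom_zero[OF cinf_ring_axioms K.cinf_ring_axioms \<phi>]
  interpret h: ring_hom_cring "ring_of A" "ring_of K" \<phi>
    by (rule cinf_hom_ring_hom[OF cinf_ring_axioms K.cinf_ring_axioms \<phi>])
  have I: "ideal ?p (ring_of A)"
  proof -
    have "a_kernel (ring_of A) (ring_of K) \<phi> = ?p" unfolding a_kernel_def' by simp
    then show ?thesis using h.ring.kernel_is_ideal by (simp only:)
  qed
  have "primeideal ?p (ring_of A)"
  proof (rule primeidealI[OF I cring_ring_of])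
    show "carrier (ring_of A) \<noteq> ?p"
    proof
      assume e: "carrier (ring_of A) = ?p"
      have "\<one>\<^bsub>ring_of A\<^esub> \<in> carrier (ring_of A)" by simp
      then have "\<one>\<^bsub>ring_of A\<^esub> \<in> ?p" by (simp only: e)
      then show False using z(2) K by (simp add: cinf_field_def)
    qed
    fix x y assume "x \<in> carrier (ring_of A)" "y \<in> carrier (ring_of A)" and xy: "x \<otimes>\<^bsub>ring_of A\<^esub> y \<in> ?p"
    then have c: "x \<in> carrier A" "y \<in> carrier A" by auto
    have eq: "\<phi> x \<otimes>\<^bsub>ring_of K\<^esub> \<phi> y = \<zero>\<^bsub>ring_of K\<^esub>" using xy a(1)[OF c] by simp
    show "x \<in> ?p \<or> y \<in> ?p"
    proof (cases "\<phi> x = \<zero>\<^bsub>ring_of K\<^esub>")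
      case False
      then have u: "\<phi> x \<in> Units (ring_of K)" using K cinf_hom_closed[OF \<phi> c(1)] by (simp add: cinf_field_def)
      have "\<phi> y = inv\<^bsub>ring_of K\<^esub> \<phi> x \<otimes>\<^bsub>ring_of K\<^esub> (\<phi> x \<otimes>\<^bsub>ring_of K\<^esub> \<phi> y)"
        using u cinf_hom_closed[OF \<phi>] c by (simp flip: K.R.m_assoc)
      then show ?thesis using eq c u by simp
    qed (use c in simp)
  qed
  moreover have "cinf_radical A ?p = ?p"
  proof
    show "cinf_radical A ?p \<subseteq> ?p"
    proof
      fix x assume x: "x \<in> cinf_radical A ?p"
      then have xc: "x \<in> carrier A" by (simp add: cinf_radical_def)
      have "\<phi> x \<notin> Units (ring_of K)"
        by (rule radical_not_unit[OF I K.cinf_ring_axioms _ \<phi> _ x]) (use K in \<open>auto simp: cinf_field_def\<close>)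
      then show "x \<in> ?p" using K cinf_hom_closed[OF \<phi> xc] xc by (auto simp: cinf_field_def)
    qed
  qed (rule ideal_subset_radical[OF I])
  ultimately show ?thesis by (simp add: cinf_Spec_def)
qed

lemma Spec_ideal: "p \<in> cinf_Spec A \<Longrightarrow> ideal p (ring_of A)"
  by (simp add: cinf_Spec_def primeideal.axioms(1))

lemma Spec_prime:
  assumes "p \<in> cinf_Spec A" "x \<in> carrier A" "y \<in> carrier A"
  shows "x \<otimes>\<^bsub>ring_of A\<^esub> y \<in> p \<longleftrightarrow> x \<in> p \<or> y \<in> p"
proof -
  interpret p: primeideal p "ring_of A" using assms(1) by (simp add: cinf_Spec_def)
  show ?thesis using assms p.I_prime p.I_l_closed p.I_r_closed by auto
qed

lemma Spec_one: "p \<in> cinf_Spec A \<Longrightarrow> \<one>\<^bsub>ring_of A\<^esub> \<notin> p"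
proof
  assume "p \<in> cinf_Spec A" "\<one>\<^bsub>ring_of A\<^esub> \<in> p"
  then interpret p: primeideal p "ring_of A" by (simp add: cinf_Spec_def)
  show False using p.I_notcarr p.one_imp_carrier \<open>\<one>\<^bsub>ring_of A\<^esub> \<in> p\<close> by auto
qed

lemma Spec_field:
  assumes p: "p \<in> cinf_Spec A" and a: "a \<in> carrier A" "a \<notin> p"
  obtains K :: "'a set frac_term set set cinf" and \<phi> where
    "cinf_field K" "\<phi> \<in> cinf_hom A K" "\<And>x. x \<in> p \<Longrightarrow> \<phi> x = \<zero>\<^bsub>ring_of K\<^esub>" "\<phi> a \<in> Units (ring_of K)"
proof -
  have "a \<notin> cinf_radical A p" using p a by (simp add: cinf_Spec_def)
  show ?thesis
    by (rule not_radical_field[OF Spec_ideal[OF p] a(1) \<open>a \<notin> cinf_radical A p\<close>]) (rule that)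
qed

text \<open>A smooth counterpart of the Nullstellensatz. An element outside a smooth prime above I
  is inverted by a field homomorphism killing I, so it is not in the radical; an element outside the
  radical is inverted by one whose kernel is a smooth prime above I.\<close>

lemma radical_eq:
  assumes I: "ideal I (ring_of A)"
  shows "cinf_radical A I = {a \<in> carrier A. \<forall>p\<in>cinf_Spec A. I \<subseteq> p \<longrightarrow> a \<in> p}"
proof (intro equalityI subsetI)
  fix a assume a: "a \<in> cinf_radical A I"
  then have ac: "a \<in> carrier A" by (simp add: cinf_radical_def)
  have "a \<in> p" if p: "p \<in> cinf_Spec A" "I \<subseteq> p" for p
  proof (rule ccontr)
    assume "a \<notin> p"
    obtain K :: "'a set frac_term set set cinf" and \<phi> where K: "cinf_field K" "\<phi> \<in> cinf_hom A K"
      "\<And>x. x \<in> p \<Longrightarrow> \<phi> x = \<zero>\<^bsub>ring_of K\<^esub>" "\<phi> a \<in> Units (ring_of K)"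
      by (rule Spec_field[OF p(1) ac \<open>a \<notin> p\<close>]) (rule that)
    have "\<phi> a \<notin> Units (ring_of K)"
      by (rule radical_not_unit[OF I _ _ K(2) _ a]) (use K p in \<open>auto simp: cinf_field_def\<close>)
    then show False using K by simp
  qed
  then show "a \<in> {a \<in> carrier A. \<forall>p\<in>cinf_Spec A. I \<subseteq> p \<longrightarrow> a \<in> p}" using ac by simp
next
  fix a assume a: "a \<in> {a \<in> carrier A. \<forall>p\<in>cinf_Spec A. I \<subseteq> p \<longrightarrow> a \<in> p}"
  show "a \<in> cinf_radical A I"
  proof (rule ccontr)
    assume n: "a \<notin> cinf_radical A I"
    have ac: "a \<in> carrier A" using a by simp
    obtain K :: "'a set frac_term set set cinf" and \<phi> where K: "cinf_field K" "\<phi> \<in> cinf_hom A K"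
      "\<And>x. x \<in> I \<Longrightarrow> \<phi> x = \<zero>\<^bsub>ring_of K\<^esub>" "\<phi> a \<in> Units (ring_of K)"
      by (rule not_radical_field[OF I ac n]) (rule that)
    have "I \<subseteq> {x \<in> carrier A. \<phi> x = \<zero>\<^bsub>ring_of K\<^esub>}" using K(3) ideal.Icarr[OF I] by auto
    then have 0: "\<phi> a = \<zero>\<^bsub>ring_of K\<^esub>" using a kernel_spec[OF K(1,2)] by blast
    interpret K: cinf_ring K using K(1) by (simp add: cinf_field_def)
    show False using K(1,4) 0 K.zero_unit by (simp add: cinf_field_def)
  qed
qed

lemma radical_ideal:
  assumes I: "ideal I (ring_of A)"
  shows "ideal (cinf_radical A I) (ring_of A)"
proof -
  \<comment> \<open>The whole ring is inserted so that the intersection stays inside the carrier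
    even if no smooth prime contains I.\<close>
  let ?S = "insert (carrier A) {p \<in> cinf_Spec A. I \<subseteq> p}"
  have "ideal (\<Inter>?S) (ring_of A)"
  proof (rule R.i_Intersect)
    fix J assume "J \<in> ?S"
    then consider "J = carrier A" | "J \<in> cinf_Spec A" by blast
    then show "ideal J (ring_of A)"
      by cases (use Spec_ideal R.oneideal in simp_all)
  qed simp
  moreover have "\<Inter>?S = cinf_radical A I" unfolding radical_eq[OF I] by auto
  ultimately show ?thesis by simp
qed

lemma rad_principal_ideal:
  assumes "b \<in> carrier A"
  shows "ideal (rad_principal A b) (ring_of A)"
  unfolding rad_principal_def by (rule radical_ideal, rule R.genideal_ideal) (use assms in simp)

text \<open>An ideal contains the principal ideal of b exactly when it contains b, so
  \<open>radical_eq\<close> turns into a condition on the closed set of b.\<close>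

lemma rad_principal_iff:
  assumes b: "b \<in> carrier A"
  shows "c \<in> rad_principal A b \<longleftrightarrow> c \<in> carrier A \<and> (\<forall>p\<in>Z_inf A b. c \<in> p)"
proof -
  have I: "ideal (genideal (ring_of A) {b}) (ring_of A)" by (rule R.genideal_ideal) (use b in simp)
  have "genideal (ring_of A) {b} \<subseteq> p \<longleftrightarrow> b \<in> p" if "p \<in> cinf_Spec A" for p
    using R.genideal_minimal[OF Spec_ideal[OF that], of "{b}"] R.genideal_self'[of b] b by auto
  then show ?thesis unfolding rad_principal_def radical_eq[OF I] Z_inf_def by auto
qed

end

section \<open>Elements of a ring of fractions\<close>

lemma tuple_upd_closed:
  assumes "\<And>i. i < m \<Longrightarrow> f i \<in> C" "s \<in> C" "i < Suc m"
  shows "(f(m := s)) i \<in> C"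
  using assms by (cases "i = m") simp_all

context cinf_ring
begin

lemma sop_reindex:
  assumes F: "csm k F" and r: "\<And>j. j < k \<Longrightarrow> r j < m" and u: "\<And>i. i < m \<Longrightarrow> u i \<in> carrier A"
  shows "csm m (\<lambda>v. F (\<lambda>j. v (r j)))" "sop A m (\<lambda>v. F (\<lambda>j. v (r j))) u = sop A k F (\<lambda>j. u (r j))"
proof -
  have c: "csm m (\<lambda>v. v (r j))" if "j < k" for j by (rule csm_coord[OF r[OF that]])
  show "csm m (\<lambda>v. F (\<lambda>j. v (r j)))" by (rule csm_comp[OF F c])
  have "sop A m (\<lambda>v. F (\<lambda>j. v (r j))) u = sop A k F (\<lambda>j. sop A m (\<lambda>v. v (r j)) u)"
    by (rule sop_comp[OF F c u])
  also have "\<dots> = sop A k F (\<lambda>j. u (r j))" by (rule sop_cong) (rule sop_coord[OF r u])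
  finally show "sop A m (\<lambda>v. F (\<lambda>j. v (r j))) u = sop A k F (\<lambda>j. u (r j))" .
qed

lemma csm_1: "smooth1 g \<Longrightarrow> csm 1 (\<lambda>v. g (v 0))"
  by (rule csm_smooth1[OF _ csm_coord]) simp_all

lemma sop_cst:
  assumes "smooth1 g" "csm n H" "\<And>i. i < n \<Longrightarrow> x i \<in> carrier A" "sop A n H x = cst A c"
  shows "sop A n (\<lambda>v. g (H v)) x = cst A (g c)"
proof -
  have "sop A n (\<lambda>v. g (H v)) x = sop A 1 (\<lambda>v. g (v 0)) (\<lambda>_. sop A n H x)"
    using sop_comp[OF csm_1[OF assms(1)], of n "\<lambda>_. H" x] assms(2,3) by simp
  also have "\<dots> = sop A 1 (\<lambda>v. g (v 0)) (\<lambda>_. sop A 0 (\<lambda>_. c) (\<lambda>_. undefined))"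
    unfolding assms(4) cst_def ..
  also have "\<dots> = sop A 0 (\<lambda>v. g c) (\<lambda>_. undefined)"
    using sop_comp[OF csm_1[OF assms(1)], of 0 "\<lambda>_ _. c" "\<lambda>_. undefined"] csm_const by simp
  finally show ?thesis by (simp add: cst_def)
qed

lemma cst_unit: "c \<noteq> 0 \<Longrightarrow> cst A c \<in> Units (ring_of A)"
proof (rule unitI[OF cst_closed cst_closed])
  assume "c \<noteq> 0"
  then have "sop A 0 (\<lambda>_. c * inverse c) (\<lambda>_. undefined) = cst A 1" by (simp add: cst_def)
  then show "cst A c \<otimes>\<^bsub>ring_of A\<^esub> cst A (inverse c) = \<one>\<^bsub>ring_of A\<^esub>"
    using sop_mult[OF csm_const csm_const, of 0 "\<lambda>_. undefined" c "inverse c"]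
    by (simp add: ring_of_one cst_def)
qed

text \<open>If \<open>t \<cdot> s = 1\<close>, smooth functions of \<open>(t, s)\<close> may be compared near the hyperbola \<open>t \<cdot> s = 1\<close> only, and
  \<open>s\<close> may be replaced by \<open>s \<cdot> \<theta> (t \<cdot> s)\<close>, which equals \<open>1 / t\<close> near the hyperbola.\<close>

lemma sop_invert_coord:
  assumes G: "csm (Suc n) G" "csm (Suc n) (invert_coord n G)"
    and u: "\<And>i. i < n \<Longrightarrow> u i \<in> carrier A" and t: "t \<in> carrier A" and s: "s \<in> carrier A"
    and ts: "t \<otimes>\<^bsub>ring_of A\<^esub> s = \<one>\<^bsub>ring_of A\<^esub>"
  shows "sop A (Suc n) (invert_coord n G) (u(n := t)) = sop A (Suc n) G (u(n := s))"
proof -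
  obtain \<theta> where \<theta>: "smooth1 \<theta>" "\<And>v. v \<ge> 1/2 \<Longrightarrow> \<theta> v = 1 / v"
    by (rule smooth_reciprocal_extension) (rule that)
  let ?N = "Suc (Suc n)"
  define W where "W = u(n := t, Suc n := s)"
  have Wc: "W i \<in> carrier A" if "i < ?N" for i
    using that u[of i] t s by (cases "i = n \<or> i = Suc n") (auto simp: W_def)
  have cn: "csm ?N (\<lambda>v. v n)" "csm ?N (\<lambda>v. v (Suc n))" by (auto intro: csm_coord)
  define H where "H = (\<lambda>v::nat\<Rightarrow>real. v n * v (Suc n))"
  have H: "csm ?N H" unfolding H_def by (rule csm_mult[OF cn])
  have HW: "sop A ?N H W = cst A 1"
  proof -
    have "sop A ?N H W = sop A ?N (\<lambda>v. v n) W \<otimes>\<^bsub>ring_of A\<^esub> sop A ?N (\<lambda>v. v (Suc n)) W"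
      unfolding H_def by (rule sop_mult[OF cn Wc])
    also have "\<dots> = W n \<otimes>\<^bsub>ring_of A\<^esub> W (Suc n)"
      using sop_coord[of n ?N W, OF _ Wc] sop_coord[of "Suc n" ?N W, OF _ Wc] by simp
    also have "\<dots> = cst A 1" using ts by (simp add: W_def ring_of_one)
    finally show ?thesis .
  qed
  \<comment> \<open>The cutoff vanishes for r <= 1/2 and is nonzero at r = 1. Since t s = 1 in the
    ring, its value at t s is a nonzero constant, hence a unit that can be cancelled.\<close>
  define g where "g r = flat1 (r - 1/2)" for r
  have g: "smooth1 g"
    unfolding g_def smooth1_def by (intro csmooth_smooth1[OF smooth1_flat] csmooth_intros)
  define E where "E = (\<lambda>v. g (H v))"
  have E: "csm ?N E" unfolding E_def by (rule csm_smooth1[OF g H])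
  have EW: "sop A ?N E W = cst A (g 1)" unfolding E_def by (rule sop_cst[OF g H Wc HW])
  \<comment> \<open>As \<theta> 1 = 1, this function still evaluates to s at the given arguments,
    but as a function it is exactly 1/t wherever t s > 1/2.\<close>
  define k where "k = (\<lambda>v. v (Suc n) * \<theta> (H v))"
  have k: "csm ?N k" unfolding k_def by (rule csm_mult[OF cn(2) csm_smooth1[OF \<theta>(1) H]])
  have kW: "sop A ?N k W = s"
  proof -
    have "sop A ?N k W = sop A ?N (\<lambda>v. v (Suc n)) W \<otimes>\<^bsub>ring_of A\<^esub> sop A ?N (\<lambda>v. \<theta> (H v)) W"
      unfolding k_def by (rule sop_mult[OF cn(2) csm_smooth1[OF \<theta>(1) H] Wc])
    also have "sop A ?N (\<lambda>v. \<theta> (H v)) W = cst A (\<theta> 1)" by (rule sop_cst[OF \<theta>(1) H Wc HW])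
    also have "sop A ?N (\<lambda>v. v (Suc n)) W = W (Suc n)" using sop_coord[of "Suc n" ?N W, OF _ Wc] by simp
    finally have "sop A ?N k W = W (Suc n) \<otimes>\<^bsub>ring_of A\<^esub> cst A (\<theta> 1)" .
    then show ?thesis using \<theta>(2)[of 1] s by (simp add: W_def flip: ring_of_one)
  qed
  define P where "P = (\<lambda>v. G (\<lambda>j. if j = n then k v else v j))"
  have pc: "csm ?N (\<lambda>v. if j = n then k v else v j)" if "j < Suc n" for j
    using that k by (cases "j = n") (auto intro: csm_coord)
  have P: "csm ?N P" unfolding P_def by (rule csm_comp[OF G(1) pc])
  have PW: "sop A ?N P W = sop A (Suc n) G (u(n := s))"
  proof -
    have "sop A ?N P W = sop A (Suc n) G (\<lambda>j. sop A ?N (\<lambda>v. if j = n then k v else v j) W)"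
      unfolding P_def by (rule sop_comp[OF G(1) pc Wc])
    also have "\<dots> = sop A (Suc n) G (u(n := s))"
    proof (rule sop_cong)
      fix j assume j: "j < Suc n"
      show "sop A ?N (\<lambda>v. if j = n then k v else v j) W = (u(n := s)) j"
      proof (cases "j = n")
        case True
        then show ?thesis using kW by simp
      next
        case False
        then show ?thesis using sop_coord[of j ?N W, OF _ Wc] j by (simp add: W_def)
      qed
    qed
    finally show ?thesis .
  qed
  have I: "csm ?N (invert_coord n G)" by (rule csm_mono[OF G(2)]) simp
  have IW: "sop A ?N (invert_coord n G) W = sop A (Suc n) (invert_coord n G) (u(n := t))"
  proof -
    have "sop A ?N (invert_coord n G) W = sop A (Suc n) (invert_coord n G) W"
      by (rule sop_extend[OF G(2) _ Wc]) simp_all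
    also have "\<dots> = sop A (Suc n) (invert_coord n G) (u(n := t))" by (rule sop_cong) (simp add: W_def)
    finally show ?thesis .
  qed
  \<comment> \<open>Either t s <= 1/2 and the cutoff is 0, or t and s are nonzero and substituting
    \<open>k\<close> is the same as inverting the coordinate n.\<close>
  have key: "E v * (invert_coord n G v - P v) = 0" for v
  proof (cases "H v \<le> 1/2")
    case True
    then show ?thesis by (simp add: E_def g_def)
  next
    case False
    then have nz: "v n \<noteq> 0" "v (Suc n) \<noteq> 0" by (auto simp: H_def)
    have t: "\<theta> (H v) = 1 / H v" by (rule \<theta>(2)) (use False in simp)
    have "k v = v (Suc n) * (1 / (v n * v (Suc n)))" unfolding k_def t by (simp only: H_def)
    also have "\<dots> = inverse (v n)" using nz by (simp add: field_simps)
    finally have "k v = inverse (v n)" .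
    then have "(\<lambda>j. if j = n then k v else v j) = v(n := inverse (v n))" by auto
    then show ?thesis using nz by (simp add: P_def invert_coord_def)
  qed
  have "sop A ?N E W \<otimes>\<^bsub>ring_of A\<^esub> (sop A ?N (invert_coord n G) W \<ominus>\<^bsub>ring_of A\<^esub> sop A ?N P W) =
      sop A ?N (\<lambda>v. E v * (invert_coord n G v - P v)) W"
    using sop_mult[where x = W, OF E csm_diff[OF I P] Wc] sop_diff[where x = W, OF I P Wc]
    by (simp only:)
  also have "\<dots> = \<zero>\<^bsub>ring_of A\<^esub>"
    unfolding key ring_of_zero by (rule sop_const[OF Wc])
  finally have 0: "cst A (g 1) \<otimes>\<^bsub>ring_of A\<^esub> (sop A ?N (invert_coord n G) W \<ominus>\<^bsub>ring_of A\<^esub> sop A ?N P W) = \<zero>\<^bsub>ring_of A\<^esub>"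
    unfolding EW .
  have "g 1 \<noteq> 0" using flat1_pos[of "1/2"] by (simp add: g_def del: flat1_pos)
  then have un: "cst A (g 1) \<in> Units (ring_of A)" by (rule cst_unit)
  have cl: "sop A ?N (invert_coord n G) W \<in> carrier A" "sop A ?N P W \<in> carrier A"
    by (rule sop_closed[OF I Wc]; assumption) (rule sop_closed[OF P Wc])
  have "sop A ?N (invert_coord n G) W \<ominus>\<^bsub>ring_of A\<^esub> sop A ?N P W = \<zero>\<^bsub>ring_of A\<^esub>"
    using R.Units_l_cancel[OF un, of "sop A ?N (invert_coord n G) W \<ominus>\<^bsub>ring_of A\<^esub> sop A ?N P W" "\<zero>\<^bsub>ring_of A\<^esub>"]
      0 cl cst_closed by simp
  from diff_zero_eq[OF this cl] show ?thesis unfolding PW IW .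
qed

end

text \<open>The adjoined element \<open>s\<close>, an inverse in the applications, sits in the last
  coordinate, the one that \<open>invert_coord m\<close> inverts.\<close>

definition smooth_expr :: "'a cinf \<Rightarrow> 'b cinf \<Rightarrow> ('a \<Rightarrow> 'b) \<Rightarrow> 'b \<Rightarrow> 'b \<Rightarrow> bool" where
  "smooth_expr A L \<eta> s x \<longleftrightarrow> (\<exists>m F y. csm (Suc m) F \<and> (\<forall>i<m. y i \<in> carrier A) \<and>
     x = sop L (Suc m) F ((\<lambda>i. \<eta> (y i))(m := s)))"

locale cinf_extension = A: cinf_ring A + L: cinf_ring L
  for A :: "'a cinf" and L :: "'b cinf" +
  fixes \<eta> s
  assumes hom: "\<eta> \<in> cinf_hom A L" and s: "s \<in> carrier L"
begin

lemma smooth_expr_map: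
  assumes "a \<in> carrier A"
  shows "smooth_expr A L \<eta> s (\<eta> a)"
  unfolding smooth_expr_def
proof (intro exI conjI)
  show "csm (Suc 1) (\<lambda>v. v 0)" by (rule csm_coord) simp
  show "\<forall>i<1. (\<lambda>_. a) i \<in> carrier A" using assms by simp
  show "\<eta> a = sop L (Suc 1) (\<lambda>v. v 0) ((\<lambda>i. \<eta> ((\<lambda>_. a) i))(1 := s))"
    using L.sop_coord[of 0 "Suc 1" "(\<lambda>i. \<eta> a)(1 := s)"] cinf_hom_closed[OF hom assms] s by auto
qed

lemma smooth_expr_gen: "smooth_expr A L \<eta> s s"
  unfolding smooth_expr_def
proof (intro exI conjI)
  show "csm (Suc 0) (\<lambda>v. v 0)" by (rule csm_coord) simp
  show "s = sop L (Suc 0) (\<lambda>v. v 0) ((\<lambda>i. \<eta> ((\<lambda>_. undefined) i))(0 := s))"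
    using L.sop_coord[of 0 "Suc 0" "(\<lambda>i. \<eta> undefined)(0 := s)"] s by auto
qed simp

text \<open>Parameter lists are concatenated, and each function reads its own list through a
  reindexing that keeps \<open>s\<close> in the last coordinate. Common parameters allow these
  functions to be composed with an operation.\<close>

lemma smooth_expr_common:
  fixes n :: nat
  assumes "\<And>i. i < n \<Longrightarrow> smooth_expr A L \<eta> s (x i)"
  shows "\<exists>m y. (\<forall>i<m. y i \<in> carrier A) \<and>
    (\<forall>i<n. \<exists>F. csm (Suc m) F \<and> x i = sop L (Suc m) F ((\<lambda>i. \<eta> (y i))(m := s)))"
  using assms
proof (induction n)
  case 0
  show ?case by (intro exI[of _ 0]) auto
next
  case (Suc n)
  then have "\<exists>m y. (\<forall>i<m. y i \<in> carrier A) \<and>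
    (\<forall>i<n. \<exists>F. csm (Suc m) F \<and> x i = sop L (Suc m) F ((\<lambda>i. \<eta> (y i))(m := s)))"
    by (intro Suc.IH Suc.prems) simp
  then obtain m1 y1 where y1: "\<forall>i<m1. y1 i \<in> carrier A"
    "\<forall>i<n. \<exists>F. csm (Suc m1) F \<and> x i = sop L (Suc m1) F ((\<lambda>i. \<eta> (y1 i))(m1 := s))"
    by (elim exE conjE) (rule that)
  obtain m2 F2 y2 where y2: "csm (Suc m2) F2" "\<forall>i<m2. y2 i \<in> carrier A"
    "x n = sop L (Suc m2) F2 ((\<lambda>i. \<eta> (y2 i))(m2 := s))"
    using Suc.prems[OF lessI] unfolding smooth_expr_def by (elim exE conjE) (rule that)
  define m y where "m = m1 + m2" and "y i = (if i < m1 then y1 i else y2 (i - m1))" for i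
  let ?u = "(\<lambda>i. \<eta> (y i))(m := s)"
  have yc: "\<forall>i<m. y i \<in> carrier A" using y1 y2 by (auto simp: y_def m_def)
  have uc: "?u i \<in> carrier L" if "i < Suc m" for i
    by (rule tuple_upd_closed[OF _ s that]) (use yc cinf_hom_closed[OF hom] in blast)
  have *: "\<exists>F. csm (Suc m) F \<and> x i = sop L (Suc m) F ?u" if i: "i < Suc n" for i
  proof (cases "i = n")
    case True
    let ?r = "\<lambda>j. if j < m2 then m1 + j else m"
    have rb: "?r j < Suc m" if "j < Suc m2" for j using that by (simp add: m_def)
    have "sop L (Suc m2) F2 ((\<lambda>i. \<eta> (y2 i))(m2 := s)) = sop L (Suc m2) F2 (\<lambda>j. ?u (?r j))"
    proof (rule sop_cong)
      fix j assume "j < Suc m2"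
      then show "((\<lambda>i. \<eta> (y2 i))(m2 := s)) j = ?u (?r j)"
        by (cases "j = m2") (simp_all add: y_def m_def)
    qed
    also have "\<dots> = sop L (Suc m) (\<lambda>v. F2 (\<lambda>j. v (?r j))) ?u"
      by (rule L.sop_reindex(2)[OF y2(1) rb uc, symmetric])
    finally have "x i = sop L (Suc m) (\<lambda>v. F2 (\<lambda>j. v (?r j))) ?u" by (simp only: True y2(3))
    with L.sop_reindex(1)[OF y2(1) rb uc] show ?thesis by (intro exI conjI)
  next
    case False
    then have "i < n" using i by simp
    then obtain F1 where F1: "csm (Suc m1) F1" "x i = sop L (Suc m1) F1 ((\<lambda>i. \<eta> (y1 i))(m1 := s))"
      using y1(2) by blast
    let ?r = "\<lambda>j. if j < m1 then j else m"
    have rb: "?r j < Suc m" if "j < Suc m1" for j using that by (simp add: m_def)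
    have "sop L (Suc m1) F1 ((\<lambda>i. \<eta> (y1 i))(m1 := s)) = sop L (Suc m1) F1 (\<lambda>j. ?u (?r j))"
    proof (rule sop_cong)
      fix j assume "j < Suc m1"
      then show "((\<lambda>i. \<eta> (y1 i))(m1 := s)) j = ?u (?r j)"
        by (cases "j = m1") (simp_all add: y_def m_def)
    qed
    also have "\<dots> = sop L (Suc m) (\<lambda>v. F1 (\<lambda>j. v (?r j))) ?u"
      by (rule L.sop_reindex(2)[OF F1(1) rb uc, symmetric])
    finally have "x i = sop L (Suc m) (\<lambda>v. F1 (\<lambda>j. v (?r j))) ?u" by (simp only: F1(2))
    with L.sop_reindex(1)[OF F1(1) rb uc] show ?thesis by (intro exI conjI)
  qed
  show ?case
  proof (intro exI conjI)
    show "\<forall>i<m. y i \<in> carrier A" by (rule yc)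
    show "\<forall>i<Suc n. \<exists>F. csm (Suc m) F \<and> x i = sop L (Suc m) F ?u" using * by blast
  qed
qed

lemma smooth_expr_op:
  assumes F: "csm n F" and x: "\<And>i. i < n \<Longrightarrow> smooth_expr A L \<eta> s (x i)"
  shows "smooth_expr A L \<eta> s (sop L n F x)"
proof -
  obtain m y where y: "\<forall>i<m. y i \<in> carrier A"
    "\<forall>i<n. \<exists>F. csm (Suc m) F \<and> x i = sop L (Suc m) F ((\<lambda>i. \<eta> (y i))(m := s))"
    using smooth_expr_common[of n x] x by blast
  let ?u = "(\<lambda>i. \<eta> (y i))(m := s)"
  have uc: "?u i \<in> carrier L" if "i < Suc m" for i
    by (rule tuple_upd_closed[OF _ s that]) (use y(1) cinf_hom_closed[OF hom] in blast)
  have "\<forall>i. \<exists>F. i < n \<longrightarrow> csm (Suc m) F \<and> x i = sop L (Suc m) F ?u" using y(2) by blast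
  from choice[OF this] obtain G where "\<forall>i. i < n \<longrightarrow> csm (Suc m) (G i) \<and> x i = sop L (Suc m) (G i) ?u" ..
  then have G: "csm (Suc m) (G i)" "x i = sop L (Suc m) (G i) ?u" if "i < n" for i using that by auto
  have "sop L (Suc m) (\<lambda>v. F (\<lambda>j. G j v)) ?u = sop L n F (\<lambda>j. sop L (Suc m) (G j) ?u)"
    by (rule L.sop_comp[OF F G(1) uc])
  also have "\<dots> = sop L n F x" by (rule sop_cong) (simp add: G(2))
  finally show ?thesis
    unfolding smooth_expr_def using csm_comp[OF F G(1)] y(1)
    by (intro exI[of _ m] exI[of _ "\<lambda>v. F (\<lambda>j. G j v)"] exI[of _ y] conjI) (assumption | rule HOL.sym)+
qed

text \<open>The inverted versions of \<Psi> and F \<Psi> can be evaluated in \<open>A\<close> itself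
  at (y, a), giving w and h. By \<open>sop_invert_coord\<close> their images are the values of
  \<Psi> and F \<Psi> at (y, s), and the former is invertible since \<Psi> is positive.\<close>

lemma fraction_form:
  assumes a: "a \<in> carrier A" "\<eta> a \<otimes>\<^bsub>ring_of L\<^esub> s = \<one>\<^bsub>ring_of L\<^esub>" and x: "smooth_expr A L \<eta> s x"
  obtains h w where "h \<in> carrier A" "w \<in> carrier A" "\<eta> w \<in> Units (ring_of L)"
    "x \<otimes>\<^bsub>ring_of L\<^esub> \<eta> w = \<eta> h"
proof -
  obtain n F y where F: "csm (Suc n) F" and y: "\<And>i. i < n \<Longrightarrow> y i \<in> carrier A"
    and xF: "x = sop L (Suc n) F ((\<lambda>i. \<eta> (y i))(n := s))"
    using x unfolding smooth_expr_def by (elim exE conjE) (rule that, simp_all)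
  obtain \<Psi> where \<Psi>: "csmooth \<Psi>" "dep (Suc n) \<Psi>" "\<And>z. \<Psi> z > 0"
    "csmooth (invert_coord n \<Psi>)" "csmooth (invert_coord n (\<lambda>z. F z * \<Psi> z))"
    by (rule invertible_coord_multiplier[of F n]) (use F in \<open>auto simp: csm_def\<close>)
  have dep: "dep (Suc n) (invert_coord n G)" if "dep (Suc n) G" for G
    unfolding dep_def
  proof (intro allI impI)
    fix x y :: "nat \<Rightarrow> real" assume xy: "\<forall>i<Suc n. x i = y i"
    have "\<forall>i<Suc n. (x(n := inverse (x n))) i = (y(n := inverse (y n))) i" using xy by simp
    then have "G (x(n := inverse (x n))) = G (y(n := inverse (y n)))"
      using that unfolding dep_def by blast
    then show "invert_coord n G x = invert_coord n G y" using xy by (simp add: invert_coord_def)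
  qed
  let ?u = "\<lambda>i. \<eta> (y i)"
  note ec = cinf_hom_closed[OF hom]
  have uc: "(?u(n := s)) i \<in> carrier L" if "i < Suc n" for i
    by (rule tuple_upd_closed[OF _ s that]) (rule ec[OF y])
  have yc: "(y(n := a)) i \<in> carrier A" if "i < Suc n" for i
    by (rule tuple_upd_closed[OF y a(1) that])
  have C: "csm (Suc n) \<Psi>" "csm (Suc n) (invert_coord n \<Psi>)"
    using \<Psi> dep by (auto simp: csm_def)
  have C': "csm (Suc n) (\<lambda>z. F z * \<Psi> z)" by (rule csm_mult[OF F C(1)])
  then have C'': "csm (Suc n) (invert_coord n (\<lambda>z. F z * \<Psi> z))"
    using \<Psi>(5) dep by (auto simp: csm_def)
  have map: "\<eta> (sop A (Suc n) (invert_coord n G) (y(n := a))) = sop L (Suc n) G (?u(n := s))"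
    if G: "csm (Suc n) G" "csm (Suc n) (invert_coord n G)" for G
  proof -
    have "\<eta> (sop A (Suc n) (invert_coord n G) (y(n := a))) =
        sop L (Suc n) (invert_coord n G) (\<lambda>i. \<eta> ((y(n := a)) i))"
      by (rule hom_sop[OF hom G(2) yc])
    also have "\<dots> = sop L (Suc n) (invert_coord n G) (?u(n := \<eta> a))"
      by (rule sop_cong) simp
    also have "\<dots> = sop L (Suc n) G (?u(n := s))"
      by (rule L.sop_invert_coord[OF G]) (use y ec a s in auto)
    finally show ?thesis .
  qed
  define w where "w = sop A (Suc n) (invert_coord n \<Psi>) (y(n := a))"
  define h where "h = sop A (Suc n) (invert_coord n (\<lambda>z. F z * \<Psi> z)) (y(n := a))"
  have w: "\<eta> w = sop L (Suc n) \<Psi> (?u(n := s))" unfolding w_def by (rule map[OF C])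
  have h: "\<eta> h = sop L (Suc n) (\<lambda>z. F z * \<Psi> z) (?u(n := s))" unfolding h_def by (rule map[OF C' C''])
  show ?thesis
  proof (rule that[of h w])
    show "h \<in> carrier A" unfolding h_def by (rule A.sop_closed[OF C'' yc])
    show "w \<in> carrier A" unfolding w_def by (rule A.sop_closed[OF C(2) yc])
    show "x \<otimes>\<^bsub>ring_of L\<^esub> \<eta> w = \<eta> h"
      unfolding w h xF by (rule L.sop_mult[OF F C(1) uc, symmetric])
    have nz: "\<Psi> z \<noteq> 0" for z using \<Psi>(3)[of z] by simp
    have ci: "csm (Suc n) (\<lambda>z. inverse (\<Psi> z))" by (rule csm_inverse[OF C(1) nz])
    have "\<eta> w \<otimes>\<^bsub>ring_of L\<^esub> sop L (Suc n) (\<lambda>z. inverse (\<Psi> z)) (?u(n := s)) =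
      sop L (Suc n) (\<lambda>z. \<Psi> z * inverse (\<Psi> z)) (?u(n := s))"
      unfolding w by (rule L.sop_mult[OF C(1) ci uc, symmetric])
    also have "(\<lambda>z. \<Psi> z * inverse (\<Psi> z)) = (\<lambda>_. 1)" using nz by simp
    also have "sop L (Suc n) (\<lambda>_. 1) (?u(n := s)) = \<one>\<^bsub>ring_of L\<^esub>"
      unfolding ring_of_one by (rule L.sop_const[OF uc])
    finally have inverse: "\<eta> w \<otimes>\<^bsub>ring_of L\<^esub> sop L (Suc n) (\<lambda>z. inverse (\<Psi> z)) (?u(n := s)) = \<one>\<^bsub>ring_of L\<^esub>" .
    have "sop L (Suc n) \<Psi> (?u(n := s)) \<in> carrier L" by (rule L.sop_closed[OF C(1) uc])
    then have "\<eta> w \<in> carrier L" by (simp only: w)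
    moreover have "sop L (Suc n) (\<lambda>z. inverse (\<Psi> z)) (?u(n := s)) \<in> carrier L" by (rule L.sop_closed[OF ci uc])
    ultimately show "\<eta> w \<in> Units (ring_of L)" using inverse by (rule L.unitI)
  qed
qed

end

section \<open>The presheaf\<close>

context cinf_ring
begin

context
  fixes a b assumes a: "a \<in> carrier A" and b: "b \<in> carrier A"
begin

lemma quot_map_rad_in: "{quot_map A (rad_principal A b) a} \<subseteq> carrier (quot_ideal A (rad_principal A b))"
  using cinf_hom_closed[OF quot_map_hom[OF rad_principal_ideal[OF b]] a] by simp

lemma local_cinf_ring: "cinf_ring (local_ring A a b)"
  unfolding local_ring_def
  by (rule cinf_ring.fractions_cinf_ring[OF quot_ideal_cinf_ring[OF rad_principal_ideal[OF b]] quot_map_rad_in])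

lemma local_map_hom: "local_map A a b \<in> cinf_hom A (local_ring A a b)"
  unfolding local_ring_def local_map_def
  by (rule cinf_hom_compose[OF quot_map_hom[OF rad_principal_ideal[OF b]]
        cinf_ring.fractions_map_hom[OF quot_ideal_cinf_ring[OF rad_principal_ideal[OF b]] quot_map_rad_in]
        cinf_ring_axioms])

lemma local_map_unit: "local_map A a b a \<in> Units (ring_of (local_ring A a b))"
  using cinf_ring.fractions_unit[OF quot_ideal_cinf_ring[OF rad_principal_ideal[OF b]] quot_map_rad_in] a
  unfolding local_ring_def local_map_def by (simp add: compose_def)

lemma local_map_rad:
  assumes "c \<in> rad_principal A b"
  shows "local_map A a b c = \<zero>\<^bsub>ring_of (local_ring A a b)\<^esub>"
proof -
  note I = rad_principal_ideal[OF b]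
  interpret Q: cinf_ring "quot_ideal A (rad_principal A b)" by (rule quot_ideal_cinf_ring[OF I])
  have c: "c \<in> carrier A" using ideal.Icarr[OF I assms] by simp
  have "quot_map A (rad_principal A b) c = \<zero>\<^bsub>ring_of (quot_ideal A (rad_principal A b))\<^esub>"
    using quot_map_zero_iff[OF I c] assms by simp
  then show ?thesis
    using cinf_hom_zero(1)[OF Q.cinf_ring_axioms Q.fractions_cinf_ring[OF quot_map_rad_in]
        Q.fractions_map_hom[OF quot_map_rad_in]] c
    by (simp add: local_map_def local_ring_def compose_def)
qed

lemma local_lift:
  assumes B: "cinf_ring B" and \<phi>: "\<phi> \<in> cinf_hom A B" and u: "\<phi> a \<in> Units (ring_of B)"
    and z: "\<And>c. c \<in> rad_principal A b \<Longrightarrow> \<phi> c = \<zero>\<^bsub>ring_of B\<^esub>"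
  obtains \<kappa> where "\<kappa> \<in> cinf_hom (local_ring A a b) B" "\<And>x. x \<in> carrier A \<Longrightarrow> \<kappa> (local_map A a b x) = \<phi> x"
proof -
  note I = rad_principal_ideal[OF b]
  interpret Q: cinf_ring "quot_ideal A (rad_principal A b)" by (rule quot_ideal_cinf_ring[OF I])
  obtain \<psi> where \<psi>: "\<psi> \<in> cinf_hom (quot_ideal A (rad_principal A b)) B"
    "\<And>x. x \<in> carrier A \<Longrightarrow> \<psi> (quot_map A (rad_principal A b) x) = \<phi> x"
    by (rule quot_ideal_lift[OF I B \<phi>], erule z) (rule that)
  have u': "\<psi> s \<in> Units (ring_of B)" if "s \<in> {quot_map A (rad_principal A b) a}" for s
    using that u \<psi>(2)[OF a] by simp
  obtain \<kappa> where \<kappa>: "\<kappa> \<in> cinf_hom (fractions (quot_ideal A (rad_principal A b)) {quot_map A (rad_principal A b) a}) B"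
    "\<And>x. x \<in> carrier (quot_ideal A (rad_principal A b)) \<Longrightarrow>
      \<kappa> (fractions_map (quot_ideal A (rad_principal A b)) {quot_map A (rad_principal A b) a} x) = \<psi> x"
    by (rule Q.fractions_lift[OF quot_map_rad_in B \<psi>(1)], erule u') (rule that)
  show ?thesis
  proof (rule that[of \<kappa>])
    show "\<kappa> \<in> cinf_hom (local_ring A a b) B" using \<kappa>(1) by (simp add: local_ring_def)
    show "\<kappa> (local_map A a b x) = \<phi> x" if "x \<in> carrier A" for x
      using \<kappa>(2)[OF cinf_hom_closed[OF quot_map_hom[OF I] that]] \<psi>(2)[OF that] that
      by (simp add: local_map_def compose_def)
  qed
qed

lemma local_hom_eqI:
  assumes B: "cinf_ring B" and \<phi>: "\<phi> \<in> cinf_hom (local_ring A a b) B" and \<psi>: "\<psi> \<in> cinf_hom (local_ring A a b) B"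
    and eq: "\<And>x. x \<in> carrier A \<Longrightarrow> \<phi> (local_map A a b x) = \<psi> (local_map A a b x)"
  shows "\<phi> = \<psi>"
proof -
  note I = rad_principal_ideal[OF b]
  interpret Q: cinf_ring "quot_ideal A (rad_principal A b)" by (rule quot_ideal_cinf_ring[OF I])
  show ?thesis
  proof (rule Q.fractions_hom_eqI[OF quot_map_rad_in B \<phi>[unfolded local_ring_def] \<psi>[unfolded local_ring_def]])
    fix \<xi> assume "\<xi> \<in> carrier (quot_ideal A (rad_principal A b))"
    then obtain x where "x \<in> carrier A" "\<xi> = quot_map A (rad_principal A b) x"
      by (rule quot_map_surj[OF I])
    then show "\<phi> (fractions_map (quot_ideal A (rad_principal A b)) {quot_map A (rad_principal A b) a} \<xi>) =
       \<psi> (fractions_map (quot_ideal A (rad_principal A b)) {quot_map A (rad_principal A b) a} \<xi>)"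
      using eq[of x] by (simp add: local_map_def compose_def)
  qed
qed

text \<open>Induction over the ring of fractions: every formal inverse occurring there inverts the
  image of a, so by uniqueness it is \<open>s\<close>, and one adjoined coordinate suffices.\<close>

lemma local_smooth_expr:
  assumes s: "s \<in> carrier (local_ring A a b)"
    "local_map A a b a \<otimes>\<^bsub>ring_of (local_ring A a b)\<^esub> s = \<one>\<^bsub>ring_of (local_ring A a b)\<^esub>"
    and x: "x \<in> carrier (local_ring A a b)"
  shows "smooth_expr A (local_ring A a b) (local_map A a b) s x"
proof -
  note I = rad_principal_ideal[OF b]
  interpret Q: cinf_ring "quot_ideal A (rad_principal A b)" by (rule quot_ideal_cinf_ring[OF I])
  interpret L: cinf_ring "local_ring A a b" by (rule local_cinf_ring)
  interpret E: cinf_extension A "local_ring A a b" "local_map A a b" s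
    by unfold_locales (rule local_map_hom, rule s)
  have "x \<in> carrier (fractions (quot_ideal A (rad_principal A b)) {quot_map A (rad_principal A b) a})"
    using x by (simp add: local_ring_def)
  then show ?thesis
  proof (induction rule: Q.fractions_induct[OF quot_map_rad_in, consumes 1, case_names elt inverse op])
    case (elt \<xi>)
    then obtain c where c: "c \<in> carrier A" "\<xi> = quot_map A (rad_principal A b) c"
      by (rule quot_map_surj[OF I])
    have "local_map A a b c = fractions_map (quot_ideal A (rad_principal A b)) {quot_map A (rad_principal A b) a} \<xi>"
      using c by (simp add: local_map_def compose_def)
    then show ?case using E.smooth_expr_map[OF c(1)] by (simp only:)
  next
    case (inverse s' \<xi>)
    note lc = cinf_hom_closed[OF local_map_hom a]
    have "local_map A a b a \<otimes>\<^bsub>ring_of (local_ring A a b)\<^esub> \<xi> = \<one>\<^bsub>ring_of (local_ring A a b)\<^esub>"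
      "\<xi> \<in> carrier (local_ring A a b)"
      using inverse a by (simp_all add: local_map_def local_ring_def compose_def)
    then have "\<xi> = s"
      using L.R.inv_unique[of \<xi> "local_map A a b a" s] s lc by (simp add: L.R.m_comm)
    then show ?case using E.smooth_expr_gen by simp
  next
    case (op n F \<xi>)
    then show ?case using E.smooth_expr_op[of n F \<xi>] by (simp add: local_ring_def)
  qed
qed

text \<open>A point p of the basic open set yields a field homomorphism factoring through the local
  ring, and units do not vanish in a field. Conversely a nonunit lies in a maximal ideal of the
  local ring, whose residue field has as kernel in \<open>A\<close> a point of the open set that
  contains c.\<close>

lemma local_unit_iff:
  assumes c: "c \<in> carrier A"
  shows "local_map A a b c \<in> Units (ring_of (local_ring A a b)) \<longleftrightarrow> D_inf A a \<inter> Z_inf A b \<subseteq> D_inf A c"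
proof
  interpret L: cinf_ring "local_ring A a b" by (rule local_cinf_ring)
  assume u: "local_map A a b c \<in> Units (ring_of (local_ring A a b))"
  show "D_inf A a \<inter> Z_inf A b \<subseteq> D_inf A c"
  proof
    fix p assume "p \<in> D_inf A a \<inter> Z_inf A b"
    then have p: "p \<in> cinf_Spec A" "a \<notin> p" "b \<in> p" by (auto simp: D_inf_def Z_inf_def)
    obtain K :: "'a set frac_term set set cinf" and \<phi> where K: "cinf_field K" "\<phi> \<in> cinf_hom A K"
      "\<And>x. x \<in> p \<Longrightarrow> \<phi> x = \<zero>\<^bsub>ring_of K\<^esub>" "\<phi> a \<in> Units (ring_of K)"
      by (rule Spec_field[OF p(1) a p(2)]) (rule that)
    interpret K: cinf_ring K using K(1) by (simp add: cinf_field_def)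
    have "\<phi> c = \<zero>\<^bsub>ring_of K\<^esub>" if "c \<in> rad_principal A b" for c
      using that p K(3) rad_principal_iff[OF b, of c] by (auto simp: Z_inf_def)
    then obtain \<kappa> where \<kappa>: "\<kappa> \<in> cinf_hom (local_ring A a b) K"
      "\<And>x. x \<in> carrier A \<Longrightarrow> \<kappa> (local_map A a b x) = \<phi> x"
      using local_lift[OF K.cinf_ring_axioms K(2,4)] by metis
    have "\<phi> c \<in> Units (ring_of K)"
      using cinf_hom_unit[OF L.cinf_ring_axioms K.cinf_ring_axioms \<kappa>(1) u] \<kappa>(2)[OF c] by simp
    then have "c \<notin> p" using K(1) K(3)[of c] K.zero_unit by (auto simp: cinf_field_def)
    then show "p \<in> D_inf A c" using p by (simp add: D_inf_def)
  qed
next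
  interpret L: cinf_ring "local_ring A a b" by (rule local_cinf_ring)
  assume sub: "D_inf A a \<inter> Z_inf A b \<subseteq> D_inf A c"
  note lc = cinf_hom_closed[OF local_map_hom c]
  show "local_map A a b c \<in> Units (ring_of (local_ring A a b))"
  proof (rule ccontr)
    assume n: "local_map A a b c \<notin> Units (ring_of (local_ring A a b))"
    let ?P = "cgenideal (ring_of (local_ring A a b)) (local_map A a b c)"
    have I: "ideal ?P (ring_of (local_ring A a b))" by (rule L.R.cgenideal_ideal) (use lc in simp)
    have 1: "\<one>\<^bsub>ring_of (local_ring A a b)\<^esub> \<notin> ?P"
    proof
      assume "\<one>\<^bsub>ring_of (local_ring A a b)\<^esub> \<in> ?P"
      then obtain y where "y \<in> carrier (local_ring A a b)"
        "\<one>\<^bsub>ring_of (local_ring A a b)\<^esub> = y \<otimes>\<^bsub>ring_of (local_ring A a b)\<^esub> local_map A a b c"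
        by (auto simp: cgenideal_def)
      then show False using n L.unitI[OF lc, of y] lc by (simp add: L.R.m_comm)
    qed
    obtain M where M: "maximalideal M (ring_of (local_ring A a b))" "?P \<subseteq> M"
      by (rule L.R.exists_maximalideal[OF I 1]) (rule that)
    have MI: "ideal M (ring_of (local_ring A a b))" by (rule maximalideal.axioms(1)[OF M(1)])
    let ?K = "quot_ideal (local_ring A a b) M" and ?q = "quot_map (local_ring A a b) M"
    have K: "cinf_field ?K" by (rule quot_maximal_field[OF L.cinf_ring_axioms M(1)])
    interpret K: cinf_ring ?K using K by (simp add: cinf_field_def)
    let ?\<phi> = "compose (carrier A) ?q (local_map A a b)"
    have \<phi>: "?\<phi> \<in> cinf_hom A ?K"
      by (rule cinf_hom_compose[OF local_map_hom L.quot_map_hom[OF MI] cinf_ring_axioms])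
    let ?p = "{x \<in> carrier A. ?\<phi> x = \<zero>\<^bsub>ring_of ?K\<^esub>}"
    have p: "?p \<in> cinf_Spec A" by (rule kernel_spec[OF K \<phi>])
    have "?\<phi> a \<in> Units (ring_of ?K)"
      using cinf_hom_unit[OF L.cinf_ring_axioms K.cinf_ring_axioms L.quot_map_hom[OF MI] local_map_unit] a
      by (simp add: compose_def)
    then have "?\<phi> a \<noteq> \<zero>\<^bsub>ring_of ?K\<^esub>" using K K.zero_unit by (auto simp: cinf_field_def)
    then have na: "a \<notin> ?p" by simp
    have "b \<in> rad_principal A b" using rad_principal_iff[OF b] b by (simp add: Z_inf_def)
    then have "?\<phi> b = \<zero>\<^bsub>ring_of ?K\<^esub>"
      using local_map_rad[of b] cinf_hom_zero(1)[OF L.cinf_ring_axioms K.cinf_ring_axioms L.quot_map_hom[OF MI]] b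
      by (simp add: compose_def)
    then have bp: "b \<in> ?p" using b by simp
    have "local_map A a b c \<in> M" using M(2) L.R.cgenideal_self[of "local_map A a b c"] lc by auto
    then have "?\<phi> c = \<zero>\<^bsub>ring_of ?K\<^esub>" using L.quot_map_zero_iff[OF MI lc] c by (simp add: compose_def)
    then have cp: "c \<in> ?p" using c by simp
    have "?p \<in> D_inf A a \<inter> Z_inf A b" using p na bp unfolding D_inf_def Z_inf_def by blast
    then have "?p \<in> D_inf A c" using sub by blast
    then show False using cp unfolding D_inf_def by blast
  qed
qed

text \<open>If c vanishes on the open set, then a c vanishes on all of the closed set of b, so it
  lies in the radical of b and is killed; the unit a cancels. The converse again uses field
  homomorphisms.\<close>

lemma local_zero_iff:
  assumes c: "c \<in> carrier A"
  shows "local_map A a b c = \<zero>\<^bsub>ring_of (local_ring A a b)\<^esub> \<longleftrightarrow> D_inf A a \<inter> Z_inf A b \<subseteq> Z_inf A c"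
proof
  interpret L: cinf_ring "local_ring A a b" by (rule local_cinf_ring)
  note ar = cinf_hom_arith[OF cinf_ring_axioms L.cinf_ring_axioms local_map_hom]
  note lc = cinf_hom_closed[OF local_map_hom]
  assume z: "local_map A a b c = \<zero>\<^bsub>ring_of (local_ring A a b)\<^esub>"
  show "D_inf A a \<inter> Z_inf A b \<subseteq> Z_inf A c"
  proof
    fix p assume "p \<in> D_inf A a \<inter> Z_inf A b"
    then have p: "p \<in> cinf_Spec A" "a \<notin> p" "b \<in> p" by (auto simp: D_inf_def Z_inf_def)
    have "c \<in> p"
    proof (rule ccontr)
      assume "c \<notin> p"
      \<comment> \<open>Working with the product gives one field in which both a and c
        survive.\<close>
      let ?d = "a \<otimes>\<^bsub>ring_of A\<^esub> c"
      have d: "?d \<in> carrier A" "?d \<notin> p" using Spec_prime[OF p(1) a c] p(2) \<open>c \<notin> p\<close> a c by auto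
      obtain K :: "'a set frac_term set set cinf" and \<phi> where K: "cinf_field K" "\<phi> \<in> cinf_hom A K"
        "\<And>x. x \<in> p \<Longrightarrow> \<phi> x = \<zero>\<^bsub>ring_of K\<^esub>" "\<phi> ?d \<in> Units (ring_of K)"
        by (rule Spec_field[OF p(1) d]) (rule that)
      interpret K: cinf_ring K using K(1) by (simp add: cinf_field_def)
      note kc = cinf_hom_closed[OF K(2)]
      have ac: "\<phi> ?d = \<phi> a \<otimes>\<^bsub>ring_of K\<^esub> \<phi> c" by (rule cinf_hom_arith(1)[OF cinf_ring_axioms K.cinf_ring_axioms K(2) a c])
      have "\<phi> a \<noteq> \<zero>\<^bsub>ring_of K\<^esub>" "\<phi> c \<noteq> \<zero>\<^bsub>ring_of K\<^esub>"
        using K(1,4) K.zero_unit kc a c unfolding ac by (auto simp: cinf_field_def)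
      then have ua: "\<phi> a \<in> Units (ring_of K)" and nc: "\<phi> c \<noteq> \<zero>\<^bsub>ring_of K\<^esub>"
        using K(1) kc[OF a] by (auto simp: cinf_field_def)
      have "\<phi> c = \<zero>\<^bsub>ring_of K\<^esub>" if "c \<in> rad_principal A b" for c
        using that p K(3) rad_principal_iff[OF b, of c] by (auto simp: Z_inf_def)
      then obtain \<kappa> where \<kappa>: "\<kappa> \<in> cinf_hom (local_ring A a b) K"
        "\<And>x. x \<in> carrier A \<Longrightarrow> \<kappa> (local_map A a b x) = \<phi> x"
        using local_lift[OF K.cinf_ring_axioms K(2) ua] by metis
      show False
        using nc \<kappa>(2)[OF c] z cinf_hom_zero(1)[OF L.cinf_ring_axioms K.cinf_ring_axioms \<kappa>(1)] by simp
    qed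
    then show "p \<in> Z_inf A c" using p by (simp add: Z_inf_def)
  qed
next
  interpret L: cinf_ring "local_ring A a b" by (rule local_cinf_ring)
  note ar = cinf_hom_arith[OF cinf_ring_axioms L.cinf_ring_axioms local_map_hom]
  note lc = cinf_hom_closed[OF local_map_hom]
  assume sub: "D_inf A a \<inter> Z_inf A b \<subseteq> Z_inf A c"
  let ?d = "a \<otimes>\<^bsub>ring_of A\<^esub> c"
  have "?d \<in> p" if "p \<in> Z_inf A b" for p
  proof -
    have p: "p \<in> cinf_Spec A" using that by (simp add: Z_inf_def)
    show ?thesis using Spec_prime[OF p a c] that sub p by (auto simp: D_inf_def Z_inf_def)
  qed
  then have "?d \<in> rad_principal A b" using rad_principal_iff[OF b] a c by simp
  then have "local_map A a b a \<otimes>\<^bsub>ring_of (local_ring A a b)\<^esub> local_map A a b c = \<zero>\<^bsub>ring_of (local_ring A a b)\<^esub>"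
    using local_map_rad ar(1)[OF a c] by simp
  then show "local_map A a b c = \<zero>\<^bsub>ring_of (local_ring A a b)\<^esub>"
    using L.R.Units_l_cancel[OF local_map_unit, of "local_map A a b c" "\<zero>\<^bsub>ring_of (local_ring A a b)\<^esub>"]
      lc[OF a] lc[OF c] by simp
qed

end

end

section \<open>Transition maps and the presheaf on basic open sets\<close>

context cinf_ring
begin

text \<open>\<open>local_unit_iff\<close> and \<open>local_zero_iff\<close> turn the inclusion of
  open sets into the hypotheses of \<open>local_lift\<close>; uniqueness is that of homomorphisms
  out of a local ring.\<close>

lemma transition_ex1:
  assumes ab: "a \<in> carrier A" "b \<in> carrier A" "a' \<in> carrier A" "b' \<in> carrier A"
    and sub: "D_inf A a \<inter> Z_inf A b \<subseteq> D_inf A a' \<inter> Z_inf A b'"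
  shows "\<exists>!\<phi>. \<phi> \<in> cinf_hom (local_ring A a' b') (local_ring A a b) \<and>
    compose (carrier A) \<phi> (local_map A a' b') = local_map A a b"
proof -
  interpret L: cinf_ring "local_ring A a b" by (rule local_cinf_ring[OF ab(1,2)])
  note h = local_map_hom[OF ab(1,2)]
  have u: "local_map A a b a' \<in> Units (ring_of (local_ring A a b))"
    using local_unit_iff[OF ab(1,2,3)] sub by blast
  have z: "local_map A a b c = \<zero>\<^bsub>ring_of (local_ring A a b)\<^esub>" if "c \<in> rad_principal A b'" for c
  proof -
    have c: "c \<in> carrier A" "\<forall>p\<in>Z_inf A b'. c \<in> p" using that rad_principal_iff[OF ab(4)] by auto
    then have "D_inf A a \<inter> Z_inf A b \<subseteq> Z_inf A c" using sub by (force simp: Z_inf_def)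
    then show ?thesis using local_zero_iff[OF ab(1,2) c(1)] by simp
  qed
  obtain \<kappa> where \<kappa>: "\<kappa> \<in> cinf_hom (local_ring A a' b') (local_ring A a b)"
    "\<And>x. x \<in> carrier A \<Longrightarrow> \<kappa> (local_map A a' b' x) = local_map A a b x"
    by (rule local_lift[OF ab(3,4) L.cinf_ring_axioms h u], erule z) (rule that)
  show ?thesis
  proof (rule ex1I[of _ \<kappa>])
    have "compose (carrier A) \<kappa> (local_map A a' b') = local_map A a b"
      by (rule extensionalityI[OF compose_extensional cinf_hom_ext[OF h]]) (simp add: compose_def \<kappa>(2))
    then show "\<kappa> \<in> cinf_hom (local_ring A a' b') (local_ring A a b) \<and>
      compose (carrier A) \<kappa> (local_map A a' b') = local_map A a b" using \<kappa>(1) by simp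
    fix \<phi> assume \<phi>: "\<phi> \<in> cinf_hom (local_ring A a' b') (local_ring A a b) \<and>
      compose (carrier A) \<phi> (local_map A a' b') = local_map A a b"
    show "\<phi> = \<kappa>"
    proof (rule local_hom_eqI[OF ab(3,4) L.cinf_ring_axioms _ \<kappa>(1)])
      fix x assume x: "x \<in> carrier A"
      have "compose (carrier A) \<phi> (local_map A a' b') x = local_map A a b x" using \<phi> by simp
      then show "\<phi> (local_map A a' b' x) = \<kappa> (local_map A a' b' x)" using x \<kappa>(2) by (simp add: compose_def)
    qed (use \<phi> in simp)
  qed
qed

lemma transition_spec:
  assumes ab: "a \<in> carrier A" "b \<in> carrier A" "a' \<in> carrier A" "b' \<in> carrier A"
    and sub: "D_inf A a \<inter> Z_inf A b \<subseteq> D_inf A a' \<inter> Z_inf A b'"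
  shows transition_hom: "transition A a' b' a b \<in> cinf_hom (local_ring A a' b') (local_ring A a b)"
    and transition_map: "x \<in> carrier A \<Longrightarrow> transition A a' b' a b (local_map A a' b' x) = local_map A a b x"
proof -
  have *: "transition A a' b' a b \<in> cinf_hom (local_ring A a' b') (local_ring A a b) \<and>
    compose (carrier A) (transition A a' b' a b) (local_map A a' b') = local_map A a b"
    unfolding transition_def by (rule theI'[OF transition_ex1[OF assms]])
  then show "transition A a' b' a b \<in> cinf_hom (local_ring A a' b') (local_ring A a b)" by simp
  assume x: "x \<in> carrier A"
  have "compose (carrier A) (transition A a' b' a b) (local_map A a' b') x = local_map A a b x" using * by simp
  then show "transition A a' b' a b (local_map A a' b' x) = local_map A a b x" using x by (simp add: compose_def)
qed

text \<open>Both sides are homomorphisms out of one local ring that agree on the image of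
  \<open>A\<close>.\<close>

lemma transition_comp:
  assumes ab: "a \<in> carrier A" "b \<in> carrier A" "a' \<in> carrier A" "b' \<in> carrier A" "a'' \<in> carrier A" "b'' \<in> carrier A"
    and sub: "D_inf A a \<inter> Z_inf A b \<subseteq> D_inf A a' \<inter> Z_inf A b'" "D_inf A a' \<inter> Z_inf A b' \<subseteq> D_inf A a'' \<inter> Z_inf A b''"
    and x: "x \<in> carrier (local_ring A a'' b'')"
  shows "transition A a' b' a b (transition A a'' b'' a' b' x) = transition A a'' b'' a b x"
proof -
  note t1 = transition_hom[OF ab(1-4) sub(1)] and m1 = transition_map[OF ab(1-4) sub(1)]
  note t2 = transition_hom[OF ab(3-6) sub(2)] and m2 = transition_map[OF ab(3-6) sub(2)]
  note t3 = transition_hom[OF ab(1,2,5,6) order.trans[OF sub]] and m3 = transition_map[OF ab(1,2,5,6) order.trans[OF sub]]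
  note L = local_cinf_ring[OF ab(5,6)]
  have "compose (carrier (local_ring A a'' b'')) (transition A a' b' a b) (transition A a'' b'' a' b') =
    transition A a'' b'' a b"
  proof (rule local_hom_eqI[OF ab(5,6) local_cinf_ring[OF ab(1,2)] cinf_hom_compose[OF t2 t1 L] t3])
    fix x assume x: "x \<in> carrier A"
    show "compose (carrier (local_ring A a'' b'')) (transition A a' b' a b) (transition A a'' b'' a' b') (local_map A a'' b'' x) =
      transition A a'' b'' a b (local_map A a'' b'' x)"
      using cinf_hom_closed[OF local_map_hom[OF ab(5,6)] x] m1[OF x] m2[OF x] m3[OF x] by (simp add: compose_def)
  qed
  from fun_cong[OF this, of x] show ?thesis using x by (simp add: compose_def)
qed

lemma transition_id:
  assumes ab: "a \<in> carrier A" "b \<in> carrier A" and x: "x \<in> carrier (local_ring A a b)"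
  shows "transition A a b a b x = x"
proof -
  note L = local_cinf_ring[OF ab]
  have "transition A a b a b = cinf_id (local_ring A a b)"
  proof (rule local_hom_eqI[OF ab L transition_hom[OF ab ab] cinf_id_hom[OF L]])
    fix x assume x: "x \<in> carrier A"
    show "transition A a b a b (local_map A a b x) = cinf_id (local_ring A a b) (local_map A a b x)"
      using transition_map[OF ab ab _ x] cinf_hom_closed[OF local_map_hom[OF ab] x] by (simp add: cinf_id_def)
  qed simp
  then show ?thesis using x by (simp add: cinf_id_def)
qed

lemma pairsD:
  assumes "(a, b) \<in> pairs A U"
  shows "a \<in> carrier A" "b \<in> carrier A" "D_inf A a \<inter> Z_inf A b = U"
  using assms by (auto simp: pairs_def)

lemma basic_opens_obtain:
  assumes "U \<in> basic_opens A"
  obtains a b where "(a, b) \<in> pairs A U"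
  using assms unfolding basic_opens_def pairs_def by blast

lemma F_carrier_iff:
  "s \<in> carrier (F_obj A U) \<longleftrightarrow> s \<in> extensional (pairs A U) \<and>
    (\<forall>a b. (a, b) \<in> pairs A U \<longrightarrow> s (a, b) \<in> carrier (local_ring A a b)) \<and>
    (\<forall>a b a' b'. (a, b) \<in> pairs A U \<longrightarrow> (a', b') \<in> pairs A U \<longrightarrow> transition A a' b' a b (s (a', b')) = s (a, b))"
  unfolding F_obj_def by (simp add: PiE_iff Ball_def split_paired_All) blast

lemma sop_F:
  "sop (F_obj A U) n F s = (\<lambda>(a, b)\<in>pairs A U. sop (local_ring A a b) n F (\<lambda>i. s i (a, b)))"
proof -
  have "(\<lambda>i\<in>{..<n}. restrict s {..<n} i (a, b)) = (\<lambda>i\<in>{..<n}. s i (a, b))" for a b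
    by (rule restrict_ext) simp
  then show ?thesis unfolding sop_def F_obj_def by simp
qed

lemma sop_F_at:
  "(a, b) \<in> pairs A U \<Longrightarrow> sop (F_obj A U) n F s (a, b) = sop (local_ring A a b) n F (\<lambda>i. s i (a, b))"
  unfolding sop_F by simp

lemma sop_F_ext: "sop (F_obj A U) n F s \<in> extensional (pairs A U)"
  unfolding sop_F by simp

lemma F_at: "s \<in> carrier (F_obj A U) \<Longrightarrow> (a, b) \<in> pairs A U \<Longrightarrow> s (a, b) \<in> carrier (local_ring A a b)"
  by (simp add: F_carrier_iff)

lemma F_transition:
  "s \<in> carrier (F_obj A U) \<Longrightarrow> (a, b) \<in> pairs A U \<Longrightarrow> (a', b') \<in> pairs A U \<Longrightarrow>
   transition A a' b' a b (s (a', b')) = s (a, b)"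
  by (simp add: F_carrier_iff)

lemma F_ext_eq:
  assumes "s \<in> extensional (pairs A U)" "t \<in> extensional (pairs A U)" "\<And>a b. (a, b) \<in> pairs A U \<Longrightarrow> s (a, b) = t (a, b)"
  shows "s = t"
  by (rule extensionalityI[OF assms(1,2)]) (use assms(3) in auto)

text \<open>The transition maps determine all components of a compatible family from any one of
  them, so computations in \<open>F_obj\<close> can be made at a single pair.\<close>

lemma F_eqI:
  assumes s: "s \<in> carrier (F_obj A U)" and t: "t \<in> carrier (F_obj A U)" and ab: "(a, b) \<in> pairs A U"
    and eq: "s (a, b) = t (a, b)"
  shows "s = t"
proof (rule F_ext_eq)
  fix a' b' assume ab': "(a', b') \<in> pairs A U"
  show "s (a', b') = t (a', b')"
    using F_transition[OF s ab' ab] F_transition[OF t ab' ab] eq by simp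
qed (use s t in \<open>auto simp: F_carrier_iff\<close>)

lemma F_cinf_ring: "cinf_ring (F_obj A U)"
proof (rule cinf_ringI)
  fix n F x assume F: "csm n F" and x: "\<And>i. i < n \<Longrightarrow> x i \<in> carrier (F_obj A U)"
  show "sop (F_obj A U) n F x \<in> carrier (F_obj A U)"
    unfolding F_carrier_iff
  proof (intro conjI allI impI sop_F_ext)
    fix a b assume ab: "(a, b) \<in> pairs A U"
    interpret L: cinf_ring "local_ring A a b" by (rule local_cinf_ring[OF pairsD(1,2)[OF ab]])
    show "sop (F_obj A U) n F x (a, b) \<in> carrier (local_ring A a b)"
      unfolding sop_F_at[OF ab] by (rule L.sop_closed[OF F F_at[OF x ab]])
    fix a' b' assume ab': "(a', b') \<in> pairs A U"
    have t: "transition A a' b' a b \<in> cinf_hom (local_ring A a' b') (local_ring A a b)"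
      by (rule transition_hom) (use pairsD[OF ab] pairsD[OF ab'] in auto)
    show "transition A a' b' a b (sop (F_obj A U) n F x (a', b')) = sop (F_obj A U) n F x (a, b)"
    proof -
      have "transition A a' b' a b (sop (F_obj A U) n F x (a', b')) =
        sop (local_ring A a b) n F (\<lambda>i. transition A a' b' a b (x i (a', b')))"
        unfolding sop_F_at[OF ab'] by (rule hom_sop[OF t F F_at[OF x ab']])
      also have "\<dots> = sop (local_ring A a b) n F (\<lambda>i. x i (a, b))"
        by (rule sop_cong) (rule F_transition[OF x ab ab'])
      finally show ?thesis unfolding sop_F_at[OF ab] .
    qed
  qed
next
  fix n i :: nat and x assume i: "i < n" and x: "\<And>i. i < n \<Longrightarrow> x i \<in> carrier (F_obj A U)"
  show "sop (F_obj A U) n (\<lambda>v. v i) x = x i"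
  proof (rule F_ext_eq[OF sop_F_ext])
    show "x i \<in> extensional (pairs A U)" using x[OF i] by (simp add: F_carrier_iff)
    fix a b assume ab: "(a, b) \<in> pairs A U"
    interpret L: cinf_ring "local_ring A a b" by (rule local_cinf_ring[OF pairsD(1,2)[OF ab]])
    show "sop (F_obj A U) n (\<lambda>v. v i) x (a, b) = x i (a, b)"
      unfolding sop_F_at[OF ab] by (rule L.sop_coord[OF i F_at[OF x ab]])
  qed
next
  fix n m F and G :: "nat \<Rightarrow> (nat \<Rightarrow> real) \<Rightarrow> real" and x
  assume F: "csm m F" and G: "\<And>j. csm n (G j)" and x: "\<And>i. i < n \<Longrightarrow> x i \<in> carrier (F_obj A U)"
  show "sop (F_obj A U) n (\<lambda>v. F (\<lambda>j. G j v)) x = sop (F_obj A U) m F (\<lambda>j. sop (F_obj A U) n (G j) x)"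
  proof (rule F_ext_eq[OF sop_F_ext sop_F_ext])
    fix a b assume ab: "(a, b) \<in> pairs A U"
    interpret L: cinf_ring "local_ring A a b" by (rule local_cinf_ring[OF pairsD(1,2)[OF ab]])
    show "sop (F_obj A U) n (\<lambda>v. F (\<lambda>j. G j v)) x (a, b) = sop (F_obj A U) m F (\<lambda>j. sop (F_obj A U) n (G j) x) (a, b)"
      unfolding sop_F_at[OF ab] by (rule L.sop_comp[OF F G F_at[OF x ab]])
  qed
qed

lemma F_eval_hom:
  assumes ab: "(a, b) \<in> pairs A U"
  shows "(\<lambda>s\<in>carrier (F_obj A U). s (a, b)) \<in> cinf_hom (F_obj A U) (local_ring A a b)"
proof (rule cinf_homI)
  interpret F: cinf_ring "F_obj A U" by (rule F_cinf_ring)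
  show "(\<lambda>s\<in>carrier (F_obj A U). s (a, b)) \<in> carrier (F_obj A U) \<rightarrow>\<^sub>E carrier (local_ring A a b)"
    using F_at[OF _ ab] by auto
  fix n F x assume F: "csm n F" and x: "\<And>i. i < n \<Longrightarrow> x i \<in> carrier (F_obj A U)"
  have "sop (local_ring A a b) n F (\<lambda>i. (\<lambda>s\<in>carrier (F_obj A U). s (a, b)) (x i)) =
    sop (local_ring A a b) n F (\<lambda>i. x i (a, b))"
    by (rule sop_cong) (simp add: x)
  then show "(\<lambda>s\<in>carrier (F_obj A U). s (a, b)) (sop (F_obj A U) n F x) =
    sop (local_ring A a b) n F (\<lambda>i. (\<lambda>s\<in>carrier (F_obj A U). s (a, b)) (x i))"
    using F.sop_closed[OF F x] sop_F_at[OF ab] by simp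
qed

lemma F_eval_surj:
  assumes ab: "(a, b) \<in> pairs A U" and y: "y \<in> carrier (local_ring A a b)"
  obtains s where "s \<in> carrier (F_obj A U)" "s (a, b) = y"
proof
  note p = pairsD[OF ab]
  define s where "s = (\<lambda>(a', b')\<in>pairs A U. transition A a b a' b' y)"
  have at: "s (a', b') = transition A a b a' b' y" if "(a', b') \<in> pairs A U" for a' b'
    using that by (simp add: s_def)
  show "s (a, b) = y" using at[OF ab] transition_id[OF p(1,2) y] by simp
  have t: "transition A a b a' b' \<in> cinf_hom (local_ring A a b) (local_ring A a' b')"
    if "(a', b') \<in> pairs A U" for a' b'
    by (rule transition_hom) (use pairsD[OF that] p in auto)
  show "s \<in> carrier (F_obj A U)"
    unfolding F_carrier_iff
  proof (intro conjI allI impI)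
    show "s \<in> extensional (pairs A U)" by (simp add: s_def)
    fix a1 b1 assume 1: "(a1, b1) \<in> pairs A U"
    show "s (a1, b1) \<in> carrier (local_ring A a1 b1)" using at[OF 1] cinf_hom_closed[OF t[OF 1] y] by simp
    fix a2 b2 assume 2: "(a2, b2) \<in> pairs A U"
    show "transition A a2 b2 a1 b1 (s (a2, b2)) = s (a1, b1)"
      unfolding at[OF 1] at[OF 2]
      by (rule transition_comp[OF _ _ _ _ _ _ _ _ y]) (use pairsD[OF 1] pairsD[OF 2] p in auto)
  qed
qed

text \<open>Compatibility of the section together with \<open>transition_comp\<close> makes the
  result independent of the pair chosen for the larger set, so the description in
  \<open>F_res\<close> denotes.\<close>

lemma F_res_at:
  assumes U: "U \<subseteq> U'" and s: "s \<in> carrier (F_obj A U')" and ab: "(a, b) \<in> pairs A U" and ab': "(a', b') \<in> pairs A U'"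
  shows "F_res A U' U s (a, b) = transition A a' b' a b (s (a', b'))"
proof -
  note p = pairsD[OF ab] and p' = pairsD[OF ab']
  have eq: "transition A a1 b1 a b (s (a1, b1)) = transition A a' b' a b (s (a', b'))"
    if 1: "(a1, b1) \<in> pairs A U'" for a1 b1
  proof -
    have "transition A a1 b1 a b (s (a1, b1)) = transition A a1 b1 a b (transition A a' b' a1 b1 (s (a', b')))"
      using F_transition[OF s 1 ab'] by simp
    also have "\<dots> = transition A a' b' a b (s (a', b'))"
      by (rule transition_comp[OF _ _ _ _ _ _ _ _ F_at[OF s ab']]) (use pairsD[OF 1] p p' U in auto)
    finally show ?thesis .
  qed
  have "(THE y. \<forall>(a', b')\<in>pairs A U'. transition A a' b' a b (s (a', b')) = y) = transition A a' b' a b (s (a', b'))"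
  proof (rule the_equality)
    show "\<forall>(a1, b1)\<in>pairs A U'. transition A a1 b1 a b (s (a1, b1)) = transition A a' b' a b (s (a', b'))"
      using eq by auto
    show "y = transition A a' b' a b (s (a', b'))"
      if "\<forall>(a1, b1)\<in>pairs A U'. transition A a1 b1 a b (s (a1, b1)) = y" for y
      using bspec[OF that ab'] by simp
  qed
  then show ?thesis using ab by (simp add: F_res_def)
qed

lemma F_res_ext: "F_res A U' U s \<in> extensional (pairs A U)"
  by (simp add: F_res_def)

lemma F_res_closed:
  assumes U: "U \<subseteq> U'" "U' \<in> basic_opens A" and s: "s \<in> carrier (F_obj A U')"
  shows "F_res A U' U s \<in> carrier (F_obj A U)"
proof -
  obtain a' b' where ab': "(a', b') \<in> pairs A U'" using U(2) by (rule basic_opens_obtain)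
  note p' = pairsD[OF ab']
  show ?thesis
    unfolding F_carrier_iff
  proof (intro conjI allI impI F_res_ext)
    fix a b assume ab: "(a, b) \<in> pairs A U"
    have "transition A a' b' a b \<in> cinf_hom (local_ring A a' b') (local_ring A a b)"
      by (rule transition_hom) (use pairsD[OF ab] p' U in auto)
    then show "F_res A U' U s (a, b) \<in> carrier (local_ring A a b)"
      using F_res_at[OF U(1) s ab ab'] cinf_hom_closed F_at[OF s ab'] by metis
    fix a1 b1 assume 1: "(a1, b1) \<in> pairs A U"
    show "transition A a1 b1 a b (F_res A U' U s (a1, b1)) = F_res A U' U s (a, b)"
      unfolding F_res_at[OF U(1) s ab ab'] F_res_at[OF U(1) s 1 ab']
      by (rule transition_comp[OF _ _ _ _ _ _ _ _ F_at[OF s ab']]) (use pairsD[OF ab] pairsD[OF 1] p' U in auto)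
  qed
qed

lemma F_res_op:
  assumes U: "U \<subseteq> U'" "U' \<in> basic_opens A" and F: "csm n F" and x: "\<And>i. i < n \<Longrightarrow> x i \<in> carrier (F_obj A U')"
  shows "F_res A U' U (sop (F_obj A U') n F x) = sop (F_obj A U) n F (\<lambda>i. F_res A U' U (x i))"
proof (rule F_ext_eq[OF F_res_ext sop_F_ext])
  obtain a' b' where ab': "(a', b') \<in> pairs A U'" using U(2) by (rule basic_opens_obtain)
  interpret F: cinf_ring "F_obj A U'" by (rule F_cinf_ring)
  fix a b assume ab: "(a, b) \<in> pairs A U"
  have t: "transition A a' b' a b \<in> cinf_hom (local_ring A a' b') (local_ring A a b)"
    by (rule transition_hom) (use pairsD[OF ab] pairsD[OF ab'] U in auto)
  have "F_res A U' U (sop (F_obj A U') n F x) (a, b) = transition A a' b' a b (sop (F_obj A U') n F x (a', b'))"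
    by (rule F_res_at[OF U(1) F.sop_closed[OF F x] ab ab'])
  also have "\<dots> = sop (local_ring A a b) n F (\<lambda>i. transition A a' b' a b (x i (a', b')))"
    unfolding sop_F_at[OF ab'] by (rule hom_sop[OF t F F_at[OF x ab']])
  also have "\<dots> = sop (local_ring A a b) n F (\<lambda>i. F_res A U' U (x i) (a, b))"
    by (rule sop_cong) (rule F_res_at[OF U(1) x ab ab', symmetric])
  also have "\<dots> = sop (F_obj A U) n F (\<lambda>i. F_res A U' U (x i)) (a, b)"
    unfolding sop_F_at[OF ab] ..
  finally show "F_res A U' U (sop (F_obj A U') n F x) (a, b) = sop (F_obj A U) n F (\<lambda>i. F_res A U' U (x i)) (a, b)" .
qed

lemma F_res_self:
  assumes U: "U \<in> basic_opens A" and s: "s \<in> carrier (F_obj A U)"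
  shows "F_res A U U s = s"
proof -
  obtain a b where ab: "(a, b) \<in> pairs A U" using U by (rule basic_opens_obtain)
  show ?thesis
    by (rule F_eqI[OF F_res_closed[OF _ U s] s ab])
       (simp_all add: F_res_at[OF _ s ab ab] F_transition[OF s ab ab])
qed

lemma F_res_comp:
  assumes U: "U \<subseteq> U'" "U' \<subseteq> U''" "U' \<in> basic_opens A" "U'' \<in> basic_opens A" and s: "s \<in> carrier (F_obj A U'')"
  shows "F_res A U' U (F_res A U'' U' s) = F_res A U'' U s"
proof (rule F_ext_eq[OF F_res_ext F_res_ext])
  obtain a' b' where ab': "(a', b') \<in> pairs A U'" using U(3) by (rule basic_opens_obtain)
  obtain a'' b'' where ab'': "(a'', b'') \<in> pairs A U''" using U(4) by (rule basic_opens_obtain)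
  note s' = F_res_closed[OF U(2,4) s]
  fix a b assume ab: "(a, b) \<in> pairs A U"
  have "U \<subseteq> U''" using U by blast
  show "F_res A U' U (F_res A U'' U' s) (a, b) = F_res A U'' U s (a, b)"
    unfolding F_res_at[OF U(1) s' ab ab'] F_res_at[OF U(2) s ab' ab''] F_res_at[OF \<open>U \<subseteq> U''\<close> s ab ab'']
    by (rule transition_comp[OF _ _ _ _ _ _ _ _ F_at[OF s ab'']])
       (use pairsD[OF ab] pairsD[OF ab'] pairsD[OF ab''] U in auto)
qed

definition F_map :: "'a set set \<Rightarrow> 'a \<Rightarrow> 'a sec" where
  "F_map U = restrict (F_unit A U) (carrier A)"

lemma F_unit_at: "(a, b) \<in> pairs A U \<Longrightarrow> F_unit A U x (a, b) = local_map A a b x"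
  by (simp add: F_unit_def)

lemma F_unit_ext: "F_unit A U x \<in> extensional (pairs A U)"
  by (simp add: F_unit_def)

lemma F_unit_closed:
  assumes x: "x \<in> carrier A"
  shows "F_unit A U x \<in> carrier (F_obj A U)"
  unfolding F_carrier_iff
proof (intro conjI allI impI F_unit_ext)
  fix a b assume ab: "(a, b) \<in> pairs A U"
  show "F_unit A U x (a, b) \<in> carrier (local_ring A a b)"
    using F_unit_at[OF ab] cinf_hom_closed[OF local_map_hom[OF pairsD(1,2)[OF ab]] x] by simp
  fix a' b' assume ab': "(a', b') \<in> pairs A U"
  show "transition A a' b' a b (F_unit A U x (a', b')) = F_unit A U x (a, b)"
    unfolding F_unit_at[OF ab] F_unit_at[OF ab']
    by (rule transition_map[OF _ _ _ _ _ x]) (use pairsD[OF ab] pairsD[OF ab'] in auto)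
qed

lemma F_map_at: "x \<in> carrier A \<Longrightarrow> (a, b) \<in> pairs A U \<Longrightarrow> F_map U x (a, b) = local_map A a b x"
  by (simp add: F_map_def F_unit_at)

lemma F_map_hom: "F_map U \<in> cinf_hom A (F_obj A U)"
proof (rule cinf_homI)
  show "F_map U \<in> carrier A \<rightarrow>\<^sub>E carrier (F_obj A U)"
    unfolding F_map_def using F_unit_closed by auto
  fix n F x assume F: "csm n F" and x: "\<And>i. i < n \<Longrightarrow> x i \<in> carrier A"
  show "F_map U (sop A n F x) = sop (F_obj A U) n F (\<lambda>i. F_map U (x i))"
  proof (rule F_ext_eq[OF _ sop_F_ext])
    show "F_map U (sop A n F x) \<in> extensional (pairs A U)"
      using sop_closed[OF F x] F_unit_ext by (simp add: F_map_def)
    fix a b assume ab: "(a, b) \<in> pairs A U"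
    have "F_map U (sop A n F x) (a, b) = local_map A a b (sop A n F x)"
      by (rule F_map_at[OF _ ab]) (rule sop_closed[OF F x])
    also have "\<dots> = sop (local_ring A a b) n F (\<lambda>i. local_map A a b (x i))"
      by (rule hom_sop[OF local_map_hom[OF pairsD(1,2)[OF ab]] F x])
    also have "\<dots> = sop (local_ring A a b) n F (\<lambda>i. F_map U (x i) (a, b))"
      by (rule sop_cong) (rule F_map_at[OF x ab, symmetric])
    finally show "F_map U (sop A n F x) (a, b) = sop (F_obj A U) n F (\<lambda>i. F_map U (x i)) (a, b)"
      unfolding sop_F_at[OF ab] .
  qed
qed

lemma F_res_map:
  assumes U: "U \<subseteq> U'" "U' \<in> basic_opens A" and x: "x \<in> carrier A"
  shows "F_res A U' U (F_map U' x) = F_map U x"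
proof (rule F_ext_eq[OF F_res_ext])
  show "F_map U x \<in> extensional (pairs A U)" using F_unit_ext x by (simp add: F_map_def)
  obtain a' b' where ab': "(a', b') \<in> pairs A U'" using U(2) by (rule basic_opens_obtain)
  fix a b assume ab: "(a, b) \<in> pairs A U"
  show "F_res A U' U (F_map U' x) (a, b) = F_map U x (a, b)"
    unfolding F_res_at[OF U(1) cinf_hom_closed[OF F_map_hom x] ab ab'] F_map_at[OF x ab] F_map_at[OF x ab']
    by (rule transition_map[OF _ _ _ _ _ x]) (use pairsD[OF ab] pairsD[OF ab'] U in auto)
qed

lemma F_lift:
  assumes ab: "(a, b) \<in> pairs A U" and B: "cinf_ring B" and \<phi>: "\<phi> \<in> cinf_hom A B" and u: "\<phi> a \<in> Units (ring_of B)"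
    and z: "\<And>c. c \<in> rad_principal A b \<Longrightarrow> \<phi> c = \<zero>\<^bsub>ring_of B\<^esub>"
  obtains \<kappa> where "\<kappa> \<in> cinf_hom (F_obj A U) B" "\<And>x. x \<in> carrier A \<Longrightarrow> \<kappa> (F_map U x) = \<phi> x"
proof -
  interpret F: cinf_ring "F_obj A U" by (rule F_cinf_ring)
  obtain \<kappa> where \<kappa>: "\<kappa> \<in> cinf_hom (local_ring A a b) B" "\<And>x. x \<in> carrier A \<Longrightarrow> \<kappa> (local_map A a b x) = \<phi> x"
    by (rule local_lift[OF pairsD(1,2)[OF ab] B \<phi> u], erule z) (rule that)
  let ?\<kappa> = "compose (carrier (F_obj A U)) \<kappa> (\<lambda>s\<in>carrier (F_obj A U). s (a, b))"
  have "?\<kappa> \<in> cinf_hom (F_obj A U) B"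
    by (rule cinf_hom_compose[OF F_eval_hom[OF ab] \<kappa>(1) F.cinf_ring_axioms])
  moreover have "?\<kappa> (F_map U x) = \<phi> x" if "x \<in> carrier A" for x
    using \<kappa>(2)[OF that] cinf_hom_closed[OF F_map_hom that] F_map_at[OF that ab] by (simp add: compose_def)
  ultimately show ?thesis by (rule that)
qed

text \<open>Evaluation at one pair is an isomorphism onto the local ring with inverse
  \<open>inj\<close>, which transports \<open>local_hom_eqI\<close> to \<open>F_obj\<close>.\<close>

lemma F_hom_eqI:
  assumes ab: "(a, b) \<in> pairs A U" and B: "cinf_ring B"
    and \<phi>: "\<phi> \<in> cinf_hom (F_obj A U) B" and \<psi>: "\<psi> \<in> cinf_hom (F_obj A U) B"
    and eq: "\<And>x. x \<in> carrier A \<Longrightarrow> \<phi> (F_map U x) = \<psi> (F_map U x)"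
  shows "\<phi> = \<psi>"
proof (rule cinf_hom_eqI[OF \<phi> \<psi>])
  define inj where "inj y = (SOME s. s \<in> carrier (F_obj A U) \<and> s (a, b) = y)" for y
  have inj: "inj y \<in> carrier (F_obj A U)" "inj y (a, b) = y" if "y \<in> carrier (local_ring A a b)" for y
    using someI_ex[of "\<lambda>s. s \<in> carrier (F_obj A U) \<and> s (a, b) = y"] F_eval_surj[OF ab that]
    unfolding inj_def by metis+
  interpret L: cinf_ring "local_ring A a b" by (rule local_cinf_ring[OF pairsD(1,2)[OF ab]])
  interpret F: cinf_ring "F_obj A U" by (rule F_cinf_ring)
  have inj_hom: "restrict inj (carrier (local_ring A a b)) \<in> cinf_hom (local_ring A a b) (F_obj A U)"
  proof (rule cinf_homI)
    show "restrict inj (carrier (local_ring A a b)) \<in> carrier (local_ring A a b) \<rightarrow>\<^sub>E carrier (F_obj A U)"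
      using inj by auto
    fix n F x assume F: "csm n F" and x: "\<And>i. i < n \<Longrightarrow> x i \<in> carrier (local_ring A a b)"
    have "sop (F_obj A U) n F (\<lambda>i. restrict inj (carrier (local_ring A a b)) (x i)) = sop (F_obj A U) n F (\<lambda>i. inj (x i))"
      by (rule sop_cong) (simp add: x)
    also have "\<dots> = inj (sop (local_ring A a b) n F x)"
    proof (rule F_eqI[OF F.sop_closed[OF F inj(1)[OF x]] inj(1)[OF L.sop_closed[OF F x]] ab])
      have "sop (F_obj A U) n F (\<lambda>i. inj (x i)) (a, b) = sop (local_ring A a b) n F x"
        unfolding sop_F_at[OF ab] by (rule sop_cong) (rule inj(2)[OF x])
      then show "sop (F_obj A U) n F (\<lambda>i. inj (x i)) (a, b) = inj (sop (local_ring A a b) n F x) (a, b)"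
        using inj(2)[OF L.sop_closed[OF F x]] by simp
    qed
    finally show "restrict inj (carrier (local_ring A a b)) (sop (local_ring A a b) n F x) =
      sop (F_obj A U) n F (\<lambda>i. restrict inj (carrier (local_ring A a b)) (x i))"
      using L.sop_closed[OF F x] by simp
  qed
  let ?j = "restrict inj (carrier (local_ring A a b))"
  have "compose (carrier (local_ring A a b)) \<phi> ?j = compose (carrier (local_ring A a b)) \<psi> ?j"
  proof (rule local_hom_eqI[OF pairsD(1,2)[OF ab] B cinf_hom_compose[OF inj_hom \<phi> L.cinf_ring_axioms]
        cinf_hom_compose[OF inj_hom \<psi> L.cinf_ring_axioms]])
    fix x assume x: "x \<in> carrier A"
    have l: "local_map A a b x \<in> carrier (local_ring A a b)"
      by (rule cinf_hom_closed[OF local_map_hom[OF pairsD(1,2)[OF ab]] x])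
    have "inj (local_map A a b x) = F_map U x"
      by (rule F_eqI[OF inj(1)[OF l] cinf_hom_closed[OF F_map_hom x] ab])
         (simp add: inj(2)[OF l] F_map_at[OF x ab])
    then show "compose (carrier (local_ring A a b)) \<phi> ?j (local_map A a b x) =
      compose (carrier (local_ring A a b)) \<psi> ?j (local_map A a b x)"
      using l eq[OF x] by (simp add: compose_def)
  qed
  note eqj = fun_cong[OF this]
  fix s assume s: "s \<in> carrier (F_obj A U)"
  have "inj (s (a, b)) = s"
    by (rule F_eqI[OF inj(1)[OF F_at[OF s ab]] s ab]) (simp add: inj(2)[OF F_at[OF s ab]])
  then show "\<phi> s = \<psi> s" using eqj[of "s (a, b)"] F_at[OF s ab] by (simp add: compose_def)
qed

lemma F_zero_at: "(a, b) \<in> pairs A U \<Longrightarrow> \<zero>\<^bsub>ring_of (F_obj A U)\<^esub> (a, b) = \<zero>\<^bsub>ring_of (local_ring A a b)\<^esub>"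
  and F_one_at: "(a, b) \<in> pairs A U \<Longrightarrow> \<one>\<^bsub>ring_of (F_obj A U)\<^esub> (a, b) = \<one>\<^bsub>ring_of (local_ring A a b)\<^esub>"
  and F_mult_at: "(a, b) \<in> pairs A U \<Longrightarrow> (s \<otimes>\<^bsub>ring_of (F_obj A U)\<^esub> t) (a, b) = s (a, b) \<otimes>\<^bsub>ring_of (local_ring A a b)\<^esub> t (a, b)"
  unfolding ring_of_zero ring_of_one ring_of_mult cst_def by (simp_all add: sop_F_at) (auto intro!: sop_cong)

lemma F_unit_iff:
  assumes ab: "(a, b) \<in> pairs A U" and s: "s \<in> carrier (F_obj A U)"
  shows "s \<in> Units (ring_of (F_obj A U)) \<longleftrightarrow> s (a, b) \<in> Units (ring_of (local_ring A a b))"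
proof -
  interpret L: cinf_ring "local_ring A a b" by (rule local_cinf_ring[OF pairsD(1,2)[OF ab]])
  interpret F: cinf_ring "F_obj A U" by (rule F_cinf_ring)
  show ?thesis
  proof
    assume "s \<in> Units (ring_of (F_obj A U))"
    from cinf_hom_unit[OF F.cinf_ring_axioms L.cinf_ring_axioms F_eval_hom[OF ab] this]
    show "s (a, b) \<in> Units (ring_of (local_ring A a b))" using s by simp
  next
    assume u: "s (a, b) \<in> Units (ring_of (local_ring A a b))"
    obtain t where t: "t \<in> carrier (F_obj A U)" "t (a, b) = inv\<^bsub>ring_of (local_ring A a b)\<^esub> s (a, b)"
      by (rule F_eval_surj[OF ab L.R.Units_inv_closed[OF u]]) (rule that)
    have "s \<otimes>\<^bsub>ring_of (F_obj A U)\<^esub> t = \<one>\<^bsub>ring_of (F_obj A U)\<^esub>"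
      by (rule F_eqI[OF _ _ ab]) (use s t u in \<open>simp_all add: F_mult_at[OF ab] F_one_at[OF ab]\<close>)
    then show "s \<in> Units (ring_of (F_obj A U))" by (rule F.unitI[OF s t(1)])
  qed
qed

lemma F_map_unit_iff:
  assumes U: "U \<in> basic_opens A" and c: "c \<in> carrier A"
  shows "F_map U c \<in> Units (ring_of (F_obj A U)) \<longleftrightarrow> U \<subseteq> D_inf A c"
proof -
  obtain a b where ab: "(a, b) \<in> pairs A U" using U by (rule basic_opens_obtain)
  show ?thesis
    using F_unit_iff[OF ab cinf_hom_closed[OF F_map_hom c]] F_map_at[OF c ab]
      local_unit_iff[OF pairsD(1,2)[OF ab] c] pairsD(3)[OF ab] by simp
qed

lemma F_map_zero_iff:
  assumes U: "U \<in> basic_opens A" and c: "c \<in> carrier A"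
  shows "F_map U c = \<zero>\<^bsub>ring_of (F_obj A U)\<^esub> \<longleftrightarrow> U \<subseteq> Z_inf A c"
proof -
  obtain a b where ab: "(a, b) \<in> pairs A U" using U by (rule basic_opens_obtain)
  interpret F: cinf_ring "F_obj A U" by (rule F_cinf_ring)
  have "F_map U c = \<zero>\<^bsub>ring_of (F_obj A U)\<^esub> \<longleftrightarrow> F_map U c (a, b) = \<zero>\<^bsub>ring_of (F_obj A U)\<^esub> (a, b)"
    using F_eqI[OF cinf_hom_closed[OF F_map_hom c] F.R.zero_closed ab] by auto
  then show ?thesis
    using F_map_at[OF c ab] F_zero_at[OF ab]
      local_zero_iff[OF pairsD(1,2)[OF ab] c] pairsD(3)[OF ab] by simp
qed

lemma F_smooth_expr:
  assumes ab: "(a, b) \<in> pairs A U" and s: "s \<in> carrier (F_obj A U)"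
    "F_map U a \<otimes>\<^bsub>ring_of (F_obj A U)\<^esub> s = \<one>\<^bsub>ring_of (F_obj A U)\<^esub>" and x: "x \<in> carrier (F_obj A U)"
  shows "smooth_expr A (F_obj A U) (F_map U) s x"
proof -
  note p = pairsD[OF ab]
  interpret L: cinf_ring "local_ring A a b" by (rule local_cinf_ring[OF p(1,2)])
  interpret F: cinf_ring "F_obj A U" by (rule F_cinf_ring)
  have "local_map A a b a \<otimes>\<^bsub>ring_of (local_ring A a b)\<^esub> s (a, b) = \<one>\<^bsub>ring_of (local_ring A a b)\<^esub>"
    using arg_cong[OF s(2), of "\<lambda>t. t (a, b)"] F_mult_at[OF ab] F_one_at[OF ab] F_map_at[OF p(1) ab] by simp
  from local_smooth_expr[OF p(1,2) F_at[OF s(1) ab] this F_at[OF x ab]]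
  obtain m F y where F: "csm (Suc m) F" and y: "\<forall>i<m. y i \<in> carrier A"
    and xy: "x (a, b) = sop (local_ring A a b) (Suc m) F ((\<lambda>i. local_map A a b (y i))(m := s (a, b)))"
    unfolding smooth_expr_def by blast
  let ?u = "(\<lambda>i. F_map U (y i))(m := s)"
  have uc: "?u i \<in> carrier (F_obj A U)" if "i < Suc m" for i
    by (rule tuple_upd_closed[OF _ s(1) that]) (use y cinf_hom_closed[OF F_map_hom] in blast)
  have "x = sop (F_obj A U) (Suc m) F ?u"
  proof (rule F_eqI[OF x F.sop_closed[OF F uc] ab])
    show "x (a, b) = sop (F_obj A U) (Suc m) F ?u (a, b)"
      unfolding xy sop_F_at[OF ab]
    proof (rule sop_cong)
      fix i assume "i < Suc m"
      then show "((\<lambda>i. local_map A a b (y i))(m := s (a, b))) i = ?u i (a, b)"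
        using y F_map_at[OF _ ab] by (cases "i = m") simp_all
    qed
  qed
  then show ?thesis unfolding smooth_expr_def using F y by blast
qed

end

section \<open>Stalks and the associated sheaf\<close>

locale base_presheaf =
  fixes \<B> :: "'p set set" and F :: "'p set \<Rightarrow> 's cinf" and \<rho> :: "'p set \<Rightarrow> 'p set \<Rightarrow> 's \<Rightarrow> 's"
  assumes Int_base: "U \<in> \<B> \<Longrightarrow> V \<in> \<B> \<Longrightarrow> U \<inter> V \<in> \<B>"
    and ring: "U \<in> \<B> \<Longrightarrow> cinf_ring (F U)"
    and res_closed: "V \<subseteq> U \<Longrightarrow> U \<in> \<B> \<Longrightarrow> V \<in> \<B> \<Longrightarrow> s \<in> carrier (F U) \<Longrightarrow> \<rho> U V s \<in> carrier (F V)"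
    and res_op: "V \<subseteq> U \<Longrightarrow> U \<in> \<B> \<Longrightarrow> V \<in> \<B> \<Longrightarrow> csm n G \<Longrightarrow> (\<And>i. i < n \<Longrightarrow> x i \<in> carrier (F U)) \<Longrightarrow>
      \<rho> U V (sop (F U) n G x) = sop (F V) n G (\<lambda>i. \<rho> U V (x i))"
    and res_self: "U \<in> \<B> \<Longrightarrow> s \<in> carrier (F U) \<Longrightarrow> \<rho> U U s = s"
    and res_comp: "V \<subseteq> U \<Longrightarrow> W \<subseteq> V \<Longrightarrow> U \<in> \<B> \<Longrightarrow> V \<in> \<B> \<Longrightarrow> W \<in> \<B> \<Longrightarrow> s \<in> carrier (F U) \<Longrightarrow>
      \<rho> V W (\<rho> U V s) = \<rho> U W s"
begin

abbreviation "gm \<equiv> germ \<B> F \<rho>"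
abbreviation "st \<equiv> stalk \<B> F \<rho>"

text \<open>A germ is encoded as its whole equivalence class; transitivity comes from restricting to
  the intersection of two witnessing neighbourhoods.\<close>

lemma germ_eq_iff:
  assumes U: "U \<in> \<B>" "p \<in> U" "s \<in> carrier (F U)" and V: "V \<in> \<B>" "p \<in> V" "t \<in> carrier (F V)"
  shows "gm p U s = gm p V t \<longleftrightarrow> (\<exists>W\<in>\<B>. p \<in> W \<and> W \<subseteq> U \<inter> V \<and> \<rho> U W s = \<rho> V W t)"
proof
  assume eq: "gm p U s = gm p V t"
  have "(V, t) \<in> gm p V t" using V unfolding germ_def by auto
  then have "(V, t) \<in> gm p U s" using eq by simp
  then show "\<exists>W\<in>\<B>. p \<in> W \<and> W \<subseteq> U \<inter> V \<and> \<rho> U W s = \<rho> V W t" unfolding germ_def by simp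
next
  have sub: "gm p V t \<subseteq> gm p U s"
    if U: "U \<in> \<B>" "p \<in> U" "s \<in> carrier (F U)" and V: "V \<in> \<B>" "p \<in> V" "t \<in> carrier (F V)"
      and W: "W \<in> \<B>" "p \<in> W" "W \<subseteq> U \<inter> V" "\<rho> U W s = \<rho> V W t" for U V W s t
  proof
    fix z assume "z \<in> gm p V t"
    then obtain V' t' W1 where z: "z = (V', t')" and V': "V' \<in> \<B>" "p \<in> V'" "t' \<in> carrier (F V')"
      and W1: "W1 \<in> \<B>" "p \<in> W1" "W1 \<subseteq> V \<inter> V'" "\<rho> V W1 t = \<rho> V' W1 t'"
      unfolding germ_def by auto
    let ?X = "W \<inter> W1"
    have X: "?X \<in> \<B>" "p \<in> ?X" "?X \<subseteq> U \<inter> V'" using W W1 Int_base by auto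
    have s1: "W \<subseteq> U" "W \<subseteq> V" "W1 \<subseteq> V" "W1 \<subseteq> V'" "?X \<subseteq> W" "?X \<subseteq> W1" using W(3) W1(3) by auto
    have "\<rho> U ?X s = \<rho> W ?X (\<rho> U W s)" by (rule res_comp[OF s1(1,5) U(1) W(1) X(1) U(3), symmetric])
    also have "\<dots> = \<rho> V ?X t" unfolding W(4) by (rule res_comp[OF s1(2,5) V(1) W(1) X(1) V(3)])
    also have "\<dots> = \<rho> W1 ?X (\<rho> V W1 t)" by (rule res_comp[OF s1(3,6) V(1) W1(1) X(1) V(3), symmetric])
    also have "\<dots> = \<rho> V' ?X t'" unfolding W1(4) by (rule res_comp[OF s1(4,6) V'(1) W1(1) X(1) V'(3)])
    finally show "z \<in> gm p U s" using z V' X unfolding germ_def by auto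
  qed
  assume "\<exists>W\<in>\<B>. p \<in> W \<and> W \<subseteq> U \<inter> V \<and> \<rho> U W s = \<rho> V W t"
  then obtain W where W: "W \<in> \<B>" "p \<in> W" "W \<subseteq> U \<inter> V" "\<rho> U W s = \<rho> V W t" by blast
  have W': "W \<subseteq> V \<inter> U" using W(3) by blast
  show "gm p U s = gm p V t"
    by (rule equalityI[OF sub[OF V U W(1,2) W' W(4)[symmetric]] sub[OF U V W]])
qed

lemma germ_res:
  assumes "U \<in> \<B>" "s \<in> carrier (F U)" "W \<in> \<B>" "W \<subseteq> U" "p \<in> W"
  shows "gm p W (\<rho> U W s) = gm p U s"
proof -
  have c: "\<rho> U W s \<in> carrier (F W)" by (rule res_closed[OF assms(4,1,3,2)])
  have p: "p \<in> U" using assms by blast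
  have "\<rho> W W (\<rho> U W s) = \<rho> U W s" by (rule res_self[OF assms(3) c])
  then show ?thesis
    unfolding germ_eq_iff[OF assms(3,5) c assms(1) p assms(2)] using assms by blast
qed

lemma germ_in_stalk: "U \<in> \<B> \<Longrightarrow> p \<in> U \<Longrightarrow> s \<in> carrier (F U) \<Longrightarrow> gm p U s \<in> carrier (st p)"
  unfolding stalk_def by auto

lemma stalk_obtain:
  assumes "\<xi> \<in> carrier (st p)"
  obtains U s where "U \<in> \<B>" "p \<in> U" "s \<in> carrier (F U)" "\<xi> = gm p U s"
  using assms unfolding stalk_def by auto

text \<open>Neighbourhoods are intersected one at a time, which uses that the base is closed under
  intersections; \<open>W\<close> provides the start when n = 0.\<close>

lemma common_neighbourhood:
  fixes n :: nat
  assumes W: "W \<in> \<B>" "p \<in> W"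
    and P: "\<And>i. i < n \<Longrightarrow> \<exists>U\<in>\<B>. p \<in> U \<and> P i U"
    and shrink: "\<And>i U V. i < n \<Longrightarrow> P i U \<Longrightarrow> U \<in> \<B> \<Longrightarrow> V \<in> \<B> \<Longrightarrow> V \<subseteq> U \<Longrightarrow> P i V"
  shows "\<exists>U\<in>\<B>. p \<in> U \<and> U \<subseteq> W \<and> (\<forall>i<n. P i U)"
  using P shrink
proof (induction n)
  case 0
  then show ?case using W by auto
next
  case (Suc n)
  have "\<exists>U\<in>\<B>. p \<in> U \<and> U \<subseteq> W \<and> (\<forall>i<n. P i U)"
    by (rule Suc.IH) (use Suc.prems less_SucI in \<open>blast+\<close>)
  then obtain U where U: "U \<in> \<B>" "p \<in> U" "U \<subseteq> W" "\<forall>i<n. P i U" by blast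
  obtain V where V: "V \<in> \<B>" "p \<in> V" "P n V" using Suc.prems(1)[of n] by blast
  have I: "U \<inter> V \<in> \<B>" by (rule Int_base[OF U(1) V(1)])
  have "P i (U \<inter> V)" if "i < Suc n" for i
  proof (cases "i = n")
    case True
    then show ?thesis using Suc.prems(2)[OF that _ V(1) I] V(3) by blast
  next
    case False
    then have "P i U" using U(4) that by simp
    then show ?thesis using Suc.prems(2)[OF that _ U(1) I] by blast
  qed
  then show ?case using I U V by (intro bexI[of _ "U \<inter> V"]) auto
qed

lemma stalk_tuple:
  fixes n :: nat
  assumes W: "W \<in> \<B>" "p \<in> W" and \<xi>: "\<And>i. i < n \<Longrightarrow> \<xi> i \<in> carrier (st p)"
  obtains U s where "U \<in> \<B>" "p \<in> U" "\<And>i. i < n \<Longrightarrow> s i \<in> carrier (F U)" "\<And>i. i < n \<Longrightarrow> \<xi> i = gm p U (s i)"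
proof -
  \<comment> \<open>The guard on p makes the property hereditary also for smaller sets that miss
    p.\<close>
  let ?P = "\<lambda>i U. p \<in> U \<longrightarrow> (\<exists>s\<in>carrier (F U). \<xi> i = gm p U s)"
  have "\<exists>U\<in>\<B>. p \<in> U \<and> U \<subseteq> W \<and> (\<forall>i<n. ?P i U)"
  proof (rule common_neighbourhood[OF W])
    fix i assume "i < n"
    then obtain U s where "U \<in> \<B>" "p \<in> U" "s \<in> carrier (F U)" "\<xi> i = gm p U s"
      using stalk_obtain[OF \<xi>] by metis
    then show "\<exists>U\<in>\<B>. p \<in> U \<and> ?P i U" by blast
  next
    fix i U V assume P: "?P i U" and UV: "U \<in> \<B>" "V \<in> \<B>" "V \<subseteq> U"
    show "?P i V"
    proof
      assume p: "p \<in> V"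
      then obtain s where s: "s \<in> carrier (F U)" "\<xi> i = gm p U s" using P UV by blast
      have "\<xi> i = gm p V (\<rho> U V s)" using germ_res[OF UV(1) s(1) UV(2,3) p] s(2) by simp
      then show "\<exists>s\<in>carrier (F V). \<xi> i = gm p V s" using res_closed[OF UV(3,1,2) s(1)] by blast
    qed
  qed
  then obtain U where U: "U \<in> \<B>" "p \<in> U" "\<forall>i<n. \<exists>s\<in>carrier (F U). \<xi> i = gm p U s" by blast
  then have "\<forall>i. \<exists>s. i < n \<longrightarrow> s \<in> carrier (F U) \<and> \<xi> i = gm p U s" by blast
  from choice[OF this] obtain s where "\<forall>i. i < n \<longrightarrow> s i \<in> carrier (F U) \<and> \<xi> i = gm p U (s i)" ..
  then show ?thesis using that[OF U(1,2), of s] by blast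
qed

text \<open>Makes the description in \<open>stalk\<close> well defined: finitely many equalities of
  germs hold on one common neighbourhood, and restriction commutes with operations.\<close>

lemma germ_sop_eq:
  assumes U: "U \<in> \<B>" "p \<in> U" "\<And>i. i < n \<Longrightarrow> s i \<in> carrier (F U)"
    and V: "V \<in> \<B>" "p \<in> V" "\<And>i. i < n \<Longrightarrow> t i \<in> carrier (F V)"
    and eq: "\<And>i. i < n \<Longrightarrow> gm p U (s i) = gm p V (t i)" and G: "csm n G"
  shows "gm p U (sop (F U) n G s) = gm p V (sop (F V) n G t)"
proof -
  interpret FU: cinf_ring "F U" by (rule ring[OF U(1)])
  interpret FV: cinf_ring "F V" by (rule ring[OF V(1)])
  have I: "U \<inter> V \<in> \<B>" "p \<in> U \<inter> V" using Int_base U V by auto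
  let ?P = "\<lambda>i W. W \<subseteq> U \<inter> V \<and> \<rho> U W (s i) = \<rho> V W (t i)"
  have "\<exists>W\<in>\<B>. p \<in> W \<and> W \<subseteq> U \<inter> V \<and> (\<forall>i<n. ?P i W)"
  proof (rule common_neighbourhood[OF I])
    show "\<exists>W\<in>\<B>. p \<in> W \<and> ?P i W" if "i < n" for i
      using eq[OF that] germ_eq_iff[OF U(1,2) U(3)[OF that] V(1,2) V(3)[OF that]] by blast
  next
    fix i W X assume i: "i < n" and P: "?P i W" and W: "W \<in> \<B>" "X \<in> \<B>" "X \<subseteq> W"
    have WU: "W \<subseteq> U" "W \<subseteq> V" using P by auto
    have "\<rho> U X (s i) = \<rho> W X (\<rho> U W (s i))" by (rule res_comp[OF WU(1) W(3) U(1) W(1,2) U(3)[OF i], symmetric])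
    also have "\<dots> = \<rho> W X (\<rho> V W (t i))" using P by simp
    also have "\<dots> = \<rho> V X (t i)" by (rule res_comp[OF WU(2) W(3) V(1) W(1,2) V(3)[OF i]])
    finally show "?P i X" using P W(3) by blast
  qed
  then obtain W where W: "W \<in> \<B>" "p \<in> W" "W \<subseteq> U \<inter> V" "\<forall>i<n. ?P i W" by blast
  have WU: "W \<subseteq> U" "W \<subseteq> V" using W by auto
  have "\<rho> U W (sop (F U) n G s) = sop (F W) n G (\<lambda>i. \<rho> U W (s i))"
    by (rule res_op[OF WU(1) U(1) W(1) G U(3)])
  also have "\<dots> = sop (F W) n G (\<lambda>i. \<rho> V W (t i))"
    by (rule sop_cong) (use W(4) in blast)
  also have "\<dots> = \<rho> V W (sop (F V) n G t)"
    by (rule res_op[OF WU(2) V(1) W(1) G V(3), symmetric])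
  finally have e: "\<rho> U W (sop (F U) n G s) = \<rho> V W (sop (F V) n G t)" .
  have c: "sop (F U) n G s \<in> carrier (F U)" "sop (F V) n G t \<in> carrier (F V)"
    by (rule FU.sop_closed[OF G U(3)]; assumption) (rule FV.sop_closed[OF G V(3)])
  show ?thesis
    unfolding germ_eq_iff[OF U(1,2) c(1) V(1,2) c(2)] using W e by blast
qed

lemma stalk_sop:
  assumes U: "U \<in> \<B>" "p \<in> U" "\<And>i. i < n \<Longrightarrow> s i \<in> carrier (F U)" and G: "csm n G"
    and \<xi>: "\<And>i. i < n \<Longrightarrow> \<xi> i = gm p U (s i)"
  shows "sop (st p) n G \<xi> = gm p U (sop (F U) n G s)"
proof -
  have op: "smooth_op (st p) n (fn n G) (restrict \<xi> {..<n}) = (THE \<eta>. \<exists>U\<in>\<B>. p \<in> U \<and>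
     (\<exists>s\<in>tuples n (carrier (F U)). (\<forall>i<n. restrict \<xi> {..<n} i = gm p U (s i)) \<and>
       \<eta> = gm p U (smooth_op (F U) n (fn n G) s)))"
    by (simp add: stalk_def)
  have "(THE \<eta>. \<exists>U\<in>\<B>. p \<in> U \<and>
     (\<exists>s\<in>tuples n (carrier (F U)). (\<forall>i<n. restrict \<xi> {..<n} i = gm p U (s i)) \<and>
       \<eta> = gm p U (smooth_op (F U) n (fn n G) s))) = gm p U (sop (F U) n G s)"
  proof (rule the_equality)
    show "\<exists>U'\<in>\<B>. p \<in> U' \<and> (\<exists>s'\<in>tuples n (carrier (F U')). (\<forall>i<n. restrict \<xi> {..<n} i = gm p U' (s' i)) \<and>
       gm p U (sop (F U) n G s) = gm p U' (smooth_op (F U') n (fn n G) s'))"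
    proof (rule bexI[OF _ U(1)], intro conjI U(2), rule bexI[of _ "restrict s {..<n}"])
      show "restrict s {..<n} \<in> tuples n (carrier (F U))" using U(3) by auto
      show "(\<forall>i<n. restrict \<xi> {..<n} i = gm p U (restrict s {..<n} i)) \<and>
        gm p U (sop (F U) n G s) = gm p U (smooth_op (F U) n (fn n G) (restrict s {..<n}))"
        using \<xi> by (simp add: sop_def)
    qed
    fix \<eta> assume "\<exists>U'\<in>\<B>. p \<in> U' \<and> (\<exists>s'\<in>tuples n (carrier (F U')). (\<forall>i<n. restrict \<xi> {..<n} i = gm p U' (s' i)) \<and>
       \<eta> = gm p U' (smooth_op (F U') n (fn n G) s'))"
    then obtain V t where V: "V \<in> \<B>" "p \<in> V" and t: "t \<in> tuples n (carrier (F V))"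
      "\<forall>i<n. restrict \<xi> {..<n} i = gm p V (t i)" "\<eta> = gm p V (smooth_op (F V) n (fn n G) t)" by blast
    have "\<eta> = gm p V (sop (F V) n G t)"
      unfolding t(3) smooth_op_sop[OF tuples_ext[OF t(1)]] ..
    also have "\<dots> = gm p U (sop (F U) n G s)"
    proof (rule germ_sop_eq[OF V tuples_mem[OF t(1)] U _ G])
      fix i assume i: "i < n"
      then have "restrict \<xi> {..<n} i = gm p V (t i)" using t(2) by blast
      then show "gm p V (t i) = gm p U (s i)" using \<xi>[OF i] i by simp
    qed
    finally show "\<eta> = gm p U (sop (F U) n G s)" .
  qed
  then show ?thesis unfolding sop_def[of "st p"] op .
qed

lemma stalk_cinf_ring:
  assumes W: "W \<in> \<B>" "p \<in> W"
  shows "cinf_ring (st p)"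
proof (rule cinf_ringI)
  fix n G \<xi> assume G: "csm n G" and \<xi>: "\<And>i. i < n \<Longrightarrow> \<xi> i \<in> carrier (st p)"
  obtain U s where U: "U \<in> \<B>" "p \<in> U" "\<And>i. i < n \<Longrightarrow> s i \<in> carrier (F U)" "\<And>i. i < n \<Longrightarrow> \<xi> i = gm p U (s i)"
    by (rule stalk_tuple[OF W, of n \<xi>], erule \<xi>) (rule that)
  have "sop (F U) n G s \<in> carrier (F U)" by (rule cinf_ring.sop_closed[OF ring[OF U(1)] G U(3)])
  from germ_in_stalk[OF U(1,2) this] show "sop (st p) n G \<xi> \<in> carrier (st p)"
    using stalk_sop[where s = s and \<xi> = \<xi>, OF U(1-3) G U(4)] by simp
next
  fix n i :: nat and \<xi> assume i: "i < n" and \<xi>: "\<And>i. i < n \<Longrightarrow> \<xi> i \<in> carrier (st p)"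
  obtain U s where U: "U \<in> \<B>" "p \<in> U" "\<And>i. i < n \<Longrightarrow> s i \<in> carrier (F U)" "\<And>i. i < n \<Longrightarrow> \<xi> i = gm p U (s i)"
    by (rule stalk_tuple[OF W, of n \<xi>], erule \<xi>) (rule that)
  have "sop (F U) n (\<lambda>v. v i) s = s i" by (rule cinf_ring.sop_coord[OF ring[OF U(1)] i U(3)])
  then show "sop (st p) n (\<lambda>v. v i) \<xi> = \<xi> i"
    using stalk_sop[where s = s and \<xi> = \<xi>, OF U(1-3) csm_coord[OF i] U(4)] U(4)[OF i] by simp
next
  fix n m H and G :: "nat \<Rightarrow> (nat \<Rightarrow> real) \<Rightarrow> real" and \<xi>
  assume H: "csm m H" and G: "\<And>j. csm n (G j)" and \<xi>: "\<And>i. i < n \<Longrightarrow> \<xi> i \<in> carrier (st p)"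
  obtain U s where U: "U \<in> \<B>" "p \<in> U" "\<And>i. i < n \<Longrightarrow> s i \<in> carrier (F U)" "\<And>i. i < n \<Longrightarrow> \<xi> i = gm p U (s i)"
    by (rule stalk_tuple[OF W, of n \<xi>], erule \<xi>) (rule that)
  interpret FU: cinf_ring "F U" by (rule ring[OF U(1)])
  have "sop (st p) n (\<lambda>v. H (\<lambda>j. G j v)) \<xi> = gm p U (sop (F U) n (\<lambda>v. H (\<lambda>j. G j v)) s)"
    by (rule stalk_sop[OF U(1-3) csm_comp[OF H G] U(4)])
  also have "sop (F U) n (\<lambda>v. H (\<lambda>j. G j v)) s = sop (F U) m H (\<lambda>j. sop (F U) n (G j) s)"
    by (rule FU.sop_comp[OF H G U(3)])
  also have "gm p U (sop (F U) m H (\<lambda>j. sop (F U) n (G j) s)) = sop (st p) m H (\<lambda>j. sop (st p) n (G j) \<xi>)"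
  proof (rule stalk_sop[OF U(1,2) _ H, symmetric])
    show "sop (F U) n (G i) s \<in> carrier (F U)" for i by (rule FU.sop_closed[OF G U(3)])
    show "sop (st p) n (G i) \<xi> = gm p U (sop (F U) n (G i) s)" for i
      by (rule stalk_sop[OF U(1-3) G U(4)])
  qed
  finally show "sop (st p) n (\<lambda>v. H (\<lambda>j. G j v)) \<xi> = sop (st p) m H (\<lambda>j. sop (st p) n (G j) \<xi>)" .
qed

lemma germ_hom:
  assumes U: "U \<in> \<B>" "p \<in> U"
  shows "(\<lambda>s\<in>carrier (F U). gm p U s) \<in> cinf_hom (F U) (st p)"
proof (rule cinf_homI)
  interpret FU: cinf_ring "F U" by (rule ring[OF U(1)])
  show "(\<lambda>s\<in>carrier (F U). gm p U s) \<in> carrier (F U) \<rightarrow>\<^sub>E carrier (st p)"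
    using germ_in_stalk[OF U] by auto
  fix n G s assume G: "csm n G" and s: "\<And>i. i < n \<Longrightarrow> s i \<in> carrier (F U)"
  have "sop (st p) n G (\<lambda>i. (\<lambda>s\<in>carrier (F U). gm p U s) (s i)) = gm p U (sop (F U) n G s)"
    by (rule stalk_sop[OF U s G]) (simp_all add: s)
  then show "(\<lambda>s\<in>carrier (F U). gm p U s) (sop (F U) n G s) =
    sop (st p) n G (\<lambda>i. (\<lambda>s\<in>carrier (F U). gm p U s) (s i))"
    using FU.sop_closed[OF G s] by simp
qed

text \<open>The universal property of a filtered colimit: two representatives of a germ have a
  common restriction, where the compatible homomorphisms give the same value.\<close>

lemma stalk_lift:
  assumes W: "W \<in> \<B>" "p \<in> W" and B: "cinf_ring B"
    and \<kappa>: "\<And>U. U \<in> \<B> \<Longrightarrow> p \<in> U \<Longrightarrow> \<kappa> U \<in> cinf_hom (F U) B"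
    and res: "\<And>U V s. U \<in> \<B> \<Longrightarrow> V \<in> \<B> \<Longrightarrow> p \<in> V \<Longrightarrow> V \<subseteq> U \<Longrightarrow> s \<in> carrier (F U) \<Longrightarrow> \<kappa> V (\<rho> U V s) = \<kappa> U s"
  obtains \<theta> where "\<theta> \<in> cinf_hom (st p) B"
    "\<And>U s. U \<in> \<B> \<Longrightarrow> p \<in> U \<Longrightarrow> s \<in> carrier (F U) \<Longrightarrow> \<theta> (gm p U s) = \<kappa> U s"
proof -
  interpret S: cinf_ring "st p" by (rule stalk_cinf_ring[OF W])
  define \<theta> where "\<theta> = (\<lambda>\<xi>\<in>carrier (st p). THE v. \<exists>U\<in>\<B>. p \<in> U \<and> (\<exists>s\<in>carrier (F U). \<xi> = gm p U s \<and> v = \<kappa> U s))"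
  have at: "\<theta> (gm p U s) = \<kappa> U s" if U: "U \<in> \<B>" "p \<in> U" "s \<in> carrier (F U)" for U s
  proof -
    have "(THE v. \<exists>V\<in>\<B>. p \<in> V \<and> (\<exists>t\<in>carrier (F V). gm p U s = gm p V t \<and> v = \<kappa> V t)) = \<kappa> U s"
    proof (rule the_equality)
      show "\<exists>V\<in>\<B>. p \<in> V \<and> (\<exists>t\<in>carrier (F V). gm p U s = gm p V t \<and> \<kappa> U s = \<kappa> V t)" using U by blast
      fix v assume "\<exists>V\<in>\<B>. p \<in> V \<and> (\<exists>t\<in>carrier (F V). gm p U s = gm p V t \<and> v = \<kappa> V t)"
      then obtain V t where V: "V \<in> \<B>" "p \<in> V" "t \<in> carrier (F V)" "gm p U s = gm p V t" "v = \<kappa> V t" by blast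
      then obtain X where X: "X \<in> \<B>" "p \<in> X" "X \<subseteq> U \<inter> V" "\<rho> U X s = \<rho> V X t"
        using germ_eq_iff[OF U V(1-3)] by blast
      have "\<kappa> U s = \<kappa> X (\<rho> U X s)" by (rule res[symmetric]) (use X U in auto)
      also have "\<dots> = \<kappa> V t" unfolding X(4) by (rule res) (use X V in auto)
      finally show "v = \<kappa> U s" using V(5) by simp
    qed
    then show ?thesis using germ_in_stalk[OF U] by (simp add: \<theta>_def)
  qed
  have "\<theta> \<in> cinf_hom (st p) B"
  proof (rule cinf_homI)
    show "\<theta> \<in> carrier (st p) \<rightarrow>\<^sub>E carrier B"
    proof (rule PiE_I)
      fix \<xi> assume "\<xi> \<in> carrier (st p)"
      then obtain U s where U: "U \<in> \<B>" "p \<in> U" "s \<in> carrier (F U)" "\<xi> = gm p U s" by (rule stalk_obtain)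
      show "\<theta> \<xi> \<in> carrier B" unfolding U(4) at[OF U(1-3)] by (rule cinf_hom_closed[OF \<kappa>[OF U(1,2)] U(3)])
    qed (simp add: \<theta>_def)
    fix n G \<xi> assume G: "csm n G" and \<xi>: "\<And>i. i < n \<Longrightarrow> \<xi> i \<in> carrier (st p)"
    obtain U s where U: "U \<in> \<B>" "p \<in> U" "\<And>i. i < n \<Longrightarrow> s i \<in> carrier (F U)" "\<And>i. i < n \<Longrightarrow> \<xi> i = gm p U (s i)"
      by (rule stalk_tuple[OF W, of n \<xi>], erule \<xi>) (rule that)
    interpret FU: cinf_ring "F U" by (rule ring[OF U(1)])
    have "\<theta> (sop (st p) n G \<xi>) = \<theta> (gm p U (sop (F U) n G s))"
      by (simp only: stalk_sop[where s = s and \<xi> = \<xi>, OF U(1-3) G U(4)])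
    also have "\<dots> = \<kappa> U (sop (F U) n G s)"
      by (rule at[OF U(1,2)]) (rule FU.sop_closed[OF G U(3)])
    also have "\<dots> = sop B n G (\<lambda>i. \<kappa> U (s i))" by (rule hom_sop[OF \<kappa>[OF U(1,2)] G U(3)])
    also have "\<dots> = sop B n G (\<lambda>i. \<theta> (\<xi> i))"
      by (rule sop_cong) (simp add: U(4) at[OF U(1,2) U(3)])
    finally show "\<theta> (sop (st p) n G \<xi>) = sop B n G (\<lambda>i. \<theta> (\<xi> i))" .
  qed
  then show ?thesis using at by (rule that)
qed

section \<open>Sections of the associated sheaf, with operations computed in the stalks\<close>

abbreviation "sheaf W \<equiv> assoc_sheaf \<B> F \<rho> W"

lemma sheaf_carrier_iff:
  "\<sigma> \<in> carrier (sheaf W) \<longleftrightarrow> \<sigma> \<in> extensional W \<and> (\<forall>p\<in>W. \<sigma> p \<in> carrier (st p)) \<and>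
    (\<forall>p\<in>W. \<exists>U\<in>\<B>. p \<in> U \<and> U \<subseteq> W \<and> (\<exists>s\<in>carrier (F U). \<forall>q\<in>U. \<sigma> q = gm q U s))"
  unfolding assoc_sheaf_def by (auto simp: PiE_iff)

lemma sop_sheaf: "sop (sheaf W) n G \<sigma> = (\<lambda>p\<in>W. sop (st p) n G (\<lambda>i. \<sigma> i p))"
proof -
  have "(\<lambda>i\<in>{..<n}. restrict \<sigma> {..<n} i p) = (\<lambda>i\<in>{..<n}. \<sigma> i p)" for p
    by (rule restrict_ext) simp
  then show ?thesis unfolding sop_def assoc_sheaf_def by simp
qed

lemma sheaf_local:
  assumes "\<sigma> \<in> carrier (sheaf W)" "p \<in> W"
  obtains U s where "U \<in> \<B>" "p \<in> U" "U \<subseteq> W" "s \<in> carrier (F U)" "\<And>q. q \<in> U \<Longrightarrow> \<sigma> q = gm q U s"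
proof -
  have "\<exists>U\<in>\<B>. p \<in> U \<and> U \<subseteq> W \<and> (\<exists>s\<in>carrier (F U). \<forall>q\<in>U. \<sigma> q = gm q U s)"
    using assms unfolding sheaf_carrier_iff by blast
  then show ?thesis using that by (elim bexE conjE) blast
qed

lemma sheaf_at: "\<sigma> \<in> carrier (sheaf W) \<Longrightarrow> p \<in> W \<Longrightarrow> \<sigma> p \<in> carrier (st p)"
  unfolding sheaf_carrier_iff by blast

lemma sheaf_ext: "\<sigma> \<in> carrier (sheaf W) \<Longrightarrow> \<sigma> \<in> extensional W"
  unfolding sheaf_carrier_iff by blast

lemma sheaf_eqI:
  assumes "\<sigma> \<in> carrier (sheaf W)" "\<tau> \<in> carrier (sheaf W)" "\<And>p. p \<in> W \<Longrightarrow> \<sigma> p = \<tau> p"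
  shows "\<sigma> = \<tau>"
  by (rule extensionalityI[OF sheaf_ext[OF assms(1)] sheaf_ext[OF assms(2)] assms(3)])

lemma sheaf_cinf_ring:
  assumes W: "W \<in> \<B>"
  shows "cinf_ring (sheaf W)"
proof (rule cinf_ringI)
  fix n G \<sigma> assume G: "csm n G" and \<sigma>: "\<And>i. i < n \<Longrightarrow> \<sigma> i \<in> carrier (sheaf W)"
  have at: "sop (sheaf W) n G \<sigma> p = sop (st p) n G (\<lambda>i. \<sigma> i p)" if "p \<in> W" for p
    using that by (simp add: sop_sheaf)
  show "sop (sheaf W) n G \<sigma> \<in> carrier (sheaf W)"
    unfolding sheaf_carrier_iff
  proof (intro conjI ballI)
    show "sop (sheaf W) n G \<sigma> \<in> extensional W" by (simp add: sop_sheaf)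
    fix p assume p: "p \<in> W"
    show "sop (sheaf W) n G \<sigma> p \<in> carrier (st p)"
      unfolding at[OF p] by (rule cinf_ring.sop_closed[OF stalk_cinf_ring[OF W p] G sheaf_at[OF \<sigma> p]])
    let ?P = "\<lambda>i U. \<exists>s\<in>carrier (F U). \<forall>q\<in>U. \<sigma> i q = gm q U s"
    have "\<exists>U\<in>\<B>. p \<in> U \<and> U \<subseteq> W \<and> (\<forall>i<n. ?P i U)"
    proof (rule common_neighbourhood[OF W p])
      fix i assume "i < n"
      then show "\<exists>U\<in>\<B>. p \<in> U \<and> ?P i U"
        using \<sigma>[of i] p unfolding sheaf_carrier_iff by blast
    next
      fix i U V assume P: "?P i U" and UV: "U \<in> \<B>" "V \<in> \<B>" "V \<subseteq> U"
      then obtain s where s: "s \<in> carrier (F U)" "\<forall>q\<in>U. \<sigma> i q = gm q U s" by blast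
      have "\<sigma> i q = gm q V (\<rho> U V s)" if "q \<in> V" for q
        using germ_res[OF UV(1) s(1) UV(2,3) that] s(2) that UV(3) by auto
      then show "?P i V" using res_closed[OF UV(3,1,2) s(1)] by blast
    qed
    then obtain U where U: "U \<in> \<B>" "p \<in> U" "U \<subseteq> W" "\<forall>i<n. ?P i U" by blast
    then have "\<forall>i. \<exists>s. i < n \<longrightarrow> s \<in> carrier (F U) \<and> (\<forall>q\<in>U. \<sigma> i q = gm q U s)" by blast
    from choice[OF this] obtain s where s: "\<forall>i. i < n \<longrightarrow> s i \<in> carrier (F U) \<and> (\<forall>q\<in>U. \<sigma> i q = gm q U (s i))" ..
    then have sc: "s i \<in> carrier (F U)" if "i < n" for i using that by blast
    have "sop (sheaf W) n G \<sigma> q = gm q U (sop (F U) n G s)" if "q \<in> U" for q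
    proof -
      have qW: "q \<in> W" using that U(3) by blast
      show ?thesis
        unfolding at[OF qW] by (rule stalk_sop[OF U(1) that sc G]) (use s that in auto)
    qed
    moreover have "sop (F U) n G s \<in> carrier (F U)" by (rule cinf_ring.sop_closed[OF ring[OF U(1)] G sc])
    ultimately show "\<exists>U\<in>\<B>. p \<in> U \<and> U \<subseteq> W \<and> (\<exists>s\<in>carrier (F U). \<forall>q\<in>U. sop (sheaf W) n G \<sigma> q = gm q U s)"
      using U(1-3) by blast
  qed
next
  fix n i :: nat and \<sigma> assume i: "i < n" and \<sigma>: "\<And>i. i < n \<Longrightarrow> \<sigma> i \<in> carrier (sheaf W)"
  show "sop (sheaf W) n (\<lambda>v. v i) \<sigma> = \<sigma> i"
  proof (rule extensionalityI[OF _ sheaf_ext[OF \<sigma>[OF i]]])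
    show "sop (sheaf W) n (\<lambda>v. v i) \<sigma> \<in> extensional W" by (simp add: sop_sheaf)
    fix p assume p: "p \<in> W"
    have "sop (st p) n (\<lambda>v. v i) (\<lambda>i. \<sigma> i p) = \<sigma> i p"
      by (rule cinf_ring.sop_coord[OF stalk_cinf_ring[OF W p] i sheaf_at[OF \<sigma> p]])
    then show "sop (sheaf W) n (\<lambda>v. v i) \<sigma> p = \<sigma> i p" using p by (simp add: sop_sheaf)
  qed
next
  fix n m H and G :: "nat \<Rightarrow> (nat \<Rightarrow> real) \<Rightarrow> real" and \<sigma>
  assume H: "csm m H" and G: "\<And>j. csm n (G j)" and \<sigma>: "\<And>i. i < n \<Longrightarrow> \<sigma> i \<in> carrier (sheaf W)"
  show "sop (sheaf W) n (\<lambda>v. H (\<lambda>j. G j v)) \<sigma> = sop (sheaf W) m H (\<lambda>j. sop (sheaf W) n (G j) \<sigma>)"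
  proof (rule extensionalityI[where A = W])
    fix p assume p: "p \<in> W"
    have "sop (st p) n (\<lambda>v. H (\<lambda>j. G j v)) (\<lambda>i. \<sigma> i p) = sop (st p) m H (\<lambda>j. sop (st p) n (G j) (\<lambda>i. \<sigma> i p))"
      by (rule cinf_ring.sop_comp[OF stalk_cinf_ring[OF W p] H G sheaf_at[OF \<sigma> p]])
    then show "sop (sheaf W) n (\<lambda>v. H (\<lambda>j. G j v)) \<sigma> p = sop (sheaf W) m H (\<lambda>j. sop (sheaf W) n (G j) \<sigma>) p"
      using p by (simp add: sop_sheaf)
  qed (simp_all add: sop_sheaf)
qed

lemma sheaf_eval_hom:
  assumes W: "W \<in> \<B>" "p \<in> W"
  shows "(\<lambda>\<sigma>\<in>carrier (sheaf W). \<sigma> p) \<in> cinf_hom (sheaf W) (st p)"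
proof (rule cinf_homI)
  interpret H: cinf_ring "sheaf W" by (rule sheaf_cinf_ring[OF W(1)])
  show "(\<lambda>\<sigma>\<in>carrier (sheaf W). \<sigma> p) \<in> carrier (sheaf W) \<rightarrow>\<^sub>E carrier (st p)"
    using sheaf_at[OF _ W(2)] by auto
  fix n G \<sigma> assume G: "csm n G" and \<sigma>: "\<And>i. i < n \<Longrightarrow> \<sigma> i \<in> carrier (sheaf W)"
  have "sop (st p) n G (\<lambda>i. (\<lambda>\<sigma>\<in>carrier (sheaf W). \<sigma> p) (\<sigma> i)) = sop (st p) n G (\<lambda>i. \<sigma> i p)"
    by (rule sop_cong) (simp add: \<sigma>)
  then show "(\<lambda>\<sigma>\<in>carrier (sheaf W). \<sigma> p) (sop (sheaf W) n G \<sigma>) =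
    sop (st p) n G (\<lambda>i. (\<lambda>\<sigma>\<in>carrier (sheaf W). \<sigma> p) (\<sigma> i))"
    using H.sop_closed[OF G \<sigma>] W(2) by (simp add: sop_sheaf)
qed

lemma sheafification_map_hom:
  assumes W: "W \<in> \<B>"
  shows "restrict (sheafification_map \<B> F \<rho> W) (carrier (F W)) \<in> cinf_hom (F W) (sheaf W)"
proof (rule cinf_homI)
  interpret FW: cinf_ring "F W" by (rule ring[OF W])
  have c: "sheafification_map \<B> F \<rho> W s \<in> carrier (sheaf W)" if "s \<in> carrier (F W)" for s
    unfolding sheaf_carrier_iff sheafification_map_def using that W germ_in_stalk[OF W _ that]
    by (intro conjI ballI) (auto intro!: bexI[of _ W] bexI[of _ s])
  then show "restrict (sheafification_map \<B> F \<rho> W) (carrier (F W)) \<in> carrier (F W) \<rightarrow>\<^sub>E carrier (sheaf W)"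
    by auto
  fix n G s assume G: "csm n G" and s: "\<And>i. i < n \<Longrightarrow> s i \<in> carrier (F W)"
  have "sop (sheaf W) n G (\<lambda>i. restrict (sheafification_map \<B> F \<rho> W) (carrier (F W)) (s i)) =
    sheafification_map \<B> F \<rho> W (sop (F W) n G s)"
  proof (rule extensionalityI[where A = W])
    fix p assume p: "p \<in> W"
    have "sop (st p) n G (\<lambda>i. restrict (sheafification_map \<B> F \<rho> W) (carrier (F W)) (s i) p) = gm p W (sop (F W) n G s)"
      by (rule stalk_sop[OF W p s G]) (use s p in \<open>auto simp: sheafification_map_def\<close>)
    then show "sop (sheaf W) n G (\<lambda>i. restrict (sheafification_map \<B> F \<rho> W) (carrier (F W)) (s i)) p =
      sheafification_map \<B> F \<rho> W (sop (F W) n G s) p"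
      using p by (simp add: sop_sheaf sheafification_map_def)
  qed (simp_all add: sop_sheaf sheafification_map_def)
  then show "restrict (sheafification_map \<B> F \<rho> W) (carrier (F W)) (sop (F W) n G s) =
    sop (sheaf W) n G (\<lambda>i. restrict (sheafification_map \<B> F \<rho> W) (carrier (F W)) (s i))"
    using FW.sop_closed[OF G s] by simp
qed

end

section \<open>Von Neumann regularity\<close>

text \<open>Regularity asks only for the first equation; the second makes the quasi-inverse unique,
  and both are preserved by homomorphisms.\<close>

definition qinv :: "'a cinf \<Rightarrow> 'a \<Rightarrow> 'a \<Rightarrow> bool" where
  "qinv A x y \<longleftrightarrow> x \<in> carrier A \<and> y \<in> carrier A \<and>
     x \<otimes>\<^bsub>ring_of A\<^esub> x \<otimes>\<^bsub>ring_of A\<^esub> y = x \<and> y \<otimes>\<^bsub>ring_of A\<^esub> y \<otimes>\<^bsub>ring_of A\<^esub> x = y"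

lemma hom_qinv:
  assumes "cinf_ring A" "cinf_ring B" "\<phi> \<in> cinf_hom A B" "qinv A x y"
  shows "qinv B (\<phi> x) (\<phi> y)"
proof -
  interpret A: cinf_ring A by fact
  note m = cinf_hom_arith(1)[OF assms(1-3)]
  have c: "x \<in> carrier A" "y \<in> carrier A" using assms(4) by (auto simp: qinv_def)
  have "\<phi> (x \<otimes>\<^bsub>ring_of A\<^esub> x \<otimes>\<^bsub>ring_of A\<^esub> y) = \<phi> x" "\<phi> (y \<otimes>\<^bsub>ring_of A\<^esub> y \<otimes>\<^bsub>ring_of A\<^esub> x) = \<phi> y"
    using assms(4) by (auto simp: qinv_def)
  then show ?thesis using c cinf_hom_closed[OF assms(3)] by (simp add: qinv_def m)
qed

context cinf_ring
begin

text \<open>First y x = z x, as either product reduces to y z x x. Inserting this twice into y = y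
  (y x) turns y into z.\<close>

lemma qinv_unique:
  assumes "qinv A x y" "qinv A x z"
  shows "y = z"
proof -
  have c: "x \<in> carrier A" "y \<in> carrier A" "z \<in> carrier A"
    and y: "x \<otimes>\<^bsub>ring_of A\<^esub> x \<otimes>\<^bsub>ring_of A\<^esub> y = x" "y \<otimes>\<^bsub>ring_of A\<^esub> y \<otimes>\<^bsub>ring_of A\<^esub> x = y"
    and z: "x \<otimes>\<^bsub>ring_of A\<^esub> x \<otimes>\<^bsub>ring_of A\<^esub> z = x" "z \<otimes>\<^bsub>ring_of A\<^esub> z \<otimes>\<^bsub>ring_of A\<^esub> x = z"
    using assms by (auto simp: qinv_def)
  have "y \<otimes>\<^bsub>ring_of A\<^esub> x = y \<otimes>\<^bsub>ring_of A\<^esub> (x \<otimes>\<^bsub>ring_of A\<^esub> x \<otimes>\<^bsub>ring_of A\<^esub> z)" using z by simp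
  also have "\<dots> = z \<otimes>\<^bsub>ring_of A\<^esub> (x \<otimes>\<^bsub>ring_of A\<^esub> x \<otimes>\<^bsub>ring_of A\<^esub> y)" using c by (simp add: R.m_ac)
  finally have e: "y \<otimes>\<^bsub>ring_of A\<^esub> x = z \<otimes>\<^bsub>ring_of A\<^esub> x" using y by simp
  have "y = y \<otimes>\<^bsub>ring_of A\<^esub> (y \<otimes>\<^bsub>ring_of A\<^esub> x)" using y c by (simp add: R.m_assoc)
  also have "\<dots> = y \<otimes>\<^bsub>ring_of A\<^esub> (z \<otimes>\<^bsub>ring_of A\<^esub> x)" by (simp only: e)
  also have "\<dots> = z \<otimes>\<^bsub>ring_of A\<^esub> (y \<otimes>\<^bsub>ring_of A\<^esub> x)" using c by (simp add: R.m_ac)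
  also have "\<dots> = z \<otimes>\<^bsub>ring_of A\<^esub> (z \<otimes>\<^bsub>ring_of A\<^esub> x)" by (simp only: e)
  also have "\<dots> = z" using z c by (simp add: R.m_assoc)
  finally show ?thesis .
qed

lemma qinv_inverse:
  assumes "x \<in> carrier A" "y \<in> carrier A" "x \<otimes>\<^bsub>ring_of A\<^esub> y = \<one>\<^bsub>ring_of A\<^esub>"
  shows "qinv A x y"
  unfolding qinv_def
proof (intro conjI assms(1,2))
  show "x \<otimes>\<^bsub>ring_of A\<^esub> x \<otimes>\<^bsub>ring_of A\<^esub> y = x" using assms by (simp add: R.m_assoc)
  show "y \<otimes>\<^bsub>ring_of A\<^esub> y \<otimes>\<^bsub>ring_of A\<^esub> x = y" using assms R.m_comm[of x y] by (simp add: R.m_assoc)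
qed

lemma qinv_unit:
  assumes "x \<in> Units (ring_of A)"
  shows "qinv A x (inv\<^bsub>ring_of A\<^esub> x)"
  using assms by (intro qinv_inverse) (simp_all add: R.Units_closed[simplified])

lemma qinv_unit_mult:
  assumes "qinv A x y" "x \<in> Units (ring_of A)"
  shows "x \<otimes>\<^bsub>ring_of A\<^esub> y = \<one>\<^bsub>ring_of A\<^esub>"
  using qinv_unique[OF assms(1) qinv_unit[OF assms(2)]] assms(2) by simp

lemma qinv_zero: "qinv A \<zero>\<^bsub>ring_of A\<^esub> \<zero>\<^bsub>ring_of A\<^esub>"
  by (simp add: qinv_def)

lemma pow_two: "x \<in> carrier A \<Longrightarrow> x [^]\<^bsub>ring_of A\<^esub> (2::nat) = x \<otimes>\<^bsub>ring_of A\<^esub> x"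
  by (simp add: numeral_2_eq_2)

text \<open>Any x with a = a a x can be corrected to x x a, which satisfies both equations.\<close>

lemma vN_regular_iff_qinv: "vN_regular A \<longleftrightarrow> (\<forall>x\<in>carrier A. \<exists>y. qinv A x y)"
proof
  assume v: "vN_regular A"
  show "\<forall>x\<in>carrier A. \<exists>y. qinv A x y"
  proof
    fix a assume a: "a \<in> carrier A"
    then obtain x where x: "x \<in> carrier A" "a = a \<otimes>\<^bsub>ring_of A\<^esub> a \<otimes>\<^bsub>ring_of A\<^esub> x"
      using v pow_two unfolding vN_regular_def by metis
    let ?y = "x \<otimes>\<^bsub>ring_of A\<^esub> x \<otimes>\<^bsub>ring_of A\<^esub> a"
    have e: "a \<otimes>\<^bsub>ring_of A\<^esub> (a \<otimes>\<^bsub>ring_of A\<^esub> x) = a" using x a by (simp add: R.m_assoc)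
    have 1: "a \<otimes>\<^bsub>ring_of A\<^esub> a \<otimes>\<^bsub>ring_of A\<^esub> ?y = a"
    proof -
      have "a \<otimes>\<^bsub>ring_of A\<^esub> a \<otimes>\<^bsub>ring_of A\<^esub> ?y = a \<otimes>\<^bsub>ring_of A\<^esub> (a \<otimes>\<^bsub>ring_of A\<^esub> x) \<otimes>\<^bsub>ring_of A\<^esub> (a \<otimes>\<^bsub>ring_of A\<^esub> x)"
        using a x(1) by (simp add: R.m_ac)
      also have "\<dots> = a" by (simp only: e)
      finally show ?thesis .
    qed
    have "?y \<otimes>\<^bsub>ring_of A\<^esub> ?y \<otimes>\<^bsub>ring_of A\<^esub> a = x \<otimes>\<^bsub>ring_of A\<^esub> x \<otimes>\<^bsub>ring_of A\<^esub>
        (a \<otimes>\<^bsub>ring_of A\<^esub> (a \<otimes>\<^bsub>ring_of A\<^esub> x) \<otimes>\<^bsub>ring_of A\<^esub> (a \<otimes>\<^bsub>ring_of A\<^esub> x))"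
      using a x(1) by (simp add: R.m_ac)
    also have "\<dots> = ?y" by (simp only: e)
    finally show "\<exists>y. qinv A a y" using 1 a x(1) by (auto simp: qinv_def intro!: exI[of _ ?y])
  qed
next
  assume q: "\<forall>x\<in>carrier A. \<exists>y. qinv A x y"
  show "vN_regular A"
    unfolding vN_regular_def
  proof
    fix a assume a: "a \<in> carrier A"
    then obtain y where "qinv A a y" using q by blast
    then show "\<exists>x\<in>carrier A. a = a [^]\<^bsub>ring_of A\<^esub> (2::nat) \<otimes>\<^bsub>ring_of A\<^esub> x"
      by (intro bexI[of _ y]) (simp_all add: qinv_def pow_two a)
  qed
qed

text \<open>For a quasi-inverse y of x, the element 1 - x y annihilates x. A maximal ideal
  containing it would also contain x y and hence 1, so it generates the unit ideal and x =
  0.\<close>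

lemma vN_zero_of_maximal:
  assumes v: "vN_regular A" and x: "x \<in> carrier A" and m: "\<And>M. maximalideal M (ring_of A) \<Longrightarrow> x \<in> M"
  shows "x = \<zero>\<^bsub>ring_of A\<^esub>"
proof -
  obtain y where y: "qinv A x y" using v x vN_regular_iff_qinv by blast
  then have yc: "y \<in> carrier A" by (simp add: qinv_def)
  let ?e = "x \<otimes>\<^bsub>ring_of A\<^esub> y" and ?d = "\<one>\<^bsub>ring_of A\<^esub> \<ominus>\<^bsub>ring_of A\<^esub> (x \<otimes>\<^bsub>ring_of A\<^esub> y)"
  have xe: "x \<otimes>\<^bsub>ring_of A\<^esub> ?e = x" using y x yc by (simp add: qinv_def R.m_assoc)
  have dc: "?d \<in> carrier A" using x yc by simp
  have xd: "x \<otimes>\<^bsub>ring_of A\<^esub> ?d = \<zero>\<^bsub>ring_of A\<^esub>"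
    using x yc xe by (simp add: R.minus_eq R.r_distr R.r_minus R.r_neg)
  show ?thesis
  proof (cases "\<one>\<^bsub>ring_of A\<^esub> \<in> cgenideal (ring_of A) ?d")
    case True
    then obtain r where r: "r \<in> carrier A" "\<one>\<^bsub>ring_of A\<^esub> = r \<otimes>\<^bsub>ring_of A\<^esub> ?d" by (auto simp: cgenideal_def)
    have "x = x \<otimes>\<^bsub>ring_of A\<^esub> (r \<otimes>\<^bsub>ring_of A\<^esub> ?d)" using r(2) x by (simp flip: r(2))
    also have "\<dots> = r \<otimes>\<^bsub>ring_of A\<^esub> (x \<otimes>\<^bsub>ring_of A\<^esub> ?d)" using r(1) x dc by (simp add: R.m_lcomm)
    finally show ?thesis using xd r(1) by simp
  next
    case False
    have I: "ideal (cgenideal (ring_of A) ?d) (ring_of A)" by (rule R.cgenideal_ideal) (use dc in simp)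
    obtain M where M: "maximalideal M (ring_of A)" "cgenideal (ring_of A) ?d \<subseteq> M"
      by (rule R.exists_maximalideal[OF I False]) (rule that)
    interpret M: maximalideal M "ring_of A" by (rule M(1))
    have dM: "?d \<in> M" using R.cgenideal_self[of ?d] dc M(2) by auto
    have "?e \<in> M" using M.I_r_closed[OF m[OF M(1)], of y] yc by simp
    from M.a_closed[OF dM this] have "\<one>\<^bsub>ring_of A\<^esub> \<in> M"
      using x yc by (simp add: R.minus_eq R.a_assoc R.l_neg)
    then have False using M.I_notcarr M.one_imp_carrier by simp
    then show ?thesis ..
  qed
qed

end

text \<open>In a field y \<beta> is 1 or 0, so 1 - y \<beta> is the indicator of y = 0; multiplied
  by x it detects membership in a basic open set.\<close>

lemma field_separator:
  assumes K: "cinf_field K" and x: "x \<in> carrier K" and y: "qinv K y \<beta>"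
  shows "x \<otimes>\<^bsub>ring_of K\<^esub> (\<one>\<^bsub>ring_of K\<^esub> \<ominus>\<^bsub>ring_of K\<^esub> y \<otimes>\<^bsub>ring_of K\<^esub> \<beta>) = \<zero>\<^bsub>ring_of K\<^esub> \<longleftrightarrow>
    x = \<zero>\<^bsub>ring_of K\<^esub> \<or> y \<noteq> \<zero>\<^bsub>ring_of K\<^esub>"
proof -
  interpret K: cinf_ring K using K by (simp add: cinf_field_def)
  have c: "y \<in> carrier K" "\<beta> \<in> carrier K" using y by (auto simp: qinv_def)
  show ?thesis
  proof (cases "y = \<zero>\<^bsub>ring_of K\<^esub>")
    case True
    then show ?thesis using x c by (simp add: K.R.minus_eq)
  next
    case False
    then have "y \<in> Units (ring_of K)" using K c by (simp add: cinf_field_def)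
    from K.qinv_unit_mult[OF y this] show ?thesis using x False by (simp add: K.R.minus_eq K.R.r_neg)
  qed
qed

text \<open>The image of the inverse s is a quasi-inverse of \<phi> a, hence equals z. An expression
  using a local inverse can thus be compared with one using a quasi-inverse that exists
  globally.\<close>

lemma hom_smooth_expr:
  assumes L: "cinf_ring L" and K: "cinf_ring K" and \<psi>: "\<psi> \<in> cinf_hom L K"
    and F: "csm (Suc m) F" and y: "\<forall>i<m. y i \<in> carrier A" and a: "a \<in> carrier A"
    and \<eta>: "\<And>c. c \<in> carrier A \<Longrightarrow> \<eta> c \<in> carrier L" and s: "s \<in> carrier L"
    "\<eta> a \<otimes>\<^bsub>ring_of L\<^esub> s = \<one>\<^bsub>ring_of L\<^esub>"
    and \<phi>: "\<And>c. c \<in> carrier A \<Longrightarrow> \<psi> (\<eta> c) = \<phi> c" and z: "qinv K (\<phi> a) z"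
  shows "\<psi> (sop L (Suc m) F ((\<lambda>i. \<eta> (y i))(m := s))) = sop K (Suc m) F ((\<lambda>i. \<phi> (y i))(m := z))"
proof -
  interpret L: cinf_ring L by fact
  interpret K: cinf_ring K by fact
  have "qinv K (\<psi> (\<eta> a)) (\<psi> s)"
    by (rule hom_qinv[OF L K \<psi> L.qinv_inverse[OF \<eta>[OF a] s]])
  then have sz: "\<psi> s = z" using K.qinv_unique z \<phi>[OF a] by simp
  have c: "((\<lambda>i. \<eta> (y i))(m := s)) i \<in> carrier L" if "i < Suc m" for i
    by (rule tuple_upd_closed[OF _ s(1) that]) (use y \<eta> in blast)
  have "\<psi> (sop L (Suc m) F ((\<lambda>i. \<eta> (y i))(m := s))) = sop K (Suc m) F (\<lambda>i. \<psi> (((\<lambda>i. \<eta> (y i))(m := s)) i))"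
    by (rule hom_sop[OF \<psi> F c])
  also have "\<dots> = sop K (Suc m) F ((\<lambda>i. \<phi> (y i))(m := z))"
  proof (rule sop_cong)
    fix i assume "i < Suc m"
    then show "\<psi> (((\<lambda>i. \<eta> (y i))(m := s)) i) = ((\<lambda>i. \<phi> (y i))(m := z)) i"
      using y \<phi> sz by (cases "i = m") simp_all
  qed
  finally show ?thesis .
qed

section \<open>Global sections\<close>

context cinf_ring
begin

lemma Spec_zero_mem: "p \<in> cinf_Spec A \<Longrightarrow> \<zero>\<^bsub>ring_of A\<^esub> \<in> p"
  using additive_subgroup.zero_closed ideal.axioms(1) Spec_ideal by metis

lemma D_one: "D_inf A \<one>\<^bsub>ring_of A\<^esub> = cinf_Spec A"
  using Spec_one by (auto simp: D_inf_def)

lemma Z_zero: "Z_inf A \<zero>\<^bsub>ring_of A\<^esub> = cinf_Spec A"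
  using Spec_zero_mem by (auto simp: Z_inf_def)

lemma basic_opensI: "a \<in> carrier A \<Longrightarrow> b \<in> carrier A \<Longrightarrow> D_inf A a \<inter> Z_inf A b \<in> basic_opens A"
  unfolding basic_opens_def by blast

lemma D_basic: "a \<in> carrier A \<Longrightarrow> D_inf A a \<in> basic_opens A"
  using basic_opensI[of a "\<zero>\<^bsub>ring_of A\<^esub>"] Int_absorb2[of "D_inf A a" "cinf_Spec A"]
  unfolding Z_zero by (auto simp: D_inf_def)

lemma Z_basic: "b \<in> carrier A \<Longrightarrow> Z_inf A b \<in> basic_opens A"
  using basic_opensI[of "\<one>\<^bsub>ring_of A\<^esub>" b] Int_absorb1[of "Z_inf A b" "cinf_Spec A"]
  unfolding D_one by (auto simp: Z_inf_def)

lemma Spec_basic: "cinf_Spec A \<in> basic_opens A"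
  using D_basic[of "\<one>\<^bsub>ring_of A\<^esub>"] D_one by simp

lemma basic_subset: "U \<in> basic_opens A \<Longrightarrow> U \<subseteq> cinf_Spec A"
  by (auto simp: basic_opens_def D_inf_def)

lemma topspace_Spec: "topspace (Spec_const A) = cinf_Spec A"
  unfolding Spec_const_def topology_generated_by_topspace using basic_subset Spec_basic by blast

text \<open>Smooth prime ideals are real, because \<open>1 + t\<^sup>2\<close> has a smooth inverse.\<close>

lemma Spec_sum_squares:
  assumes p: "p \<in> cinf_Spec A" and b: "b \<in> carrier A" "c \<in> carrier A"
  shows "b \<otimes>\<^bsub>ring_of A\<^esub> b \<oplus>\<^bsub>ring_of A\<^esub> c \<otimes>\<^bsub>ring_of A\<^esub> c \<in> p \<longleftrightarrow> b \<in> p \<and> c \<in> p"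
proof -
  have one: "b \<in> p" if b: "b \<in> carrier A" "c \<in> carrier A"
    and bc: "b \<otimes>\<^bsub>ring_of A\<^esub> b \<oplus>\<^bsub>ring_of A\<^esub> c \<otimes>\<^bsub>ring_of A\<^esub> c \<in> p" for b c
  proof (rule ccontr)
    assume "b \<notin> p"
    obtain K :: "'a set frac_term set set cinf" and \<phi> where K: "cinf_field K" "\<phi> \<in> cinf_hom A K"
      "\<And>x. x \<in> p \<Longrightarrow> \<phi> x = \<zero>\<^bsub>ring_of K\<^esub>" "\<phi> b \<in> Units (ring_of K)"
      by (rule Spec_field[OF p b(1) \<open>b \<notin> p\<close>]) (rule that)
    interpret K: cinf_ring K using K(1) by (simp add: cinf_field_def)
    note ar = cinf_hom_arith[OF cinf_ring_axioms K.cinf_ring_axioms K(2)]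
    let ?\<beta> = "\<phi> b" and ?\<gamma> = "\<phi> c"
    have kc: "?\<beta> \<in> carrier K" "?\<gamma> \<in> carrier K" using cinf_hom_closed[OF K(2)] b by auto
    have 0: "?\<beta> \<otimes>\<^bsub>ring_of K\<^esub> ?\<beta> \<oplus>\<^bsub>ring_of K\<^esub> ?\<gamma> \<otimes>\<^bsub>ring_of K\<^esub> ?\<gamma> = \<zero>\<^bsub>ring_of K\<^esub>"
      using K(3)[OF bc] b ar by simp
    define i where "i = inv\<^bsub>ring_of K\<^esub> ?\<beta>"
    have i: "i \<in> carrier K" "?\<beta> \<otimes>\<^bsub>ring_of K\<^esub> i = \<one>\<^bsub>ring_of K\<^esub>" using K(4) by (auto simp: i_def)
    \<comment> \<open>Dividing the relation by the square of \<phi> b gives 1 + t t = 0 in K,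
      against the smooth inverse of 1 + t t.\<close>
    define t where "t = ?\<gamma> \<otimes>\<^bsub>ring_of K\<^esub> i"
    have tc: "t \<in> carrier K" using kc i by (simp add: t_def)
    have "\<one>\<^bsub>ring_of K\<^esub> \<oplus>\<^bsub>ring_of K\<^esub> t \<otimes>\<^bsub>ring_of K\<^esub> t =
      (?\<beta> \<otimes>\<^bsub>ring_of K\<^esub> i) \<otimes>\<^bsub>ring_of K\<^esub> (?\<beta> \<otimes>\<^bsub>ring_of K\<^esub> i) \<oplus>\<^bsub>ring_of K\<^esub> t \<otimes>\<^bsub>ring_of K\<^esub> t"
      using i(2) by simp
    also have "\<dots> = (?\<beta> \<otimes>\<^bsub>ring_of K\<^esub> ?\<beta> \<oplus>\<^bsub>ring_of K\<^esub> ?\<gamma> \<otimes>\<^bsub>ring_of K\<^esub> ?\<gamma>) \<otimes>\<^bsub>ring_of K\<^esub> (i \<otimes>\<^bsub>ring_of K\<^esub> i)"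
      unfolding t_def using kc i(1) by (simp add: K.R.l_distr K.R.r_distr K.R.m_ac)
    finally have t0: "\<one>\<^bsub>ring_of K\<^esub> \<oplus>\<^bsub>ring_of K\<^esub> t \<otimes>\<^bsub>ring_of K\<^esub> t = \<zero>\<^bsub>ring_of K\<^esub>"
      unfolding 0 using i by simp
    have c0: "csm 1 (\<lambda>v. v 0)" by (rule csm_coord) simp
    have c1: "csm 1 (\<lambda>v. 1 + v 0 * v 0)" by (intro csm_add csm_const csm_mult c0)
    have nz: "1 + v 0 * v 0 \<noteq> 0" for v :: "nat \<Rightarrow> real" using zero_le_square[of "v 0"] by linarith
    have c2: "csm 1 (\<lambda>v. inverse (1 + v 0 * v 0))" by (rule csm_inverse[OF c1]) (rule nz)
    have tt: "(\<lambda>_. t) j \<in> carrier K" if "j < 1" for j :: nat using tc by simp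
    have v0: "sop K 1 (\<lambda>v. v 0) (\<lambda>_. t) = t" using K.sop_coord[of 0 1 "\<lambda>_. t"] tc by simp
    have "sop K 1 (\<lambda>v. 1 + v 0 * v 0) (\<lambda>_. t) = sop K 1 (\<lambda>v. 1) (\<lambda>_. t) \<oplus>\<^bsub>ring_of K\<^esub> sop K 1 (\<lambda>v. v 0 * v 0) (\<lambda>_. t)"
      by (rule K.sop_add[OF csm_const csm_mult[OF c0 c0] tt])
    also have "sop K 1 (\<lambda>v. v 0 * v 0) (\<lambda>_. t) = t \<otimes>\<^bsub>ring_of K\<^esub> t"
      using K.sop_mult[where x = "\<lambda>_. t", OF c0 c0 tt] v0 by simp
    also have "sop K 1 (\<lambda>v. 1) (\<lambda>_. t) = \<one>\<^bsub>ring_of K\<^esub>"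
      unfolding ring_of_one by (rule K.sop_const[OF tt])
    finally have s0: "sop K 1 (\<lambda>v. 1 + v 0 * v 0) (\<lambda>_. t) = \<zero>\<^bsub>ring_of K\<^esub>" using t0 by simp
    have "sop K 1 (\<lambda>v. (1 + v 0 * v 0) * inverse (1 + v 0 * v 0)) (\<lambda>_. t) =
      sop K 1 (\<lambda>v. 1 + v 0 * v 0) (\<lambda>_. t) \<otimes>\<^bsub>ring_of K\<^esub> sop K 1 (\<lambda>v. inverse (1 + v 0 * v 0)) (\<lambda>_. t)"
      by (rule K.sop_mult[OF c1 c2 tt])
    moreover have "(\<lambda>v::nat\<Rightarrow>real. (1 + v 0 * v 0) * inverse (1 + v 0 * v 0)) = (\<lambda>_. 1)"
      by (rule ext, rule right_inverse, rule nz)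
    moreover have "sop K 1 (\<lambda>_. 1) (\<lambda>_. t) = \<one>\<^bsub>ring_of K\<^esub>"
      unfolding ring_of_one by (rule K.sop_const[OF tt])
    moreover have "sop K 1 (\<lambda>v. inverse (1 + v 0 * v 0)) (\<lambda>_. t) \<in> carrier K"
      by (rule K.sop_closed[OF c2 tt])
    ultimately have "\<one>\<^bsub>ring_of K\<^esub> = \<zero>\<^bsub>ring_of K\<^esub>" using s0 by simp
    then show False using K(1) by (simp add: cinf_field_def)
  qed
  interpret P: ideal p "ring_of A" by (rule Spec_ideal[OF p])
  show ?thesis
  proof
    assume bc: "b \<otimes>\<^bsub>ring_of A\<^esub> b \<oplus>\<^bsub>ring_of A\<^esub> c \<otimes>\<^bsub>ring_of A\<^esub> c \<in> p"
    then have "c \<otimes>\<^bsub>ring_of A\<^esub> c \<oplus>\<^bsub>ring_of A\<^esub> b \<otimes>\<^bsub>ring_of A\<^esub> b \<in> p" using b by (simp add: R.a_comm)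
    then show "b \<in> p \<and> c \<in> p" using one[OF b bc] one[of c b] b by blast
  next
    assume "b \<in> p \<and> c \<in> p"
    then show "b \<otimes>\<^bsub>ring_of A\<^esub> b \<oplus>\<^bsub>ring_of A\<^esub> c \<otimes>\<^bsub>ring_of A\<^esub> c \<in> p"
      using P.I_l_closed[of b b] P.I_l_closed[of c c] b by (intro P.a_closed) auto
  qed
qed

text \<open>Primality handles the two open conditions by a product; reality of smooth primes handles
  the two closed conditions by a sum of squares, so a single pair describes the
  intersection.\<close>

lemma basic_Int:
  assumes "U \<in> basic_opens A" "V \<in> basic_opens A"
  shows "U \<inter> V \<in> basic_opens A"
proof -
  obtain a b where U: "(a, b) \<in> pairs A U" using assms(1) by (rule basic_opens_obtain)
  obtain c d where V: "(c, d) \<in> pairs A V" using assms(2) by (rule basic_opens_obtain)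
  note u = pairsD[OF U] and v = pairsD[OF V]
  have "U \<inter> V = D_inf A (a \<otimes>\<^bsub>ring_of A\<^esub> c) \<inter> Z_inf A (b \<otimes>\<^bsub>ring_of A\<^esub> b \<oplus>\<^bsub>ring_of A\<^esub> d \<otimes>\<^bsub>ring_of A\<^esub> d)"
    unfolding u(3)[symmetric] v(3)[symmetric]
    using Spec_prime[OF _ u(1) v(1)] Spec_sum_squares[OF _ u(2) v(2)] by (auto simp: D_inf_def Z_inf_def)
  then show ?thesis using basic_opensI u v by simp
qed

lemma base_presheaf_F: "base_presheaf (basic_opens A) (F_obj A) (F_res A)"
proof (rule base_presheaf.intro, goal_cases)
  case (1 U V)
  then show ?case by (rule basic_Int)
next
  case (2 U)
  show ?case by (rule F_cinf_ring)
next
  case (3 V U s)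
  show ?case by (rule F_res_closed[OF 3(1,2,4)])
next
  case (4 V U n G x)
  show ?case by (rule F_res_op[OF 4(1,2,4,5)])
next
  case (5 U s)
  then show ?case by (rule F_res_self)
next
  case (6 V U W s)
  show ?case by (rule F_res_comp[OF 6(2,1,4,3,6)])
qed

lemma HH_eq: "HH A = assoc_sheaf (basic_opens A) (F_obj A) (F_res A) (cinf_Spec A)"
  by (simp add: HH_def H_sheaf_def topspace_Spec)

interpretation P: base_presheaf "basic_opens A" "F_obj A" "F_res A"
  by (rule base_presheaf_F)

lemma HH_cinf_ring: "cinf_ring (HH A)"
  unfolding HH_eq by (rule P.sheaf_cinf_ring[OF Spec_basic])

lemma mu_hom: "mu A \<in> cinf_hom A (HH A)"
proof -
  have "mu A = compose (carrier A) (restrict (sheafification_map (basic_opens A) (F_obj A) (F_res A) (cinf_Spec A))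
      (carrier (F_obj A (cinf_Spec A)))) (F_map (cinf_Spec A))"
    unfolding mu_def compose_def topspace_Spec
    by (rule restrict_ext) (simp add: F_map_def F_unit_closed)
  then show ?thesis
    using cinf_hom_compose[OF F_map_hom P.sheafification_map_hom[OF Spec_basic] cinf_ring_axioms] by (simp add: HH_eq)
qed

lemma mu_at:
  assumes x: "x \<in> carrier A" and U: "U \<in> basic_opens A" "p \<in> U"
  shows "mu A x p = P.gm p U (F_map U x)"
proof -
  have s: "U \<subseteq> cinf_Spec A" by (rule basic_subset[OF U(1)])
  have "mu A x p = P.gm p (cinf_Spec A) (F_map (cinf_Spec A) x)"
    using x U s by (auto simp: mu_def topspace_Spec sheafification_map_def F_map_def)
  also have "\<dots> = P.gm p U (F_res A (cinf_Spec A) U (F_map (cinf_Spec A) x))"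
    by (rule P.germ_res[OF Spec_basic cinf_hom_closed[OF F_map_hom x] U(1) s U(2), symmetric])
  finally show ?thesis unfolding F_res_map[OF s Spec_basic x] .
qed

lemma eval_hom: "p \<in> cinf_Spec A \<Longrightarrow> (\<lambda>\<sigma>\<in>carrier (HH A). \<sigma> p) \<in> cinf_hom (HH A) (P.st p)"
  unfolding HH_eq by (rule P.sheaf_eval_hom[OF Spec_basic])

lemma stalk_ring: "p \<in> cinf_Spec A \<Longrightarrow> cinf_ring (P.st p)"
  by (rule P.stalk_cinf_ring[OF Spec_basic])

text \<open>The germ may be computed on the neighbourhood \<open>Z_inf A x\<close>, where the
  section of x is already zero.\<close>

lemma mu_at_zero:
  assumes p: "p \<in> cinf_Spec A" and x: "x \<in> carrier A" "x \<in> p"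
  shows "mu A x p = \<zero>\<^bsub>ring_of (P.st p)\<^esub>"
proof -
  have U: "Z_inf A x \<in> basic_opens A" "p \<in> Z_inf A x" using Z_basic p x by (auto simp: Z_inf_def)
  interpret F: cinf_ring "F_obj A (Z_inf A x)" by (rule F_cinf_ring)
  have "F_map (Z_inf A x) x = \<zero>\<^bsub>ring_of (F_obj A (Z_inf A x))\<^esub>" using F_map_zero_iff[OF U(1) x(1)] by simp
  then have "mu A x p = P.gm p (Z_inf A x) \<zero>\<^bsub>ring_of (F_obj A (Z_inf A x))\<^esub>" using mu_at[OF x(1) U] by simp
  also have "\<dots> = \<zero>\<^bsub>ring_of (P.st p)\<^esub>"
    using cinf_hom_zero(1)[OF F.cinf_ring_axioms stalk_ring[OF p] P.germ_hom[OF U]] by simp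
  finally show ?thesis .
qed

text \<open>The germ may be computed on \<open>D_inf A x\<close>, where the section of x is already
  invertible.\<close>

lemma mu_at_unit:
  assumes p: "p \<in> cinf_Spec A" and x: "x \<in> carrier A" "x \<notin> p"
  shows "mu A x p \<in> Units (ring_of (P.st p))"
proof -
  have U: "D_inf A x \<in> basic_opens A" "p \<in> D_inf A x" using D_basic p x by (auto simp: D_inf_def)
  interpret F: cinf_ring "F_obj A (D_inf A x)" by (rule F_cinf_ring)
  have "F_map (D_inf A x) x \<in> Units (ring_of (F_obj A (D_inf A x)))" using F_map_unit_iff[OF U(1) x(1)] by simp
  from cinf_hom_unit[OF F.cinf_ring_axioms stalk_ring[OF p] P.germ_hom[OF U] this]
  show ?thesis using mu_at[OF x(1) U] cinf_hom_closed[OF F_map_hom x(1)] by simp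
qed

lemma F_section_expr:
  assumes ab: "(a, b) \<in> pairs A U" and s: "s \<in> carrier (F_obj A U)"
  obtains \<eta> m F y where "\<eta> \<in> carrier (F_obj A U)"
    "F_map U a \<otimes>\<^bsub>ring_of (F_obj A U)\<^esub> \<eta> = \<one>\<^bsub>ring_of (F_obj A U)\<^esub>"
    "csm (Suc m) F" "\<forall>i<m. y i \<in> carrier A" "s = sop (F_obj A U) (Suc m) F ((\<lambda>i. F_map U (y i))(m := \<eta>))"
proof -
  interpret F: cinf_ring "F_obj A U" by (rule F_cinf_ring)
  have U: "U \<in> basic_opens A" using basic_opensI pairsD[OF ab] by metis
  have u: "F_map U a \<in> Units (ring_of (F_obj A U))"
    unfolding F_map_unit_iff[OF U pairsD(1)[OF ab]] using pairsD(3)[OF ab] by blast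
  let ?\<eta> = "inv\<^bsub>ring_of (F_obj A U)\<^esub> F_map U a"
  have \<eta>: "?\<eta> \<in> carrier (F_obj A U)" "F_map U a \<otimes>\<^bsub>ring_of (F_obj A U)\<^esub> ?\<eta> = \<one>\<^bsub>ring_of (F_obj A U)\<^esub>"
    using u F.R.Units_inv_closed F.R.Units_r_inv by auto
  from F_smooth_expr[OF ab \<eta> s]
  show ?thesis unfolding smooth_expr_def using that[OF \<eta>] by blast
qed

text \<open>By the fraction form, a section is locally zero or invertible, according to its numerator.\<close>

lemma local_qinv:
  assumes U: "U \<in> basic_opens A" "p \<in> U" and s: "s \<in> carrier (F_obj A U)"
  obtains W u where "W \<in> basic_opens A" "p \<in> W" "W \<subseteq> U" "qinv (F_obj A W) (F_res A U W s) u"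
proof -
  obtain a b where ab: "(a, b) \<in> pairs A U" using U(1) by (rule basic_opens_obtain)
  interpret F: cinf_ring "F_obj A U" by (rule F_cinf_ring)
  obtain \<eta> m F y where \<eta>: "\<eta> \<in> carrier (F_obj A U)"
    "F_map U a \<otimes>\<^bsub>ring_of (F_obj A U)\<^esub> \<eta> = \<one>\<^bsub>ring_of (F_obj A U)\<^esub>"
    by (rule F_section_expr[OF ab s]) (rule that)
  interpret E: cinf_extension A "F_obj A U" "F_map U" \<eta>
    by unfold_locales (rule F_map_hom, rule \<eta>)
  obtain h w where hw: "h \<in> carrier A" "w \<in> carrier A" "F_map U w \<in> Units (ring_of (F_obj A U))"
    "s \<otimes>\<^bsub>ring_of (F_obj A U)\<^esub> F_map U w = F_map U h"
    by (rule E.fraction_form[OF pairsD(1)[OF ab] \<eta>(2) F_smooth_expr[OF ab \<eta> s]]) (rule that)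
  have p: "p \<in> cinf_Spec A" using basic_subset[OF U(1)] U(2) by blast
  have res: "F_res A U W s \<in> carrier (F_obj A W)" "F_map W w \<in> Units (ring_of (F_obj A W))"
    "F_res A U W s \<otimes>\<^bsub>ring_of (F_obj A W)\<^esub> F_map W w = F_map W h" if W: "W \<in> basic_opens A" "W \<subseteq> U" for W
  proof -
    interpret FW: cinf_ring "F_obj A W" by (rule F_cinf_ring)
    show "F_res A U W s \<in> carrier (F_obj A W)" by (rule F_res_closed[OF W(2) U(1) s])
    have rh: "restrict (F_res A U W) (carrier (F_obj A U)) \<in> cinf_hom (F_obj A U) (F_obj A W)"
    proof (rule cinf_homI)
      show "restrict (F_res A U W) (carrier (F_obj A U)) \<in> carrier (F_obj A U) \<rightarrow>\<^sub>E carrier (F_obj A W)"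
        using F_res_closed[OF W(2) U(1)] by auto
      fix n G x assume G: "csm n G" and x: "\<And>i. i < n \<Longrightarrow> x i \<in> carrier (F_obj A U)"
      have "sop (F_obj A W) n G (\<lambda>i. F_res A U W (x i)) =
        sop (F_obj A W) n G (\<lambda>i. restrict (F_res A U W) (carrier (F_obj A U)) (x i))"
        by (rule sop_cong) (simp add: x)
      then show "restrict (F_res A U W) (carrier (F_obj A U)) (sop (F_obj A U) n G x) =
        sop (F_obj A W) n G (\<lambda>i. restrict (F_res A U W) (carrier (F_obj A U)) (x i))"
        using F.sop_closed[OF G x] F_res_op[where x = x, OF W(2) U(1) G x] by simp
    qed
    have "W \<subseteq> D_inf A w" using hw(3) W(2) unfolding F_map_unit_iff[OF U(1) hw(2)] by blast
    then show "F_map W w \<in> Units (ring_of (F_obj A W))" using F_map_unit_iff[OF W(1) hw(2)] by simp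
    have c: "F_map U w \<in> carrier (F_obj A U)" "F_map U h \<in> carrier (F_obj A U)"
      using cinf_hom_closed[OF F_map_hom] hw by auto
    show "F_res A U W s \<otimes>\<^bsub>ring_of (F_obj A W)\<^esub> F_map W w = F_map W h"
      using cinf_hom_arith(1)[OF F.cinf_ring_axioms FW.cinf_ring_axioms rh s c(1)] hw(4) s c
        F_res_map[OF W(2) U(1)] hw(1,2) by simp
  qed
  show ?thesis
  proof (cases "h \<in> p")
    case True
    \<comment> \<open>Here h becomes zero while w stays invertible, so the section is zero and is
      its own quasi-inverse.\<close>
    let ?W = "U \<inter> Z_inf A h"
    have W: "?W \<in> basic_opens A" "p \<in> ?W" "?W \<subseteq> U"
      using basic_Int[OF U(1) Z_basic[OF hw(1)]] U(2) True p by (auto simp: Z_inf_def)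
    interpret FW: cinf_ring "F_obj A ?W" by (rule F_cinf_ring)
    note r = res[OF W(1,3)]
    have "F_map ?W h = \<zero>\<^bsub>ring_of (F_obj A ?W)\<^esub>" using F_map_zero_iff[OF W(1) hw(1)] by simp
    then have "F_map ?W w \<otimes>\<^bsub>ring_of (F_obj A ?W)\<^esub> F_res A U ?W s = F_map ?W w \<otimes>\<^bsub>ring_of (F_obj A ?W)\<^esub> \<zero>\<^bsub>ring_of (F_obj A ?W)\<^esub>"
      using r cinf_hom_closed[OF F_map_hom hw(2)] by (simp add: FW.R.m_comm)
    then have "F_res A U ?W s = \<zero>\<^bsub>ring_of (F_obj A ?W)\<^esub>"
      using FW.R.Units_l_cancel[OF r(2)] r(1) by simp
    then show ?thesis using that[OF W] FW.qinv_zero by simp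
  next
    case False
    \<comment> \<open>Here h becomes invertible, and w divided by h inverts the section.\<close>
    let ?W = "U \<inter> D_inf A h"
    have W: "?W \<in> basic_opens A" "p \<in> ?W" "?W \<subseteq> U"
      using basic_Int[OF U(1) D_basic[OF hw(1)]] U(2) False p by (auto simp: D_inf_def)
    interpret FW: cinf_ring "F_obj A ?W" by (rule F_cinf_ring)
    note r = res[OF W(1,3)]
    have u: "F_map ?W h \<in> Units (ring_of (F_obj A ?W))" using F_map_unit_iff[OF W(1) hw(1)] by simp
    let ?i = "F_map ?W w \<otimes>\<^bsub>ring_of (F_obj A ?W)\<^esub> inv\<^bsub>ring_of (F_obj A ?W)\<^esub> F_map ?W h"
    have wc: "F_map ?W w \<in> carrier (F_obj A ?W)" by (rule cinf_hom_closed[OF F_map_hom hw(2)])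
    have ic: "inv\<^bsub>ring_of (F_obj A ?W)\<^esub> F_map ?W h \<in> carrier (F_obj A ?W)" using FW.R.Units_inv_closed[OF u] by simp
    have "F_res A U ?W s \<otimes>\<^bsub>ring_of (F_obj A ?W)\<^esub> ?i = \<one>\<^bsub>ring_of (F_obj A ?W)\<^esub>"
      using r(1,3) wc ic FW.R.Units_r_inv[OF u] by (simp flip: FW.R.m_assoc)
    then have "qinv (F_obj A ?W) (F_res A U ?W s) ?i" using r(1) wc ic by (intro FW.qinv_inverse) simp_all
    then show ?thesis by (rule that[OF W])
  qed
qed

text \<open>\<open>local_qinv\<close> gives quasi-inverses on small neighbourhoods, and the two
  equations can be checked in the stalks.\<close>

lemma HH_vN_regular: "vN_regular (HH A)"
proof -
  interpret H: cinf_ring "HH A" by (rule HH_cinf_ring)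
  have "\<exists>\<tau>. qinv (HH A) \<sigma> \<tau>" if \<sigma>: "\<sigma> \<in> carrier (HH A)" for \<sigma>
  proof -
    have \<sigma>': "\<sigma> \<in> carrier (P.sheaf (cinf_Spec A))" using \<sigma> by (simp add: HH_eq)
    have "\<exists>W u. W \<in> basic_opens A \<and> p \<in> W \<and> u \<in> carrier (F_obj A W) \<and>
      (\<forall>q\<in>W. qinv (P.st q) (\<sigma> q) (P.gm q W u))" if p: "p \<in> cinf_Spec A" for p
    proof -
      obtain U s where U: "U \<in> basic_opens A" "p \<in> U" "U \<subseteq> cinf_Spec A" "s \<in> carrier (F_obj A U)"
        "\<And>q. q \<in> U \<Longrightarrow> \<sigma> q = P.gm q U s"
        by (rule P.sheaf_local[OF \<sigma>' p]) (rule that)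
      obtain W u where W: "W \<in> basic_opens A" "p \<in> W" "W \<subseteq> U" "qinv (F_obj A W) (F_res A U W s) u"
        by (rule local_qinv[OF U(1,2,4)]) (rule that)
      have uc: "u \<in> carrier (F_obj A W)" "F_res A U W s \<in> carrier (F_obj A W)" using W(4) by (auto simp: qinv_def)
      have "qinv (P.st q) (\<sigma> q) (P.gm q W u)" if q: "q \<in> W" for q
      proof -
        have qS: "q \<in> cinf_Spec A" "q \<in> U" using basic_subset[OF W(1)] q W(3) by auto
        have "P.gm q W (F_res A U W s) = \<sigma> q"
          using P.germ_res[OF U(1,4) W(1,3) q] U(5)[OF qS(2)] by simp
        then show ?thesis
          using hom_qinv[OF F_cinf_ring stalk_ring[OF qS(1)] P.germ_hom[OF W(1) q] W(4)] uc by simp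
      qed
      then show ?thesis using W uc by blast
    qed
    then have "\<forall>p. \<exists>Wu. p \<in> cinf_Spec A \<longrightarrow> fst Wu \<in> basic_opens A \<and> p \<in> fst Wu \<and> snd Wu \<in> carrier (F_obj A (fst Wu)) \<and>
      (\<forall>q\<in>fst Wu. qinv (P.st q) (\<sigma> q) (P.gm q (fst Wu) (snd Wu)))" by (metis fst_conv snd_conv)
    from choice[OF this] obtain c where c: "\<forall>p. p \<in> cinf_Spec A \<longrightarrow> fst (c p) \<in> basic_opens A \<and> p \<in> fst (c p) \<and>
      snd (c p) \<in> carrier (F_obj A (fst (c p))) \<and> (\<forall>q\<in>fst (c p). qinv (P.st q) (\<sigma> q) (P.gm q (fst (c p)) (snd (c p))))" ..
    \<comment> \<open>Each point picks a germ from its own neighbourhood; the picks form a section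
      because quasi-inverses in a stalk are unique, so nearby picks agree.\<close>
    define \<tau> where "\<tau> = (\<lambda>p\<in>cinf_Spec A. P.gm p (fst (c p)) (snd (c p)))"
    have \<tau>p: "qinv (P.st p) (\<sigma> p) (\<tau> p)" if "p \<in> cinf_Spec A" for p using c that by (simp add: \<tau>_def)
    have \<tau>: "\<tau> \<in> carrier (P.sheaf (cinf_Spec A))"
      unfolding P.sheaf_carrier_iff
    proof (intro conjI ballI)
      show "\<tau> \<in> extensional (cinf_Spec A)" by (simp add: \<tau>_def)
      fix p assume p: "p \<in> cinf_Spec A"
      show "\<tau> p \<in> carrier (P.st p)" using \<tau>p[OF p] by (simp add: qinv_def)
      let ?W = "fst (c p)" and ?u = "snd (c p)"
      have W: "?W \<in> basic_opens A" "p \<in> ?W" "?u \<in> carrier (F_obj A ?W)"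
        "\<forall>q\<in>?W. qinv (P.st q) (\<sigma> q) (P.gm q ?W ?u)" using c p by auto
      note WS = basic_subset[OF W(1)]
      have "\<tau> q = P.gm q ?W ?u" if "q \<in> ?W" for q
      proof -
        have qS: "q \<in> cinf_Spec A" using that WS by blast
        show ?thesis
          by (rule cinf_ring.qinv_unique[OF stalk_ring[OF qS] \<tau>p[OF qS]]) (use W(4) that in blast)
      qed
      then show "\<exists>U\<in>basic_opens A. p \<in> U \<and> U \<subseteq> cinf_Spec A \<and> (\<exists>s\<in>carrier (F_obj A U). \<forall>q\<in>U. \<tau> q = P.gm q U s)"
        using W WS by blast
    qed
    then have \<tau>H: "\<tau> \<in> carrier (HH A)" by (simp add: HH_eq)
    have ev: "(x \<otimes>\<^bsub>ring_of (HH A)\<^esub> x \<otimes>\<^bsub>ring_of (HH A)\<^esub> y) p = x p \<otimes>\<^bsub>ring_of (P.st p)\<^esub> x p \<otimes>\<^bsub>ring_of (P.st p)\<^esub> y p"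
      if p: "p \<in> cinf_Spec A" and xy: "x \<in> carrier (HH A)" "y \<in> carrier (HH A)" for p x y
    proof -
      note m = cinf_hom_arith(1)[OF H.cinf_ring_axioms stalk_ring[OF p] eval_hom[OF p]]
      show ?thesis using m[of "x \<otimes>\<^bsub>ring_of (HH A)\<^esub> x" y] m[of x x] xy by simp
    qed
    have "x \<otimes>\<^bsub>ring_of (HH A)\<^esub> x \<otimes>\<^bsub>ring_of (HH A)\<^esub> y = x"
      if xy: "x \<in> carrier (HH A)" "y \<in> carrier (HH A)"
        and eq: "\<And>p. p \<in> cinf_Spec A \<Longrightarrow> x p \<otimes>\<^bsub>ring_of (P.st p)\<^esub> x p \<otimes>\<^bsub>ring_of (P.st p)\<^esub> y p = x p" for x y
    proof (rule P.sheaf_eqI[where W = "cinf_Spec A"])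
      show "x \<otimes>\<^bsub>ring_of (HH A)\<^esub> x \<otimes>\<^bsub>ring_of (HH A)\<^esub> y \<in> carrier (P.sheaf (cinf_Spec A))"
        using xy by (simp flip: HH_eq)
      show "x \<in> carrier (P.sheaf (cinf_Spec A))" using xy by (simp flip: HH_eq)
      show "(x \<otimes>\<^bsub>ring_of (HH A)\<^esub> x \<otimes>\<^bsub>ring_of (HH A)\<^esub> y) p = x p" if "p \<in> cinf_Spec A" for p
        using ev[OF that xy] eq[OF that] by simp
    qed
    then have "qinv (HH A) \<sigma> \<tau>"
      using \<sigma> \<tau>H \<tau>p unfolding qinv_def by blast
    then show ?thesis by blast
  qed
  then show ?thesis unfolding H.vN_regular_iff_qinv by blast
qed

end

section \<open>The universal property\<close>

lemma quot_compose_field: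
  assumes A: "cinf_ring A" and V: "cinf_ring V" and f: "f \<in> cinf_hom A V" and q: "maximalideal q (ring_of V)"
  shows "cinf_field (quot_ideal V q)" "compose (carrier A) (quot_map V q) f \<in> cinf_hom A (quot_ideal V q)"
  using quot_maximal_field[OF V q]
    cinf_hom_compose[OF f cinf_ring.quot_map_hom[OF V maximalideal.axioms(1)[OF q]] A] by auto

context cinf_ring
begin

interpretation P: base_presheaf "basic_opens A" "F_obj A" "F_res A"
  by (rule base_presheaf_F)

text \<open>\<open>\<epsilon>\<close> vanishes off \<open>U = D(a) \<inter> Z(b)\<close>, and on \<open>U\<close> the section \<open>\<sigma>\<close> agrees with a smooth expression in
  elements of the image of \<open>mu\<close> and their quasi-inverses.\<close>

lemma section_expr:
  assumes \<sigma>: "\<sigma> \<in> carrier (HH A)" and p: "p \<in> cinf_Spec A"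
  obtains a b \<alpha> \<beta> m F y where "a \<in> carrier A" "b \<in> carrier A" "a \<notin> p" "b \<in> p"
    "qinv (HH A) (mu A a) \<alpha>" "qinv (HH A) (mu A b) \<beta>" "csm (Suc m) F" "\<forall>i<m. y i \<in> carrier A"
    "mu A a \<otimes>\<^bsub>ring_of (HH A)\<^esub> (\<one>\<^bsub>ring_of (HH A)\<^esub> \<ominus>\<^bsub>ring_of (HH A)\<^esub> mu A b \<otimes>\<^bsub>ring_of (HH A)\<^esub> \<beta>) \<otimes>\<^bsub>ring_of (HH A)\<^esub> \<sigma> =
     mu A a \<otimes>\<^bsub>ring_of (HH A)\<^esub> (\<one>\<^bsub>ring_of (HH A)\<^esub> \<ominus>\<^bsub>ring_of (HH A)\<^esub> mu A b \<otimes>\<^bsub>ring_of (HH A)\<^esub> \<beta>) \<otimes>\<^bsub>ring_of (HH A)\<^esub>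
       sop (HH A) (Suc m) F ((\<lambda>i. mu A (y i))(m := \<alpha>))"
proof -
  interpret H: cinf_ring "HH A" by (rule HH_cinf_ring)
  have \<sigma>': "\<sigma> \<in> carrier (P.sheaf (cinf_Spec A))" using \<sigma> by (simp add: HH_eq)
  obtain U s where U: "U \<in> basic_opens A" "p \<in> U" "U \<subseteq> cinf_Spec A" "s \<in> carrier (F_obj A U)"
    "\<And>q. q \<in> U \<Longrightarrow> \<sigma> q = P.gm q U s"
    by (rule P.sheaf_local[OF \<sigma>' p]) (rule that)
  obtain a b where ab: "(a, b) \<in> pairs A U" using U(1) by (rule basic_opens_obtain)
  note pab = pairsD[OF ab]
  interpret FU: cinf_ring "F_obj A U" by (rule F_cinf_ring)
  obtain \<eta> m F y where \<eta>: "\<eta> \<in> carrier (F_obj A U)"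
    "F_map U a \<otimes>\<^bsub>ring_of (F_obj A U)\<^esub> \<eta> = \<one>\<^bsub>ring_of (F_obj A U)\<^esub>"
    and F: "csm (Suc m) F" and y: "\<forall>i<m. y i \<in> carrier A"
    and sF: "s = sop (F_obj A U) (Suc m) F ((\<lambda>i. F_map U (y i))(m := \<eta>))"
    by (rule F_section_expr[OF ab U(4)]) (rule that)
  note mc = cinf_hom_closed[OF mu_hom]
  obtain \<alpha> where \<alpha>: "qinv (HH A) (mu A a) \<alpha>"
    using HH_vN_regular H.vN_regular_iff_qinv mc[OF pab(1)] by blast
  obtain \<beta> where \<beta>: "qinv (HH A) (mu A b) \<beta>"
    using HH_vN_regular H.vN_regular_iff_qinv mc[OF pab(2)] by blast
  have c: "mu A a \<in> carrier (HH A)" "mu A b \<in> carrier (HH A)" "\<alpha> \<in> carrier (HH A)" "\<beta> \<in> carrier (HH A)"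
    using \<alpha> \<beta> by (auto simp: qinv_def)
  let ?u = "(\<lambda>i. mu A (y i))(m := \<alpha>)"
  have uc: "?u i \<in> carrier (HH A)" if "i < Suc m" for i
    by (rule tuple_upd_closed[OF _ c(3) that]) (use y mc in blast)
  let ?\<zeta> = "sop (HH A) (Suc m) F ?u"
  have \<zeta>: "?\<zeta> \<in> carrier (HH A)" by (rule H.sop_closed[OF F uc])
  define d where "d = \<one>\<^bsub>ring_of (HH A)\<^esub> \<ominus>\<^bsub>ring_of (HH A)\<^esub> mu A b \<otimes>\<^bsub>ring_of (HH A)\<^esub> \<beta>"
  define \<epsilon> where "\<epsilon> = mu A a \<otimes>\<^bsub>ring_of (HH A)\<^esub> d"
  have dc: "d \<in> carrier (HH A)" using c by (simp add: d_def)
  have \<epsilon>c: "\<epsilon> \<in> carrier (HH A)" using c dc by (simp add: \<epsilon>_def)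
  have pt: "(\<epsilon> \<otimes>\<^bsub>ring_of (HH A)\<^esub> \<sigma>) q = (\<epsilon> \<otimes>\<^bsub>ring_of (HH A)\<^esub> ?\<zeta>) q" if q: "q \<in> cinf_Spec A" for q
  proof -
    interpret S: cinf_ring "P.st q" by (rule stalk_ring[OF q])
    note eh = eval_hom[OF q]
    note ar = cinf_hom_arith[OF H.cinf_ring_axioms S.cinf_ring_axioms eh]
    have mult: "(x \<otimes>\<^bsub>ring_of (HH A)\<^esub> z) q = x q \<otimes>\<^bsub>ring_of (P.st q)\<^esub> z q"
      if "x \<in> carrier (HH A)" "z \<in> carrier (HH A)" for x z using ar(1)[OF that] that by simp
    have at: "x q \<in> carrier (P.st q)" if "x \<in> carrier (HH A)" for x
      using cinf_hom_closed[OF eh that] that by simp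
    have dq: "d q = \<one>\<^bsub>ring_of (P.st q)\<^esub> \<ominus>\<^bsub>ring_of (P.st q)\<^esub> (mu A b q \<otimes>\<^bsub>ring_of (P.st q)\<^esub> \<beta> q)"
      using ar(3)[of "\<one>\<^bsub>ring_of (HH A)\<^esub>" "mu A b \<otimes>\<^bsub>ring_of (HH A)\<^esub> \<beta>"] c mult[OF c(2,4)]
        cinf_hom_zero(2)[OF H.cinf_ring_axioms S.cinf_ring_axioms eh]
      by (simp add: d_def)
    have \<epsilon>q: "\<epsilon> q = mu A a q \<otimes>\<^bsub>ring_of (P.st q)\<^esub> d q" using mult[OF c(1) dc] by (simp add: \<epsilon>_def)
    show ?thesis
    proof (cases "q \<in> U")
      case True
      have "qinv (P.st q) (mu A a q) (\<alpha> q)"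
        using hom_qinv[OF H.cinf_ring_axioms S.cinf_ring_axioms eh \<alpha>] c by simp
      note z = this
      have Fc: "F_map U x \<in> carrier (F_obj A U)" if "x \<in> carrier A" for x by (rule cinf_hom_closed[OF F_map_hom that])
      have \<phi>: "(\<lambda>s\<in>carrier (F_obj A U). P.gm q U s) (F_map U x) = mu A x q" if "x \<in> carrier A" for x
        using mu_at[OF that U(1) True] Fc[OF that] by simp
      have "\<sigma> q = (\<lambda>s\<in>carrier (F_obj A U). P.gm q U s) s" using U(4) U(5)[OF True] by simp
      also have "\<dots> = sop (P.st q) (Suc m) F ((\<lambda>i. mu A (y i) q)(m := \<alpha> q))"
        unfolding sF 
        by (rule hom_smooth_expr[where A = A and \<eta> = "F_map U" and \<phi> = "\<lambda>x. mu A x q",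
              OF FU.cinf_ring_axioms S.cinf_ring_axioms P.germ_hom[OF U(1) True] F y pab(1) Fc \<eta> \<phi> z])
      also have "\<dots> = sop (P.st q) (Suc m) F (\<lambda>i. ?u i q)"
      proof (rule sop_cong)
        fix i show "((\<lambda>i. mu A (y i) q)(m := \<alpha> q)) i = ?u i q" by (cases "i = m") simp_all
      qed
      also have "\<dots> = ?\<zeta> q" using q by (simp add: HH_eq P.sop_sheaf)
      finally show ?thesis using mult[OF \<epsilon>c \<sigma>] mult[OF \<epsilon>c \<zeta>] by simp
    next
      case False
      \<comment> \<open>Off U the factor dies in the stalk: either the germ of \<open>mu A a\<close>
        is zero, or that of \<open>mu A b\<close> is a unit and the germ \<open>d q\<close> is
        zero.\<close>
      then have "a \<in> q \<or> b \<notin> q" using pab(3) q by (auto simp: D_inf_def Z_inf_def)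
      then have "\<epsilon> q = \<zero>\<^bsub>ring_of (P.st q)\<^esub>"
      proof
        assume "a \<in> q"
        then show ?thesis using \<epsilon>q mu_at_zero[OF q pab(1)] at[OF dc] by simp
      next
        assume "b \<notin> q"
        have "qinv (P.st q) (mu A b q) (\<beta> q)"
          using hom_qinv[OF H.cinf_ring_axioms S.cinf_ring_axioms eh \<beta>] c by simp
        from S.qinv_unit_mult[OF this mu_at_unit[OF q pab(2) \<open>b \<notin> q\<close>]]
        have "d q = \<zero>\<^bsub>ring_of (P.st q)\<^esub>" using dq by (simp add: S.R.minus_eq S.R.r_neg)
        then show ?thesis using \<epsilon>q at[OF c(1)] by simp
      qed
      then show ?thesis using mult[OF \<epsilon>c \<sigma>] mult[OF \<epsilon>c \<zeta>] at[OF \<sigma>] at[OF \<zeta>] by simp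
    qed
  qed
  have "\<epsilon> \<otimes>\<^bsub>ring_of (HH A)\<^esub> \<sigma> = \<epsilon> \<otimes>\<^bsub>ring_of (HH A)\<^esub> ?\<zeta>"
  proof (rule P.sheaf_eqI[OF _ _ pt])
    show "\<epsilon> \<otimes>\<^bsub>ring_of (HH A)\<^esub> \<sigma> \<in> carrier (P.sheaf (cinf_Spec A))" using H.R.m_closed[OF \<epsilon>c \<sigma>] by (simp only: HH_eq)
    show "\<epsilon> \<otimes>\<^bsub>ring_of (HH A)\<^esub> ?\<zeta> \<in> carrier (P.sheaf (cinf_Spec A))" using H.R.m_closed[OF \<epsilon>c \<zeta>] by (simp only: HH_eq)
  qed
  note eq = this[unfolded \<epsilon>_def d_def]
  have "a \<notin> p" "b \<in> p" using U(2) pab(3) by (auto simp: D_inf_def Z_inf_def)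
  then show ?thesis using that[OF pab(1,2) _ _ \<alpha> \<beta> F y eq] by simp
qed

text \<open>By \<open>vN_zero_of_maximal\<close> it suffices to compare modulo a maximal ideal q.
  Take the section near the kernel of the common composite from \<open>A\<close> to V/q: there it
  equals a smooth expression up to a factor invertible in V/q, and both homomorphisms agree on the
  expression since quasi-inverses are unique.\<close>

lemma HH_hom_eqI:
  assumes V: "vN_cinf_ring V" and g: "g \<in> cinf_hom (HH A) V" and h: "h \<in> cinf_hom (HH A) V"
    and eq: "\<And>x. x \<in> carrier A \<Longrightarrow> g (mu A x) = h (mu A x)"
  shows "g = h"
proof (rule cinf_hom_eqI[OF g h])
  have Vr: "cinf_ring V" "vN_regular V" using V by (auto simp: vN_cinf_ring_def)
  interpret V: cinf_ring V by (rule Vr)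
  interpret H: cinf_ring "HH A" by (rule HH_cinf_ring)
  fix \<sigma> assume \<sigma>: "\<sigma> \<in> carrier (HH A)"
  have gc: "g \<sigma> \<in> carrier V" "h \<sigma> \<in> carrier V" using cinf_hom_closed[OF g \<sigma>] cinf_hom_closed[OF h \<sigma>] by auto
  have "g \<sigma> \<ominus>\<^bsub>ring_of V\<^esub> h \<sigma> \<in> q" if q: "maximalideal q (ring_of V)" for q
  proof -
    note qi = maximalideal.axioms(1)[OF q]
    let ?K = "quot_ideal V q"
    note K = quot_compose_field(1)[OF H.cinf_ring_axioms Vr(1) g q]
    interpret K: cinf_ring ?K using K by (simp add: cinf_field_def)
    define \<gamma> where "\<gamma> k = compose (carrier (HH A)) (quot_map V q) k" for k
    have \<gamma>: "\<gamma> g \<in> cinf_hom (HH A) ?K" "\<gamma> h \<in> cinf_hom (HH A) ?K"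
      unfolding \<gamma>_def using quot_compose_field(2)[OF H.cinf_ring_axioms Vr(1) _ q] g h by auto
    note mc = cinf_hom_closed[OF mu_hom]
    have \<gamma>mu: "\<gamma> h (mu A x) = \<gamma> g (mu A x)" if "x \<in> carrier A" for x
      using eq[OF that] mc[OF that] by (simp add: \<gamma>_def compose_def)
    define \<phi> where "\<phi> = compose (carrier A) (\<gamma> g) (mu A)"
    have \<phi>: "\<phi> \<in> cinf_hom A ?K" unfolding \<phi>_def by (rule cinf_hom_compose[OF mu_hom \<gamma>(1) cinf_ring_axioms])
    have \<phi>at: "\<gamma> g (mu A x) = \<phi> x" if "x \<in> carrier A" for x using that by (simp add: \<phi>_def compose_def)
    let ?p = "{x \<in> carrier A. \<phi> x = \<zero>\<^bsub>ring_of ?K\<^esub>}"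
    have p: "?p \<in> cinf_Spec A" by (rule kernel_spec[OF K \<phi>])
    obtain a b \<alpha> \<beta> m F y where ab: "a \<in> carrier A" "b \<in> carrier A" "a \<notin> ?p" "b \<in> ?p"
      and \<alpha>: "qinv (HH A) (mu A a) \<alpha>" and \<beta>: "qinv (HH A) (mu A b) \<beta>" and F: "csm (Suc m) F" and y: "\<forall>i<m. y i \<in> carrier A"
      and eqs: "mu A a \<otimes>\<^bsub>ring_of (HH A)\<^esub> (\<one>\<^bsub>ring_of (HH A)\<^esub> \<ominus>\<^bsub>ring_of (HH A)\<^esub> mu A b \<otimes>\<^bsub>ring_of (HH A)\<^esub> \<beta>) \<otimes>\<^bsub>ring_of (HH A)\<^esub> \<sigma> =
       mu A a \<otimes>\<^bsub>ring_of (HH A)\<^esub> (\<one>\<^bsub>ring_of (HH A)\<^esub> \<ominus>\<^bsub>ring_of (HH A)\<^esub> mu A b \<otimes>\<^bsub>ring_of (HH A)\<^esub> \<beta>) \<otimes>\<^bsub>ring_of (HH A)\<^esub>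
       sop (HH A) (Suc m) F ((\<lambda>i. mu A (y i))(m := \<alpha>))"
      by (rule section_expr[OF \<sigma> p]) (rule that)
    have c: "mu A a \<in> carrier (HH A)" "mu A b \<in> carrier (HH A)" "\<alpha> \<in> carrier (HH A)" "\<beta> \<in> carrier (HH A)"
      using \<alpha> \<beta> by (auto simp: qinv_def)
    let ?u = "(\<lambda>i. mu A (y i))(m := \<alpha>)"
    have uc: "?u i \<in> carrier (HH A)" if "i < Suc m" for i
      by (rule tuple_upd_closed[OF _ c(3) that]) (use y mc in blast)
    let ?\<zeta> = "sop (HH A) (Suc m) F ?u"
    have \<zeta>: "?\<zeta> \<in> carrier (HH A)" by (rule H.sop_closed[OF F uc])
    have \<alpha>eq: "\<gamma> h \<alpha> = \<gamma> g \<alpha>"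
      using K.qinv_unique hom_qinv[OF H.cinf_ring_axioms K.cinf_ring_axioms \<gamma>(1) \<alpha>]
        hom_qinv[OF H.cinf_ring_axioms K.cinf_ring_axioms \<gamma>(2) \<alpha>] \<gamma>mu[OF ab(1)] by metis
    have \<zeta>eq: "\<gamma> g ?\<zeta> = \<gamma> h ?\<zeta>"
    proof -
      have "\<gamma> g ?\<zeta> = sop ?K (Suc m) F (\<lambda>i. \<gamma> g (?u i))" by (rule hom_sop[OF \<gamma>(1) F uc])
      also have "\<dots> = sop ?K (Suc m) F (\<lambda>i. \<gamma> h (?u i))"
      proof (rule sop_cong)
        fix i assume "i < Suc m"
        then show "\<gamma> g (?u i) = \<gamma> h (?u i)" using \<alpha>eq \<gamma>mu y by (cases "i = m") simp_all
      qed
      also have "\<dots> = \<gamma> h ?\<zeta>" by (rule hom_sop[OF \<gamma>(2) F uc, symmetric])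
      finally show ?thesis .
    qed
    \<comment> \<open>As a lies outside and b inside the kernel, \<open>field_separator\<close>
      makes the image of the factor nonzero, so it cancels in the field.\<close>
    have red: "k \<sigma> = k ?\<zeta>" if k: "k \<in> cinf_hom (HH A) ?K" and kmu: "\<And>x. x \<in> carrier A \<Longrightarrow> k (mu A x) = \<phi> x" for k
    proof -
      note ar = cinf_hom_arith[OF H.cinf_ring_axioms K.cinf_ring_axioms k]
      let ?d = "\<one>\<^bsub>ring_of (HH A)\<^esub> \<ominus>\<^bsub>ring_of (HH A)\<^esub> mu A b \<otimes>\<^bsub>ring_of (HH A)\<^esub> \<beta>"
      let ?\<epsilon> = "mu A a \<otimes>\<^bsub>ring_of (HH A)\<^esub> ?d"
      have dc: "?d \<in> carrier (HH A)" "mu A b \<otimes>\<^bsub>ring_of (HH A)\<^esub> \<beta> \<in> carrier (HH A)" using c by auto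
      have \<epsilon>c: "?\<epsilon> \<in> carrier (HH A)" using c dc by simp
      have "k ?\<epsilon> = \<phi> a \<otimes>\<^bsub>ring_of ?K\<^esub> (\<one>\<^bsub>ring_of ?K\<^esub> \<ominus>\<^bsub>ring_of ?K\<^esub> \<phi> b \<otimes>\<^bsub>ring_of ?K\<^esub> k \<beta>)"
        using ar(1)[OF c(1) dc(1)] ar(3)[OF H.R.one_closed dc(2)] ar(1)[OF c(2,4)]
          cinf_hom_zero(2)[OF H.cinf_ring_axioms K.cinf_ring_axioms k] kmu ab by simp
      moreover have "qinv ?K (\<phi> b) (k \<beta>)"
        using hom_qinv[OF H.cinf_ring_axioms K.cinf_ring_axioms k \<beta>] kmu[OF ab(2)] by simp
      ultimately have "k ?\<epsilon> \<noteq> \<zero>\<^bsub>ring_of ?K\<^esub>"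
        using field_separator[OF K cinf_hom_closed[OF \<phi> ab(1)], of "\<phi> b" "k \<beta>"] ab by simp
      then have u: "k ?\<epsilon> \<in> Units (ring_of ?K)" using K cinf_hom_closed[OF k \<epsilon>c] by (simp add: cinf_field_def)
      have "k ?\<epsilon> \<otimes>\<^bsub>ring_of ?K\<^esub> k \<sigma> = k ?\<epsilon> \<otimes>\<^bsub>ring_of ?K\<^esub> k ?\<zeta>"
        using arg_cong[OF eqs, of k] ar(1)[OF \<epsilon>c \<sigma>] ar(1)[OF \<epsilon>c \<zeta>] by simp
      then show ?thesis
        using K.R.Units_l_cancel[OF u] cinf_hom_closed[OF k \<sigma>] cinf_hom_closed[OF k \<zeta>] by simp
    qed
    have "\<gamma> g \<sigma> = \<gamma> h \<sigma>"
      using red[OF \<gamma>(1) \<phi>at] red[OF \<gamma>(2)] \<gamma>mu \<phi>at \<zeta>eq by simp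
    then have "quot_map V q (g \<sigma>) = quot_map V q (h \<sigma>)" using \<sigma> by (simp add: \<gamma>_def compose_def)
    then show ?thesis using V.quot_map_eq[OF qi gc] by simp
  qed
  then have "g \<sigma> \<ominus>\<^bsub>ring_of V\<^esub> h \<sigma> = \<zero>\<^bsub>ring_of V\<^esub>"
    using gc by (intro V.vN_zero_of_maximal[OF Vr(2)]) simp_all
  then show "g \<sigma> = h \<sigma>" using V.diff_zero_eq gc by blast
qed

text \<open>On each basic neighbourhood of p the map \<phi> inverts a and kills the radical of b, so
  it extends to sections; uniqueness of the extensions makes them compatible, and
  \<open>stalk_lift\<close> assembles them.\<close>

lemma stalk_field_hom:
  assumes K: "cinf_field K" and \<phi>: "\<phi> \<in> cinf_hom A K" and p: "p = {x \<in> carrier A. \<phi> x = \<zero>\<^bsub>ring_of K\<^esub>}"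
  obtains \<theta> where "\<theta> \<in> cinf_hom (P.st p) K"
    "\<And>U x. U \<in> basic_opens A \<Longrightarrow> p \<in> U \<Longrightarrow> x \<in> carrier A \<Longrightarrow> \<theta> (P.gm p U (F_map U x)) = \<phi> x"
proof -
  interpret K: cinf_ring K using K by (simp add: cinf_field_def)
  have pS: "p \<in> cinf_Spec A" unfolding p by (rule kernel_spec[OF K \<phi>])
  have "\<exists>\<kappa>. \<kappa> \<in> cinf_hom (F_obj A U) K \<and> (\<forall>x\<in>carrier A. \<kappa> (F_map U x) = \<phi> x)"
    if U: "U \<in> basic_opens A" "p \<in> U" for U
  proof -
    obtain a b where ab: "(a, b) \<in> pairs A U" using U(1) by (rule basic_opens_obtain)
    note pab = pairsD[OF ab]
    have a: "a \<notin> p" and b: "p \<in> Z_inf A b" using U(2) pab(3) by (auto simp: D_inf_def)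
    have "\<phi> a \<noteq> \<zero>\<^bsub>ring_of K\<^esub>" using a pab(1) by (simp add: p)
    then have u: "\<phi> a \<in> Units (ring_of K)"
      using K cinf_hom_closed[OF \<phi> pab(1)] by (simp add: cinf_field_def)
    have z: "\<phi> c = \<zero>\<^bsub>ring_of K\<^esub>" if "c \<in> rad_principal A b" for c
    proof -
      have "c \<in> p" using that b rad_principal_iff[OF pab(2)] by simp
      then show ?thesis by (simp add: p)
    qed
    show ?thesis
      by (rule F_lift[OF ab K.cinf_ring_axioms \<phi> u], erule z) blast
  qed
  then have "\<forall>U. \<exists>\<kappa>. U \<in> basic_opens A \<and> p \<in> U \<longrightarrow> \<kappa> \<in> cinf_hom (F_obj A U) K \<and> (\<forall>x\<in>carrier A. \<kappa> (F_map U x) = \<phi> x)"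
    by blast
  from choice[OF this] obtain \<kappa> where "\<forall>U. U \<in> basic_opens A \<and> p \<in> U \<longrightarrow>
    \<kappa> U \<in> cinf_hom (F_obj A U) K \<and> (\<forall>x\<in>carrier A. \<kappa> U (F_map U x) = \<phi> x)" ..
  then have \<kappa>: "\<kappa> U \<in> cinf_hom (F_obj A U) K" "\<And>x. x \<in> carrier A \<Longrightarrow> \<kappa> U (F_map U x) = \<phi> x"
    if "U \<in> basic_opens A" "p \<in> U" for U using that by auto
  \<comment> \<open>Both sides, as functions of the section, are homomorphisms on
    \<open>F_obj A U\<close> extending \<phi>, so \<open>F_hom_eqI\<close> applies.\<close>
  have res: "\<kappa> W (F_res A U W s) = \<kappa> U s"
    if U: "U \<in> basic_opens A" and W: "W \<in> basic_opens A" "p \<in> W" "W \<subseteq> U" and s: "s \<in> carrier (F_obj A U)" for U W s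
  proof -
    have pU: "p \<in> U" using W by blast
    interpret FU: cinf_ring "F_obj A U" by (rule F_cinf_ring)
    obtain a b where ab: "(a, b) \<in> pairs A U" using U by (rule basic_opens_obtain)
    have rc: "F_res A U W s \<in> carrier (F_obj A W)" if "s \<in> carrier (F_obj A U)" for s
      by (rule F_res_closed[OF W(3) U that])
    have "(\<lambda>s\<in>carrier (F_obj A U). \<kappa> W (F_res A U W s)) \<in> cinf_hom (F_obj A U) K"
    proof (rule cinf_homI)
      show "(\<lambda>s\<in>carrier (F_obj A U). \<kappa> W (F_res A U W s)) \<in> carrier (F_obj A U) \<rightarrow>\<^sub>E carrier K"
        using rc cinf_hom_closed[OF \<kappa>(1)[OF W(1,2)]] by auto
      fix n G x assume G: "csm n G" and x: "\<And>i. i < n \<Longrightarrow> x i \<in> carrier (F_obj A U)"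
      have "\<kappa> W (F_res A U W (sop (F_obj A U) n G x)) = \<kappa> W (sop (F_obj A W) n G (\<lambda>i. F_res A U W (x i)))"
        using F_res_op[where x = x, OF W(3) U G x] by simp
      also have "\<dots> = sop K n G (\<lambda>i. \<kappa> W (F_res A U W (x i)))"
        by (rule hom_sop[OF \<kappa>(1)[OF W(1,2)] G rc[OF x]])
      also have "\<dots> = sop K n G (\<lambda>i. (\<lambda>s\<in>carrier (F_obj A U). \<kappa> W (F_res A U W s)) (x i))"
        by (rule sop_cong) (simp add: x)
      finally show "(\<lambda>s\<in>carrier (F_obj A U). \<kappa> W (F_res A U W s)) (sop (F_obj A U) n G x) =
        sop K n G (\<lambda>i. (\<lambda>s\<in>carrier (F_obj A U). \<kappa> W (F_res A U W s)) (x i))"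
        using FU.sop_closed[OF G x] by simp
    qed
    then have "(\<lambda>s\<in>carrier (F_obj A U). \<kappa> W (F_res A U W s)) = \<kappa> U"
    proof (rule F_hom_eqI[OF ab K.cinf_ring_axioms _ \<kappa>(1)[OF U pU]])
      fix x assume x: "x \<in> carrier A"
      show "(\<lambda>s\<in>carrier (F_obj A U). \<kappa> W (F_res A U W s)) (F_map U x) = \<kappa> U (F_map U x)"
        using cinf_hom_closed[OF F_map_hom x] F_res_map[OF W(3) U x] \<kappa>(2)[OF W(1,2) x] \<kappa>(2)[OF U pU x] by simp
    qed
    from fun_cong[OF this, of s] show ?thesis using s by simp
  qed
  obtain \<theta> where \<theta>: "\<theta> \<in> cinf_hom (P.st p) K"
    "\<And>U s. U \<in> basic_opens A \<Longrightarrow> p \<in> U \<Longrightarrow> s \<in> carrier (F_obj A U) \<Longrightarrow> \<theta> (P.gm p U s) = \<kappa> U s"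
    by (rule P.stalk_lift[OF Spec_basic pS K.cinf_ring_axioms, of \<kappa>]) (rule \<kappa>(1) res that; assumption)+
  show ?thesis
    by (rule that[OF \<theta>(1)]) (simp add: \<theta>(2) \<kappa>(2) cinf_hom_closed[OF F_map_hom])
qed

text \<open>The value of the extension at a section is determined modulo every maximal ideal of \<open>V\<close>. Locally on the
  maximal spectrum it is given by a smooth expression, and the ideal of those \<open>e\<close> such that a common value exists
  where \<open>e\<close> does not vanish is not contained in any maximal ideal.\<close>

lemma HH_lift:
  assumes V: "vN_cinf_ring V" and f: "f \<in> cinf_hom A V"
  obtains g where "g \<in> cinf_hom (HH A) V" "\<And>x. x \<in> carrier A \<Longrightarrow> g (mu A x) = f x"
proof -
  have Vr: "cinf_ring V" "vN_regular V" using V by (auto simp: vN_cinf_ring_def)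
  interpret V: cinf_ring V by (rule Vr)
  interpret H: cinf_ring "HH A" by (rule HH_cinf_ring)
  let ?Max = "\<lambda>q. maximalideal q (ring_of V)"
  define \<phi> where "\<phi> q = compose (carrier A) (quot_map V q) f" for q
  define p where "p q = {x \<in> carrier A. \<phi> q x = \<zero>\<^bsub>ring_of (quot_ideal V q)\<^esub>}" for q
  have fc: "f x \<in> carrier V" if "x \<in> carrier A" for x by (rule cinf_hom_closed[OF f that])
  have K: "cinf_field (quot_ideal V q)" "cinf_ring (quot_ideal V q)" and \<phi>: "\<phi> q \<in> cinf_hom A (quot_ideal V q)"
    and qh: "quot_map V q \<in> cinf_hom V (quot_ideal V q)" and qi: "ideal q (ring_of V)" if q: "?Max q" for q
  proof -
    show K: "cinf_field (quot_ideal V q)" and "\<phi> q \<in> cinf_hom A (quot_ideal V q)"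
      using quot_compose_field[OF cinf_ring_axioms Vr(1) f q] by (auto simp: \<phi>_def)
    show "cinf_ring (quot_ideal V q)" using K by (simp add: cinf_field_def)
    show "ideal q (ring_of V)" by (rule maximalideal.axioms(1)[OF q])
    then show "quot_map V q \<in> cinf_hom V (quot_ideal V q)" by (rule V.quot_map_hom)
  qed
  have \<phi>at: "quot_map V q (f x) = \<phi> q x" if "x \<in> carrier A" for q x using that by (simp add: \<phi>_def compose_def)
  have pS: "p q \<in> cinf_Spec A" if "?Max q" for q unfolding p_def by (rule kernel_spec[OF K(1)[OF that] \<phi>[OF that]])
  define good where "good q t \<longleftrightarrow> t \<in> cinf_hom (P.st (p q)) (quot_ideal V q) \<and>
    (\<forall>U\<in>basic_opens A. p q \<in> U \<longrightarrow> (\<forall>x\<in>carrier A. t (P.gm (p q) U (F_map U x)) = \<phi> q x))" for q t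
  have good_ex: "\<exists>t. good q t" if q: "?Max q" for q
  proof -
    obtain t where t: "t \<in> cinf_hom (P.st (p q)) (quot_ideal V q)"
      "\<And>U x. U \<in> basic_opens A \<Longrightarrow> p q \<in> U \<Longrightarrow> x \<in> carrier A \<Longrightarrow> t (P.gm (p q) U (F_map U x)) = \<phi> q x"
      by (rule stalk_field_hom[OF K(1)[OF q] \<phi>[OF q] p_def[of q]]) (rule that)
    show ?thesis unfolding good_def by (intro exI[of _ t] conjI ballI impI t)
  qed
  define \<theta> where "\<theta> q = (SOME t. good q t)" for q
  have good: "good q (\<theta> q)" if "?Max q" for q
    unfolding \<theta>_def by (rule someI_ex[OF good_ex[OF that]])
  have \<theta>: "\<theta> q \<in> cinf_hom (P.st (p q)) (quot_ideal V q)"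
    "\<And>U x. U \<in> basic_opens A \<Longrightarrow> p q \<in> U \<Longrightarrow> x \<in> carrier A \<Longrightarrow> \<theta> q (P.gm (p q) U (F_map U x)) = \<phi> q x"
    if "?Max q" for q using good[OF that] by (simp_all add: good_def)
  define match where "match \<sigma> v q \<longleftrightarrow> \<theta> q (\<sigma> (p q)) = quot_map V q v" for \<sigma> v q
  have local: "\<exists>e v. e \<in> carrier V \<and> v \<in> carrier V \<and> e \<notin> q0 \<and> (\<forall>q. ?Max q \<longrightarrow> e \<notin> q \<longrightarrow> match \<sigma> v q)"
    if \<sigma>: "\<sigma> \<in> carrier (HH A)" and q0: "?Max q0" for \<sigma> q0
  proof -
    have \<sigma>': "\<sigma> \<in> carrier (P.sheaf (cinf_Spec A))" using \<sigma> by (simp add: HH_eq)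
    obtain U s where U: "U \<in> basic_opens A" "p q0 \<in> U" "U \<subseteq> cinf_Spec A" "s \<in> carrier (F_obj A U)"
      "\<And>q. q \<in> U \<Longrightarrow> \<sigma> q = P.gm q U s"
      by (rule P.sheaf_local[OF \<sigma>' pS[OF q0]]) (rule that)
    obtain a b where ab: "(a, b) \<in> pairs A U" using U(1) by (rule basic_opens_obtain)
    note pab = pairsD[OF ab]
    interpret FU: cinf_ring "F_obj A U" by (rule F_cinf_ring)
    obtain \<eta> m F y where \<eta>: "\<eta> \<in> carrier (F_obj A U)"
      "F_map U a \<otimes>\<^bsub>ring_of (F_obj A U)\<^esub> \<eta> = \<one>\<^bsub>ring_of (F_obj A U)\<^esub>"
      and F: "csm (Suc m) F" and y: "\<forall>i<m. y i \<in> carrier A"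
      and sF: "s = sop (F_obj A U) (Suc m) F ((\<lambda>i. F_map U (y i))(m := \<eta>))"
      by (rule F_section_expr[OF ab U(4)]) (rule that)
    obtain \<alpha> where \<alpha>: "qinv V (f a) \<alpha>" using Vr(2) V.vN_regular_iff_qinv fc[OF pab(1)] by blast
    obtain \<beta> where \<beta>: "qinv V (f b) \<beta>" using Vr(2) V.vN_regular_iff_qinv fc[OF pab(2)] by blast
    have c: "f a \<in> carrier V" "f b \<in> carrier V" "\<alpha> \<in> carrier V" "\<beta> \<in> carrier V"
      using \<alpha> \<beta> by (auto simp: qinv_def)
    let ?u = "(\<lambda>i. f (y i))(m := \<alpha>)"
    have uc: "?u i \<in> carrier V" if "i < Suc m" for i
      by (rule tuple_upd_closed[OF _ c(3) that]) (use y fc in blast)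
    let ?v = "sop V (Suc m) F ?u"
    let ?d = "\<one>\<^bsub>ring_of V\<^esub> \<ominus>\<^bsub>ring_of V\<^esub> f b \<otimes>\<^bsub>ring_of V\<^esub> \<beta>"
    let ?e = "f a \<otimes>\<^bsub>ring_of V\<^esub> ?d"
    have ec: "?e \<in> carrier V" "?d \<in> carrier V" "f b \<otimes>\<^bsub>ring_of V\<^esub> \<beta> \<in> carrier V" using c by auto
    \<comment> \<open>Modulo q the factor \<open>?d\<close> is the indicator of f b = 0, so
      \<open>?e\<close> survives exactly when a lies outside and b inside
      \<open>p q\<close>.\<close>
    have e_iff: "?e \<notin> q \<longleftrightarrow> p q \<in> U" if q: "?Max q" for q
    proof -
      note ar = cinf_hom_arith[OF Vr(1) K(2)[OF q] qh[OF q]]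
      have "quot_map V q ?e = \<phi> q a \<otimes>\<^bsub>ring_of (quot_ideal V q)\<^esub> (\<one>\<^bsub>ring_of (quot_ideal V q)\<^esub> \<ominus>\<^bsub>ring_of (quot_ideal V q)\<^esub>
          \<phi> q b \<otimes>\<^bsub>ring_of (quot_ideal V q)\<^esub> quot_map V q \<beta>)"
        using ar(1)[OF c(1) ec(2)] ar(3)[OF V.R.one_closed ec(3)] ar(1)[OF c(2,4)]
          cinf_hom_zero(2)[OF Vr(1) K(2)[OF q] qh[OF q]] \<phi>at pab by simp
      moreover have "qinv (quot_ideal V q) (\<phi> q b) (quot_map V q \<beta>)"
        using hom_qinv[OF Vr(1) K(2)[OF q] qh[OF q] \<beta>] \<phi>at[OF pab(2)] by simp
      ultimately have "quot_map V q ?e = \<zero>\<^bsub>ring_of (quot_ideal V q)\<^esub> \<longleftrightarrow>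
        \<phi> q a = \<zero>\<^bsub>ring_of (quot_ideal V q)\<^esub> \<or> \<phi> q b \<noteq> \<zero>\<^bsub>ring_of (quot_ideal V q)\<^esub>"
        using field_separator[OF K(1)[OF q] cinf_hom_closed[OF \<phi>[OF q] pab(1)]] by simp
      then have "?e \<in> q \<longleftrightarrow> a \<in> p q \<or> b \<notin> p q"
        using V.quot_map_zero_iff[OF qi[OF q] ec(1)] pab by (simp add: p_def)
      then show ?thesis using pab(3) pS[OF q] by (auto simp: D_inf_def Z_inf_def)
    qed
    have "match \<sigma> ?v q" if q: "?Max q" and e: "?e \<notin> q" for q
    proof -
      have pU: "p q \<in> U" using e_iff[OF q] e by simp
      have Fc: "F_map U x \<in> carrier (F_obj A U)" if "x \<in> carrier A" for x by (rule cinf_hom_closed[OF F_map_hom that])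
      let ?\<psi> = "compose (carrier (F_obj A U)) (\<theta> q) (\<lambda>s\<in>carrier (F_obj A U). P.gm (p q) U s)"
      have \<psi>: "?\<psi> \<in> cinf_hom (F_obj A U) (quot_ideal V q)"
        by (rule cinf_hom_compose[OF P.germ_hom[OF U(1) pU] \<theta>(1)[OF q] FU.cinf_ring_axioms])
      have \<psi>at: "?\<psi> (F_map U x) = \<phi> q x" if "x \<in> carrier A" for x
        using \<theta>(2)[OF q U(1) pU that] Fc[OF that] by (simp add: compose_def)
      have z: "qinv (quot_ideal V q) (\<phi> q a) (quot_map V q \<alpha>)"
        using hom_qinv[OF Vr(1) K(2)[OF q] qh[OF q] \<alpha>] \<phi>at[OF pab(1)] by simp
      have "\<theta> q (\<sigma> (p q)) = ?\<psi> s" using U(4) U(5)[OF pU] by (simp add: compose_def)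
      also have "\<dots> = sop (quot_ideal V q) (Suc m) F ((\<lambda>i. \<phi> q (y i))(m := quot_map V q \<alpha>))"
        unfolding sF 
        by (rule hom_smooth_expr[where A = A and \<eta> = "F_map U" and \<phi> = "\<phi> q",
              OF FU.cinf_ring_axioms K(2)[OF q] \<psi> F y pab(1) Fc \<eta> \<psi>at z])
      also have "\<dots> = sop (quot_ideal V q) (Suc m) F (\<lambda>i. quot_map V q (?u i))"
      proof (rule sop_cong)
        fix i assume "i < Suc m"
        then show "((\<lambda>i. \<phi> q (y i))(m := quot_map V q \<alpha>)) i = quot_map V q (?u i)"
          using \<phi>at y by (cases "i = m") simp_all
      qed
      also have "\<dots> = quot_map V q ?v" by (rule hom_sop[OF qh[OF q] F uc, symmetric])
      finally show ?thesis by (simp add: match_def)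
    qed
    moreover have "?v \<in> carrier V" by (rule V.sop_closed[OF F uc])
    ultimately show ?thesis using ec(1) e_iff[OF q0] U(2) by blast
  qed
  have "\<exists>v. v \<in> carrier V \<and> (\<forall>q. ?Max q \<longrightarrow> match \<sigma> v q)" if \<sigma>: "\<sigma> \<in> carrier (HH A)" for \<sigma>
  proof -
    define J where "J = {e \<in> carrier V. \<exists>v. v \<in> carrier V \<and> (\<forall>q. ?Max q \<longrightarrow> e \<notin> q \<longrightarrow> match \<sigma> v q)}"
    have zq: "\<zero>\<^bsub>ring_of V\<^esub> \<in> q" if "?Max q" for q
      using additive_subgroup.zero_closed[OF ideal.axioms(1)[OF qi[OF that]]] .
    have J0: "\<zero>\<^bsub>ring_of V\<^esub> \<in> J" unfolding J_def using zq V.R.zero_closed by blast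
    have Jmult: "r \<otimes>\<^bsub>ring_of V\<^esub> e \<in> J" if e: "e \<in> J" and r: "r \<in> carrier V" for e r
    proof -
      obtain v where v: "v \<in> carrier V" "\<And>q. ?Max q \<Longrightarrow> e \<notin> q \<Longrightarrow> match \<sigma> v q" "e \<in> carrier V"
        using e unfolding J_def by blast
      have "e \<notin> q" if "?Max q" "r \<otimes>\<^bsub>ring_of V\<^esub> e \<notin> q" for q
        using ideal.I_l_closed[OF qi[OF that(1)], of e r] that(2) r by auto
      then show ?thesis unfolding J_def using v r V.R.m_closed by blast
    qed
    have Jadd: "e1 \<oplus>\<^bsub>ring_of V\<^esub> e2 \<in> J" if e1: "e1 \<in> J" and e2: "e2 \<in> J" for e1 e2
    proof -
      obtain v1 where v1: "v1 \<in> carrier V" "\<And>q. ?Max q \<Longrightarrow> e1 \<notin> q \<Longrightarrow> match \<sigma> v1 q" "e1 \<in> carrier V"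
        using e1 unfolding J_def by blast
      obtain v2 where v2: "v2 \<in> carrier V" "\<And>q. ?Max q \<Longrightarrow> e2 \<notin> q \<Longrightarrow> match \<sigma> v2 q" "e2 \<in> carrier V"
        using e2 unfolding J_def by blast
      obtain \<iota> where \<iota>: "qinv V e1 \<iota>" using Vr(2) V.vN_regular_iff_qinv v1(3) by blast
      then have \<iota>c: "\<iota> \<in> carrier V" by (simp add: qinv_def)
      let ?i = "e1 \<otimes>\<^bsub>ring_of V\<^esub> \<iota>"
      \<comment> \<open>Modulo q the product of e1 with its quasi-inverse is 1 or 0, so
        \<open>?v\<close> reduces to v1 where e1 survives and to v2 elsewhere.\<close>
      let ?v = "v2 \<oplus>\<^bsub>ring_of V\<^esub> ?i \<otimes>\<^bsub>ring_of V\<^esub> (v1 \<ominus>\<^bsub>ring_of V\<^esub> v2)"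
      have c: "?i \<in> carrier V" "v1 \<ominus>\<^bsub>ring_of V\<^esub> v2 \<in> carrier V" using v1 v2 \<iota>c by auto
      have vc: "?v \<in> carrier V" using c v2 by simp
      have "match \<sigma> ?v q" if q: "?Max q" and e: "e1 \<oplus>\<^bsub>ring_of V\<^esub> e2 \<notin> q" for q
      proof -
        interpret Q: cinf_ring "quot_ideal V q" by (rule K(2)[OF q])
        note ar = cinf_hom_arith[OF Vr(1) K(2)[OF q] qh[OF q]]
        note qc = cinf_hom_closed[OF qh[OF q]]
        let ?x = "quot_map V q"
        have eq: "?x ?v = ?x v2 \<oplus>\<^bsub>ring_of (quot_ideal V q)\<^esub> (?x e1 \<otimes>\<^bsub>ring_of (quot_ideal V q)\<^esub> ?x \<iota>) \<otimes>\<^bsub>ring_of (quot_ideal V q)\<^esub>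
          (?x v1 \<ominus>\<^bsub>ring_of (quot_ideal V q)\<^esub> ?x v2)"
          using ar(2)[of v2 "?i \<otimes>\<^bsub>ring_of V\<^esub> (v1 \<ominus>\<^bsub>ring_of V\<^esub> v2)"] ar(1)[OF c] ar(1)[OF v1(3) \<iota>c] ar(3)[OF v1(1) v2(1)] c v2 by simp
        show ?thesis
        proof (cases "e1 \<in> q")
          case True
          then have "?x e1 = \<zero>\<^bsub>ring_of (quot_ideal V q)\<^esub>" using V.quot_map_zero_iff[OF qi[OF q] v1(3)] by simp
          then have xv: "?x ?v = ?x v2" unfolding eq using qc v1 v2 \<iota>c by simp
          have "e2 \<notin> q"
            using e True additive_subgroup.a_closed[OF ideal.axioms(1)[OF qi[OF q]]] by blast
          then show ?thesis using v2(2)[OF q] xv by (simp add: match_def)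
        next
          case False
          then have "?x e1 \<in> Units (ring_of (quot_ideal V q))"
            using K(1)[OF q] V.quot_map_zero_iff[OF qi[OF q] v1(3)] qc[OF v1(3)] by (simp add: cinf_field_def)
          then have "?x e1 \<otimes>\<^bsub>ring_of (quot_ideal V q)\<^esub> ?x \<iota> = \<one>\<^bsub>ring_of (quot_ideal V q)\<^esub>"
            by (rule Q.qinv_unit_mult[OF hom_qinv[OF Vr(1) K(2)[OF q] qh[OF q] \<iota>]])
          then have xv: "?x ?v = ?x v1" unfolding eq using qc[OF v1(1)] qc[OF v2(1)]
            by (simp add: Q.R.minus_eq Q.R.a_lcomm[of "?x v2"] Q.R.r_neg)
          then show ?thesis using v1(2)[OF q False] by (simp add: match_def)
        qed
      qed
      then show ?thesis unfolding J_def using vc v1(3) v2(3) V.R.a_closed by blast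
    qed
    have Jc: "J \<subseteq> carrier V" by (auto simp: J_def)
    have J: "ideal J (ring_of V)"
    proof (rule idealI[OF V.R.ring_axioms])
      show "subgroup J (add_monoid (ring_of V))"
      proof (rule group.subgroupI[OF abelian_group.a_group[OF ring.is_abelian_group[OF cring.axioms(1)[OF V.cring_ring_of]]]])
        show "J \<subseteq> carrier (add_monoid (ring_of V))" using Jc by simp
        show "J \<noteq> {}" using J0 by blast
        show "a \<otimes>\<^bsub>add_monoid (ring_of V)\<^esub> b \<in> J" if "a \<in> J" "b \<in> J" for a b using Jadd[OF that] by simp
        show "inv\<^bsub>add_monoid (ring_of V)\<^esub> a \<in> J" if a: "a \<in> J" for a
        proof -
          have ac: "a \<in> carrier V" using a Jc by blast
          have "\<ominus>\<^bsub>ring_of V\<^esub> a = (\<ominus>\<^bsub>ring_of V\<^esub> \<one>\<^bsub>ring_of V\<^esub>) \<otimes>\<^bsub>ring_of V\<^esub> a" using ac by (simp add: V.R.l_minus)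
          then have "\<ominus>\<^bsub>ring_of V\<^esub> a \<in> J" using Jmult[OF a, of "\<ominus>\<^bsub>ring_of V\<^esub> \<one>\<^bsub>ring_of V\<^esub>"] by simp
          then show ?thesis by (simp only: a_inv_def)
        qed
      qed
      show "x \<otimes>\<^bsub>ring_of V\<^esub> a \<in> J" "a \<otimes>\<^bsub>ring_of V\<^esub> x \<in> J" if "a \<in> J" "x \<in> carrier (ring_of V)" for a x
        using Jmult[OF that(1), of x] that V.R.m_comm[of a x] Jc by auto
    qed
    have "\<one>\<^bsub>ring_of V\<^esub> \<in> J"
    proof (rule ccontr)
      assume n: "\<one>\<^bsub>ring_of V\<^esub> \<notin> J"
      obtain M where M: "?Max M" "J \<subseteq> M" by (rule V.R.exists_maximalideal[OF J n]) (rule that)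
      from local[OF \<sigma> M(1)] obtain e v where "e \<in> carrier V" "v \<in> carrier V" "e \<notin> M"
        "\<forall>q. ?Max q \<longrightarrow> e \<notin> q \<longrightarrow> match \<sigma> v q" by blast
      then have "e \<in> J" unfolding J_def by blast
      then show False using M(2) \<open>e \<notin> M\<close> by blast
    qed
    then obtain v where v: "v \<in> carrier V" "\<forall>q. ?Max q \<longrightarrow> \<one>\<^bsub>ring_of V\<^esub> \<notin> q \<longrightarrow> match \<sigma> v q"
      unfolding J_def by blast
    have "\<one>\<^bsub>ring_of V\<^esub> \<notin> q" if "?Max q" for q
      using maximalideal.I_notcarr[OF that] ideal.one_imp_carrier[OF qi[OF that]] by auto
    then show ?thesis using v by blast
  qed
  then have "\<forall>\<sigma>. \<exists>v. \<sigma> \<in> carrier (HH A) \<longrightarrow> v \<in> carrier V \<and> (\<forall>q. ?Max q \<longrightarrow> match \<sigma> v q)" by blast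
  from choice[OF this] obtain G where "\<forall>\<sigma>. \<sigma> \<in> carrier (HH A) \<longrightarrow> G \<sigma> \<in> carrier V \<and> (\<forall>q. ?Max q \<longrightarrow> match \<sigma> (G \<sigma>) q)" ..
  then have G: "G \<sigma> \<in> carrier V" "\<And>q. ?Max q \<Longrightarrow> match \<sigma> (G \<sigma>) q" if "\<sigma> \<in> carrier (HH A)" for \<sigma> using that by auto
  \<comment> \<open>Two elements matching the same section differ by an element of every maximal
    ideal, which is zero in a regular ring.\<close>
  have match_unique: "v = w" if vw: "v \<in> carrier V" "w \<in> carrier V"
    "\<And>q. ?Max q \<Longrightarrow> match \<sigma> v q" "\<And>q. ?Max q \<Longrightarrow> match \<sigma> w q" for \<sigma> v w
  proof -
    have "v \<ominus>\<^bsub>ring_of V\<^esub> w \<in> q" if q: "?Max q" for q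
    proof -
      have "quot_map V q v = quot_map V q w" using vw(3,4)[OF q] by (simp add: match_def)
      then show ?thesis using V.quot_map_eq[OF qi[OF q] \<open>v \<in> carrier V\<close> \<open>w \<in> carrier V\<close>] by simp
    qed
    then have "v \<ominus>\<^bsub>ring_of V\<^esub> w = \<zero>\<^bsub>ring_of V\<^esub>"
      using vw(1,2) by (intro V.vN_zero_of_maximal[OF Vr(2)]) simp_all
    then show ?thesis using V.diff_zero_eq vw(1,2) by blast
  qed
  let ?g = "restrict G (carrier (HH A))"
  have "?g \<in> cinf_hom (HH A) V"
  proof (rule cinf_homI)
    show "?g \<in> carrier (HH A) \<rightarrow>\<^sub>E carrier V" using G by auto
    fix n F \<sigma> assume F: "csm n F" and \<sigma>: "\<And>i. i < n \<Longrightarrow> \<sigma> i \<in> carrier (HH A)"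
    have sc: "sop (HH A) n F \<sigma> \<in> carrier (HH A)" by (rule H.sop_closed[OF F \<sigma>])
    \<comment> \<open>\<open>G\<close> was chosen section by section; it respects operations because
      both sides match the same section at every maximal ideal.\<close>
    have "G (sop (HH A) n F \<sigma>) = sop V n F (\<lambda>i. G (\<sigma> i))"
    proof (rule match_unique)
      show "G (sop (HH A) n F \<sigma>) \<in> carrier V" by (rule G(1)[OF sc])
      show "sop V n F (\<lambda>i. G (\<sigma> i)) \<in> carrier V" by (rule V.sop_closed[OF F G(1)[OF \<sigma>]])
      show "match (sop (HH A) n F \<sigma>) (G (sop (HH A) n F \<sigma>)) q" if "?Max q" for q by (rule G(2)[OF sc that])
      show "match (sop (HH A) n F \<sigma>) (sop V n F (\<lambda>i. G (\<sigma> i))) q" if q: "?Max q" for q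
      proof -
        have at: "\<sigma> i (p q) \<in> carrier (P.st (p q))" if "i < n" for i
          using cinf_hom_closed[OF eval_hom[OF pS[OF q]] \<sigma>[OF that]] \<sigma>[OF that] by simp
        have "sop (HH A) n F \<sigma> (p q) = sop (P.st (p q)) n F (\<lambda>i. \<sigma> i (p q))"
          using pS[OF q] by (simp add: HH_eq P.sop_sheaf)
        then have "\<theta> q (sop (HH A) n F \<sigma> (p q)) = sop (quot_ideal V q) n F (\<lambda>i. \<theta> q (\<sigma> i (p q)))"
          using hom_sop[where x = "\<lambda>i. \<sigma> i (p q)", OF \<theta>(1)[OF q] F at] by simp
        also have "\<dots> = sop (quot_ideal V q) n F (\<lambda>i. quot_map V q (G (\<sigma> i)))"
          by (rule sop_cong) (use G(2)[OF \<sigma> q] in \<open>simp add: match_def\<close>)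
        also have "\<dots> = quot_map V q (sop V n F (\<lambda>i. G (\<sigma> i)))"
          by (rule hom_sop[OF qh[OF q] F G(1)[OF \<sigma>], symmetric])
        finally show ?thesis by (simp add: match_def)
      qed
    qed
    also have "\<dots> = sop V n F (\<lambda>i. ?g (\<sigma> i))" by (rule sop_cong) (simp add: \<sigma>)
    finally show "?g (sop (HH A) n F \<sigma>) = sop V n F (\<lambda>i. ?g (\<sigma> i))" using sc by simp
  qed
  moreover have "?g (mu A x) = f x" if x: "x \<in> carrier A" for x
  proof -
    have mc: "mu A x \<in> carrier (HH A)" by (rule cinf_hom_closed[OF mu_hom x])
    have "G (mu A x) = f x"
    proof (rule match_unique)
      show "G (mu A x) \<in> carrier V" "f x \<in> carrier V" using G(1)[OF mc] fc[OF x] by auto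
      show "match (mu A x) (G (mu A x)) q" if "?Max q" for q by (rule G(2)[OF mc that])
      show "match (mu A x) (f x) q" if q: "?Max q" for q
        unfolding match_def mu_at[OF x Spec_basic pS[OF q]] \<theta>(2)[OF q Spec_basic pS[OF q] x]
        using \<phi>at[OF x] by simp
    qed
    then show ?thesis using mc by simp
  qed
  ultimately show ?thesis by (rule that)
qed

lemma HH_universal:
  assumes V: "vN_cinf_ring V" and f: "f \<in> cinf_hom A V"
  shows "\<exists>!g. g \<in> cinf_hom (HH A) V \<and> compose (carrier A) g (mu A) = f"
proof -
  obtain g where g: "g \<in> cinf_hom (HH A) V" "\<And>x. x \<in> carrier A \<Longrightarrow> g (mu A x) = f x"
    by (rule HH_lift[OF V f]) (rule that)
  show ?thesis
  proof (rule ex1I[of _ g])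
    have "compose (carrier A) g (mu A) = f"
      by (rule extensionalityI[OF compose_extensional cinf_hom_ext[OF f]]) (simp add: compose_def g(2))
    then show "g \<in> cinf_hom (HH A) V \<and> compose (carrier A) g (mu A) = f" using g(1) by simp
    fix h assume h: "h \<in> cinf_hom (HH A) V \<and> compose (carrier A) h (mu A) = f"
    show "h = g"
    proof (rule HH_hom_eqI[OF V _ g(1)])
      show "h \<in> cinf_hom (HH A) V" using h by simp
      fix x assume x: "x \<in> carrier A"
      have "compose (carrier A) h (mu A) x = f x" using h by simp
      then show "h (mu A x) = g (mu A x)" using g(2)[OF x] x by (simp add: compose_def)
    qed
  qed
qed

lemma HH_vN_cinf_ring: "vN_cinf_ring (HH A)"
  unfolding vN_cinf_ring_def using HH_cinf_ring HH_vN_regular by blast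

end

section \<open>Functoriality and the adjunction\<close>

lemma vN_map_spec:
  assumes A: "cinf_ring A" and B: "cinf_ring B" and f: "f \<in> cinf_hom A B"
  shows vN_map_hom: "vN_map A B f \<in> cinf_hom (HH A) (HH B)"
    and vN_map_compose: "compose (carrier A) (vN_map A B f) (mu A) = compose (carrier A) (mu B) f"
    and vN_map_eqI: "\<And>g. g \<in> cinf_hom (HH A) (HH B) \<Longrightarrow>
      compose (carrier A) g (mu A) = compose (carrier A) (mu B) f \<Longrightarrow> vN_map A B f = g"
proof -
  have ex1: "\<exists>!g. g \<in> cinf_hom (HH A) (HH B) \<and> compose (carrier A) g (mu A) = compose (carrier A) (mu B) f"
    by (rule cinf_ring.HH_universal[OF A cinf_ring.HH_vN_cinf_ring[OF B]
          cinf_hom_compose[OF f cinf_ring.mu_hom[OF B] A]])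
  from theI'[OF ex1] show "vN_map A B f \<in> cinf_hom (HH A) (HH B)"
    "compose (carrier A) (vN_map A B f) (mu A) = compose (carrier A) (mu B) f"
    unfolding vN_map_def by auto
  show "vN_map A B f = g" if "g \<in> cinf_hom (HH A) (HH B)" "compose (carrier A) g (mu A) = compose (carrier A) (mu B) f" for g
    unfolding vN_map_def by (rule the1_equality[OF ex1]) (use that in simp)
qed

lemma vN_map_mu:
  assumes "cinf_ring A" "cinf_ring B" "f \<in> cinf_hom A B" "x \<in> carrier A"
  shows "vN_map A B f (mu A x) = mu B (f x)"
  using fun_cong[OF vN_map_compose[OF assms(1-3)], of x] assms(4) by (simp add: compose_def)

lemma vN_map_id:
  assumes A: "cinf_ring A"
  shows "vN_map A A (cinf_id A) = cinf_id (HH A)"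
proof (rule vN_map_eqI[OF A A cinf_id_hom[OF A] cinf_id_hom[OF cinf_ring.HH_cinf_ring[OF A]]])
  show "compose (carrier A) (cinf_id (HH A)) (mu A) = compose (carrier A) (mu A) (cinf_id A)"
    unfolding compose_def
    by (rule restrict_ext) (simp add: cinf_id_def cinf_hom_closed[OF cinf_ring.mu_hom[OF A]])
qed

text \<open>The composite on the right satisfies the equation that characterises the map on the
  left, because \<open>vN_map\<close> commutes with \<open>mu\<close>.\<close>

lemma vN_map_comp:
  assumes A: "cinf_ring A" and B: "cinf_ring B" and C: "cinf_ring C"
    and f: "f \<in> cinf_hom A B" and g: "g \<in> cinf_hom B C"
  shows "vN_map A C (compose (carrier A) g f) = compose (carrier (HH A)) (vN_map B C g) (vN_map A B f)"
proof (rule vN_map_eqI[OF A C cinf_hom_compose[OF f g A]])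
  show "compose (carrier (HH A)) (vN_map B C g) (vN_map A B f) \<in> cinf_hom (HH A) (HH C)"
    by (rule cinf_hom_compose[OF vN_map_hom[OF A B f] vN_map_hom[OF B C g] cinf_ring.HH_cinf_ring[OF A]])
  show "compose (carrier A) (compose (carrier (HH A)) (vN_map B C g) (vN_map A B f)) (mu A) =
    compose (carrier A) (mu C) (compose (carrier A) g f)"
    unfolding compose_def
    by (rule restrict_ext)
       (simp add: cinf_hom_closed[OF cinf_ring.mu_hom[OF A]] vN_map_mu[OF A B f] vN_map_mu[OF B C g] cinf_hom_closed[OF f])
qed

text \<open>Without a type of all smooth rings, the adjunction is expressed as a bijection of hom
  sets, composition with the unit \<open>mu\<close>, natural in both arguments and for carriers of
  independent types.\<close>

theorem theorem10:
  fixes A :: "'a cinf"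
  assumes A: "cinf_ring A"
  shows
    "(vN_cinf_ring (HH A) \<and> mu A \<in> cinf_hom A (HH A) \<and>
      (\<forall>V::'v cinf. vN_cinf_ring V \<longrightarrow>
        (\<forall>f\<in>cinf_hom A V. \<exists>!g. g \<in> cinf_hom (HH A) V \<and> compose (carrier A) g (mu A) = f)))
     \<and>
     (vN_map A A (cinf_id A) = cinf_id (HH A) \<and>
      (\<forall>B::'b cinf. cinf_ring B \<longrightarrow>
        (\<forall>f\<in>cinf_hom A B.
          vN_map A B f \<in> cinf_hom (HH A) (HH B) \<and>
          (\<forall>C::'c cinf. cinf_ring C \<longrightarrow>
            (\<forall>g\<in>cinf_hom B C.
              vN_map A C (compose (carrier A) g f) =
              compose (carrier (HH A)) (vN_map B C g) (vN_map A B f))))))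
     \<and>
     (\<forall>V::'v cinf. vN_cinf_ring V \<longrightarrow>
       bij_betw (\<lambda>h. compose (carrier A) h (mu A)) (cinf_hom (HH A) V) (cinf_hom A V) \<and>
       (\<forall>h\<in>cinf_hom (HH A) V.
         (\<forall>B::'b cinf. cinf_ring B \<longrightarrow>
           (\<forall>f\<in>cinf_hom B A.
             compose (carrier B) (compose (carrier (HH B)) h (vN_map B A f)) (mu B) =
             compose (carrier B) (compose (carrier A) h (mu A)) f)) \<and>
         (\<forall>W::'w cinf. vN_cinf_ring W \<longrightarrow>
           (\<forall>k\<in>cinf_hom V W.
             compose (carrier A) (compose (carrier (HH A)) k h) (mu A) =
             compose (carrier A) k (compose (carrier A) h (mu A))))))"
proof (intro conjI allI impI ballI)
  note muc = cinf_hom_closed[OF cinf_ring.mu_hom[OF A]]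
  show "vN_cinf_ring (HH A)" by (rule cinf_ring.HH_vN_cinf_ring[OF A])
  show "mu A \<in> cinf_hom A (HH A)" by (rule cinf_ring.mu_hom[OF A])
  show "\<exists>!g. g \<in> cinf_hom (HH A) V \<and> compose (carrier A) g (mu A) = f"
    if "vN_cinf_ring V" "f \<in> cinf_hom A V" for V :: "'v cinf" and f
    by (rule cinf_ring.HH_universal[OF A that])
  show "vN_map A A (cinf_id A) = cinf_id (HH A)" by (rule vN_map_id[OF A])
  show "vN_map A B f \<in> cinf_hom (HH A) (HH B)" if "cinf_ring B" "f \<in> cinf_hom A B" for B :: "'b cinf" and f
    by (rule vN_map_hom[OF A that])
  show "vN_map A C (compose (carrier A) g f) = compose (carrier (HH A)) (vN_map B C g) (vN_map A B f)"
    if "cinf_ring B" "f \<in> cinf_hom A B" "cinf_ring C" "g \<in> cinf_hom B C" for B :: "'b cinf" and C :: "'c cinf" and f g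
    by (rule vN_map_comp[OF A that(1,3,2,4)])
  show "bij_betw (\<lambda>h. compose (carrier A) h (mu A)) (cinf_hom (HH A) V) (cinf_hom A V)"
    if V: "vN_cinf_ring V" for V :: "'v cinf"
    unfolding bij_betw_def
  proof (intro conjI equalityI subsetI)
    note ex1 = cinf_ring.HH_universal[OF A V]
    have c: "compose (carrier A) h (mu A) \<in> cinf_hom A V" if "h \<in> cinf_hom (HH A) V" for h
      by (rule cinf_hom_compose[OF cinf_ring.mu_hom[OF A] that A])
    show "inj_on (\<lambda>h. compose (carrier A) h (mu A)) (cinf_hom (HH A) V)"
      using ex1[OF c] by (intro inj_onI) blast
    show "f \<in> cinf_hom A V" if "f \<in> (\<lambda>h. compose (carrier A) h (mu A)) ` cinf_hom (HH A) V" for f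
      using that c by blast
    show "f \<in> (\<lambda>h. compose (carrier A) h (mu A)) ` cinf_hom (HH A) V" if "f \<in> cinf_hom A V" for f
      using ex1[OF that] by blast
  qed
  show "compose (carrier B) (compose (carrier (HH B)) h (vN_map B A f)) (mu B) =
    compose (carrier B) (compose (carrier A) h (mu A)) f"
    if "cinf_ring B" "f \<in> cinf_hom B A" for B :: "'b cinf" and h :: "'a glob \<Rightarrow> 'v" and f
    unfolding compose_def
    by (rule restrict_ext)
       (simp add: cinf_hom_closed[OF cinf_ring.mu_hom[OF that(1)]] vN_map_mu[OF that(1) A that(2)] cinf_hom_closed[OF that(2)])
  show "compose (carrier A) (compose (carrier (HH A)) k h) (mu A) =
    compose (carrier A) k (compose (carrier A) h (mu A))" for k :: "'v \<Rightarrow> 'w" and h :: "'a glob \<Rightarrow> 'v"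
    unfolding compose_def by (rule restrict_ext) (simp add: muc)
qed

end
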